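(* For every pointed derivator $\mathscr D$ and $n\ge 1$ there is a canonical isomorphism $$\mathsf{tcof}\cong C^n\colon\mathscr D^{\square^n}\to\mathscr D$$ between the total cofiber morphism and the $n$-fold iterated cone morphism.
   Context: Derivators. $\mathrm{Cat}$ is the 2-category of small categories, $\mathrm{CAT}$ that of not necessarily small categories, $\mathbb 1$ the terminal category. A prederivator is a strict 2-functor $\mathscr D\colon\mathrm{Cat}^{\mathrm{op}}\to\mathrm{CAT}$ (1-cells reversed); write $u^*=\mathscr D(u)$. It is a derivator if: (Der1) $\mathscr D(\coprod_i A_i)\to\prod_i\mathscr D(A_i)$ is an equivalence; (Der2) a morphism $f$ of $\mathscr D(A)$ is invertible iff $f_a:=a^*f$ is invertible for all objects $a\colon\mathbb 1\to A$; (Der3) every $u^*$ has a left adjoint $u_!$ and a right adjoint $u_*$; (Der4) for $u\colon A\to B$ and $b\in B$ the canonical maps $\operatorname{colim}_{(u/b)}p^*X\to (u_!X)_b$ and $(u_*X)_b\to\lim_{(b/u)}q^*X$ are isomorphisms, where $p\colon(u/b)\to A$, $q\colon (b/u)\to A$ are the projections and $\operatorname{colim}_A=\pi_!$, $\lim_A=\pi_*$ for $\pi\colon A\to\mathbb 1$. Morphisms of derivators are pseudo-natural transformations; natural transformations between them are modifications. For $A\in\mathrm{Cat}$, $\mathscr D^A$ is the derivator $B\mapsto\mathscr D(A\times B)$; a functor $u\colon A\to B$ induces morphisms of derivators $u^*\colon\mathscr D^B\to\mathscr D^A$ and $u_!,u_*\colon\mathscr D^A\to\mathscr D^B$. $\mathscr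 D$ is pointed if $\mathscr D(\mathbb 1)$ has a zero object. Cofibers and cones. Let $[1]=(0<1)$, $\square=[1]^2$, $\ulcorner=\square\setminus\{(1,1)\}$, $i_\ulcorner\colon\ulcorner\to\square$ the inclusion, and $i\colon[1]\to\ulcorner$ the functor $0\mapsto(0,0)$, $1\mapsto(1,0)$. For $\mathscr D$ pointed, $\mathsf{cof}\colon\mathscr D^{[1]}\to\mathscr D^{[1]}$ is $(i_\ulcorner)_!\,i_*$ followed by restriction to the edge $(1,0)\to(1,1)$; it sends $f\colon x\to y$ to $y\to Cf$. The cone is $C=1^*\circ\mathsf{cof}\colon\mathscr D^{[1]}\to\mathscr D$. Cubes. $\square^n$ is the power set of $\{1,\dots,n\}$, identified with $[1]^n$, with terminal object $\infty=(1,\dots,1)$. For $1\le i\le n$, $\mathsf{cof}^{e_i}\colon\mathscr D^{\square^n}\to\mathscr D^{\square^n}$ applies $\mathsf{cof}$ in the $i$-th coordinate, the other coordinates being parameters; $\mathsf{cof}^{\underline 1}=\mathsf{cof}^{e_n}\circ\cdots\circ\mathsf{cof}^{e_1}$. The iterated cone is $C^n=\infty^*\circ\mathsf{cof}^{\underline 1}\colon\mathscr D^{\square^n}\to\mathscr D$. Total cofiber. Let $(\square^n)^\rhd$ be $\square^n$ with a new terminal object $\infty+1$ adjoined, and let $t\colon\square^n\to(\square^n)^\rhd$ be the fully faithful functor that is the identity on $\square^n\setminus\{\infty\}$ and sends $\infty$ to $\infty+1$. The total cofiber of $X\in\mathscr D^{\square^n}$ is the cone of the (coherent) comparison map: $\mathsf{tcof}(X)=C\big(t_!(X)_\infty\to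 t_!(X)_{\infty+1}\big)$, i.e. $\mathsf{tcof}=C\circ j^*\circ t_!$ with $j\colon[1]\to(\square^n)^\rhd$ classifying $\infty\to\infty+1$. *)

theory Defs
  imports Main "HOL-Library.FuncSet"
begin

text \<open>
  Categories, functors and natural transformations are records whose operations are required to be
  \<open>undefined\<close> outside their domains. Hence HOL equality of such records is equality of
  categories (functors, transformations) in the usual sense, as needed for \<^emph>\<open>strict\<close> 2-functors.
\<close>

section \<open>Categories\<close>

record ('o, 'm) cat =
  Obj :: "'o set"
  Arr :: "'m set"
  Dom :: "'m \<Rightarrow> 'o"
  Cod :: "'m \<Rightarrow> 'o"
  Ident :: "'o \<Rightarrow> 'm"
  Comp :: "'m \<Rightarrow> 'm \<Rightarrow> 'm"

text \<open>\<open>Comp C g f\<close> is the composite of first \<open>f\<close>, then \<open>g\<close>.\<close>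

definition composable :: "('o, 'm) cat \<Rightarrow> 'm \<Rightarrow> 'm \<Rightarrow> bool" where
  "composable C g f \<longleftrightarrow> g \<in> Arr C \<and> f \<in> Arr C \<and> Dom C g = Cod C f"

locale category =
  fixes C :: "('o, 'm) cat"
  assumes Dom_Obj: "f \<in> Arr C \<Longrightarrow> Dom C f \<in> Obj C"
    and Cod_Obj: "f \<in> Arr C \<Longrightarrow> Cod C f \<in> Obj C"
    and Ident_Arr: "x \<in> Obj C \<Longrightarrow> Ident C x \<in> Arr C"
    and Dom_Ident: "x \<in> Obj C \<Longrightarrow> Dom C (Ident C x) = x"
    and Cod_Ident: "x \<in> Obj C \<Longrightarrow> Cod C (Ident C x) = x"
    and Comp_Arr: "composable C g f \<Longrightarrow> Comp C g f \<in> Arr C"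
    and Dom_Comp: "composable C g f \<Longrightarrow> Dom C (Comp C g f) = Dom C f"
    and Cod_Comp: "composable C g f \<Longrightarrow> Cod C (Comp C g f) = Cod C g"
    and Comp_Ident_right: "f \<in> Arr C \<Longrightarrow> Comp C f (Ident C (Dom C f)) = f"
    and Comp_Ident_left: "f \<in> Arr C \<Longrightarrow> Comp C (Ident C (Cod C f)) f = f"
    and Comp_assoc: "composable C h g \<Longrightarrow> composable C g f \<Longrightarrow>
      Comp C h (Comp C g f) = Comp C (Comp C h g) f"
    and Dom_ext: "Dom C \<in> extensional (Arr C)"
    and Cod_ext: "Cod C \<in> extensional (Arr C)"
    and Ident_ext: "Ident C \<in> extensional (Obj C)"
    and Comp_ext: "\<not> composable C g f \<Longrightarrow> Comp C g f = undefined"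

definition hom :: "('o, 'm) cat \<Rightarrow> 'o \<Rightarrow> 'o \<Rightarrow> 'm set" where
  "hom C x y = {f \<in> Arr C. Dom C f = x \<and> Cod C f = y}"

definition inverse_arr :: "('o, 'm) cat \<Rightarrow> 'm \<Rightarrow> 'm \<Rightarrow> bool" where
  "inverse_arr C f g \<longleftrightarrow> composable C g f \<and> composable C f g \<and>
     Comp C g f = Ident C (Dom C f) \<and> Comp C f g = Ident C (Cod C f)"

definition iso_arr :: "('o, 'm) cat \<Rightarrow> 'm \<Rightarrow> bool" where
  "iso_arr C f \<longleftrightarrow> (\<exists>g. inverse_arr C f g)"

definition inv_arr :: "('o, 'm) cat \<Rightarrow> 'm \<Rightarrow> 'm" where
  "inv_arr C f = (THE g. inverse_arr C f g)"

definition zero_object :: "('o, 'm) cat \<Rightarrow> 'o \<Rightarrow> bool" where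
  "zero_object C z \<longleftrightarrow> z \<in> Obj C \<and>
     (\<forall>x\<in>Obj C. (\<exists>!f. f \<in> hom C x z) \<and> (\<exists>!f. f \<in> hom C z x))"


section \<open>Functors\<close>

record ('o1, 'm1, 'o2, 'm2) cfun =
  Src :: "('o1, 'm1) cat"
  Tgt :: "('o2, 'm2) cat"
  FO :: "'o1 \<Rightarrow> 'o2"
  FA :: "'m1 \<Rightarrow> 'm2"

locale cat_functor = S: category "Src F" + T: category "Tgt F"
  for F :: "('o1, 'm1, 'o2, 'm2) cfun" +
  assumes FO_Obj: "x \<in> Obj (Src F) \<Longrightarrow> FO F x \<in> Obj (Tgt F)"
    and FA_hom: "f \<in> Arr (Src F) \<Longrightarrow>
      FA F f \<in> hom (Tgt F) (FO F (Dom (Src F) f)) (FO F (Cod (Src F) f))"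
    and FA_Ident: "x \<in> Obj (Src F) \<Longrightarrow> FA F (Ident (Src F) x) = Ident (Tgt F) (FO F x)"
    and FA_Comp: "composable (Src F) g f \<Longrightarrow>
      FA F (Comp (Src F) g f) = Comp (Tgt F) (FA F g) (FA F f)"
    and FO_ext: "FO F \<in> extensional (Obj (Src F))"
    and FA_ext: "FA F \<in> extensional (Arr (Src F))"

definition fhom :: "('o1, 'm1) cat \<Rightarrow> ('o2, 'm2) cat \<Rightarrow> ('o1, 'm1, 'o2, 'm2) cfun set" where
  "fhom A B = {F. cat_functor F \<and> Src F = A \<and> Tgt F = B}"

definition fid :: "('o, 'm) cat \<Rightarrow> ('o, 'm, 'o, 'm) cfun" where
  "fid A = \<lparr>Src = A, Tgt = A, FO = \<lambda>x\<in>Obj A. x, FA = \<lambda>f\<in>Arr A. f\<rparr>"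

definition fcomp ::
  "('o2, 'm2, 'o3, 'm3) cfun \<Rightarrow> ('o1, 'm1, 'o2, 'm2) cfun \<Rightarrow> ('o1, 'm1, 'o3, 'm3) cfun"
  (infixl "\<odot>" 70) where
  "G \<odot> F = \<lparr>Src = Src F, Tgt = Tgt G,
     FO = \<lambda>x\<in>Obj (Src F). FO G (FO F x), FA = \<lambda>f\<in>Arr (Src F). FA G (FA F f)\<rparr>"

text \<open>The inverse of an isomorphism of categories.\<close>

definition finv :: "('o1, 'm1, 'o2, 'm2) cfun \<Rightarrow> ('o2, 'm2, 'o1, 'm1) cfun" where
  "finv F = \<lparr>Src = Tgt F, Tgt = Src F,
     FO = \<lambda>y\<in>Obj (Tgt F). inv_into (Obj (Src F)) (FO F) y,
     FA = \<lambda>g\<in>Arr (Tgt F). inv_into (Arr (Src F)) (FA F) g\<rparr>"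

definition const_fun ::
  "('o1, 'm1) cat \<Rightarrow> ('o2, 'm2) cat \<Rightarrow> 'o2 \<Rightarrow> ('o1, 'm1, 'o2, 'm2) cfun" where
  "const_fun A B b = \<lparr>Src = A, Tgt = B, FO = \<lambda>x\<in>Obj A. b, FA = \<lambda>f\<in>Arr A. Ident B b\<rparr>"


section \<open>Natural transformations\<close>

record ('o1, 'm1, 'o2, 'm2) ntr =
  NSrc :: "('o1, 'm1, 'o2, 'm2) cfun"
  NTgt :: "('o1, 'm1, 'o2, 'm2) cfun"
  NT :: "'o1 \<Rightarrow> 'm2"

locale nat_trans = S: cat_functor "NSrc \<alpha>" + T: cat_functor "NTgt \<alpha>"
  for \<alpha> :: "('o1, 'm1, 'o2, 'm2) ntr" +
  assumes Src_eq: "Src (NSrc \<alpha>) = Src (NTgt \<alpha>)"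
    and Tgt_eq: "Tgt (NSrc \<alpha>) = Tgt (NTgt \<alpha>)"
    and NT_hom: "x \<in> Obj (Src (NSrc \<alpha>)) \<Longrightarrow>
      NT \<alpha> x \<in> hom (Tgt (NSrc \<alpha>)) (FO (NSrc \<alpha>) x) (FO (NTgt \<alpha>) x)"
    and NT_natural: "f \<in> hom (Src (NSrc \<alpha>)) x y \<Longrightarrow>
      Comp (Tgt (NSrc \<alpha>)) (NT \<alpha> y) (FA (NSrc \<alpha>) f) =
      Comp (Tgt (NSrc \<alpha>)) (FA (NTgt \<alpha>) f) (NT \<alpha> x)"
    and NT_ext: "NT \<alpha> \<in> extensional (Obj (Src (NSrc \<alpha>)))"

definition nts :: "('o1, 'm1, 'o2, 'm2) cfun \<Rightarrow> ('o1, 'm1, 'o2, 'm2) cfun \<Rightarrow>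
  ('o1, 'm1, 'o2, 'm2) ntr set" where
  "nts F G = {\<alpha>. nat_trans \<alpha> \<and> NSrc \<alpha> = F \<and> NTgt \<alpha> = G}"

definition nid :: "('o1, 'm1, 'o2, 'm2) cfun \<Rightarrow> ('o1, 'm1, 'o2, 'm2) ntr" where
  "nid F = \<lparr>NSrc = F, NTgt = F, NT = \<lambda>x\<in>Obj (Src F). Ident (Tgt F) (FO F x)\<rparr>"

text \<open>Vertical composition (first \<open>\<alpha>\<close>, then \<open>\<beta>\<close>), whiskering and horizontal composition.\<close>

definition vcomp :: "('o1, 'm1, 'o2, 'm2) ntr \<Rightarrow> ('o1, 'm1, 'o2, 'm2) ntr \<Rightarrow>
  ('o1, 'm1, 'o2, 'm2) ntr" (infixl "\<cdot>" 60) where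
  "\<beta> \<cdot> \<alpha> = \<lparr>NSrc = NSrc \<alpha>, NTgt = NTgt \<beta>,
     NT = \<lambda>x\<in>Obj (Src (NSrc \<alpha>)). Comp (Tgt (NSrc \<alpha>)) (NT \<beta> x) (NT \<alpha> x)\<rparr>"

definition whisk_left :: "('o2, 'm2, 'o3, 'm3) cfun \<Rightarrow> ('o1, 'm1, 'o2, 'm2) ntr \<Rightarrow>
  ('o1, 'm1, 'o3, 'm3) ntr" (infixr "\<rhd>" 65) where
  "G \<rhd> \<alpha> = \<lparr>NSrc = G \<odot> NSrc \<alpha>, NTgt = G \<odot> NTgt \<alpha>,
     NT = \<lambda>x\<in>Obj (Src (NSrc \<alpha>)). FA G (NT \<alpha> x)\<rparr>"

definition whisk_right :: "('o2, 'm2, 'o3, 'm3) ntr \<Rightarrow> ('o1, 'm1, 'o2, 'm2) cfun \<Rightarrow>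
  ('o1, 'm1, 'o3, 'm3) ntr" (infixl "\<lhd>" 66) where
  "\<beta> \<lhd> F = \<lparr>NSrc = NSrc \<beta> \<odot> F, NTgt = NTgt \<beta> \<odot> F,
     NT = \<lambda>x\<in>Obj (Src F). NT \<beta> (FO F x)\<rparr>"

definition hcomp :: "('o2, 'm2, 'o3, 'm3) ntr \<Rightarrow> ('o1, 'm1, 'o2, 'm2) ntr \<Rightarrow>
  ('o1, 'm1, 'o3, 'm3) ntr" where
  "hcomp \<beta> \<alpha> = (\<beta> \<lhd> NTgt \<alpha>) \<cdot> (NSrc \<beta> \<rhd> \<alpha>)"

definition nat_iso :: "('o1, 'm1, 'o2, 'm2) ntr \<Rightarrow> bool" where
  "nat_iso \<alpha> \<longleftrightarrow> (\<forall>x\<in>Obj (Src (NSrc \<alpha>)). iso_arr (Tgt (NSrc \<alpha>)) (NT \<alpha> x))"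

definition ninv :: "('o1, 'm1, 'o2, 'm2) ntr \<Rightarrow> ('o1, 'm1, 'o2, 'm2) ntr" where
  "ninv \<alpha> = \<lparr>NSrc = NTgt \<alpha>, NTgt = NSrc \<alpha>,
     NT = \<lambda>x\<in>Obj (Src (NSrc \<alpha>)). inv_arr (Tgt (NSrc \<alpha>)) (NT \<alpha> x)\<rparr>"

definition equivalence :: "('o1, 'm1, 'o2, 'm2) cfun \<Rightarrow> bool" where
  "equivalence F \<longleftrightarrow> cat_functor F \<and>
     (\<exists>G \<in> fhom (Tgt F) (Src F).
        (\<exists>\<eta> \<in> nts (fid (Src F)) (G \<odot> F). nat_iso \<eta>) \<and>
        (\<exists>\<epsilon> \<in> nts (F \<odot> G) (fid (Tgt F)). nat_iso \<epsilon>))"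


section \<open>Adjunctions and mates\<close>

locale adjunction =
  fixes L :: "('o1, 'm1, 'o2, 'm2) cfun" and R :: "('o2, 'm2, 'o1, 'm1) cfun"
    and \<eta> :: "('o1, 'm1, 'o1, 'm1) ntr" and \<epsilon> :: "('o2, 'm2, 'o2, 'm2) ntr"
  assumes L_fun: "cat_functor L"
    and R_fun: "R \<in> fhom (Tgt L) (Src L)"
    and unit: "\<eta> \<in> nts (fid (Src L)) (R \<odot> L)"
    and counit: "\<epsilon> \<in> nts (L \<odot> R) (fid (Tgt L))"
    and triangle_L: "(\<epsilon> \<lhd> L) \<cdot> (L \<rhd> \<eta>) = nid L"
    and triangle_R: "(R \<rhd> \<epsilon>) \<cdot> (\<eta> \<lhd> R) = nid R"

text \<open>
  For a 2-cell \<open>\<alpha> : P \<odot> R1 \<Rightarrow> R2 \<odot> Q\<close> and adjunctions \<open>L1 \<stileturn> R1\<close>, \<open>L2 \<stileturn> R2\<close>, the left mate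
  \<open>L2 \<odot> P \<Rightarrow> L2 \<odot> P \<odot> R1 \<odot> L1 \<Rightarrow> L2 \<odot> R2 \<odot> Q \<odot> L1 \<Rightarrow> Q \<odot> L1\<close>.
\<close>

definition left_mate where
  "left_mate L1 \<eta>1 L2 \<epsilon>2 P Q \<alpha> =
     (\<epsilon>2 \<lhd> (Q \<odot> L1)) \<cdot> ((L2 \<rhd> (\<alpha> \<lhd> L1)) \<cdot> ((L2 \<odot> P) \<rhd> \<eta>1))"

text \<open>
  For a 2-cell \<open>\<alpha> : L2 \<odot> Q \<Rightarrow> P \<odot> L1\<close> and adjunctions \<open>L1 \<stileturn> R1\<close>, \<open>L2 \<stileturn> R2\<close>, the right mate
  \<open>Q \<odot> R1 \<Rightarrow> R2 \<odot> L2 \<odot> Q \<odot> R1 \<Rightarrow> R2 \<odot> P \<odot> L1 \<odot> R1 \<Rightarrow> R2 \<odot> P\<close>.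
\<close>

definition right_mate where
  "right_mate R1 \<epsilon>1 R2 \<eta>2 P Q \<alpha> =
     ((R2 \<odot> P) \<rhd> \<epsilon>1) \<cdot> ((R2 \<rhd> (\<alpha> \<lhd> R1)) \<cdot> (\<eta>2 \<lhd> (Q \<odot> R1)))"


section \<open>Small categories\<close>

text \<open>
  Small categories have their objects and arrows in the type \<open>'u el\<close>, which is closed under
  forming tuples. Its cardinality is the maximum of the cardinality of \<open>'u\<close> and \<open>\<aleph>\<^sub>0\<close>, so by the
  choice of \<open>'u\<close> it is an arbitrary infinite cardinal \<open>\<kappa>\<close>; small means of cardinality \<open>< \<kappa>\<close>. If
  \<open>\<kappa>\<close> is regular, this class is closed under all the constructions below (including small
  coproducts); if \<open>\<kappa>\<close> is strongly inaccessible, these are the small categories of a Grothendieck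
  universe.
\<close>

datatype 'u el = Atom 'u | Tup (entries: "'u el list")

abbreviation pr :: "nat \<Rightarrow> 'u el \<Rightarrow> 'u el" where
  "pr k x \<equiv> entries x ! k"

type_synonym 'u scat = "('u el, 'u el) cat"
type_synonym 'u sfun = "('u el, 'u el, 'u el, 'u el) cfun"
type_synonym 'u snt = "('u el, 'u el, 'u el, 'u el) ntr"

definition small_set :: "'u el set \<Rightarrow> bool" where
  "small_set S \<longleftrightarrow> (card_of S, card_of (UNIV :: 'u el set)) \<in> ordLess"

definition regular_universe :: "'u itself \<Rightarrow> bool" where
  "regular_universe _ \<longleftrightarrow> regularCard (card_of (UNIV :: 'u el set))"

definition Cat :: "'u scat set" where
  "Cat = {A. category A \<and> small_set (Obj A) \<and> small_set (Arr A)}"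

text \<open>A partially ordered set \<open>(P, le)\<close>, with the arrow \<open>x \<rightarrow> y\<close> given by the pair of \<open>x\<close> and \<open>y\<close>.\<close>

definition poset_cat :: "'u el set \<Rightarrow> ('u el \<Rightarrow> 'u el \<Rightarrow> bool) \<Rightarrow> 'u scat" where
  "poset_cat P le = (let A = {Tup [x, y] | x y. x \<in> P \<and> y \<in> P \<and> le x y} in
     \<lparr>Obj = P, Arr = A, Dom = \<lambda>f\<in>A. pr 0 f, Cod = \<lambda>f\<in>A. pr 1 f, Ident = \<lambda>x\<in>P. Tup [x, x],
      Comp = \<lambda>g f. if g \<in> A \<and> f \<in> A \<and> pr 0 g = pr 1 f then Tup [pr 0 f, pr 1 g] else undefined\<rparr>)"

text \<open>The functor into a category of the form \<open>poset_cat P le\<close> given by a map on objects.\<close>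

definition to_poset :: "'u scat \<Rightarrow> 'u scat \<Rightarrow> ('u el \<Rightarrow> 'u el) \<Rightarrow> 'u sfun" where
  "to_poset A B \<phi> = \<lparr>Src = A, Tgt = B, FO = \<lambda>x\<in>Obj A. \<phi> x,
     FA = \<lambda>f\<in>Arr A. Tup [\<phi> (Dom A f), \<phi> (Cod A f)]\<rparr>"

definition one_cat :: "'u scat" where
  "one_cat = poset_cat {Tup []} (\<lambda>_ _. True)"

definition bang :: "'u scat \<Rightarrow> 'u sfun" where
  "bang A = const_fun A one_cat (Tup [])"

definition point :: "'u scat \<Rightarrow> 'u el \<Rightarrow> 'u sfun" where
  "point A a = const_fun one_cat A a"

definition prod_cat :: "'u scat \<Rightarrow> 'u scat \<Rightarrow> 'u scat" (infixr "\<otimes>" 75) where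
  "A \<otimes> B = (let M = {Tup [f, g] | f g. f \<in> Arr A \<and> g \<in> Arr B} in
     \<lparr>Obj = {Tup [a, b] | a b. a \<in> Obj A \<and> b \<in> Obj B}, Arr = M,
      Dom = \<lambda>h\<in>M. Tup [Dom A (pr 0 h), Dom B (pr 1 h)],
      Cod = \<lambda>h\<in>M. Tup [Cod A (pr 0 h), Cod B (pr 1 h)],
      Ident = \<lambda>x\<in>{Tup [a, b] | a b. a \<in> Obj A \<and> b \<in> Obj B}.
        Tup [Ident A (pr 0 x), Ident B (pr 1 x)],
      Comp = \<lambda>k h. if k \<in> M \<and> h \<in> M \<and> composable A (pr 0 k) (pr 0 h) \<and> composable B (pr 1 k) (pr 1 h)
        then Tup [Comp A (pr 0 k) (pr 0 h), Comp B (pr 1 k) (pr 1 h)] else undefined\<rparr>)"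

definition prod_fun :: "'u sfun \<Rightarrow> 'u sfun \<Rightarrow> 'u sfun" (infixr "\<otimes>\<^sub>f" 75) where
  "u \<otimes>\<^sub>f v = \<lparr>Src = Src u \<otimes> Src v, Tgt = Tgt u \<otimes> Tgt v,
     FO = \<lambda>x\<in>Obj (Src u \<otimes> Src v). Tup [FO u (pr 0 x), FO v (pr 1 x)],
     FA = \<lambda>h\<in>Arr (Src u \<otimes> Src v). Tup [FA u (pr 0 h), FA v (pr 1 h)]\<rparr>"

definition prod_nt :: "'u snt \<Rightarrow> 'u snt \<Rightarrow> 'u snt" (infixr "\<otimes>\<^sub>n" 75) where
  "\<alpha> \<otimes>\<^sub>n \<beta> = \<lparr>NSrc = NSrc \<alpha> \<otimes>\<^sub>f NSrc \<beta>, NTgt = NTgt \<alpha> \<otimes>\<^sub>f NTgt \<beta>,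
     NT = \<lambda>x\<in>Obj (Src (NSrc \<alpha>) \<otimes> Src (NSrc \<beta>)). Tup [NT \<alpha> (pr 0 x), NT \<beta> (pr 1 x)]\<rparr>"

definition prod_assoc :: "'u scat \<Rightarrow> 'u scat \<Rightarrow> 'u scat \<Rightarrow> 'u sfun" where
  "prod_assoc A B C = \<lparr>Src = A \<otimes> B \<otimes> C, Tgt = (A \<otimes> B) \<otimes> C,
     FO = \<lambda>x\<in>Obj (A \<otimes> B \<otimes> C). Tup [Tup [pr 0 x, pr 0 (pr 1 x)], pr 1 (pr 1 x)],
     FA = \<lambda>h\<in>Arr (A \<otimes> B \<otimes> C). Tup [Tup [pr 0 h, pr 0 (pr 1 h)], pr 1 (pr 1 h)]\<rparr>"

text \<open>The functor \<open>B \<rightarrow> A \<otimes> B\<close>, \<open>b \<mapsto> (a, b)\<close>.\<close>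

definition slice_at :: "'u scat \<Rightarrow> 'u el \<Rightarrow> 'u scat \<Rightarrow> 'u sfun" where
  "slice_at A a B = \<lparr>Src = B, Tgt = A \<otimes> B,
     FO = \<lambda>b\<in>Obj B. Tup [a, b], FA = \<lambda>g\<in>Arr B. Tup [Ident A a, g]\<rparr>"

definition coprod_cat :: "'u el set \<Rightarrow> ('u el \<Rightarrow> 'u scat) \<Rightarrow> 'u scat" where
  "coprod_cat I A = (let N = {Tup [i, a] | i a. i \<in> I \<and> a \<in> Obj (A i)};
       M = {Tup [i, f] | i f. i \<in> I \<and> f \<in> Arr (A i)} in
     \<lparr>Obj = N, Arr = M,
      Dom = \<lambda>h\<in>M. Tup [pr 0 h, Dom (A (pr 0 h)) (pr 1 h)],
      Cod = \<lambda>h\<in>M. Tup [pr 0 h, Cod (A (pr 0 h)) (pr 1 h)],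
      Ident = \<lambda>x\<in>N. Tup [pr 0 x, Ident (A (pr 0 x)) (pr 1 x)],
      Comp = \<lambda>k h. if k \<in> M \<and> h \<in> M \<and> pr 0 k = pr 0 h \<and> composable (A (pr 0 h)) (pr 1 k) (pr 1 h)
        then Tup [pr 0 h, Comp (A (pr 0 h)) (pr 1 k) (pr 1 h)] else undefined\<rparr>)"

definition coprod_incl :: "'u el set \<Rightarrow> ('u el \<Rightarrow> 'u scat) \<Rightarrow> 'u el \<Rightarrow> 'u sfun" where
  "coprod_incl I A i = \<lparr>Src = A i, Tgt = coprod_cat I A,
     FO = \<lambda>a\<in>Obj (A i). Tup [i, a], FA = \<lambda>f\<in>Arr (A i). Tup [i, f]\<rparr>"

text \<open>
  Common construction for the two kinds of comma categories: the objects are pairs of an object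
  of \<open>A\<close> and additional data, the arrows \<open>x \<rightarrow> y\<close> are triples \<open>(x, h, y)\<close> with \<open>h\<close> an arrow of \<open>A\<close>
  between the first components such that \<open>R x h y\<close>.
\<close>

definition lift_cat ::
  "'u scat \<Rightarrow> 'u el set \<Rightarrow> ('u el \<Rightarrow> 'u el \<Rightarrow> 'u el \<Rightarrow> bool) \<Rightarrow> 'u scat" where
  "lift_cat A N R =
     (let M = {Tup [x, h, y] | x h y. x \<in> N \<and> y \<in> N \<and> h \<in> hom A (pr 0 x) (pr 0 y) \<and> R x h y} in
     \<lparr>Obj = N, Arr = M, Dom = \<lambda>k\<in>M. pr 0 k, Cod = \<lambda>k\<in>M. pr 2 k,
      Ident = \<lambda>x\<in>N. Tup [x, Ident A (pr 0 x), x],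
      Comp = \<lambda>l k. if l \<in> M \<and> k \<in> M \<and> pr 0 l = pr 2 k
        then Tup [pr 0 k, Comp A (pr 1 l) (pr 1 k), pr 2 l] else undefined\<rparr>)"

definition lift_proj :: "'u scat \<Rightarrow> 'u scat \<Rightarrow> 'u sfun" where
  "lift_proj K A = \<lparr>Src = K, Tgt = A, FO = \<lambda>x\<in>Obj K. pr 0 x, FA = \<lambda>k\<in>Arr K. pr 1 k\<rparr>"

text \<open>For \<open>u : A \<rightarrow> B\<close>, the categories \<open>(u/b)\<close> of pairs \<open>(a, f : u a \<rightarrow> b)\<close> and \<open>(b/u)\<close> of pairs
  \<open>(a, f : b \<rightarrow> u a)\<close>, their projections to \<open>A\<close> and the tautological 2-cells.\<close>

definition over_cat :: "'u sfun \<Rightarrow> 'u el \<Rightarrow> 'u scat" where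
  "over_cat u b = lift_cat (Src u)
     {Tup [a, f] | a f. a \<in> Obj (Src u) \<and> f \<in> hom (Tgt u) (FO u a) b}
     (\<lambda>x h y. Comp (Tgt u) (pr 1 y) (FA u h) = pr 1 x)"

definition under_cat :: "'u sfun \<Rightarrow> 'u el \<Rightarrow> 'u scat" where
  "under_cat u b = lift_cat (Src u)
     {Tup [a, f] | a f. a \<in> Obj (Src u) \<and> f \<in> hom (Tgt u) b (FO u a)}
     (\<lambda>x h y. Comp (Tgt u) (FA u h) (pr 1 x) = pr 1 y)"

definition over_proj :: "'u sfun \<Rightarrow> 'u el \<Rightarrow> 'u sfun" where
  "over_proj u b = lift_proj (over_cat u b) (Src u)"

definition under_proj :: "'u sfun \<Rightarrow> 'u el \<Rightarrow> 'u sfun" where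
  "under_proj u b = lift_proj (under_cat u b) (Src u)"

definition over_cell :: "'u sfun \<Rightarrow> 'u el \<Rightarrow> 'u snt" where
  "over_cell u b = \<lparr>NSrc = u \<odot> over_proj u b, NTgt = point (Tgt u) b \<odot> bang (over_cat u b),
     NT = \<lambda>x\<in>Obj (over_cat u b). pr 1 x\<rparr>"

definition under_cell :: "'u sfun \<Rightarrow> 'u el \<Rightarrow> 'u snt" where
  "under_cell u b = \<lparr>NSrc = point (Tgt u) b \<odot> bang (under_cat u b), NTgt = u \<odot> under_proj u b,
     NT = \<lambda>x\<in>Obj (under_cat u b). pr 1 x\<rparr>"


section \<open>Derivators\<close>

text \<open>
  The values of a prederivator are categories with objects in \<open>'o\<close> and arrows in \<open>'m\<close>; these types
  are arbitrary and unrelated to the type \<open>'u el\<close> of the small categories.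
\<close>

record ('u, 'o, 'm) prederiv =
  dcat :: "'u scat \<Rightarrow> ('o, 'm) cat"
  dfun :: "'u sfun \<Rightarrow> ('o, 'm, 'o, 'm) cfun"
  dnt :: "'u snt \<Rightarrow> ('o, 'm, 'o, 'm) ntr"

text \<open>Strict 2-functors from \<open>Cat\<close>, contravariant on functors and covariant on transformations.\<close>

locale prederivator =
  fixes D :: "('u, 'o, 'm) prederiv"
  assumes dcat_category: "A \<in> Cat \<Longrightarrow> category (dcat D A)"
    and dfun_fhom: "A \<in> Cat \<Longrightarrow> B \<in> Cat \<Longrightarrow> u \<in> fhom A B \<Longrightarrow>
      dfun D u \<in> fhom (dcat D B) (dcat D A)"
    and dfun_id: "A \<in> Cat \<Longrightarrow> dfun D (fid A) = fid (dcat D A)"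
    and dfun_comp: "A \<in> Cat \<Longrightarrow> B \<in> Cat \<Longrightarrow> C \<in> Cat \<Longrightarrow> u \<in> fhom A B \<Longrightarrow> v \<in> fhom B C \<Longrightarrow>
      dfun D (v \<odot> u) = dfun D u \<odot> dfun D v"
    and dnt_nts: "A \<in> Cat \<Longrightarrow> B \<in> Cat \<Longrightarrow> u \<in> fhom A B \<Longrightarrow> v \<in> fhom A B \<Longrightarrow> \<alpha> \<in> nts u v \<Longrightarrow>
      dnt D \<alpha> \<in> nts (dfun D u) (dfun D v)"
    and dnt_id: "A \<in> Cat \<Longrightarrow> B \<in> Cat \<Longrightarrow> u \<in> fhom A B \<Longrightarrow> dnt D (nid u) = nid (dfun D u)"
    and dnt_vcomp: "A \<in> Cat \<Longrightarrow> B \<in> Cat \<Longrightarrow> u \<in> fhom A B \<Longrightarrow> v \<in> fhom A B \<Longrightarrow> w \<in> fhom A B \<Longrightarrow>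
      \<alpha> \<in> nts u v \<Longrightarrow> \<beta> \<in> nts v w \<Longrightarrow> dnt D (\<beta> \<cdot> \<alpha>) = dnt D \<beta> \<cdot> dnt D \<alpha>"
    and dnt_hcomp: "A \<in> Cat \<Longrightarrow> B \<in> Cat \<Longrightarrow> C \<in> Cat \<Longrightarrow> u \<in> fhom A B \<Longrightarrow> u' \<in> fhom A B \<Longrightarrow>
      v \<in> fhom B C \<Longrightarrow> v' \<in> fhom B C \<Longrightarrow> \<alpha> \<in> nts u u' \<Longrightarrow> \<beta> \<in> nts v v' \<Longrightarrow>
      dnt D (hcomp \<beta> \<alpha>) = hcomp (dnt D \<alpha>) (dnt D \<beta>)"

text \<open>
  Chosen left and right adjoints of \<open>dfun D u\<close>, with units and counits: \<open>lan D u\<close> is \<open>u\<^sub>!\<close> and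
  \<open>ran D u\<close> is \<open>u\<^sub>*\<close>.
\<close>

definition lan_data where
  "lan_data D u = (SOME (L, \<eta>, \<epsilon>). adjunction L (dfun D u) \<eta> \<epsilon>)"

definition ran_data where
  "ran_data D u = (SOME (R, \<eta>, \<epsilon>). adjunction (dfun D u) R \<eta> \<epsilon>)"

definition lan :: "('u, 'o, 'm) prederiv \<Rightarrow> 'u sfun \<Rightarrow> ('o, 'm, 'o, 'm) cfun" where
  "lan D u = fst (lan_data D u)"
definition lan_unit :: "('u, 'o, 'm) prederiv \<Rightarrow> 'u sfun \<Rightarrow> ('o, 'm, 'o, 'm) ntr" where
  "lan_unit D u = fst (snd (lan_data D u))"
definition lan_counit :: "('u, 'o, 'm) prederiv \<Rightarrow> 'u sfun \<Rightarrow> ('o, 'm, 'o, 'm) ntr" where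
  "lan_counit D u = snd (snd (lan_data D u))"

definition ran :: "('u, 'o, 'm) prederiv \<Rightarrow> 'u sfun \<Rightarrow> ('o, 'm, 'o, 'm) cfun" where
  "ran D u = fst (ran_data D u)"
definition ran_unit :: "('u, 'o, 'm) prederiv \<Rightarrow> 'u sfun \<Rightarrow> ('o, 'm, 'o, 'm) ntr" where
  "ran_unit D u = fst (snd (ran_data D u))"
definition ran_counit :: "('u, 'o, 'm) prederiv \<Rightarrow> 'u sfun \<Rightarrow> ('o, 'm, 'o, 'm) ntr" where
  "ran_counit D u = snd (snd (ran_data D u))"

text \<open>The mates of \<open>\<alpha>\<close>, for a square \<open>\<alpha> : u1 \<odot> p \<Rightarrow> q \<odot> u2\<close> respectively
  \<open>\<alpha> : q \<odot> u2 \<Rightarrow> u1 \<odot> p\<close>: they are transformations \<open>u2\<^sub>! p\<^sup>* \<Rightarrow> q\<^sup>* u1\<^sub>!\<close> respectively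
  \<open>q\<^sup>* u1\<^sub>* \<Rightarrow> u2\<^sub>* p\<^sup>*\<close>.\<close>

definition lan_mate :: "('u, 'o, 'm) prederiv \<Rightarrow> 'u sfun \<Rightarrow> 'u sfun \<Rightarrow> 'u sfun \<Rightarrow> 'u sfun \<Rightarrow>
  'u snt \<Rightarrow> ('o, 'm, 'o, 'm) ntr" where
  "lan_mate D u1 u2 p q \<alpha> = left_mate (lan D u1) (lan_unit D u1) (lan D u2) (lan_counit D u2)
     (dfun D p) (dfun D q) (dnt D \<alpha>)"

definition ran_mate :: "('u, 'o, 'm) prederiv \<Rightarrow> 'u sfun \<Rightarrow> 'u sfun \<Rightarrow> 'u sfun \<Rightarrow> 'u sfun \<Rightarrow>
  'u snt \<Rightarrow> ('o, 'm, 'o, 'm) ntr" where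
  "ran_mate D u1 u2 p q \<alpha> = right_mate (ran D u1) (ran_counit D u1) (ran D u2) (ran_unit D u2)
     (dfun D p) (dfun D q) (dnt D \<alpha>)"

text \<open>Products of large categories and the canonical functor
  \<open>D (\<Coprod>\<^sub>i A\<^sub>i) \<rightarrow> \<Prod>\<^sub>i D (A\<^sub>i)\<close>.\<close>

definition big_prod_cat :: "'i set \<Rightarrow> ('i \<Rightarrow> ('o, 'm) cat) \<Rightarrow> ('i \<Rightarrow> 'o, 'i \<Rightarrow> 'm) cat" where
  "big_prod_cat I C = (let N = (\<Pi>\<^sub>E i\<in>I. Obj (C i)); M = (\<Pi>\<^sub>E i\<in>I. Arr (C i)) in
     \<lparr>Obj = N, Arr = M,
      Dom = \<lambda>f\<in>M. \<lambda>i\<in>I. Dom (C i) (f i), Cod = \<lambda>f\<in>M. \<lambda>i\<in>I. Cod (C i) (f i),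
      Ident = \<lambda>x\<in>N. \<lambda>i\<in>I. Ident (C i) (x i),
      Comp = \<lambda>g f. if g \<in> M \<and> f \<in> M \<and> (\<forall>i\<in>I. composable (C i) (g i) (f i))
        then (\<lambda>i\<in>I. Comp (C i) (g i) (f i)) else undefined\<rparr>)"

definition coprod_comparison :: "('u, 'o, 'm) prederiv \<Rightarrow> 'u el set \<Rightarrow> ('u el \<Rightarrow> 'u scat) \<Rightarrow>
  ('o, 'm, 'u el \<Rightarrow> 'o, 'u el \<Rightarrow> 'm) cfun" where
  "coprod_comparison D I A =
     \<lparr>Src = dcat D (coprod_cat I A), Tgt = big_prod_cat I (\<lambda>i. dcat D (A i)),
      FO = \<lambda>x\<in>Obj (dcat D (coprod_cat I A)). \<lambda>i\<in>I. FO (dfun D (coprod_incl I A i)) x,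
      FA = \<lambda>f\<in>Arr (dcat D (coprod_cat I A)). \<lambda>i\<in>I. FA (dfun D (coprod_incl I A i)) f\<rparr>"

locale derivator = prederivator D for D :: "('u, 'o, 'm) prederiv" +
  assumes Der1: "small_set I \<Longrightarrow> (\<And>i. i \<in> I \<Longrightarrow> K i \<in> Cat) \<Longrightarrow>
      equivalence (coprod_comparison D I K)"
    and Der2: "A \<in> Cat \<Longrightarrow> f \<in> Arr (dcat D A) \<Longrightarrow>
      iso_arr (dcat D A) f \<longleftrightarrow>
      (\<forall>a\<in>Obj A. iso_arr (dcat D one_cat) (FA (dfun D (point A a)) f))"
    and Der3_left: "A \<in> Cat \<Longrightarrow> B \<in> Cat \<Longrightarrow> u \<in> fhom A B \<Longrightarrow>
      \<exists>L \<eta> \<epsilon>. adjunction L (dfun D u) \<eta> \<epsilon>"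
    and Der3_right: "A \<in> Cat \<Longrightarrow> B \<in> Cat \<Longrightarrow> u \<in> fhom A B \<Longrightarrow>
      \<exists>R \<eta> \<epsilon>. adjunction (dfun D u) R \<eta> \<epsilon>"
    and Der4_left: "A \<in> Cat \<Longrightarrow> B \<in> Cat \<Longrightarrow> u \<in> fhom A B \<Longrightarrow> b \<in> Obj B \<Longrightarrow>
      nat_iso (lan_mate D u (bang (over_cat u b)) (over_proj u b) (point B b) (over_cell u b))"
    and Der4_right: "A \<in> Cat \<Longrightarrow> B \<in> Cat \<Longrightarrow> u \<in> fhom A B \<Longrightarrow> b \<in> Obj B \<Longrightarrow>
      nat_iso (ran_mate D u (bang (under_cat u b)) (under_proj u b) (point B b) (under_cell u b))"

definition pointed :: "('u, 'o, 'm) prederiv \<Rightarrow> bool" where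
  "pointed D \<longleftrightarrow> (\<exists>z. zero_object (dcat D one_cat) z)"

text \<open>The derivator \<open>D\<^sup>A\<close>, \<open>B \<mapsto> D (A \<otimes> B)\<close>.\<close>

definition shift :: "('u, 'o, 'm) prederiv \<Rightarrow> 'u scat \<Rightarrow> ('u, 'o, 'm) prederiv" where
  "shift D A = \<lparr>dcat = \<lambda>B. dcat D (A \<otimes> B), dfun = \<lambda>u. dfun D (fid A \<otimes>\<^sub>f u),
     dnt = \<lambda>\<alpha>. dnt D (nid (fid A) \<otimes>\<^sub>n \<alpha>)\<rparr>"


section \<open>Morphisms of derivators and modifications\<close>

text \<open>
  A morphism \<open>F : D \<rightarrow> E\<close> consists of functors \<open>mfun F A : D A \<rightarrow> E A\<close> and, for \<open>u : A \<rightarrow> B\<close>,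
  of transformations \<open>mnt F u : E u \<odot> mfun F B \<Rightarrow> mfun F A \<odot> D u\<close>.
\<close>

record ('u, 'o1, 'm1, 'o2, 'm2) dmor =
  mfun :: "'u scat \<Rightarrow> ('o1, 'm1, 'o2, 'm2) cfun"
  mnt :: "'u sfun \<Rightarrow> ('o1, 'm1, 'o2, 'm2) ntr"

locale pseudonatural =
  fixes D :: "('u, 'o1, 'm1) prederiv" and E :: "('u, 'o2, 'm2) prederiv"
    and F :: "('u, 'o1, 'm1, 'o2, 'm2) dmor"
  assumes mfun_fhom: "A \<in> Cat \<Longrightarrow> mfun F A \<in> fhom (dcat D A) (dcat E A)"
    and mnt_nts: "A \<in> Cat \<Longrightarrow> B \<in> Cat \<Longrightarrow> u \<in> fhom A B \<Longrightarrow>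
      mnt F u \<in> nts (dfun E u \<odot> mfun F B) (mfun F A \<odot> dfun D u)"
    and mnt_iso: "A \<in> Cat \<Longrightarrow> B \<in> Cat \<Longrightarrow> u \<in> fhom A B \<Longrightarrow> nat_iso (mnt F u)"
    and mnt_id: "A \<in> Cat \<Longrightarrow> mnt F (fid A) = nid (mfun F A)"
    and mnt_comp: "A \<in> Cat \<Longrightarrow> B \<in> Cat \<Longrightarrow> C \<in> Cat \<Longrightarrow> u \<in> fhom A B \<Longrightarrow> v \<in> fhom B C \<Longrightarrow>
      mnt F (v \<odot> u) = (mnt F u \<lhd> dfun D v) \<cdot> (dfun E u \<rhd> mnt F v)"
    and mnt_natural: "A \<in> Cat \<Longrightarrow> B \<in> Cat \<Longrightarrow> u \<in> fhom A B \<Longrightarrow> v \<in> fhom A B \<Longrightarrow> \<alpha> \<in> nts u v \<Longrightarrow>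
      (mfun F A \<rhd> dnt D \<alpha>) \<cdot> mnt F u = mnt F v \<cdot> (dnt E \<alpha> \<lhd> mfun F B)"

locale modification =
  F: pseudonatural D E F + G: pseudonatural D E G
  for D :: "('u, 'o1, 'm1) prederiv" and E :: "('u, 'o2, 'm2) prederiv"
    and F G :: "('u, 'o1, 'm1, 'o2, 'm2) dmor" +
  fixes \<tau> :: "'u scat \<Rightarrow> ('o1, 'm1, 'o2, 'm2) ntr"
  assumes component: "A \<in> Cat \<Longrightarrow> \<tau> A \<in> nts (mfun F A) (mfun G A)"
    and compat: "A \<in> Cat \<Longrightarrow> B \<in> Cat \<Longrightarrow> u \<in> fhom A B \<Longrightarrow>
      (\<tau> A \<lhd> dfun D u) \<cdot> mnt F u = mnt G u \<cdot> (dfun E u \<rhd> \<tau> B)"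

definition iso_modification where
  "iso_modification D E F G \<tau> \<longleftrightarrow> modification D E F G \<tau> \<and> (\<forall>A\<in>Cat. nat_iso (\<tau> A))"

definition mcomp :: "('u, 'o2, 'm2, 'o3, 'm3) dmor \<Rightarrow> ('u, 'o1, 'm1, 'o2, 'm2) dmor \<Rightarrow>
  ('u, 'o1, 'm1, 'o3, 'm3) dmor" (infixr "\<circ>\<^sub>d" 55) where
  "G \<circ>\<^sub>d F = \<lparr>mfun = \<lambda>A. mfun G A \<odot> mfun F A,
     mnt = \<lambda>u. (mfun G (Src u) \<rhd> mnt F u) \<cdot> (mnt G u \<lhd> mfun F (Tgt u))\<rparr>"

text \<open>The strictly natural morphism into \<open>E\<close> with components \<open>\<Phi> A\<close>.\<close>

definition strict_mor :: "('u, 'o2, 'm2) prederiv \<Rightarrow> ('u scat \<Rightarrow> ('o1, 'm1, 'o2, 'm2) cfun) \<Rightarrow>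
  ('u, 'o1, 'm1, 'o2, 'm2) dmor" where
  "strict_mor E \<Phi> = \<lparr>mfun = \<Phi>, mnt = \<lambda>u. nid (dfun E u \<odot> \<Phi> (Tgt u))\<rparr>"

definition id_mor :: "('u, 'o, 'm) prederiv \<Rightarrow> ('u, 'o, 'm, 'o, 'm) dmor" where
  "id_mor D = strict_mor D (\<lambda>A. fid (dcat D A))"

text \<open>Evaluation \<open>a\<^sup>* : D\<^sup>A \<rightarrow> D\<close> at an object \<open>a\<close> of \<open>A\<close>.\<close>

definition eval_mor :: "('u, 'o, 'm) prederiv \<Rightarrow> 'u scat \<Rightarrow> 'u el \<Rightarrow> ('u, 'o, 'm, 'o, 'm) dmor" where
  "eval_mor D A a = strict_mor D (\<lambda>B. dfun D (slice_at A a B))"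

text \<open>For \<open>u : A \<rightarrow> B\<close>, the morphisms \<open>u\<^sup>* : D\<^sup>B \<rightarrow> D\<^sup>A\<close> and \<open>u\<^sub>!, u\<^sub>* : D\<^sup>A \<rightarrow> D\<^sup>B\<close>. The
  structure of \<open>u\<^sub>!\<close> and \<open>u\<^sub>*\<close> at \<open>w\<close> is given by the mates of the commuting square
  of \<open>u \<otimes> C\<close>, \<open>u \<otimes> C'\<close>, \<open>A \<otimes> w\<close>, \<open>B \<otimes> w\<close>; for \<open>u\<^sub>!\<close> the mate has to be inverted.\<close>

definition restr_mor :: "('u, 'o, 'm) prederiv \<Rightarrow> 'u sfun \<Rightarrow> ('u, 'o, 'm, 'o, 'm) dmor" where
  "restr_mor D u = strict_mor (shift D (Src u)) (\<lambda>C. dfun D (u \<otimes>\<^sub>f fid C))"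

definition lan_mor :: "('u, 'o, 'm) prederiv \<Rightarrow> 'u sfun \<Rightarrow> ('u, 'o, 'm, 'o, 'm) dmor" where
  "lan_mor D u = \<lparr>mfun = \<lambda>C. lan D (u \<otimes>\<^sub>f fid C),
     mnt = \<lambda>w. ninv (lan_mate D (u \<otimes>\<^sub>f fid (Tgt w)) (u \<otimes>\<^sub>f fid (Src w))
       (fid (Src u) \<otimes>\<^sub>f w) (fid (Tgt u) \<otimes>\<^sub>f w) (nid (u \<otimes>\<^sub>f w)))\<rparr>"

definition ran_mor :: "('u, 'o, 'm) prederiv \<Rightarrow> 'u sfun \<Rightarrow> ('u, 'o, 'm, 'o, 'm) dmor" where
  "ran_mor D u = \<lparr>mfun = \<lambda>C. ran D (u \<otimes>\<^sub>f fid C),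
     mnt = \<lambda>w. ran_mate D (u \<otimes>\<^sub>f fid (Tgt w)) (u \<otimes>\<^sub>f fid (Src w))
       (fid (Src u) \<otimes>\<^sub>f w) (fid (Tgt u) \<otimes>\<^sub>f w) (nid (u \<otimes>\<^sub>f w))\<rparr>"

text \<open>The morphism \<open>F\<^sup>P : D\<^sup>P \<rightarrow> E\<^sup>P\<close> induced by \<open>F : D \<rightarrow> E\<close>.\<close>

definition shift_mor :: "'u scat \<Rightarrow> ('u, 'o1, 'm1, 'o2, 'm2) dmor \<Rightarrow>
  ('u, 'o1, 'm1, 'o2, 'm2) dmor" where
  "shift_mor P F = \<lparr>mfun = \<lambda>B. mfun F (P \<otimes> B), mnt = \<lambda>w. mnt F (fid P \<otimes>\<^sub>f w)\<rparr>"


section \<open>Cubes, cofibers and cones\<close>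

definition b0 :: "'u el" where "b0 = Tup []"
definition b1 :: "'u el" where "b1 = Tup [Tup []]"

definition ble :: "'u el \<Rightarrow> 'u el \<Rightarrow> bool" where
  "ble x y \<longleftrightarrow> x = b0 \<or> y = b1"

definition arrow_cat :: "'u scat" where
  "arrow_cat = poset_cat {b0, b1} ble"

text \<open>The vertices of \<open>[1]\<^sup>n\<close> are the \<open>n\<close>-tuples of elements of \<open>{b0, b1}\<close>.\<close>

definition cube_pts :: "nat \<Rightarrow> 'u el set" where
  "cube_pts n = {Tup xs | xs. length xs = n \<and> set xs \<subseteq> {b0, b1}}"

definition cube_le :: "'u el \<Rightarrow> 'u el \<Rightarrow> bool" where
  "cube_le x y \<longleftrightarrow> list_all2 ble (entries x) (entries y)"

definition cube :: "nat \<Rightarrow> 'u scat" where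
  "cube n = poset_cat (cube_pts n) cube_le"

definition top_pt :: "nat \<Rightarrow> 'u el" where
  "top_pt n = Tup (replicate n b1)"

definition corner :: "'u scat" where
  "corner = poset_cat (cube_pts 2 - {Tup [b1, b1]}) cube_le"

definition corner_incl :: "'u sfun" where
  "corner_incl = to_poset corner (cube 2) (\<lambda>x. x)"

definition corner_arrow :: "'u sfun" where
  "corner_arrow = to_poset arrow_cat corner (\<lambda>x. Tup [x, b0])"

definition cof_edge :: "'u sfun" where
  "cof_edge = to_poset arrow_cat (cube 2) (\<lambda>x. Tup [b1, x])"

definition cof :: "('u, 'o, 'm) prederiv \<Rightarrow> ('u, 'o, 'm, 'o, 'm) dmor" where
  "cof D = restr_mor D cof_edge \<circ>\<^sub>d lan_mor D corner_incl \<circ>\<^sub>d ran_mor D corner_arrow"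

definition cone :: "('u, 'o, 'm) prederiv \<Rightarrow> ('u, 'o, 'm, 'o, 'm) dmor" where
  "cone D = eval_mor D arrow_cat b1 \<circ>\<^sub>d cof D"

text \<open>The isomorphism \<open>[1] \<otimes> [1]\<^sup>n\<^sup>-\<^sup>1 \<rightarrow> [1]\<^sup>n\<close> placing the first factor in coordinate \<open>i\<close>
  (\<open>1 \<le> i \<le> n\<close>), and the resulting isomorphism \<open>[1] \<otimes> ([1]\<^sup>n\<^sup>-\<^sup>1 \<otimes> B) \<rightarrow> [1]\<^sup>n \<otimes> B\<close>.\<close>

definition insert_coord :: "nat \<Rightarrow> nat \<Rightarrow> 'u sfun" where
  "insert_coord n i = to_poset (arrow_cat \<otimes> cube (n - 1)) (cube n)
     (\<lambda>x. Tup (take (i - 1) (entries (pr 1 x)) @ pr 0 x # drop (i - 1) (entries (pr 1 x))))"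

definition coord_iso :: "nat \<Rightarrow> nat \<Rightarrow> 'u scat \<Rightarrow> 'u sfun" where
  "coord_iso n i B = (insert_coord n i \<otimes>\<^sub>f fid B) \<odot> prod_assoc arrow_cat (cube (n - 1)) B"

text \<open>The morphism \<open>cof\<close> in coordinate \<open>i\<close>, with parameters in \<open>[1]\<^sup>n\<^sup>-\<^sup>1\<close>.\<close>

definition cof_dir :: "('u, 'o, 'm) prederiv \<Rightarrow> nat \<Rightarrow> nat \<Rightarrow> ('u, 'o, 'm, 'o, 'm) dmor" where
  "cof_dir D n i =
     strict_mor (shift D (cube n)) (\<lambda>B. dfun D (finv (coord_iso n i B))) \<circ>\<^sub>d
     shift_mor (cube (n - 1)) (cof D) \<circ>\<^sub>d
     strict_mor (shift (shift D arrow_cat) (cube (n - 1))) (\<lambda>B. dfun D (coord_iso n i B))"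

text \<open>The composite \<open>cof_dir D n k \<circ>\<^sub>d \<dots> \<circ>\<^sub>d cof_dir D n 1\<close>.\<close>

primrec cof_upto :: "('u, 'o, 'm) prederiv \<Rightarrow> nat \<Rightarrow> nat \<Rightarrow> ('u, 'o, 'm, 'o, 'm) dmor" where
  "cof_upto D n 0 = id_mor (shift D (cube n))"
| "cof_upto D n (Suc k) = cof_dir D n (Suc k) \<circ>\<^sub>d cof_upto D n k"

definition iterated_cone :: "('u, 'o, 'm) prederiv \<Rightarrow> nat \<Rightarrow> ('u, 'o, 'm, 'o, 'm) dmor" where
  "iterated_cone D n = eval_mor D (cube n) (top_pt n) \<circ>\<^sub>d cof_upto D n n"


section \<open>The total cofiber\<close>

text \<open>The poset obtained from \<open>[1]\<^sup>n\<close> by adjoining a new greatest element \<open>Tup []\<close>; the old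
  elements \<open>x\<close> become \<open>Tup [x]\<close>.\<close>

definition ext_le :: "'u el \<Rightarrow> 'u el \<Rightarrow> bool" where
  "ext_le x y \<longleftrightarrow> y = Tup [] \<or> (\<exists>x' y'. x = Tup [x'] \<and> y = Tup [y'] \<and> cube_le x' y')"

definition ext_cube :: "nat \<Rightarrow> 'u scat" where
  "ext_cube n = poset_cat (insert (Tup []) ((\<lambda>x. Tup [x]) ` cube_pts n)) ext_le"

definition tcof_incl :: "nat \<Rightarrow> 'u sfun" where
  "tcof_incl n = to_poset (cube n) (ext_cube n) (\<lambda>x. if x = top_pt n then Tup [] else Tup [x])"

definition tcof_edge :: "nat \<Rightarrow> 'u sfun" where
  "tcof_edge n = to_poset arrow_cat (ext_cube n) (\<lambda>x. if x = b1 then Tup [] else Tup [top_pt n])"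

definition tcof :: "('u, 'o, 'm) prederiv \<Rightarrow> nat \<Rightarrow> ('u, 'o, 'm, 'o, 'm) dmor" where
  "tcof D n = cone D \<circ>\<^sub>d restr_mor D (tcof_edge n) \<circ>\<^sub>d lan_mor D (tcof_incl n)"

end

theory Submission
  imports Defs
begin

text \<open>
  Extending the cofiber square of \<open>f : x \<rightarrow> y\<close> to the edges of \<open>\<box>\<close>, the map from \<open>f\<close> (top edge) to
  \<open>0 \<rightarrow> C f\<close> (bottom edge) is the reflection of \<open>f\<close> into the objects of \<open>D\<^sup>[\<^sup>1\<^sup>]\<close> vanishing at \<open>0\<close>.
  The diagonal \<open>x \<rightarrow> C f\<close> of the square maps to the bottom edge and to \<open>cof f = (y \<rightarrow> C f)\<close> by maps that
  are the identity at the target. Applying this in each coordinate of the cube in turn shows that the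
  iterated cone inverts every map that is local with respect to the objects of \<open>D\<^sup>\<box>\<^sup>n\<close> vanishing
  off the last vertex; and on these objects evaluation at the last vertex agrees with the iterated
  cone.

  Let \<open>\<chi> : \<box>\<^sup>n \<rightarrow> [1]\<close> be the functor that sends only the last vertex to \<open>1\<close>, so that the objects
  vanishing off the last vertex are the \<open>\<chi>\<^sup>* g\<close> with \<open>g\<close> vanishing at \<open>0\<close>. By adjunction
  \<open>hom (X, \<chi>\<^sup>* g) = hom (N X, g)\<close>, where \<open>N X\<close> is the comparison map whose cone is the total cofiber.
  Hence \<open>X \<rightarrow> \<chi>\<^sup>* N X\<close> and \<open>\<chi>\<^sup>* N X \<rightarrow> \<chi>\<^sup>* (0 \<rightarrow> C (N X))\<close> are inverted by the iterated cone, and the iterated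
  cone of the last object is \<open>C (N X)\<close>.
\<close>

section \<open>Categories, functors and transformations\<close>

text \<open>The isomorphism has to be a modification, so it is not built value by value: each
  comparison map is assembled from units, counits and 2-cells that vary naturally in the parameter
  category, and only its invertibility is tested pointwise through Der2. This is why Kan extensions
  are first made into morphisms of derivators. Universal properties replace any computation of
  iterated pushouts: a map is recognized as invertible once its own two ends are local for it. The
  obstacle is that the reflection produces the bottom edge of the cofiber square while
  \<open>cof\<close> is another edge, and the sources (0,1) and (1,0) of these edges are
  incomparable, so that no 2-cell joins them directly. The diagonal provides a zigzag instead. Its
  two legs are invertible only where the treated coordinate is 1, which suffices because cofibers in
  the other directions do not leave that face and the last vertex lies on it. The bound n >= 1
  separates the least vertex from the last one; this gives \<chi> a section that is left adjoint to
  it.\<close>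

lemma hom_iff [simp]: "f \<in> hom C x y \<longleftrightarrow> f \<in> Arr C \<and> Dom C f = x \<and> Cod C f = y"
  by (simp add: hom_def)

declare composable_def [simp]

lemma Dom_Obj' [simp]: "category C \<Longrightarrow> f \<in> Arr C \<Longrightarrow> Dom C f \<in> Obj C"
  by (rule category.Dom_Obj)

lemma Cod_Obj' [simp]: "category C \<Longrightarrow> f \<in> Arr C \<Longrightarrow> Cod C f \<in> Obj C"
  by (rule category.Cod_Obj)

lemma Ident_Arr' [simp]: "category C \<Longrightarrow> x \<in> Obj C \<Longrightarrow> Ident C x \<in> Arr C"
  by (rule category.Ident_Arr)

lemma Dom_Ident' [simp]: "category C \<Longrightarrow> x \<in> Obj C \<Longrightarrow> Dom C (Ident C x) = x"
  by (rule category.Dom_Ident)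

lemma Cod_Ident' [simp]: "category C \<Longrightarrow> x \<in> Obj C \<Longrightarrow> Cod C (Ident C x) = x"
  by (rule category.Cod_Ident)

lemma Comp_Arr' [simp]: "category C \<Longrightarrow> g \<in> Arr C \<Longrightarrow> f \<in> Arr C \<Longrightarrow> Dom C g = Cod C f \<Longrightarrow> Comp C g f \<in> Arr C"
  by (rule category.Comp_Arr) simp_all

lemma Dom_Comp' [simp]: "category C \<Longrightarrow> g \<in> Arr C \<Longrightarrow> f \<in> Arr C \<Longrightarrow> Dom C g = Cod C f \<Longrightarrow> Dom C (Comp C g f) = Dom C f"
  by (rule category.Dom_Comp) simp_all

lemma Cod_Comp' [simp]: "category C \<Longrightarrow> g \<in> Arr C \<Longrightarrow> f \<in> Arr C \<Longrightarrow> Dom C g = Cod C f \<Longrightarrow> Cod C (Comp C g f) = Cod C g"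
  by (rule category.Cod_Comp) simp_all

lemma Comp_Ident_right' [simp]: "category C \<Longrightarrow> f \<in> Arr C \<Longrightarrow> Dom C f = x \<Longrightarrow> Comp C f (Ident C x) = f"
  by (metis category.Comp_Ident_right)

lemma Comp_Ident_left' [simp]: "category C \<Longrightarrow> f \<in> Arr C \<Longrightarrow> Cod C f = x \<Longrightarrow> Comp C (Ident C x) f = f"
  by (metis category.Comp_Ident_left)

lemma Comp_assoc' [simp]: "category C \<Longrightarrow> h \<in> Arr C \<Longrightarrow> g \<in> Arr C \<Longrightarrow> f \<in> Arr C \<Longrightarrow> Dom C h = Cod C g \<Longrightarrow>
    Dom C g = Cod C f \<Longrightarrow> Comp C (Comp C h g) f = Comp C h (Comp C g f)"
  by (rule category.Comp_assoc[symmetric]) simp_all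

text \<open>Simplification nests composites to the right by \<open>Comp_assoc'\<close>, which hides
  a subterm \<open>Comp C a b\<close> inside \<open>Comp C a (Comp C b z)\<close>. This lemma and
  the next apply an equation between composites in front of such a tail \<open>z\<close>.\<close>

lemma Comp_eq_extend1:
  assumes "category C" "Comp C a b = c" "a \<in> Arr C" "b \<in> Arr C" "Dom C a = Cod C b" "z \<in> Arr C" "Cod C z = Dom C b"
  shows "Comp C a (Comp C b z) = Comp C c z"
  unfolding assms(2)[symmetric] by (rule Comp_assoc'[symmetric]) (use assms in auto)

lemma Comp_eq_extend:
  assumes "category C" "Comp C a b = Comp C c d" "a \<in> Arr C" "b \<in> Arr C" "c \<in> Arr C" "d \<in> Arr C"
    "Dom C a = Cod C b" "Dom C c = Cod C d" "z \<in> Arr C" "Cod C z = Dom C b" "Dom C d = Dom C b"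
  shows "Comp C a (Comp C b z) = Comp C c (Comp C d z)"
proof -
  have "Comp C a (Comp C b z) = Comp C (Comp C c d) z" by (rule Comp_eq_extend1) (use assms in auto)
  also have "\<dots> = Comp C c (Comp C d z)" by (rule Comp_assoc') (use assms in auto)
  finally show ?thesis .
qed

lemma cat_eqI:
  assumes "category A" "category B" "Obj A = Obj B" "Arr A = Arr B"
    "\<And>f. f \<in> Arr B \<Longrightarrow> Dom A f = Dom B f" "\<And>f. f \<in> Arr B \<Longrightarrow> Cod A f = Cod B f"
    "\<And>x. x \<in> Obj B \<Longrightarrow> Ident A x = Ident B x"
    "\<And>g f. g \<in> Arr B \<Longrightarrow> f \<in> Arr B \<Longrightarrow> Dom B g = Cod B f \<Longrightarrow> Comp A g f = Comp B g f"
  shows "A = (B :: ('o, 'm) cat)"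
proof -
  have "Dom A = Dom B"
    by (rule extensionalityI[OF category.Dom_ext[OF assms(1), unfolded assms(4)] category.Dom_ext[OF assms(2)] assms(5)])
  moreover have "Cod A = Cod B"
    by (rule extensionalityI[OF category.Cod_ext[OF assms(1), unfolded assms(4)] category.Cod_ext[OF assms(2)] assms(6)])
  moreover have "Ident A = Ident B"
    by (rule extensionalityI[OF category.Ident_ext[OF assms(1), unfolded assms(3)] category.Ident_ext[OF assms(2)] assms(7)])
  moreover have "Comp A g f = Comp B g f" for g f
    using category.Comp_ext[OF assms(1), of g f] category.Comp_ext[OF assms(2), of g f] assms
    by (cases "composable B g f") auto
  hence "Comp A = Comp B" by blast
  ultimately show ?thesis using assms(3,4) by (cases A; cases B) simp
qed

subsection \<open>Isomorphisms\<close>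

lemma inverse_arr_iff: "inverse_arr C f g \<longleftrightarrow> g \<in> Arr C \<and> f \<in> Arr C \<and> Dom C g = Cod C f \<and> Dom C f = Cod C g \<and>
    Comp C g f = Ident C (Dom C f) \<and> Comp C f g = Ident C (Cod C f)"
  by (auto simp: inverse_arr_def)

lemma inverse_arr_unique:
  assumes "category C" "inverse_arr C f g" "inverse_arr C f h" shows "g = h"
proof -
  note * = assms(2,3)[unfolded inverse_arr_iff]
  have "g = Comp C g (Comp C f h)" using assms(1) * by (metis Comp_Ident_right')
  also have "\<dots> = Comp C (Comp C g f) h" by (rule Comp_assoc'[symmetric]) (use assms(1) * in auto)
  also have "\<dots> = h" using assms(1) * by (metis Comp_Ident_left')
  finally show ?thesis .
qed

lemma inverse_arr_inv_arr: "category C \<Longrightarrow> iso_arr C f \<Longrightarrow> inverse_arr C f (inv_arr C f)"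
  unfolding iso_arr_def inv_arr_def using inverse_arr_unique by (metis the_equality)

lemma iso_arr_Arr: "iso_arr C f \<Longrightarrow> f \<in> Arr C"
  by (auto simp: iso_arr_def inverse_arr_iff)

lemma inv_arr_simps [simp]:
  assumes "category C" "iso_arr C f"
  shows "inv_arr C f \<in> Arr C" "Dom C (inv_arr C f) = Cod C f" "Cod C (inv_arr C f) = Dom C f"
    "Comp C (inv_arr C f) f = Ident C (Dom C f)" "Comp C f (inv_arr C f) = Ident C (Cod C f)"
  using inverse_arr_inv_arr[OF assms] by (auto simp: inverse_arr_iff)

lemma inv_arr_cancel [simp]:
  assumes "category C" "iso_arr C f" "z \<in> Arr C"
  shows "Cod C z = Dom C f \<Longrightarrow> Comp C (inv_arr C f) (Comp C f z) = z"
    "Cod C z = Cod C f \<Longrightarrow> Comp C f (Comp C (inv_arr C f) z) = z"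
  using assms iso_arr_Arr[OF assms(2)] by (simp_all add: Comp_assoc'[symmetric] del: Comp_assoc')

lemma iso_arrI: "f \<in> Arr C \<Longrightarrow> g \<in> Arr C \<Longrightarrow> Dom C g = Cod C f \<Longrightarrow> Dom C f = Cod C g \<Longrightarrow>
    Comp C g f = Ident C (Dom C f) \<Longrightarrow> Comp C f g = Ident C (Cod C f) \<Longrightarrow> iso_arr C f"
  by (auto simp: iso_arr_def inverse_arr_iff)

lemma iso_arr_inv: "category C \<Longrightarrow> iso_arr C f \<Longrightarrow> iso_arr C (inv_arr C f)"
  by (rule iso_arrI[where g = f]) (auto simp: iso_arr_Arr)

lemma iso_arr_Ident: "category C \<Longrightarrow> x \<in> Obj C \<Longrightarrow> iso_arr C (Ident C x)"
  by (rule iso_arrI[where g = "Ident C x"]) auto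

lemma iso_arr_Comp:
  assumes "category C" "iso_arr C g" "iso_arr C f" "Dom C g = Cod C f"
  shows "iso_arr C (Comp C g f)"
  using assms iso_arr_Arr[OF assms(2)] iso_arr_Arr[OF assms(3)]
  by (intro iso_arrI[where g = "Comp C (inv_arr C f) (inv_arr C g)"]) auto

lemma iso_arr_cancel_left:
  assumes "category C" "iso_arr C g" "iso_arr C (Comp C g f)" "f \<in> Arr C" "Dom C g = Cod C f"
  shows "iso_arr C f"
proof -
  have "f = Comp C (inv_arr C g) (Comp C g f)" using assms iso_arr_Arr by simp
  thus ?thesis using assms iso_arr_Arr[OF assms(2)] iso_arr_Comp[OF assms(1) iso_arr_inv[OF assms(1,2)] assms(3)] by simp
qed

lemma iso_arr_cancel_right:
  assumes "category C" "iso_arr C f" "iso_arr C (Comp C g f)" "g \<in> Arr C" "Dom C g = Cod C f"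
  shows "iso_arr C g"
proof -
  have "g = Comp C (Comp C g f) (inv_arr C f)" using assms iso_arr_Arr[OF assms(2)] by simp
  thus ?thesis using assms iso_arr_Arr[OF assms(2)] iso_arr_Comp[OF assms(1) assms(3) iso_arr_inv[OF assms(1,2)]] by simp
qed

lemma iso_arr_epi:
  assumes "category C" "iso_arr C f" "Comp C g f = Comp C h f" "g \<in> Arr C" "h \<in> Arr C"
    "Dom C g = Cod C f" "Dom C h = Cod C f"
  shows "g = h"
proof -
  have "Comp C g (Comp C f (inv_arr C f)) = Comp C h (Comp C f (inv_arr C f))"
    by (rule Comp_eq_extend) (use assms iso_arr_Arr[OF assms(2)] in simp_all)
  thus ?thesis using assms(1,2,4-7) by simp
qed

lemma iso_arr_mono:
  assumes "category C" "iso_arr C f" "Comp C f g = Comp C f h" "g \<in> Arr C" "h \<in> Arr C"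
    "Cod C g = Dom C f" "Cod C h = Dom C f"
  shows "g = h"
  by (metis assms inv_arr_cancel(1))

lemma iso_arr_square:
  assumes C: "category C" and "Comp C b f = Comp C g a" "iso_arr C a" "iso_arr C b"
    "f \<in> Arr C" "g \<in> Arr C" "Dom C f = Dom C a" "Cod C f = Dom C b" "Dom C g = Cod C a" "Cod C g = Cod C b"
  shows "iso_arr C f \<longleftrightarrow> iso_arr C g"
proof
  assume f: "iso_arr C f"
  hence "iso_arr C (Comp C g a)" using iso_arr_Comp[OF C assms(4) f] assms(8) by (simp add: assms(2))
  thus "iso_arr C g" using iso_arr_cancel_right[OF C assms(3)] assms(6,9) by blast
next
  assume g: "iso_arr C g"
  hence "iso_arr C (Comp C b f)" using iso_arr_Comp[OF C g assms(3)] assms(9) by (simp add: assms(2))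
  thus "iso_arr C f" using iso_arr_cancel_left[OF C assms(4)] assms(5,8) by simp
qed

subsection \<open>Zero objects\<close>

lemma zero_object_Obj [simp]: "zero_object C z \<Longrightarrow> z \<in> Obj C"
  by (simp add: zero_object_def)

definition initial_object :: "('o, 'm) cat \<Rightarrow> 'o \<Rightarrow> bool" where
  "initial_object C z \<longleftrightarrow> z \<in> Obj C \<and> (\<forall>x\<in>Obj C. \<exists>!f. f \<in> hom C z x)"

definition terminal_object :: "('o, 'm) cat \<Rightarrow> 'o \<Rightarrow> bool" where
  "terminal_object C z \<longleftrightarrow> z \<in> Obj C \<and> (\<forall>x\<in>Obj C. \<exists>!f. f \<in> hom C x z)"

lemma zero_object_iff: "zero_object C z \<longleftrightarrow> initial_object C z \<and> terminal_object C z"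
  unfolding zero_object_def initial_object_def terminal_object_def by blast

lemma initial_object_eq:
  assumes "initial_object C z" "f \<in> hom C z x" "g \<in> hom C z x" "category C"
  shows "f = g"
proof -
  have "x \<in> Obj C" using assms(2,4) by auto
  thus ?thesis using assms(1-3) unfolding initial_object_def by blast
qed

lemma terminal_object_eq:
  assumes "terminal_object C z" "f \<in> hom C x z" "g \<in> hom C x z" "category C"
  shows "f = g"
proof -
  have "x \<in> Obj C" using assms(2,4) by auto
  thus ?thesis using assms(1-3) unfolding terminal_object_def by blast
qed

lemma initial_arr_iso:
  assumes C: "category C" and x: "initial_object C x" and y: "initial_object C y" and f: "f \<in> hom C x y"
  shows "iso_arr C f"
proof -
  obtain g where g: "g \<in> hom C y x" using x y by (meson initial_object_def)
  have "Comp C g f = Ident C x" using f g x C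
    by (intro initial_object_eq[OF x, of _ x]) (auto simp: initial_object_def)
  moreover have "Comp C f g = Ident C y" using f g y C
    by (intro initial_object_eq[OF y, of _ y]) (auto simp: initial_object_def)
  ultimately show ?thesis using f g by (intro iso_arrI[where g = g]) auto
qed

lemma terminal_arr_iso:
  assumes C: "category C" and x: "terminal_object C x" and y: "terminal_object C y" and f: "f \<in> hom C x y"
  shows "iso_arr C f"
proof -
  obtain g where g: "g \<in> hom C y x" using x y by (meson terminal_object_def)
  have "Comp C g f = Ident C x" using f g x C
    by (intro terminal_object_eq[OF x, of _ x]) (auto simp: terminal_object_def)
  moreover have "Comp C f g = Ident C y" using f g y C
    by (intro terminal_object_eq[OF y, of _ y]) (auto simp: terminal_object_def)
  ultimately show ?thesis using f g by (intro iso_arrI[where g = g]) auto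
qed

lemma zero_arr_iso: "category C \<Longrightarrow> zero_object C x \<Longrightarrow> zero_object C y \<Longrightarrow> f \<in> hom C x y \<Longrightarrow> iso_arr C f"
  by (rule initial_arr_iso) (auto simp: zero_object_iff)

lemma iso_hom_bij:
  assumes C: "category C" and f: "iso_arr C f" "f \<in> hom C x y" and w: "w \<in> Obj C"
  shows "(\<exists>!h. h \<in> hom C x w) \<longleftrightarrow> (\<exists>!h. h \<in> hom C y w)"
    and "(\<exists>!h. h \<in> hom C w x) \<longleftrightarrow> (\<exists>!h. h \<in> hom C w y)"
proof -
  have 1: "bij_betw (\<lambda>h. Comp C h f) (hom C y w) (hom C x w)"
    by (rule bij_betw_byWitness[where f' = "\<lambda>h. Comp C h (inv_arr C f)"]) (use C f in auto)
  have 2: "bij_betw (\<lambda>h. Comp C f h) (hom C w x) (hom C w y)"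
    by (rule bij_betw_byWitness[where f' = "\<lambda>h. Comp C (inv_arr C f) h"]) (use C f in auto)
  \<comment> \<open>Unique existence means cardinality one, so the bijections of hom sets transport
    it.\<close>
  have *: "(\<exists>!h. h \<in> A) \<longleftrightarrow> card A = 1" for A :: "'b set" by (metis card_1_singleton_iff One_nat_def insertI1 singletonD subsetI
     subset_antisym empty_iff insertE)
  show "(\<exists>!h. h \<in> hom C x w) \<longleftrightarrow> (\<exists>!h. h \<in> hom C y w)"
    unfolding * using bij_betw_same_card[OF 1] by simp
  show "(\<exists>!h. h \<in> hom C w x) \<longleftrightarrow> (\<exists>!h. h \<in> hom C w y)"
    unfolding * using bij_betw_same_card[OF 2] by simp
qed

lemma zero_object_iso_iff:
  assumes C: "category C" and f: "iso_arr C f"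
  shows "zero_object C (Dom C f) \<longleftrightarrow> zero_object C (Cod C f)"
  using iso_hom_bij[OF C f, of "Dom C f" "Cod C f"] C iso_arr_Arr[OF f]
  unfolding zero_object_def by (auto simp del: hom_iff simp: hom_iff[of f])

text \<open>The arrow from the zero object to \<open>t\<close> runs between terminal objects, so it
  is invertible. With this lemma and the next, a vanishing statement needs only one half of the
  universal property.\<close>

lemma terminal_is_zero:
  assumes C: "category C" and z: "zero_object C z" and t: "terminal_object C t"
  shows "zero_object C t"
proof -
  obtain f where f: "f \<in> hom C z t" using t z unfolding zero_object_def terminal_object_def by blast
  have "iso_arr C f" using terminal_arr_iso[OF C _ t f] z by (simp add: zero_object_iff)
  thus ?thesis using zero_object_iso_iff[OF C] f z by auto
qed

lemma initial_is_zero: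
  assumes C: "category C" and z: "zero_object C z" and t: "initial_object C t"
  shows "zero_object C t"
proof -
  obtain f where f: "f \<in> hom C z t" using t z unfolding zero_object_def initial_object_def by blast
  have "iso_arr C f" using initial_arr_iso[OF C _ t f] z by (simp add: zero_object_iff)
  thus ?thesis using zero_object_iso_iff[OF C] f z by auto
qed

subsection \<open>Objects local with respect to an arrow\<close>

text \<open>Stated as a bijection rather than as unique factorization, so that two-out-of-three
  follows from composing bijections.\<close>

definition local_for :: "('o, 'm) cat \<Rightarrow> 'm \<Rightarrow> 'o \<Rightarrow> bool" where
  "local_for C f w \<longleftrightarrow> bij_betw (\<lambda>h. Comp C h f) (hom C (Cod C f) w) (hom C (Dom C f) w)"

lemma local_forI:
  assumes C: "category C" and f: "f \<in> Arr C"
    and "\<And>h. h \<in> hom C (Dom C f) w \<Longrightarrow> \<exists>k. k \<in> hom C (Cod C f) w \<and> Comp C k f = h"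
    and "\<And>k l. k \<in> hom C (Cod C f) w \<Longrightarrow> l \<in> hom C (Cod C f) w \<Longrightarrow> Comp C k f = Comp C l f \<Longrightarrow> k = l"
  shows "local_for C f w"
  unfolding local_for_def bij_betw_def
proof (intro conjI set_eqI iffI)
  show "inj_on (\<lambda>h. Comp C h f) (hom C (Cod C f) w)" using assms(4) by (auto intro!: inj_onI)
  show "h \<in> hom C (Dom C f) w" if "h \<in> (\<lambda>h. Comp C h f) ` hom C (Cod C f) w" for h
    using that C f by auto
  show "h \<in> (\<lambda>h. Comp C h f) ` hom C (Cod C f) w" if "h \<in> hom C (Dom C f) w" for h
    using assms(3)[OF that] by (auto simp del: hom_iff)
qed

lemma local_forE:
  assumes "local_for C f w" "h \<in> hom C (Dom C f) w"
  obtains k where "k \<in> hom C (Cod C f) w" "Comp C k f = h"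
proof -
  have "h \<in> (\<lambda>h. Comp C h f) ` hom C (Cod C f) w" using assms unfolding local_for_def bij_betw_def by blast
  thus ?thesis using that by blast
qed

lemma local_for_inj:
  assumes "local_for C f w" "k \<in> hom C (Cod C f) w" "l \<in> hom C (Cod C f) w" "Comp C k f = Comp C l f"
  shows "k = l"
  using assms unfolding local_for_def bij_betw_def by (auto simp del: hom_iff dest: inj_onD)

lemma local_for_iso:
  assumes C: "category C" and f: "iso_arr C f"
  shows "local_for C f w"
proof (rule local_forI[OF C iso_arr_Arr[OF f]])
  fix h assume "h \<in> hom C (Dom C f) w"
  thus "\<exists>k. k \<in> hom C (Cod C f) w \<and> Comp C k f = h"
    using C f iso_arr_Arr[OF f] by (intro exI[of _ "Comp C h (inv_arr C f)"]) auto
qed (use C f iso_arr_epi in auto)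

lemma local_for_Comp:
  assumes C: "category C" and fg: "f \<in> Arr C" "g \<in> Arr C" "Dom C g = Cod C f"
  shows "local_for C f w \<Longrightarrow> local_for C g w \<Longrightarrow> local_for C (Comp C g f) w"
    and "local_for C f w \<Longrightarrow> local_for C (Comp C g f) w \<Longrightarrow> local_for C g w"
    and "local_for C g w \<Longrightarrow> local_for C (Comp C g f) w \<Longrightarrow> local_for C f w"
proof -
  let ?F = "\<lambda>h. Comp C h f" and ?G = "\<lambda>h. Comp C h g" and ?H = "\<lambda>h. Comp C h (Comp C g f)"
  have eq: "bij_betw ?H (hom C (Cod C g) w) (hom C (Dom C f) w) \<longleftrightarrow>
     bij_betw (?F \<circ> ?G) (hom C (Cod C g) w) (hom C (Dom C f) w)"
    by (rule bij_betw_cong) (use C fg in auto)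
  have sub: "?G ` hom C (Cod C g) w \<subseteq> hom C (Cod C f) w" using C fg by auto
  note * = local_for_def fg C Dom_Comp' Cod_Comp' eq
  show "local_for C f w \<Longrightarrow> local_for C g w \<Longrightarrow> local_for C (Comp C g f) w"
    unfolding local_for_def using bij_betw_trans eq fg C by (simp del: hom_iff) blast
  show "local_for C f w \<Longrightarrow> local_for C (Comp C g f) w \<Longrightarrow> local_for C g w"
    unfolding local_for_def using bij_betw_comp_iff2[of ?F _ _ ?G, OF _ sub] eq fg C by (simp del: hom_iff)
  show "local_for C g w \<Longrightarrow> local_for C (Comp C g f) w \<Longrightarrow> local_for C f w"
    unfolding local_for_def using bij_betw_comp_iff[of ?G _ _ ?F] eq fg C by (simp del: hom_iff)
qed

lemma local_for_square:
  assumes C: "category C" and "Comp C b f = Comp C g a" "local_for C a w" "local_for C b w"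
    "a \<in> Arr C" "b \<in> Arr C"
    "f \<in> Arr C" "g \<in> Arr C" "Dom C f = Dom C a" "Cod C f = Dom C b" "Dom C g = Cod C a" "Cod C g = Cod C b"
  shows "local_for C f w \<longleftrightarrow> local_for C g w"
  using local_for_Comp[OF C, of a g w] local_for_Comp[OF C, of f b w] assms by metis

lemma local_for_iso_target:
  assumes C: "category C" and f: "f \<in> Arr C" and i: "iso_arr C i" and l: "local_for C f (Dom C i)"
  shows "local_for C f (Cod C i)"
proof (rule local_forI[OF C f])
  note [simp] = iso_arr_Arr[OF i]
  fix h assume h: "h \<in> hom C (Dom C f) (Cod C i)"
  obtain k where "k \<in> hom C (Cod C f) (Dom C i)" "Comp C k f = Comp C (inv_arr C i) h"
    using local_forE[OF l, of "Comp C (inv_arr C i) h"] C h i by auto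
  thus "\<exists>k. k \<in> hom C (Cod C f) (Cod C i) \<and> Comp C k f = h"
    using C h i f by (intro exI[of _ "Comp C i k"]) auto
next
  note [simp] = iso_arr_Arr[OF i]
  fix k m assume km: "k \<in> hom C (Cod C f) (Cod C i)" "m \<in> hom C (Cod C f) (Cod C i)" "Comp C k f = Comp C m f"
  hence "Comp C (inv_arr C i) k = Comp C (inv_arr C i) m"
    using C i f by - (rule local_for_inj[OF l], auto)
  thus "k = m" using km C i iso_arr_mono[OF C iso_arr_inv[OF C i], of k m] by auto
qed

text \<open>Locality of the domain extends its identity along \<open>f\<close> to a retraction g.
  Then f g and the identity of the codomain agree after composition with \<open>f\<close>, so they
  agree by locality of the codomain.\<close>

lemma iso_if_local:
  assumes C: "category C" and f: "f \<in> Arr C" and l: "local_for C f (Dom C f)" "local_for C f (Cod C f)"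
  shows "iso_arr C f"
proof -
  obtain g where g: "g \<in> hom C (Cod C f) (Dom C f)" "Comp C g f = Ident C (Dom C f)"
    using local_forE[OF l(1), of "Ident C (Dom C f)"] C f by auto
  have "Comp C f g = Ident C (Cod C f)"
    using C f g by - (rule local_for_inj[OF l(2)], auto)
  thus ?thesis using f g by (intro iso_arrI[where g = g]) auto
qed

subsection \<open>Functors\<close>

lemma fhom_iff [simp]: "F \<in> fhom A B \<longleftrightarrow> cat_functor F \<and> Src F = A \<and> Tgt F = B"
  by (simp add: fhom_def)

lemma cat_functor_categories [simp]: "cat_functor F \<Longrightarrow> category (Src F)" "cat_functor F \<Longrightarrow> category (Tgt F)"
  unfolding cat_functor_def by auto

lemma FO_Obj' [simp]: "cat_functor F \<Longrightarrow> Tgt F = C \<Longrightarrow> x \<in> Obj (Src F) \<Longrightarrow> FO F x \<in> Obj C"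
  by (auto intro: cat_functor.FO_Obj)

lemma FA_simps [simp]:
  assumes "cat_functor F" "Tgt F = C" "f \<in> Arr (Src F)"
  shows "FA F f \<in> Arr C" "Dom C (FA F f) = FO F (Dom (Src F) f)" "Cod C (FA F f) = FO F (Cod (Src F) f)"
  using cat_functor.FA_hom[OF assms(1,3)] assms(2) by auto

lemma FA_Ident' [simp]: "cat_functor F \<Longrightarrow> Src F = C \<Longrightarrow> x \<in> Obj C \<Longrightarrow> FA F (Ident C x) = Ident (Tgt F) (FO F x)"
  by (auto intro: cat_functor.FA_Ident)

lemma FA_Comp' [simp]: "cat_functor F \<Longrightarrow> Src F = C \<Longrightarrow> g \<in> Arr C \<Longrightarrow> f \<in> Arr C \<Longrightarrow> Dom C g = Cod C f \<Longrightarrow>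
   FA F (Comp C g f) = Comp (Tgt F) (FA F g) (FA F f)"
  by (auto intro: cat_functor.FA_Comp)

lemma cfun_eqI:
  assumes "cat_functor F" "cat_functor G" "Src F = Src G" "Tgt F = Tgt G"
    "\<And>x. x \<in> Obj (Src G) \<Longrightarrow> FO F x = FO G x" "\<And>f. f \<in> Arr (Src G) \<Longrightarrow> FA F f = FA G f"
  shows "F = G"
proof -
  have "FO F = FO G"
    by (rule extensionalityI[OF cat_functor.FO_ext[OF assms(1), unfolded assms(3)] cat_functor.FO_ext[OF assms(2)] assms(5)])
  moreover have "FA F = FA G"
    by (rule extensionalityI[OF cat_functor.FA_ext[OF assms(1), unfolded assms(3)] cat_functor.FA_ext[OF assms(2)] assms(6)])
  ultimately show ?thesis using assms(3,4) by (cases F; cases G) simp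
qed

lemma cat_functorI:
  assumes "category (Src F)" "category (Tgt F)"
    "\<And>x. x \<in> Obj (Src F) \<Longrightarrow> FO F x \<in> Obj (Tgt F)"
    "\<And>f. f \<in> Arr (Src F) \<Longrightarrow> FA F f \<in> Arr (Tgt F)"
    "\<And>f. f \<in> Arr (Src F) \<Longrightarrow> Dom (Tgt F) (FA F f) = FO F (Dom (Src F) f)"
    "\<And>f. f \<in> Arr (Src F) \<Longrightarrow> Cod (Tgt F) (FA F f) = FO F (Cod (Src F) f)"
    "\<And>x. x \<in> Obj (Src F) \<Longrightarrow> FA F (Ident (Src F) x) = Ident (Tgt F) (FO F x)"
    "\<And>g f. g \<in> Arr (Src F) \<Longrightarrow> f \<in> Arr (Src F) \<Longrightarrow> Dom (Src F) g = Cod (Src F) f \<Longrightarrow>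
      FA F (Comp (Src F) g f) = Comp (Tgt F) (FA F g) (FA F f)"
    "FO F \<in> extensional (Obj (Src F))" "FA F \<in> extensional (Arr (Src F))"
  shows "cat_functor F"
  unfolding cat_functor_def cat_functor_axioms_def hom_iff composable_def using assms by blast

lemma iso_arr_FA: "cat_functor F \<Longrightarrow> iso_arr (Src F) f \<Longrightarrow> Tgt F = C \<Longrightarrow> iso_arr C (FA F f)"
  using iso_arr_Arr[of "Src F" f]
  by (intro iso_arrI[where g = "FA F (inv_arr (Src F) f)"]) (auto simp flip: FA_Comp' FA_Ident')

lemma fid_simps [simp]: "Src (fid A) = A" "Tgt (fid A) = A"
  "x \<in> Obj A \<Longrightarrow> FO (fid A) x = x" "f \<in> Arr A \<Longrightarrow> FA (fid A) f = f"
  by (auto simp: fid_def)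

lemma cat_functor_fid [simp]: "category A \<Longrightarrow> cat_functor (fid A)"
  by (rule cat_functorI) (auto simp: fid_def)

lemma fcomp_simps [simp]: "Src (G \<odot> F) = Src F" "Tgt (G \<odot> F) = Tgt G"
  "x \<in> Obj (Src F) \<Longrightarrow> FO (G \<odot> F) x = FO G (FO F x)" "f \<in> Arr (Src F) \<Longrightarrow> FA (G \<odot> F) f = FA G (FA F f)"
  by (auto simp: fcomp_def)

lemma cat_functor_fcomp [simp]: "cat_functor G \<Longrightarrow> cat_functor F \<Longrightarrow> Src G = Tgt F \<Longrightarrow> cat_functor (G \<odot> F)"
  by (rule cat_functorI) (auto simp: fcomp_def)

lemma fcomp_assoc: "cat_functor F \<Longrightarrow> cat_functor G \<Longrightarrow> cat_functor H \<Longrightarrow> Src G = Tgt F \<Longrightarrow> Src H = Tgt G \<Longrightarrow>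
    (H \<odot> G) \<odot> F = H \<odot> (G \<odot> F)"
  by (rule cfun_eqI) auto

lemma fcomp_fid [simp]: "cat_functor F \<Longrightarrow> Src F = A \<Longrightarrow> F \<odot> fid A = F"
  by (auto intro!: cfun_eqI)

lemma fid_fcomp [simp]: "cat_functor F \<Longrightarrow> Tgt F = A \<Longrightarrow> fid A \<odot> F = F"
  by (auto intro!: cfun_eqI)

lemma const_fun_simps [simp]: "Src (const_fun A B b) = A" "Tgt (const_fun A B b) = B"
  "x \<in> Obj A \<Longrightarrow> FO (const_fun A B b) x = b" "f \<in> Arr A \<Longrightarrow> FA (const_fun A B b) f = Ident B b"
  by (auto simp: const_fun_def)

lemma cat_functor_const_fun [simp]: "category A \<Longrightarrow> category B \<Longrightarrow> b \<in> Obj B \<Longrightarrow> cat_functor (const_fun A B b)"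
  by (rule cat_functorI) (auto simp: const_fun_def)

lemma finv_simps [simp]: "Src (finv F) = Tgt F" "Tgt (finv F) = Src F"
  by (auto simp: finv_def)

lemma finv_functor:
  assumes F: "cat_functor F" and O: "bij_betw (FO F) (Obj (Src F)) (Obj (Tgt F))"
    and A: "bij_betw (FA F) (Arr (Src F)) (Arr (Tgt F))"
  shows "cat_functor (finv F)" "finv F \<odot> F = fid (Src F)" "F \<odot> finv F = fid (Tgt F)"
proof -
  let ?o = "inv_into (Obj (Src F)) (FO F)" and ?a = "inv_into (Arr (Src F)) (FA F)"
  have o: "\<And>y. y \<in> Obj (Tgt F) \<Longrightarrow> ?o y \<in> Obj (Src F)" "\<And>y. y \<in> Obj (Tgt F) \<Longrightarrow> FO F (?o y) = y"
    "\<And>x. x \<in> Obj (Src F) \<Longrightarrow> ?o (FO F x) = x"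
    using O by (auto simp: bij_betw_def inv_into_into f_inv_into_f)
  have a: "\<And>y. y \<in> Arr (Tgt F) \<Longrightarrow> ?a y \<in> Arr (Src F)" "\<And>y. y \<in> Arr (Tgt F) \<Longrightarrow> FA F (?a y) = y"
    "\<And>x. x \<in> Arr (Src F) \<Longrightarrow> ?a (FA F x) = x"
    using A by (auto simp: bij_betw_def inv_into_into f_inv_into_f)
  have d: "Dom (Src F) (?a y) = ?o (Dom (Tgt F) y)" "Cod (Src F) (?a y) = ?o (Cod (Tgt F) y)" if "y \<in> Arr (Tgt F)" for y
    using FA_simps(2,3)[OF F refl a(1)[OF that]] o(3) a(1,2)[OF that] F by (metis Dom_Obj' Cod_Obj' cat_functor_categories(1))+
  show 1: "cat_functor (finv F)"
  proof (rule cat_functorI)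
    fix x assume x: "x \<in> Obj (Src (finv F))"
    have "FA F (Ident (Src F) (?o x)) = Ident (Tgt F) x" using F x o by simp
    hence "?a (Ident (Tgt F) x) = Ident (Src F) (?o x)" using F x o(1) a(3) by (metis Ident_Arr' cat_functor_categories(1) finv_simps(1))
    thus "FA (finv F) (Ident (Src (finv F)) x) = Ident (Tgt (finv F)) (FO (finv F) x)"
      using x F by (simp add: finv_def)
  next
    fix g f assume gf: "g \<in> Arr (Src (finv F))" "f \<in> Arr (Src (finv F))" "Dom (Src (finv F)) g = Cod (Src (finv F)) f"
    have "FA F (Comp (Src F) (?a g) (?a f)) = Comp (Tgt F) g f" using F gf a d by simp
    hence "?a (Comp (Tgt F) g f) = Comp (Src F) (?a g) (?a f)"
      using F gf a d by (metis Comp_Arr' cat_functor_categories(1) finv_simps(1))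
    thus "FA (finv F) (Comp (Src (finv F)) g f) = Comp (Tgt (finv F)) (FA (finv F) g) (FA (finv F) f)"
      using gf F by (simp add: finv_def)
  qed (use F o a d in \<open>auto simp: finv_def\<close>)
  show "finv F \<odot> F = fid (Src F)" "F \<odot> finv F = fid (Tgt F)"
    using F 1 o a by (auto intro!: cfun_eqI simp: finv_def)
qed

subsection \<open>Natural transformations\<close>

lemma nts_iff [simp]: "\<alpha> \<in> nts F G \<longleftrightarrow> nat_trans \<alpha> \<and> NSrc \<alpha> = F \<and> NTgt \<alpha> = G"
  by (simp add: nts_def)

lemma nat_trans_functors [simp]: "nat_trans \<alpha> \<Longrightarrow> cat_functor (NSrc \<alpha>)" "nat_trans \<alpha> \<Longrightarrow> cat_functor (NTgt \<alpha>)"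
  unfolding nat_trans_def by auto

lemma nat_trans_NTgt [simp]: "nat_trans \<alpha> \<Longrightarrow> Src (NTgt \<alpha>) = Src (NSrc \<alpha>)" "nat_trans \<alpha> \<Longrightarrow> Tgt (NTgt \<alpha>) = Tgt (NSrc \<alpha>)"
  by (simp_all add: nat_trans.Src_eq nat_trans.Tgt_eq)

lemma NT_simps [simp]:
  assumes "nat_trans \<alpha>" "Tgt (NSrc \<alpha>) = C" "x \<in> Obj (Src (NSrc \<alpha>))"
  shows "NT \<alpha> x \<in> Arr C" "Dom C (NT \<alpha> x) = FO (NSrc \<alpha>) x" "Cod C (NT \<alpha> x) = FO (NTgt \<alpha>) x"
  using nat_trans.NT_hom[OF assms(1,3)] assms(2) by auto

lemma NT_naturality:
  "nat_trans \<alpha> \<Longrightarrow> Tgt (NSrc \<alpha>) = C \<Longrightarrow> f \<in> Arr (Src (NSrc \<alpha>)) \<Longrightarrow> Cod (Src (NSrc \<alpha>)) f = y \<Longrightarrow>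
    Comp C (NT \<alpha> y) (FA (NSrc \<alpha>) f) = Comp C (FA (NTgt \<alpha>) f) (NT \<alpha> (Dom (Src (NSrc \<alpha>)) f))"
  using nat_trans.NT_natural[of \<alpha> f "Dom (Src (NSrc \<alpha>)) f" y] by auto

lemma nat_transI:
  assumes "cat_functor (NSrc \<alpha>)" "cat_functor (NTgt \<alpha>)" "Src (NSrc \<alpha>) = Src (NTgt \<alpha>)" "Tgt (NSrc \<alpha>) = Tgt (NTgt \<alpha>)"
    "\<And>x. x \<in> Obj (Src (NSrc \<alpha>)) \<Longrightarrow> NT \<alpha> x \<in> hom (Tgt (NSrc \<alpha>)) (FO (NSrc \<alpha>) x) (FO (NTgt \<alpha>) x)"
    "\<And>f. f \<in> Arr (Src (NSrc \<alpha>)) \<Longrightarrow> Comp (Tgt (NSrc \<alpha>)) (NT \<alpha> (Cod (Src (NSrc \<alpha>)) f)) (FA (NSrc \<alpha>) f) =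
      Comp (Tgt (NSrc \<alpha>)) (FA (NTgt \<alpha>) f) (NT \<alpha> (Dom (Src (NSrc \<alpha>)) f))"
    "NT \<alpha> \<in> extensional (Obj (Src (NSrc \<alpha>)))"
  shows "nat_trans \<alpha>"
proof (intro nat_trans.intro nat_trans_axioms.intro)
  fix f x y assume "f \<in> hom (Src (NSrc \<alpha>)) x y"
  thus "Comp (Tgt (NSrc \<alpha>)) (NT \<alpha> y) (FA (NSrc \<alpha>) f) = Comp (Tgt (NSrc \<alpha>)) (FA (NTgt \<alpha>) f) (NT \<alpha> x)"
    using assms(6)[of f] by simp
qed (use assms in blast)+

lemma ntr_eqI:
  assumes "nat_trans \<alpha>" "nat_trans \<beta>" "NSrc \<alpha> = NSrc \<beta>" "NTgt \<alpha> = NTgt \<beta>"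
    "\<And>x. x \<in> Obj (Src (NSrc \<beta>)) \<Longrightarrow> NT \<alpha> x = NT \<beta> x"
  shows "\<alpha> = \<beta>"
proof -
  have "NT \<alpha> = NT \<beta>"
    by (rule extensionalityI[OF nat_trans.NT_ext[OF assms(1), unfolded assms(3)] nat_trans.NT_ext[OF assms(2)] assms(5)])
  thus ?thesis using assms(3,4) by (cases \<alpha>; cases \<beta>) simp
qed

lemma nid_simps [simp]: "NSrc (nid F) = F" "NTgt (nid F) = F"
   "x \<in> Obj (Src F) \<Longrightarrow> NT (nid F) x = Ident (Tgt F) (FO F x)"
  by (auto simp: nid_def)

lemma nat_trans_nid [simp]: "cat_functor F \<Longrightarrow> nat_trans (nid F)"
  by (rule nat_transI) (auto simp: nid_def)

lemma vcomp_simps [simp]: "NSrc (\<beta> \<cdot> \<alpha>) = NSrc \<alpha>" "NTgt (\<beta> \<cdot> \<alpha>) = NTgt \<beta>"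
   "x \<in> Obj (Src (NSrc \<alpha>)) \<Longrightarrow> NT (\<beta> \<cdot> \<alpha>) x = Comp (Tgt (NSrc \<alpha>)) (NT \<beta> x) (NT \<alpha> x)"
  by (auto simp: vcomp_def)

lemma nat_trans_vcomp [simp]:
  assumes "nat_trans \<beta>" "nat_trans \<alpha>" "NSrc \<beta> = NTgt \<alpha>"
  shows "nat_trans (\<beta> \<cdot> \<alpha>)"
proof (rule nat_transI)
  fix f assume "f \<in> Arr (Src (NSrc (\<beta> \<cdot> \<alpha>)))"
  thus "Comp (Tgt (NSrc (\<beta> \<cdot> \<alpha>))) (NT (\<beta> \<cdot> \<alpha>) (Cod (Src (NSrc (\<beta> \<cdot> \<alpha>))) f)) (FA (NSrc (\<beta> \<cdot> \<alpha>)) f) =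
    Comp (Tgt (NSrc (\<beta> \<cdot> \<alpha>))) (FA (NTgt (\<beta> \<cdot> \<alpha>)) f) (NT (\<beta> \<cdot> \<alpha>) (Dom (Src (NSrc (\<beta> \<cdot> \<alpha>))) f))"
    using assms NT_naturality[OF assms(1) refl, of f] NT_naturality[OF assms(2) refl, of f]
    by (simp add: Comp_eq_extend[of _ "NT \<beta> (Cod (Src (NSrc \<alpha>)) f)" "FA (NTgt \<alpha>) f"])
qed (use assms nat_trans_functors[OF assms(1)] in \<open>auto simp: vcomp_def nat_trans_NTgt[OF assms(1)]\<close>)

lemma whisk_left_simps [simp]: "NSrc (G \<rhd> \<alpha>) = G \<odot> NSrc \<alpha>" "NTgt (G \<rhd> \<alpha>) = G \<odot> NTgt \<alpha>"
   "x \<in> Obj (Src (NSrc \<alpha>)) \<Longrightarrow> NT (G \<rhd> \<alpha>) x = FA G (NT \<alpha> x)"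
  by (auto simp: whisk_left_def)

lemma nat_trans_whisk_left [simp]:
  assumes "cat_functor G" "nat_trans \<alpha>" "Src G = Tgt (NSrc \<alpha>)"
  shows "nat_trans (G \<rhd> \<alpha>)"
proof (rule nat_transI)
  fix f assume "f \<in> Arr (Src (NSrc (G \<rhd> \<alpha>)))"
  thus "Comp (Tgt (NSrc (G \<rhd> \<alpha>))) (NT (G \<rhd> \<alpha>) (Cod (Src (NSrc (G \<rhd> \<alpha>))) f)) (FA (NSrc (G \<rhd> \<alpha>)) f) =
    Comp (Tgt (NSrc (G \<rhd> \<alpha>))) (FA (NTgt (G \<rhd> \<alpha>)) f) (NT (G \<rhd> \<alpha>) (Dom (Src (NSrc (G \<rhd> \<alpha>))) f))"
    using assms NT_naturality[OF assms(2) refl, of f]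
    by (simp flip: FA_Comp')
qed (use assms in \<open>auto simp: whisk_left_def\<close>)

lemma whisk_right_simps [simp]: "NSrc (\<beta> \<lhd> F) = NSrc \<beta> \<odot> F" "NTgt (\<beta> \<lhd> F) = NTgt \<beta> \<odot> F"
   "x \<in> Obj (Src F) \<Longrightarrow> NT (\<beta> \<lhd> F) x = NT \<beta> (FO F x)"
  by (auto simp: whisk_right_def)

lemma nat_trans_whisk_right [simp]:
  assumes "cat_functor F" "nat_trans \<beta>" "Tgt F = Src (NSrc \<beta>)"
  shows "nat_trans (\<beta> \<lhd> F)"
proof (rule nat_transI)
  fix f assume "f \<in> Arr (Src (NSrc (\<beta> \<lhd> F)))"
  thus "Comp (Tgt (NSrc (\<beta> \<lhd> F))) (NT (\<beta> \<lhd> F) (Cod (Src (NSrc (\<beta> \<lhd> F))) f)) (FA (NSrc (\<beta> \<lhd> F)) f) =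
    Comp (Tgt (NSrc (\<beta> \<lhd> F))) (FA (NTgt (\<beta> \<lhd> F)) f) (NT (\<beta> \<lhd> F) (Dom (Src (NSrc (\<beta> \<lhd> F))) f))"
    using assms NT_naturality[OF assms(2) refl, of "FA F f"] by simp
qed (use assms in \<open>auto simp: whisk_right_def\<close>)

lemma nat_isoD: "nat_iso \<alpha> \<Longrightarrow> Tgt (NSrc \<alpha>) = C \<Longrightarrow> x \<in> Obj (Src (NSrc \<alpha>)) \<Longrightarrow> iso_arr C (NT \<alpha> x)"
  by (auto simp: nat_iso_def)

lemma ninv_simps [simp]: "NSrc (ninv \<alpha>) = NTgt \<alpha>" "NTgt (ninv \<alpha>) = NSrc \<alpha>"
  "x \<in> Obj (Src (NSrc \<alpha>)) \<Longrightarrow> NT (ninv \<alpha>) x = inv_arr (Tgt (NSrc \<alpha>)) (NT \<alpha> x)"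
  by (auto simp: ninv_def)

lemma inv_arr_naturality:
  assumes C: "category C" and "Comp C b f = Comp C g a" "iso_arr C a" "iso_arr C b"
    "f \<in> Arr C" "g \<in> Arr C" "Dom C f = Dom C a" "Cod C f = Dom C b" "Dom C g = Cod C a" "Cod C g = Cod C b"
  shows "Comp C (inv_arr C b) g = Comp C f (inv_arr C a)"
proof -
  note [simp] = iso_arr_Arr[OF assms(3)] iso_arr_Arr[OF assms(4)]
  have "Comp C (inv_arr C b) g = Comp C (inv_arr C b) (Comp C (Comp C g a) (inv_arr C a))" using assms(3-10) C by simp
  also have "\<dots> = Comp C (inv_arr C b) (Comp C (Comp C b f) (inv_arr C a))" by (simp only: assms(2))
  also have "\<dots> = Comp C f (inv_arr C a)" using C assms(3-10) by simp
  finally show ?thesis .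
qed

lemma nat_trans_ninv [simp]:
  assumes "nat_trans \<alpha>" "nat_iso \<alpha>"
  shows "nat_trans (ninv \<alpha>)"
proof (rule nat_transI)
  note [simp] = nat_isoD[OF assms(2) refl]
  fix f assume "f \<in> Arr (Src (NSrc (ninv \<alpha>)))"
  thus "Comp (Tgt (NSrc (ninv \<alpha>))) (NT (ninv \<alpha>) (Cod (Src (NSrc (ninv \<alpha>))) f)) (FA (NSrc (ninv \<alpha>)) f) =
    Comp (Tgt (NSrc (ninv \<alpha>))) (FA (NTgt (ninv \<alpha>)) f) (NT (ninv \<alpha>) (Dom (Src (NSrc (ninv \<alpha>))) f))"
    using assms by (simp, intro inv_arr_naturality) (auto simp: NT_naturality)
qed (use assms in \<open>auto simp: ninv_def nat_iso_def\<close>)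

lemma nat_iso_ninv: "nat_trans \<alpha> \<Longrightarrow> nat_iso \<alpha> \<Longrightarrow> nat_iso (ninv \<alpha>)"
  by (auto simp: nat_iso_def intro!: iso_arr_inv)

section \<open>Small categories\<close>

subsection \<open>Cardinality\<close>

text \<open>The tuples of all lengths with entries \<open>Tup []\<close> are distinct whatever
  \<open>'u\<close> is, so finite posets are always small.\<close>

lemma infinite_UNIV_el: "infinite (UNIV :: 'u el set)"
proof -
  have "inj (\<lambda>n. Tup (replicate n (Tup [])) :: 'u el)" by (auto intro!: injI)
  thus ?thesis using infinite_UNIV_nat finite_imageD finite_subset subset_UNIV by metis
qed

lemma finite_card_of_ordLess: "finite A \<Longrightarrow> infinite B \<Longrightarrow> (card_of A, card_of B) \<in> ordLess"
  by (rule finite_ordLess_infinite[OF card_of_Well_order card_of_Well_order]) (simp_all add: Field_card_of)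

lemma finite_small_set [simp]: "finite S \<Longrightarrow> small_set S"
  unfolding small_set_def using infinite_UNIV_el finite_card_of_ordLess by blast

lemma small_set_image: "small_set S \<Longrightarrow> small_set (f ` S)" for f :: "'u el \<Rightarrow> 'u el"
  unfolding small_set_def by (rule ordLeq_ordLess_trans[OF card_of_image])

lemma small_set_subset: "small_set S \<Longrightarrow> T \<subseteq> S \<Longrightarrow> small_set T"
  unfolding small_set_def by (rule ordLeq_ordLess_trans[OF card_of_mono1])

text \<open>If one factor is infinite and both are nonempty, the product has the larger of the two
  cardinalities, which is below that of \<open>C\<close>; a finite product is below it because
  \<open>C\<close> is infinite.\<close>

lemma ordLess_Times:
  assumes "infinite C" "(card_of A, card_of C) \<in> ordLess" "(card_of B, card_of C) \<in> ordLess"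
  shows "(card_of (A \<times> B), card_of C) \<in> ordLess"
proof (cases "finite A \<and> finite B")
  case True
  thus ?thesis using assms(1) by (intro finite_card_of_ordLess) simp_all
next
  case fin: False
  have tot: "(card_of A, card_of B) \<in> ordLeq \<or> (card_of B, card_of A) \<in> ordLeq"
    by (rule ordLeq_total[OF card_of_Well_order card_of_Well_order])
  show ?thesis
  proof (cases "A = {} \<or> B = {}")
    case True
    hence "finite (A \<times> B)" by auto
    thus ?thesis using assms(1) by (intro finite_card_of_ordLess) simp_all
  next
    case ne: False
    from tot show ?thesis
    proof
      assume le: "(card_of A, card_of B) \<in> ordLeq"
      hence "infinite B" using fin card_of_ordLeq_finite[OF le] by blast
      hence "(card_of (A \<times> B), card_of B) \<in> ordIso" using card_of_Times_infinite[of B A] ne le by blast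
      thus ?thesis by (rule ordIso_ordLess_trans[OF _ assms(3)])
    next
      assume le: "(card_of B, card_of A) \<in> ordLeq"
      hence "infinite A" using fin card_of_ordLeq_finite[OF le] by blast
      hence "(card_of (A \<times> B), card_of A) \<in> ordIso" using card_of_Times_infinite[of A B] ne le by blast
      thus ?thesis by (rule ordIso_ordLess_trans[OF _ assms(2)])
    qed
  qed
qed

lemma small_set_Times:
  assumes "small_set S" "small_set T"
  shows "small_set {Tup [a, b] | a b. a \<in> S \<and> b \<in> T}"
proof -
  have "{Tup [a, b] | a b. a \<in> S \<and> b \<in> T} = (\<lambda>(a, b). Tup [a, b]) ` (S \<times> T)" by auto
  thus ?thesis using ordLess_Times[OF infinite_UNIV_el assms[unfolded small_set_def]]
    unfolding small_set_def by (simp only: ordLeq_ordLess_trans[OF card_of_image])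
qed

lemma Cat_category [simp]: "A \<in> Cat \<Longrightarrow> category A"
  by (simp add: Cat_def)

text \<open>The axioms of \<open>prederivator\<close> quantify over the two ends of a functor.
  Reading both ends off \<open>u\<close> turns these axioms into simplification rules with one side
  condition; \<open>isnt\<close> does the same for 2-cells.\<close>

definition isfun :: "'u sfun \<Rightarrow> bool" where
  "isfun u \<longleftrightarrow> cat_functor u \<and> Src u \<in> Cat \<and> Tgt u \<in> Cat"

lemma isfunD [simp]: "isfun u \<Longrightarrow> cat_functor u" "isfun u \<Longrightarrow> Src u \<in> Cat" "isfun u \<Longrightarrow> Tgt u \<in> Cat"
  unfolding isfun_def by blast+

lemma isfunI: "cat_functor u \<Longrightarrow> Src u \<in> Cat \<Longrightarrow> Tgt u \<in> Cat \<Longrightarrow> isfun u"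
  unfolding isfun_def by blast

definition isnt :: "'u snt \<Rightarrow> bool" where
  "isnt \<alpha> \<longleftrightarrow> nat_trans \<alpha> \<and> isfun (NSrc \<alpha>)"

lemma isntD [simp]: "isnt \<alpha> \<Longrightarrow> nat_trans \<alpha>" "isnt \<alpha> \<Longrightarrow> isfun (NSrc \<alpha>)"
  unfolding isnt_def by blast+

lemma isnt_NTgt [simp]: "isnt \<alpha> \<Longrightarrow> isfun (NTgt \<alpha>)"
  by (rule isfunI) simp_all

lemma isntI: "nat_trans \<alpha> \<Longrightarrow> isfun (NSrc \<alpha>) \<Longrightarrow> isnt \<alpha>"
  unfolding isnt_def by blast

lemma isfun_fid [simp]: "A \<in> Cat \<Longrightarrow> isfun (fid A)"
  by (rule isfunI) simp_all

lemma isfun_fcomp [simp]: "isfun v \<Longrightarrow> isfun u \<Longrightarrow> Src v = Tgt u \<Longrightarrow> isfun (v \<odot> u)"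
  by (rule isfunI) simp_all

lemma isnt_nid [simp]: "isfun u \<Longrightarrow> isnt (nid u)"
  by (rule isntI) simp_all

lemma isnt_whisk_left [simp]: "isfun v \<Longrightarrow> isnt \<alpha> \<Longrightarrow> Src v = Tgt (NSrc \<alpha>) \<Longrightarrow> isnt (v \<rhd> \<alpha>)"
  by (rule isntI) simp_all

lemma isnt_whisk_right [simp]: "isfun u \<Longrightarrow> isnt \<beta> \<Longrightarrow> Tgt u = Src (NSrc \<beta>) \<Longrightarrow> isnt (\<beta> \<lhd> u)"
  by (rule isntI) simp_all

subsection \<open>Products\<close>

lemma Obj_prod: "Obj (A \<otimes> B) = {Tup [a, b] | a b. a \<in> Obj A \<and> b \<in> Obj B}"
  by (simp add: prod_cat_def Let_def)

lemma Arr_prod: "Arr (A \<otimes> B) = {Tup [f, g] | f g. f \<in> Arr A \<and> g \<in> Arr B}"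
  by (simp add: prod_cat_def Let_def)

lemma Obj_prod_iff [simp]: "Tup [a, b] \<in> Obj (A \<otimes> B) \<longleftrightarrow> a \<in> Obj A \<and> b \<in> Obj B"
  by (auto simp: Obj_prod)

lemma Arr_prod_iff [simp]: "Tup [f, g] \<in> Arr (A \<otimes> B) \<longleftrightarrow> f \<in> Arr A \<and> g \<in> Arr B"
  by (auto simp: Arr_prod)

lemma Obj_prodE: assumes "x \<in> Obj (A \<otimes> B)" obtains a b where "x = Tup [a, b]" "a \<in> Obj A" "b \<in> Obj B"
  using assms by (auto simp: Obj_prod)

lemma Arr_prodE: assumes "h \<in> Arr (A \<otimes> B)" obtains f g where "h = Tup [f, g]" "f \<in> Arr A" "g \<in> Arr B"
  using assms by (auto simp: Arr_prod)

lemma prod_simps [simp]: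
  "f \<in> Arr A \<Longrightarrow> g \<in> Arr B \<Longrightarrow> Dom (A \<otimes> B) (Tup [f, g]) = Tup [Dom A f, Dom B g]"
  "f \<in> Arr A \<Longrightarrow> g \<in> Arr B \<Longrightarrow> Cod (A \<otimes> B) (Tup [f, g]) = Tup [Cod A f, Cod B g]"
  "a \<in> Obj A \<Longrightarrow> b \<in> Obj B \<Longrightarrow> Ident (A \<otimes> B) (Tup [a, b]) = Tup [Ident A a, Ident B b]"
  "f \<in> Arr A \<Longrightarrow> g \<in> Arr B \<Longrightarrow> f' \<in> Arr A \<Longrightarrow> g' \<in> Arr B \<Longrightarrow> Dom A f' = Cod A f \<Longrightarrow> Dom B g' = Cod B g \<Longrightarrow>
    Comp (A \<otimes> B) (Tup [f', g']) (Tup [f, g]) = Tup [Comp A f' f, Comp B g' g]"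
  by (auto simp: prod_cat_def Let_def)

lemma category_prod [simp]:
  assumes A: "category A" and B: "category B"
  shows "category (A \<otimes> B)"
proof
  show "Dom (A \<otimes> B) \<in> extensional (Arr (A \<otimes> B))" "Cod (A \<otimes> B) \<in> extensional (Arr (A \<otimes> B))"
    "Ident (A \<otimes> B) \<in> extensional (Obj (A \<otimes> B))" by (auto simp: prod_cat_def Let_def)
  fix g f assume "\<not> composable (A \<otimes> B) g f"
  thus "Comp (A \<otimes> B) g f = undefined"
    by (auto simp: prod_cat_def Let_def)
qed (use A B in \<open>auto elim!: Obj_prodE Arr_prodE\<close>)

lemma Cat_prod [simp]: "A \<in> Cat \<Longrightarrow> B \<in> Cat \<Longrightarrow> A \<otimes> B \<in> Cat"
  unfolding Cat_def by (auto simp: small_set_Times Obj_prod Arr_prod)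

lemma cfun_prod_eqI:
  assumes "cat_functor F" "cat_functor G" "Src F = A \<otimes> B" "Src G = A \<otimes> B" "Tgt F = Tgt G"
    "\<And>a b. a \<in> Obj A \<Longrightarrow> b \<in> Obj B \<Longrightarrow> FO F (Tup [a, b]) = FO G (Tup [a, b])"
    "\<And>f g. f \<in> Arr A \<Longrightarrow> g \<in> Arr B \<Longrightarrow> FA F (Tup [f, g]) = FA G (Tup [f, g])"
  shows "F = G"
  using assms by (intro cfun_eqI) (auto elim!: Obj_prodE Arr_prodE)

lemma prod_fun_simps [simp]:
  "Src (u \<otimes>\<^sub>f v) = Src u \<otimes> Src v" "Tgt (u \<otimes>\<^sub>f v) = Tgt u \<otimes> Tgt v"
  "a \<in> Obj (Src u) \<Longrightarrow> b \<in> Obj (Src v) \<Longrightarrow> FO (u \<otimes>\<^sub>f v) (Tup [a, b]) = Tup [FO u a, FO v b]"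
  "f \<in> Arr (Src u) \<Longrightarrow> g \<in> Arr (Src v) \<Longrightarrow> FA (u \<otimes>\<^sub>f v) (Tup [f, g]) = Tup [FA u f, FA v g]"
  by (auto simp: prod_fun_def)

lemma cat_functor_prod_fun [simp]:
  assumes "cat_functor u" "cat_functor v"
  shows "cat_functor (u \<otimes>\<^sub>f v)"
proof (rule cat_functorI)
  show "FO (u \<otimes>\<^sub>f v) \<in> extensional (Obj (Src (u \<otimes>\<^sub>f v)))" "FA (u \<otimes>\<^sub>f v) \<in> extensional (Arr (Src (u \<otimes>\<^sub>f v)))"
    by (auto simp: prod_fun_def)
qed (use assms in \<open>auto elim!: Obj_prodE Arr_prodE\<close>)

lemma isfun_prod_fun [simp]: "isfun u \<Longrightarrow> isfun v \<Longrightarrow> isfun (u \<otimes>\<^sub>f v)"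
  by (rule isfunI) simp_all

lemma prod_fun_fid [simp]: "category A \<Longrightarrow> category B \<Longrightarrow> fid A \<otimes>\<^sub>f fid B = fid (A \<otimes> B)"
  by (rule cfun_prod_eqI[where A = A and B = B]) auto

lemma prod_fun_fcomp [simp]:
  "cat_functor u \<Longrightarrow> cat_functor v \<Longrightarrow> cat_functor u' \<Longrightarrow> cat_functor v' \<Longrightarrow> Src u' = Tgt u \<Longrightarrow> Src v' = Tgt v \<Longrightarrow>
    (u' \<otimes>\<^sub>f v') \<odot> (u \<otimes>\<^sub>f v) = (u' \<odot> u) \<otimes>\<^sub>f (v' \<odot> v)"
  by (rule cfun_prod_eqI[where A = "Src u" and B = "Src v"]) auto

lemma prod_nt_simps [simp]:
  "NSrc (\<alpha> \<otimes>\<^sub>n \<beta>) = NSrc \<alpha> \<otimes>\<^sub>f NSrc \<beta>" "NTgt (\<alpha> \<otimes>\<^sub>n \<beta>) = NTgt \<alpha> \<otimes>\<^sub>f NTgt \<beta>"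
  "a \<in> Obj (Src (NSrc \<alpha>)) \<Longrightarrow> b \<in> Obj (Src (NSrc \<beta>)) \<Longrightarrow> NT (\<alpha> \<otimes>\<^sub>n \<beta>) (Tup [a, b]) = Tup [NT \<alpha> a, NT \<beta> b]"
  by (auto simp: prod_nt_def)

lemma nat_trans_prod_nt [simp]:
  assumes "nat_trans \<alpha>" "nat_trans \<beta>"
  shows "nat_trans (\<alpha> \<otimes>\<^sub>n \<beta>)"
proof (rule nat_transI)
  show "NT (\<alpha> \<otimes>\<^sub>n \<beta>) \<in> extensional (Obj (Src (NSrc (\<alpha> \<otimes>\<^sub>n \<beta>))))" by (auto simp: prod_nt_def)
qed (use assms in \<open>auto elim!: Obj_prodE Arr_prodE simp: NT_naturality\<close>)

lemma isnt_prod_nt [simp]: "isnt \<alpha> \<Longrightarrow> isnt \<beta> \<Longrightarrow> isnt (\<alpha> \<otimes>\<^sub>n \<beta>)"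
  by (rule isntI) simp_all

lemma ntr_prod_eqI:
  assumes "nat_trans \<alpha>" "nat_trans \<beta>" "NSrc \<alpha> = NSrc \<beta>" "NTgt \<alpha> = NTgt \<beta>" "Src (NSrc \<beta>) = A \<otimes> B"
    "\<And>a b. a \<in> Obj A \<Longrightarrow> b \<in> Obj B \<Longrightarrow> NT \<alpha> (Tup [a, b]) = NT \<beta> (Tup [a, b])"
  shows "\<alpha> = \<beta>"
  using assms by (intro ntr_eqI) (auto elim!: Obj_prodE)

lemma prod_nid [simp]: "cat_functor u \<Longrightarrow> cat_functor v \<Longrightarrow> nid u \<otimes>\<^sub>n nid v = nid (u \<otimes>\<^sub>f v)"
  by (rule ntr_prod_eqI[where A = "Src u" and B = "Src v"]) auto

lemma prod_nt_whisk_left [simp]: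
  "cat_functor u \<Longrightarrow> cat_functor v \<Longrightarrow> nat_trans \<alpha> \<Longrightarrow> nat_trans \<beta> \<Longrightarrow> Src u = Tgt (NSrc \<alpha>) \<Longrightarrow> Src v = Tgt (NSrc \<beta>) \<Longrightarrow>
    (u \<otimes>\<^sub>f v) \<rhd> (\<alpha> \<otimes>\<^sub>n \<beta>) = (u \<rhd> \<alpha>) \<otimes>\<^sub>n (v \<rhd> \<beta>)"
  by (rule ntr_prod_eqI[where A = "Src (NSrc \<alpha>)" and B = "Src (NSrc \<beta>)"]) auto

lemma prod_nt_whisk_right [simp]:
  "cat_functor u \<Longrightarrow> cat_functor v \<Longrightarrow> nat_trans \<alpha> \<Longrightarrow> nat_trans \<beta> \<Longrightarrow> Tgt u = Src (NSrc \<alpha>) \<Longrightarrow> Tgt v = Src (NSrc \<beta>) \<Longrightarrow>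
    (\<alpha> \<otimes>\<^sub>n \<beta>) \<lhd> (u \<otimes>\<^sub>f v) = (\<alpha> \<lhd> u) \<otimes>\<^sub>n (\<beta> \<lhd> v)"
  by (rule ntr_prod_eqI[where A = "Src u" and B = "Src v"]) auto

lemma prod_nt_vcomp [simp]:
  "nat_trans \<alpha> \<Longrightarrow> nat_trans \<beta> \<Longrightarrow> nat_trans \<alpha>' \<Longrightarrow> nat_trans \<beta>' \<Longrightarrow> NSrc \<alpha>' = NTgt \<alpha> \<Longrightarrow> NSrc \<beta>' = NTgt \<beta> \<Longrightarrow>
    (\<alpha>' \<otimes>\<^sub>n \<beta>') \<cdot> (\<alpha> \<otimes>\<^sub>n \<beta>) = (\<alpha>' \<cdot> \<alpha>) \<otimes>\<^sub>n (\<beta>' \<cdot> \<beta>)"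
  by (rule ntr_prod_eqI[where A = "Src (NSrc \<alpha>)" and B = "Src (NSrc \<beta>)"]) auto

lemma fid_whisk [simp]:
  assumes "nat_trans \<alpha>" "Tgt (NSrc \<alpha>) = B"
  shows "fid B \<rhd> \<alpha> = \<alpha>"
proof -
  have [simp]: "category B" using assms cat_functor_categories(2)[of "NSrc \<alpha>"] by simp
  show ?thesis by (rule ntr_eqI) (use assms in simp_all)
qed

lemma whisk_fid [simp]:
  assumes "nat_trans \<alpha>" "Src (NSrc \<alpha>) = A"
  shows "\<alpha> \<lhd> fid A = \<alpha>"
proof -
  have [simp]: "category A" using assms cat_functor_categories(1)[of "NSrc \<alpha>"] by simp
  show ?thesis by (rule ntr_eqI) (use assms in simp_all)
qed

lemma whisk_nid [simp]: "cat_functor v \<Longrightarrow> cat_functor u \<Longrightarrow> Src v = Tgt u \<Longrightarrow> v \<rhd> nid u = nid (v \<odot> u)"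
  "cat_functor v \<Longrightarrow> cat_functor u \<Longrightarrow> Src v = Tgt u \<Longrightarrow> nid v \<lhd> u = nid (v \<odot> u)"
  by (rule ntr_eqI; auto)+

lemma vcomp_nid [simp]: "nat_trans \<alpha> \<Longrightarrow> NTgt \<alpha> = u \<Longrightarrow> nid u \<cdot> \<alpha> = \<alpha>" "nat_trans \<alpha> \<Longrightarrow> NSrc \<alpha> = u \<Longrightarrow> \<alpha> \<cdot> nid u = \<alpha>"
  by (rule ntr_eqI; auto)+

lemma slice_at_simps [simp]: "Src (slice_at A a B) = B" "Tgt (slice_at A a B) = A \<otimes> B"
  "b \<in> Obj B \<Longrightarrow> FO (slice_at A a B) b = Tup [a, b]" "g \<in> Arr B \<Longrightarrow> FA (slice_at A a B) g = Tup [Ident A a, g]"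
  by (auto simp: slice_at_def)

lemma isfun_slice_at [simp]:
  assumes "A \<in> Cat" "B \<in> Cat" "a \<in> Obj A" shows "isfun (slice_at A a B)"
proof (rule isfunI)
  show "cat_functor (slice_at A a B)"
  proof (rule cat_functorI)
    show "FO (slice_at A a B) \<in> extensional (Obj (Src (slice_at A a B)))"
      "FA (slice_at A a B) \<in> extensional (Arr (Src (slice_at A a B)))" by (auto simp: slice_at_def)
  qed (use assms in auto)
qed (use assms in auto)

lemma slice_at_natural:
  "A \<in> Cat \<Longrightarrow> a \<in> Obj A \<Longrightarrow> isfun w \<Longrightarrow> (fid A \<otimes>\<^sub>f w) \<odot> slice_at A a (Src w) = slice_at A a (Tgt w) \<odot> w"
  by (rule cfun_eqI) auto

lemma slice_at_natural2:
  "A \<in> Cat \<Longrightarrow> a \<in> Obj A \<Longrightarrow> isnt \<alpha> \<Longrightarrow> (nid (fid A) \<otimes>\<^sub>n \<alpha>) \<lhd> slice_at A a (Src (NSrc \<alpha>)) = slice_at A a (Tgt (NSrc \<alpha>)) \<rhd> \<alpha>"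
  using slice_at_natural[of A a "NSrc \<alpha>"] slice_at_natural[of A a "NTgt \<alpha>"]
  by (intro ntr_eqI) auto

lemma fun_slice_at:
  "isfun u \<Longrightarrow> B \<in> Cat \<Longrightarrow> a \<in> Obj (Src u) \<Longrightarrow> (u \<otimes>\<^sub>f fid B) \<odot> slice_at (Src u) a B = slice_at (Tgt u) (FO u a) B"
  by (rule cfun_eqI) auto

lemma prod_assoc_simps [simp]: "Src (prod_assoc A B C) = A \<otimes> (B \<otimes> C)" "Tgt (prod_assoc A B C) = (A \<otimes> B) \<otimes> C"
  "a \<in> Obj A \<Longrightarrow> b \<in> Obj B \<Longrightarrow> c \<in> Obj C \<Longrightarrow> FO (prod_assoc A B C) (Tup [a, Tup [b, c]]) = Tup [Tup [a, b], c]"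
  "f \<in> Arr A \<Longrightarrow> g \<in> Arr B \<Longrightarrow> h \<in> Arr C \<Longrightarrow> FA (prod_assoc A B C) (Tup [f, Tup [g, h]]) = Tup [Tup [f, g], h]"
  by (auto simp: prod_assoc_def)

lemma isfun_prod_assoc [simp]:
  assumes "A \<in> Cat" "B \<in> Cat" "C \<in> Cat" shows "isfun (prod_assoc A B C)"
proof (rule isfunI)
  show "cat_functor (prod_assoc A B C)"
  proof (rule cat_functorI)
    show "FO (prod_assoc A B C) \<in> extensional (Obj (Src (prod_assoc A B C)))"
      "FA (prod_assoc A B C) \<in> extensional (Arr (Src (prod_assoc A B C)))" by (auto simp: prod_assoc_def)
  qed (use assms in \<open>auto elim!: Obj_prodE Arr_prodE\<close>)
qed (use assms in auto)

subsection \<open>Posets\<close>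

lemma poset_cat_simps [simp]:
  "Obj (poset_cat P le) = P"
  "Tup [x, y] \<in> Arr (poset_cat P le) \<longleftrightarrow> x \<in> P \<and> y \<in> P \<and> le x y"
  "x \<in> P \<Longrightarrow> y \<in> P \<Longrightarrow> le x y \<Longrightarrow> Dom (poset_cat P le) (Tup [x, y]) = x"
  "x \<in> P \<Longrightarrow> y \<in> P \<Longrightarrow> le x y \<Longrightarrow> Cod (poset_cat P le) (Tup [x, y]) = y"
  "x \<in> P \<Longrightarrow> Ident (poset_cat P le) x = Tup [x, x]"
  "x \<in> P \<Longrightarrow> y \<in> P \<Longrightarrow> z \<in> P \<Longrightarrow> le x y \<Longrightarrow> le y z \<Longrightarrow> Comp (poset_cat P le) (Tup [y, z]) (Tup [x, y]) = Tup [x, z]"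
  by (auto simp: poset_cat_def Let_def)

lemma Arr_poset_catE:
  assumes "f \<in> Arr (poset_cat P le)" obtains x y where "f = Tup [x, y]" "x \<in> P" "y \<in> P" "le x y"
  using assms by (auto simp: poset_cat_def Let_def)

lemma Arr_poset_cat_eq: "f \<in> Arr (poset_cat P le) \<Longrightarrow> f = Tup [Dom (poset_cat P le) f, Cod (poset_cat P le) f]"
  by (auto elim!: Arr_poset_catE)

lemma category_poset_cat:
  assumes r: "\<And>x. x \<in> P \<Longrightarrow> le x x" and t: "\<And>x y z. x \<in> P \<Longrightarrow> y \<in> P \<Longrightarrow> z \<in> P \<Longrightarrow> le x y \<Longrightarrow> le y z \<Longrightarrow> le x z"
  shows "category (poset_cat P le)"
proof
  show "Dom (poset_cat P le) \<in> extensional (Arr (poset_cat P le))" "Cod (poset_cat P le) \<in> extensional (Arr (poset_cat P le))"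
    "Ident (poset_cat P le) \<in> extensional (Obj (poset_cat P le))" by (auto simp: poset_cat_def Let_def)
  fix g f assume "\<not> composable (poset_cat P le) g f"
  thus "Comp (poset_cat P le) g f = undefined"
    by (auto simp: poset_cat_def Let_def)
next
  fix h g f assume *: "composable (poset_cat P le) h g" "composable (poset_cat P le) g f"
  obtain x y where f: "f = Tup [x, y]" "x \<in> P" "y \<in> P" "le x y" using * by (auto elim: Arr_poset_catE)
  obtain y' z where g: "g = Tup [y', z]" "y' \<in> P" "z \<in> P" "le y' z" using * by (auto elim: Arr_poset_catE)
  obtain z' w where h: "h = Tup [z', w]" "z' \<in> P" "w \<in> P" "le z' w" using * by (auto elim: Arr_poset_catE)
  have [simp]: "y' = y" "z' = z" using * f g h by simp_all
  have [simp]: "le y z" "le z w" "w \<in> P" using g h by simp_all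
  note [simp] = f g h
  have [simp]: "le x z" "le y w" using t[of x y z] t[of y z w] f g h by simp_all
  have [simp]: "le x w" using t[of x y w] f g h by simp
  show "Comp (poset_cat P le) h (Comp (poset_cat P le) g f) = Comp (poset_cat P le) (Comp (poset_cat P le) h g) f"
    by simp
next
  fix g f assume *: "composable (poset_cat P le) g f"
  obtain x y where f: "f = Tup [x, y]" "x \<in> P" "y \<in> P" "le x y" using * by (auto elim: Arr_poset_catE)
  obtain y' z where g: "g = Tup [y', z]" "y' \<in> P" "z \<in> P" "le y' z" using * by (auto elim: Arr_poset_catE)
  have y: "y' = y" using * f g by simp
  have "le x z" using t[of x y z] f g y by simp
  thus "Comp (poset_cat P le) g f \<in> Arr (poset_cat P le)"
    "Dom (poset_cat P le) (Comp (poset_cat P le) g f) = Dom (poset_cat P le) f"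
    "Cod (poset_cat P le) (Comp (poset_cat P le) g f) = Cod (poset_cat P le) g"
    using f g y by simp_all
qed (auto elim!: Arr_poset_catE simp: r)

lemma Cat_poset_cat:
  assumes "category (poset_cat P le)" "finite P"
  shows "poset_cat P le \<in> Cat"
proof -
  have "Arr (poset_cat P le) \<subseteq> (\<lambda>(x, y). Tup [x, y]) ` (P \<times> P)" by (auto elim!: Arr_poset_catE)
  hence "finite (Arr (poset_cat P le))" using assms(2) finite_subset by blast
  thus ?thesis using assms unfolding Cat_def by simp
qed

lemma to_poset_simps [simp]: "Src (to_poset A B \<phi>) = A" "Tgt (to_poset A B \<phi>) = B"
  "x \<in> Obj A \<Longrightarrow> FO (to_poset A B \<phi>) x = \<phi> x"
  by (auto simp: to_poset_def)

lemma cat_functor_to_poset: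
  assumes "category A" "category (poset_cat P le)" "\<And>x. x \<in> Obj A \<Longrightarrow> \<phi> x \<in> P"
    "\<And>f. f \<in> Arr A \<Longrightarrow> le (\<phi> (Dom A f)) (\<phi> (Cod A f))"
  shows "cat_functor (to_poset A (poset_cat P le) \<phi>)"
proof (rule cat_functorI)
  show "FO (to_poset A (poset_cat P le) \<phi>) \<in> extensional (Obj (Src (to_poset A (poset_cat P le) \<phi>)))"
    "FA (to_poset A (poset_cat P le) \<phi>) \<in> extensional (Arr (Src (to_poset A (poset_cat P le) \<phi>)))"
    by (auto simp: to_poset_def)
  fix g f assume "g \<in> Arr (Src (to_poset A (poset_cat P le) \<phi>))" "f \<in> Arr (Src (to_poset A (poset_cat P le) \<phi>))"
    "Dom (Src (to_poset A (poset_cat P le) \<phi>)) g = Cod (Src (to_poset A (poset_cat P le) \<phi>)) f"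
  thus "FA (to_poset A (poset_cat P le) \<phi>) (Comp (Src (to_poset A (poset_cat P le) \<phi>)) g f) =
    Comp (Tgt (to_poset A (poset_cat P le) \<phi>)) (FA (to_poset A (poset_cat P le) \<phi>) g) (FA (to_poset A (poset_cat P le) \<phi>) f)"
    using assms(1) assms(3)[of "Dom A f"] assms(3)[of "Cod A f"] assms(3)[of "Cod A g"] assms(4)[of f] assms(4)[of g]
    by (simp add: to_poset_def)
qed (use assms in \<open>auto simp: to_poset_def\<close>)

text \<open>An arrow of \<open>poset_cat P le\<close> is the pair of its ends, so the values on
  objects force those on arrows.\<close>

lemma cfun_poset_eqI:
  assumes "cat_functor F" "cat_functor G" "Src F = Src G" "Tgt F = Tgt G" "Tgt G = poset_cat P le"
    "\<And>x. x \<in> Obj (Src G) \<Longrightarrow> FO F x = FO G x"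
  shows "F = G"
proof (rule cfun_eqI)
  fix f assume f: "f \<in> Arr (Src G)"
  have "Tup [Dom (poset_cat P le) (FA F f), Cod (poset_cat P le) (FA F f)]
    = Tup [Dom (poset_cat P le) (FA G f), Cod (poset_cat P le) (FA G f)]"
    using assms f by simp
  moreover have "FA F f \<in> Arr (poset_cat P le)" "FA G f \<in> Arr (poset_cat P le)" using assms f by auto
  ultimately show "FA F f = FA G f" using Arr_poset_cat_eq by metis
qed (use assms in auto)

text \<open>The only candidate for a 2-cell between functors into a poset; it is one as soon as
  \<open>F\<close> lies pointwise below \<open>G\<close>.\<close>

definition poset_nt :: "'u sfun \<Rightarrow> 'u sfun \<Rightarrow> 'u snt" where
  "poset_nt F G = \<lparr>NSrc = F, NTgt = G, NT = \<lambda>x\<in>Obj (Src F). Tup [FO F x, FO G x]\<rparr>"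

lemma poset_nt_simps [simp]: "NSrc (poset_nt F G) = F" "NTgt (poset_nt F G) = G"
  "x \<in> Obj (Src F) \<Longrightarrow> NT (poset_nt F G) x = Tup [FO F x, FO G x]"
  by (auto simp: poset_nt_def)

lemma nat_trans_poset_nt:
  assumes F: "cat_functor F" and G: "cat_functor G" and S: "Src F = Src G" "Tgt F = poset_cat P le" "Tgt G = poset_cat P le"
    and le: "\<And>x. x \<in> Obj (Src G) \<Longrightarrow> le (FO F x) (FO G x)"
  shows "nat_trans (poset_nt F G)"
proof (rule nat_transI)
  have P: "x \<in> Obj (Src G) \<Longrightarrow> FO F x \<in> P \<and> FO G x \<in> P" for x
    using FO_Obj'[OF F S(2), of x] FO_Obj'[OF G S(3), of x] S(1) by simp
  have C: "category (poset_cat P le)" using F S(2) by (metis cat_functor_categories(2))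
  show "NT (poset_nt F G) x \<in> hom (Tgt (NSrc (poset_nt F G))) (FO (NSrc (poset_nt F G)) x) (FO (NTgt (poset_nt F G)) x)"
    if "x \<in> Obj (Src (NSrc (poset_nt F G)))" for x
    using that P S le by (auto simp: poset_nt_def)
  show "NT (poset_nt F G) \<in> extensional (Obj (Src (NSrc (poset_nt F G))))" by (auto simp: poset_nt_def)
  fix f assume "f \<in> Arr (Src (NSrc (poset_nt F G)))"
  hence f: "f \<in> Arr (Src G)" by (simp add: S)
  let ?x = "Dom (Src G) f" and ?y = "Cod (Src G) f"
  have xy: "?x \<in> Obj (Src G)" "?y \<in> Obj (Src G)" using f G by auto
  have "FA F f = Tup [FO F ?x, FO F ?y]" "FA G f = Tup [FO G ?x, FO G ?y]"
    using Arr_poset_cat_eq[of "FA F f" P le] Arr_poset_cat_eq[of "FA G f" P le] F G S f by auto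
  moreover from this have "le (FO F ?x) (FO F ?y)" "le (FO G ?x) (FO G ?y)"
    using FA_simps(1)[OF F S(2), of f] FA_simps(1)[OF G S(3), of f] f S by auto
  ultimately show "Comp (Tgt (NSrc (poset_nt F G))) (NT (poset_nt F G) (Cod (Src (NSrc (poset_nt F G))) f))
         (FA (NSrc (poset_nt F G)) f) =
        Comp (Tgt (NSrc (poset_nt F G))) (FA (NTgt (poset_nt F G)) f)
         (NT (poset_nt F G) (Dom (Src (NSrc (poset_nt F G))) f))"
    using xy P le S by simp
qed (use assms in auto)

lemma ntr_poset_eqI:
  assumes "nat_trans \<alpha>" "nat_trans \<beta>" "NSrc \<alpha> = NSrc \<beta>" "NTgt \<alpha> = NTgt \<beta>" "Tgt (NSrc \<beta>) = poset_cat P le"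
  shows "\<alpha> = \<beta>"
proof (rule ntr_eqI)
  fix x assume x: "x \<in> Obj (Src (NSrc \<beta>))"
  have "NT \<alpha> x = Tup [FO (NSrc \<alpha>) x, FO (NTgt \<alpha>) x]"
    using Arr_poset_cat_eq[of "NT \<alpha> x" P le] assms x by auto
  moreover have "NT \<beta> x = Tup [FO (NSrc \<beta>) x, FO (NTgt \<beta>) x]"
    using Arr_poset_cat_eq[of "NT \<beta> x" P le] assms x by auto
  ultimately show "NT \<alpha> x = NT \<beta> x" using assms by simp
qed (use assms in auto)

subsection \<open>The terminal category\<close>

lemma one_cat_simps [simp]: "Obj one_cat = {Tup []}" "Arr one_cat = {Tup [Tup [], Tup []]}"
  "Dom one_cat (Tup [Tup [], Tup []]) = Tup []" "Cod one_cat (Tup [Tup [], Tup []]) = Tup []"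
  "Ident one_cat (Tup []) = Tup [Tup [], Tup []]"
  by (auto simp: one_cat_def poset_cat_def Let_def)

lemma category_one [simp]: "category one_cat"
  unfolding one_cat_def by (rule category_poset_cat) auto

lemma Cat_one [simp]: "one_cat \<in> Cat"
  using category_one Cat_poset_cat[of "{Tup []}"] by (simp add: one_cat_def)

lemma bang_simps [simp]: "Src (bang A) = A" "Tgt (bang A) = one_cat"
  "x \<in> Obj A \<Longrightarrow> FO (bang A) x = Tup []" "f \<in> Arr A \<Longrightarrow> FA (bang A) f = Tup [Tup [], Tup []]"
  by (auto simp: bang_def)

lemma isfun_bang [simp]: "A \<in> Cat \<Longrightarrow> isfun (bang A)"
  by (rule isfunI) (simp_all add: bang_def)

lemma cfun_one_eqI: "cat_functor F \<Longrightarrow> cat_functor G \<Longrightarrow> Src F = Src G \<Longrightarrow> Tgt F = one_cat \<Longrightarrow> Tgt G = one_cat \<Longrightarrow> F = G"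
  using FO_Obj'[of F one_cat] FO_Obj'[of G one_cat]
  by (intro cfun_poset_eqI[where P = "{Tup []}" and le = "\<lambda>_ _. True"]) (auto simp flip: one_cat_def)

lemma ntr_one_eqI: "nat_trans \<alpha> \<Longrightarrow> nat_trans \<beta> \<Longrightarrow> NSrc \<alpha> = NSrc \<beta> \<Longrightarrow> NTgt \<alpha> = NTgt \<beta> \<Longrightarrow> Tgt (NSrc \<beta>) = one_cat \<Longrightarrow> \<alpha> = \<beta>"
  by (rule ntr_poset_eqI) (auto simp: one_cat_def)

lemma bang_fcomp [simp]: "isfun u \<Longrightarrow> Tgt u = B \<Longrightarrow> bang B \<odot> u = bang (Src u)"
  by (rule cfun_one_eqI) auto

lemma bang_one [simp]: "bang one_cat = fid one_cat"
  by (rule cfun_one_eqI) auto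

lemma point_simps [simp]: "Src (point A a) = one_cat" "Tgt (point A a) = A"
  "FO (point A a) (Tup []) = a" "FA (point A a) (Tup [Tup [], Tup []]) = Ident A a"
  by (auto simp: point_def)

lemma isfun_point [simp]: "A \<in> Cat \<Longrightarrow> a \<in> Obj A \<Longrightarrow> isfun (point A a)"
  by (rule isfunI) (simp_all add: point_def)

lemma point_one [simp]: "point one_cat (Tup []) = fid one_cat"
  by (rule cfun_one_eqI) auto

lemma fun_point [simp]: "isfun u \<Longrightarrow> Src u = A \<Longrightarrow> a \<in> Obj A \<Longrightarrow> u \<odot> point A a = point (Tgt u) (FO u a)"
  by (rule cfun_eqI) auto

subsection \<open>Comma categories\<close>

lemma over_cat_Obj_iff [simp]: "Tup [a, f] \<in> Obj (over_cat u b) \<longleftrightarrow> a \<in> Obj (Src u) \<and> f \<in> hom (Tgt u) (FO u a) b"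
  by (auto simp: over_cat_def lift_cat_def Let_def)

lemma over_cat_ObjE:
  assumes "x \<in> Obj (over_cat u b)"
  obtains a f where "x = Tup [a, f]" "a \<in> Obj (Src u)" "f \<in> Arr (Tgt u)" "Dom (Tgt u) f = FO u a" "Cod (Tgt u) f = b"
  using assms by (auto simp: over_cat_def lift_cat_def Let_def)

lemma over_cat_Arr_iff [simp]: "Tup [Tup [a, f], h, Tup [a', f']] \<in> Arr (over_cat u b) \<longleftrightarrow>
    a \<in> Obj (Src u) \<and> f \<in> hom (Tgt u) (FO u a) b \<and> a' \<in> Obj (Src u) \<and> f' \<in> hom (Tgt u) (FO u a') b \<and>
    h \<in> hom (Src u) a a' \<and> Comp (Tgt u) f' (FA u h) = f"
  by (auto simp: over_cat_def lift_cat_def Let_def)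

lemma over_cat_ArrE:
  assumes "k \<in> Arr (over_cat u b)"
  obtains a f h a' f' where "k = Tup [Tup [a, f], h, Tup [a', f']]" "a \<in> Obj (Src u)"
    "f \<in> Arr (Tgt u)" "Dom (Tgt u) f = FO u a" "Cod (Tgt u) f = b" "a' \<in> Obj (Src u)"
    "f' \<in> Arr (Tgt u)" "Dom (Tgt u) f' = FO u a'" "Cod (Tgt u) f' = b"
    "h \<in> Arr (Src u)" "Dom (Src u) h = a" "Cod (Src u) h = a'" "Comp (Tgt u) f' (FA u h) = f"
  using assms by (auto simp: over_cat_def lift_cat_def Let_def)

lemma over_cat_simps [simp]:
  "k \<in> Arr (over_cat u b) \<Longrightarrow> Dom (over_cat u b) k = pr 0 k"
  "k \<in> Arr (over_cat u b) \<Longrightarrow> Cod (over_cat u b) k = pr 2 k"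
  "x \<in> Obj (over_cat u b) \<Longrightarrow> Ident (over_cat u b) x = Tup [x, Ident (Src u) (pr 0 x), x]"
  "k \<in> Arr (over_cat u b) \<Longrightarrow> l \<in> Arr (over_cat u b) \<Longrightarrow> pr 0 l = pr 2 k \<Longrightarrow>
    Comp (over_cat u b) l k = Tup [pr 0 k, Comp (Src u) (pr 1 l) (pr 1 k), pr 2 l]"
  by (auto simp: over_cat_def lift_cat_def Let_def)

lemma category_over_cat:
  assumes u: "isfun u"
  shows "category (over_cat u b)"
proof -
  have comp: "Tup [pr 0 k, Comp (Src u) (pr 1 l) (pr 1 k), pr 2 l] \<in> Arr (over_cat u b)"
    if k: "k \<in> Arr (over_cat u b)" and l: "l \<in> Arr (over_cat u b)" and e: "pr 0 l = pr 2 k" for k l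
  proof -
    obtain a f h a' f' where k': "k = Tup [Tup [a, f], h, Tup [a', f']]" "a \<in> Obj (Src u)"
      "f \<in> Arr (Tgt u)" "Dom (Tgt u) f = FO u a" "Cod (Tgt u) f = b" "a' \<in> Obj (Src u)"
      "f' \<in> Arr (Tgt u)" "Dom (Tgt u) f' = FO u a'" "Cod (Tgt u) f' = b"
      "h \<in> Arr (Src u)" "Dom (Src u) h = a" "Cod (Src u) h = a'" "Comp (Tgt u) f' (FA u h) = f"
      using k by (rule over_cat_ArrE)
    obtain a1 f1 h' a'' f'' where l': "l = Tup [Tup [a1, f1], h', Tup [a'', f'']]"
      "a'' \<in> Obj (Src u)"
      "f'' \<in> Arr (Tgt u)" "Dom (Tgt u) f'' = FO u a''" "Cod (Tgt u) f'' = b"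
      "h' \<in> Arr (Src u)" "Dom (Src u) h' = a1" "Cod (Src u) h' = a''" "Comp (Tgt u) f'' (FA u h') = f1"
      using l by (rule over_cat_ArrE)
    have e': "a1 = a'" "f1 = f'" using e k' l' by auto
    have "Comp (Tgt u) f'' (FA u (Comp (Src u) h' h)) = Comp (Tgt u) f'' (Comp (Tgt u) (FA u h') (FA u h))"
      using u k' l' e' by simp
    also have "\<dots> = Comp (Tgt u) (Comp (Tgt u) f'' (FA u h')) (FA u h)"
      by (rule Comp_assoc'[symmetric]) (use u k' l' e' in simp_all)
    finally have "Comp (Tgt u) f'' (FA u (Comp (Src u) h' h)) = f" using k' l' e' by simp
    thus ?thesis using u k' l' e' by simp
  qed
  show ?thesis
  proof
  show "Dom (over_cat u b) \<in> extensional (Arr (over_cat u b))" "Cod (over_cat u b) \<in> extensional (Arr (over_cat u b))"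
    "Ident (over_cat u b) \<in> extensional (Obj (over_cat u b))" by (auto simp: over_cat_def lift_cat_def Let_def)
  fix g f assume "\<not> composable (over_cat u b) g f"
  hence "\<not> (g \<in> Arr (over_cat u b) \<and> f \<in> Arr (over_cat u b) \<and> pr 0 g = pr 2 f)" by auto
  moreover have "Comp (over_cat u b) = (\<lambda>l k. if l \<in> Arr (over_cat u b) \<and> k \<in> Arr (over_cat u b) \<and> pr 0 l = pr 2 k
      then Tup [pr 0 k, Comp (Src u) (pr 1 l) (pr 1 k), pr 2 l] else undefined)"
    unfolding over_cat_def lift_cat_def Let_def by (simp only: cat.simps)
  ultimately show "Comp (over_cat u b) g f = undefined" by (simp only: if_False)
next
  fix l k assume "composable (over_cat u b) l k"
  hence lk: "k \<in> Arr (over_cat u b)" "l \<in> Arr (over_cat u b)" "pr 0 l = pr 2 k" by auto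
  show "Comp (over_cat u b) l k \<in> Arr (over_cat u b)"
    "Dom (over_cat u b) (Comp (over_cat u b) l k) = Dom (over_cat u b) k"
    "Cod (over_cat u b) (Comp (over_cat u b) l k) = Cod (over_cat u b) l"
    using comp[OF lk] lk by simp_all
next
  fix m l k assume *: "composable (over_cat u b) m l" "composable (over_cat u b) l k"
  have "k \<in> Arr (over_cat u b)" "l \<in> Arr (over_cat u b)" "m \<in> Arr (over_cat u b)" "pr 0 l = pr 2 k" "pr 0 m = pr 2 l"
    using * by auto
  moreover from this have "pr 1 k \<in> Arr (Src u)" "pr 1 l \<in> Arr (Src u)" "pr 1 m \<in> Arr (Src u)"
    "Dom (Src u) (pr 1 l) = Cod (Src u) (pr 1 k)" "Dom (Src u) (pr 1 m) = Cod (Src u) (pr 1 l)"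
    by (auto elim!: over_cat_ArrE)
  ultimately show "Comp (over_cat u b) m (Comp (over_cat u b) l k) = Comp (over_cat u b) (Comp (over_cat u b) m l) k"
    using u comp[of k l] comp[of l m] by simp
qed (use u in \<open>auto elim!: over_cat_ObjE over_cat_ArrE\<close>)
qed

lemma Cat_over_cat [simp]:
  assumes u: "isfun u"
  shows "over_cat u b \<in> Cat"
proof -
  have S: "small_set (Obj (Src u))" "small_set (Arr (Src u))" "small_set (Arr (Tgt u))"
    using isfunD(2,3)[OF u] unfolding Cat_def by auto
  have 1: "small_set (Obj (over_cat u b))"
    by (rule small_set_subset[OF small_set_Times[OF S(1,3)]]) (auto elim!: over_cat_ObjE)
  \<comment> \<open>Arrows are triples, while smallness is known for sets of pairs; the map re-nests
    a pair (x, (h, y)) as a triple.\<close>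
  have "Arr (over_cat u b) \<subseteq> (\<lambda>x. Tup [pr 0 x, pr 0 (pr 1 x), pr 1 (pr 1 x)]) `
      {Tup [x, y] | x y. x \<in> Obj (over_cat u b) \<and> y \<in> {Tup [h, z] | h z. h \<in> Arr (Src u) \<and> z \<in> Obj (over_cat u b)}}"
  proof
    fix k assume "k \<in> Arr (over_cat u b)"
    then obtain x h y where k: "k = Tup [x, h, y]" "x \<in> Obj (over_cat u b)" "h \<in> Arr (Src u)" "y \<in> Obj (over_cat u b)"
      by (auto elim!: over_cat_ArrE)
    thus "k \<in> (\<lambda>x. Tup [pr 0 x, pr 0 (pr 1 x), pr 1 (pr 1 x)]) `
      {Tup [x, y] | x y. x \<in> Obj (over_cat u b) \<and> y \<in> {Tup [h, z] | h z. h \<in> Arr (Src u) \<and> z \<in> Obj (over_cat u b)}}"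
      by (intro image_eqI[of _ _ "Tup [x, Tup [h, y]]"]) auto
  qed
  hence "small_set (Arr (over_cat u b))"
    by (rule small_set_subset[rotated]) (intro small_set_image small_set_Times 1 S)
  thus ?thesis using 1 category_over_cat[OF u] unfolding Cat_def by simp
qed

lemma over_proj_simps [simp]: "Src (over_proj u b) = over_cat u b" "Tgt (over_proj u b) = Src u"
  "x \<in> Obj (over_cat u b) \<Longrightarrow> FO (over_proj u b) x = pr 0 x" "k \<in> Arr (over_cat u b) \<Longrightarrow> FA (over_proj u b) k = pr 1 k"
  by (auto simp: over_proj_def lift_proj_def)

lemma isfun_over_proj [simp]:
  assumes u: "isfun u" shows "isfun (over_proj u b)"
proof (rule isfunI)
  show "cat_functor (over_proj u b)"
  proof (rule cat_functorI)
    show "FO (over_proj u b) \<in> extensional (Obj (Src (over_proj u b)))"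
      "FA (over_proj u b) \<in> extensional (Arr (Src (over_proj u b)))"
      by (auto simp: over_proj_def lift_proj_def)
    fix l k assume lk: "l \<in> Arr (Src (over_proj u b))" "k \<in> Arr (Src (over_proj u b))"
       "Dom (Src (over_proj u b)) l = Cod (Src (over_proj u b)) k"
    hence "Comp (over_cat u b) l k \<in> Arr (over_cat u b)"
      by (intro Comp_Arr' category_over_cat u) simp_all
    thus "FA (over_proj u b) (Comp (Src (over_proj u b)) l k) =
       Comp (Tgt (over_proj u b)) (FA (over_proj u b) l) (FA (over_proj u b) k)" using lk by simp
  qed (use u in \<open>auto elim!: over_cat_ObjE over_cat_ArrE\<close>)
qed (use u in auto)

lemma over_cell_simps [simp]: "NSrc (over_cell u b) = u \<odot> over_proj u b"
  "NTgt (over_cell u b) = point (Tgt u) b \<odot> bang (over_cat u b)"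
  "x \<in> Obj (over_cat u b) \<Longrightarrow> NT (over_cell u b) x = pr 1 x"
  by (auto simp: over_cell_def)

lemma isnt_over_cell [simp]:
  assumes u: "isfun u" and b: "b \<in> Obj (Tgt u)" shows "isnt (over_cell u b)"
proof (rule isntI)
  show "nat_trans (over_cell u b)"
  proof (rule nat_transI)
    show "NT (over_cell u b) \<in> extensional (Obj (Src (NSrc (over_cell u b))))" by (auto simp: over_cell_def)
    show "NT (over_cell u b) x \<in> hom (Tgt (NSrc (over_cell u b))) (FO (NSrc (over_cell u b)) x) (FO (NTgt (over_cell u b)) x)"
      if "x \<in> Obj (Src (NSrc (over_cell u b)))" for x
      using that u b by (auto elim!: over_cat_ObjE)
    fix k assume "k \<in> Arr (Src (NSrc (over_cell u b)))"
    hence k: "k \<in> Arr (over_cat u b)" by simp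
    then obtain a f h a' f' where k': "k = Tup [Tup [a, f], h, Tup [a', f']]" "a \<in> Obj (Src u)"
      "f \<in> Arr (Tgt u)" "Dom (Tgt u) f = FO u a" "Cod (Tgt u) f = b" "a' \<in> Obj (Src u)"
      "f' \<in> Arr (Tgt u)" "Dom (Tgt u) f' = FO u a'" "Cod (Tgt u) f' = b"
      "h \<in> Arr (Src u)" "Dom (Src u) h = a" "Cod (Src u) h = a'" "Comp (Tgt u) f' (FA u h) = f"
      by (rule over_cat_ArrE)
    show "Comp (Tgt (NSrc (over_cell u b))) (NT (over_cell u b) (Cod (Src (NSrc (over_cell u b))) k)) (FA (NSrc (over_cell u b)) k) =
      Comp (Tgt (NSrc (over_cell u b))) (FA (NTgt (over_cell u b)) k) (NT (over_cell u b) (Dom (Src (NSrc (over_cell u b))) k))"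
      using u b k k' by simp
  qed (use u b in simp_all)
qed (use u b in auto)

subsection \<open>Reflections and coreflections\<close>

text \<open>A functor \<open>l\<close> that is left adjoint to a section \<open>s\<close>, with unit \<open>\<upsilon>\<close> and identity counit;
  respectively right adjoint to a section, with counit \<open>\<kappa>\<close> and identity unit.\<close>

definition reflection :: "'u sfun \<Rightarrow> 'u sfun \<Rightarrow> 'u snt \<Rightarrow> bool" where
  "reflection l s \<upsilon> \<longleftrightarrow> isfun l \<and> isfun s \<and> Src s = Tgt l \<and> Tgt s = Src l \<and> l \<odot> s = fid (Tgt l) \<and>
     isnt \<upsilon> \<and> NSrc \<upsilon> = fid (Src l) \<and> NTgt \<upsilon> = s \<odot> l \<and> l \<rhd> \<upsilon> = nid l \<and> \<upsilon> \<lhd> s = nid s"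

definition coreflection :: "'u sfun \<Rightarrow> 'u sfun \<Rightarrow> 'u snt \<Rightarrow> bool" where
  "coreflection r s \<kappa> \<longleftrightarrow> isfun r \<and> isfun s \<and> Src s = Tgt r \<and> Tgt s = Src r \<and> r \<odot> s = fid (Tgt r) \<and>
     isnt \<kappa> \<and> NSrc \<kappa> = s \<odot> r \<and> NTgt \<kappa> = fid (Src r) \<and> r \<rhd> \<kappa> = nid r \<and> \<kappa> \<lhd> s = nid s"

lemma reflection_prod:
  assumes "reflection l s \<upsilon>" "C \<in> Cat"
  shows "reflection (l \<otimes>\<^sub>f fid C) (s \<otimes>\<^sub>f fid C) (\<upsilon> \<otimes>\<^sub>n nid (fid C))"
  using assms unfolding reflection_def by (intro conjI) simp_all

lemma coreflection_prod:
  assumes "coreflection l s \<upsilon>" "C \<in> Cat"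
  shows "coreflection (l \<otimes>\<^sub>f fid C) (s \<otimes>\<^sub>f fid C) (\<upsilon> \<otimes>\<^sub>n nid (fid C))"
  using assms unfolding coreflection_def by (intro conjI) simp_all

text \<open>The unique arrows x -> k into a terminal object form the unit of an adjunction between
  \<open>bang K\<close> and the point k. By \<open>ucocone_reflection\<close>, colimits over
  \<open>K\<close> are then values at k.\<close>

lemma reflection_terminal:
  assumes K: "K \<in> Cat" and k: "k \<in> Obj K" and t: "\<And>x. x \<in> Obj K \<Longrightarrow> \<exists>!f. f \<in> hom K x k"
  shows "\<exists>\<upsilon>. reflection (bang K) (point K k) \<upsilon>"
proof -
  define t where "t x = (THE f. f \<in> hom K x k)" for x
  have t: "t x \<in> hom K x k" if "x \<in> Obj K" for x unfolding t_def using assms(3)[OF that] by (rule theI')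
  have tu: "f = t x" if "f \<in> hom K x k" for f x
  proof -
    have "x \<in> Obj K" using that K by auto
    thus ?thesis using t[of x] assms(3)[of x] that by blast
  qed
  define \<upsilon> where "\<upsilon> = \<lparr>NSrc = fid K, NTgt = point K k \<odot> bang K, NT = \<lambda>x\<in>Obj K. t x\<rparr>"
  have [simp]: "NSrc \<upsilon> = fid K" "NTgt \<upsilon> = point K k \<odot> bang K" "x \<in> Obj K \<Longrightarrow> NT \<upsilon> x = t x" for x
    by (simp_all add: \<upsilon>_def)
  have n: "isnt \<upsilon>"
  proof (rule isntI)
    show "nat_trans \<upsilon>"
    proof (rule nat_transI)
      show "NT \<upsilon> \<in> extensional (Obj (Src (NSrc \<upsilon>)))" by (simp add: \<upsilon>_def)
      show "NT \<upsilon> x \<in> hom (Tgt (NSrc \<upsilon>)) (FO (NSrc \<upsilon>) x) (FO (NTgt \<upsilon>) x)"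
        if "x \<in> Obj (Src (NSrc \<upsilon>))" for x
        using that t[of x] K k by simp
      fix f assume "f \<in> Arr (Src (NSrc \<upsilon>))"
      hence f: "f \<in> Arr K" by simp
      have "Comp K (t (Cod K f)) f = t (Dom K f)" by (rule tu) (use f K t[of "Cod K f"] in auto)
      thus "Comp (Tgt (NSrc \<upsilon>)) (NT \<upsilon> (Cod (Src (NSrc \<upsilon>)) f)) (FA (NSrc \<upsilon>) f) =
       Comp (Tgt (NSrc \<upsilon>)) (FA (NTgt \<upsilon>) f) (NT \<upsilon> (Dom (Src (NSrc \<upsilon>)) f))" using f K k t[of "Dom K f"] by simp
    qed (use K k in simp_all)
  qed (use K in simp)
  have "\<upsilon> \<lhd> point K k = nid (point K k)"
  proof -
    have "t k = Ident K k" by (rule tu[symmetric]) (use k K in auto)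
    thus ?thesis using n K k by (intro ntr_eqI) simp_all
  qed
  moreover have "bang K \<rhd> \<upsilon> = nid (bang K)"
    by (rule ntr_one_eqI) (use n K k in simp_all)
  ultimately have "reflection (bang K) (point K k) \<upsilon>"
    unfolding reflection_def using n K k by simp
  thus ?thesis ..
qed

section \<open>Prederivators and derivators\<close>

context prederivator
begin

lemma category_dcat [simp]: "A \<in> Cat \<Longrightarrow> category (dcat D A)"
  by (rule dcat_category)

lemma dfun_simps [simp]:
  assumes "isfun u"
  shows "cat_functor (dfun D u)" "Src (dfun D u) = dcat D (Tgt u)" "Tgt (dfun D u) = dcat D (Src u)"
  using dfun_fhom[of "Src u" "Tgt u" u] assms by auto

lemma dnt_simps [simp]:
  assumes "isnt \<alpha>"
  shows "nat_trans (dnt D \<alpha>)" "NSrc (dnt D \<alpha>) = dfun D (NSrc \<alpha>)" "NTgt (dnt D \<alpha>) = dfun D (NTgt \<alpha>)"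
  using dnt_nts[of "Src (NSrc \<alpha>)" "Tgt (NSrc \<alpha>)" "NSrc \<alpha>" "NTgt \<alpha>" \<alpha>] assms by auto

lemma dfun_fcomp: "isfun u \<Longrightarrow> isfun v \<Longrightarrow> Src v = Tgt u \<Longrightarrow> dfun D (v \<odot> u) = dfun D u \<odot> dfun D v"
  using dfun_comp[of "Src u" "Tgt u" "Tgt v" u v] by auto

lemma FO_dfun_comp [simp]:
  assumes "isfun u" "isfun v" "Src v = Tgt u" "X \<in> Obj (dcat D (Tgt v))"
  shows "FO (dfun D u) (FO (dfun D v) X) = FO (dfun D (v \<odot> u)) X"
  using dfun_fcomp[OF assms(1-3)] assms by simp

lemma FA_dfun_comp [simp]:
  assumes "isfun u" "isfun v" "Src v = Tgt u" "f \<in> Arr (dcat D (Tgt v))"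
  shows "FA (dfun D u) (FA (dfun D v) f) = FA (dfun D (v \<odot> u)) f"
  using dfun_fcomp[OF assms(1-3)] assms by simp

lemma dfun_fid [simp]: "A \<in> Cat \<Longrightarrow> dfun D (fid A) = fid (dcat D A)"
  by (rule dfun_id)

lemma dnt_nid [simp]: "isfun u \<Longrightarrow> dnt D (nid u) = nid (dfun D u)"
  by (rule dnt_id[of "Src u" "Tgt u"]) auto

lemma NT_dnt_whisk_right [simp]:
  assumes "isfun w" "isnt \<alpha>" "Tgt w = Src (NSrc \<alpha>)" "X \<in> Obj (dcat D (Tgt (NSrc \<alpha>)))"
  shows "FA (dfun D w) (NT (dnt D \<alpha>) X) = NT (dnt D (\<alpha> \<lhd> w)) X"
proof -
  have h: "hcomp \<alpha> (nid w) = \<alpha> \<lhd> w" using assms by (simp add: hcomp_def)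
  have "dnt D (hcomp \<alpha> (nid w)) = hcomp (dnt D (nid w)) (dnt D \<alpha>)"
    using assms by (intro dnt_hcomp[of "Src w" "Tgt w" "Tgt (NSrc \<alpha>)" w w "NSrc \<alpha>" "NTgt \<alpha>"]) auto
  also have "\<dots> = dfun D w \<rhd> dnt D \<alpha>"
    using assms by (simp add: hcomp_def)
  finally show ?thesis using assms by (simp add: h)
qed

lemma NT_dnt_whisk_left [simp]:
  assumes "isfun v" "isnt \<alpha>" "Src v = Tgt (NSrc \<alpha>)" "X \<in> Obj (dcat D (Tgt v))"
  shows "NT (dnt D \<alpha>) (FO (dfun D v) X) = NT (dnt D (v \<rhd> \<alpha>)) X"
proof -
  have h: "hcomp (nid v) \<alpha> = v \<rhd> \<alpha>" using assms by (simp add: hcomp_def)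
  have "dnt D (hcomp (nid v) \<alpha>) = hcomp (dnt D \<alpha>) (dnt D (nid v))"
    using assms by (intro dnt_hcomp[of "Src (NSrc \<alpha>)" "Src v" "Tgt v" "NSrc \<alpha>" "NTgt \<alpha>" v v]) auto
  also have "\<dots> = dnt D \<alpha> \<lhd> dfun D v"
    using assms by (simp add: hcomp_def)
  finally show ?thesis using assms by (simp add: h)
qed

lemma NT_dnt_natural:
  assumes "isnt \<alpha>" "f \<in> Arr (dcat D (Tgt (NSrc \<alpha>)))" "Src (NSrc \<alpha>) = A"
    "Dom (dcat D (Tgt (NSrc \<alpha>))) f = X" "Cod (dcat D (Tgt (NSrc \<alpha>))) f = Y"
  shows "Comp (dcat D A) (NT (dnt D \<alpha>) Y) (FA (dfun D (NSrc \<alpha>)) f) =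
    Comp (dcat D A) (FA (dfun D (NTgt \<alpha>)) f) (NT (dnt D \<alpha>) X)"
  using NT_naturality[of "dnt D \<alpha>" "dcat D A" f Y] assms by simp

text \<open>A prederivator reverses functors and keeps the direction of 2-cells, so \<open>l\<close>
  left adjoint to \<open>s\<close> becomes s^* left adjoint to l^*, with unit
  \<open>dnt D \<upsilon>\<close> and, because \<open>l \<odot> s\<close> is an identity, identity
  counit. The two facts say that hom(s^*X, Y) and hom(X, l^*Y) correspond by transposition.\<close>

lemma reflection_transpose:
  assumes r: "reflection l s \<upsilon>" and X: "X \<in> Obj (dcat D (Src l))" and Y: "Y \<in> Obj (dcat D (Tgt l))"
  shows "h \<in> hom (dcat D (Tgt l)) (FO (dfun D s) X) Y \<Longrightarrow>
      FA (dfun D s) (Comp (dcat D (Src l)) (FA (dfun D l) h) (NT (dnt D \<upsilon>) X)) = h"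
    and "k \<in> hom (dcat D (Src l)) X (FO (dfun D l) Y) \<Longrightarrow>
      Comp (dcat D (Src l)) (FA (dfun D l) (FA (dfun D s) k)) (NT (dnt D \<upsilon>) X) = k"
proof -
  have R [simp]: "isfun l" "isfun s" "Src s = Tgt l" "Tgt s = Src l" "l \<odot> s = fid (Tgt l)"
     "isnt \<upsilon>" "NSrc \<upsilon> = fid (Src l)" "NTgt \<upsilon> = s \<odot> l" "l \<rhd> \<upsilon> = nid l" "\<upsilon> \<lhd> s = nid s"
    using r by (simp_all add: reflection_def)
  note [simp] = X Y
  show "FA (dfun D s) (Comp (dcat D (Src l)) (FA (dfun D l) h) (NT (dnt D \<upsilon>) X)) = h"
    if "h \<in> hom (dcat D (Tgt l)) (FO (dfun D s) X) Y" using that by simp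
  assume k: "k \<in> hom (dcat D (Src l)) X (FO (dfun D l) Y)"
  show "Comp (dcat D (Src l)) (FA (dfun D l) (FA (dfun D s) k)) (NT (dnt D \<upsilon>) X) = k"
    using NT_dnt_natural[of \<upsilon> k "Src l" X "FO (dfun D l) Y"] k by simp
qed

text \<open>The dual case: \<open>r\<close> right adjoint to \<open>s\<close> makes r^* left adjoint
  to s^*, so that hom(r^*Y, X) and hom(Y, s^*X) correspond.\<close>

lemma coreflection_transpose:
  assumes r: "coreflection r s \<kappa>" and X: "X \<in> Obj (dcat D (Src r))" and Y: "Y \<in> Obj (dcat D (Tgt r))"
  shows "h \<in> hom (dcat D (Tgt r)) Y (FO (dfun D s) X) \<Longrightarrow>
      FA (dfun D s) (Comp (dcat D (Src r)) (NT (dnt D \<kappa>) X) (FA (dfun D r) h)) = h"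
    and "k \<in> hom (dcat D (Src r)) (FO (dfun D r) Y) X \<Longrightarrow>
      Comp (dcat D (Src r)) (NT (dnt D \<kappa>) X) (FA (dfun D r) (FA (dfun D s) k)) = k"
proof -
  have R [simp]: "isfun r" "isfun s" "Src s = Tgt r" "Tgt s = Src r" "r \<odot> s = fid (Tgt r)"
     "isnt \<kappa>" "NSrc \<kappa> = s \<odot> r" "NTgt \<kappa> = fid (Src r)" "r \<rhd> \<kappa> = nid r" "\<kappa> \<lhd> s = nid s"
    using r by (simp_all add: coreflection_def)
  note [simp] = X Y
  show "FA (dfun D s) (Comp (dcat D (Src r)) (NT (dnt D \<kappa>) X) (FA (dfun D r) h)) = h"
    if "h \<in> hom (dcat D (Tgt r)) Y (FO (dfun D s) X)" using that by simp
  assume k: "k \<in> hom (dcat D (Src r)) (FO (dfun D r) Y) X"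
  show "Comp (dcat D (Src r)) (NT (dnt D \<kappa>) X) (FA (dfun D r) (FA (dfun D s) k)) = k"
    using NT_dnt_natural[of \<kappa> k "Src r" "FO (dfun D r) Y" X] k by simp
qed

text \<open>The cocone \<open>c\<close> exhibits \<open>V\<close> as a colimit of \<open>T\<close>.
  The universal property replaces the chosen \<open>lan D (bang K)\<close>, so that colimits over
  different index categories can be compared.\<close>

definition ucocone where
  "ucocone K T V c \<longleftrightarrow> K \<in> Cat \<and> T \<in> Obj (dcat D K) \<and> V \<in> Obj (dcat D one_cat) \<and>
     c \<in> hom (dcat D K) T (FO (dfun D (bang K)) V) \<and>
     (\<forall>Z\<in>Obj (dcat D one_cat). \<forall>h\<in>hom (dcat D K) T (FO (dfun D (bang K)) Z).
        \<exists>!k. k \<in> hom (dcat D one_cat) V Z \<and> Comp (dcat D K) (FA (dfun D (bang K)) k) c = h)"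

end

subsection \<open>Adjunctions and mates\<close>

lemma adjunction_simps:
  assumes "adjunction L R \<eta> \<epsilon>"
  shows "cat_functor L" "cat_functor R" "Src R = Tgt L" "Tgt R = Src L"
    "nat_trans \<eta>" "NSrc \<eta> = fid (Src L)" "NTgt \<eta> = R \<odot> L"
    "nat_trans \<epsilon>" "NSrc \<epsilon> = L \<odot> R" "NTgt \<epsilon> = fid (Tgt L)"
  using assms unfolding adjunction_def by simp_all

lemma adjunction_triangles:
  assumes "adjunction L R \<eta> \<epsilon>"
  shows "X \<in> Obj (Src L) \<Longrightarrow> Comp (Tgt L) (NT \<epsilon> (FO L X)) (FA L (NT \<eta> X)) = Ident (Tgt L) (FO L X)"
    "Y \<in> Obj (Tgt L) \<Longrightarrow> Comp (Src L) (FA R (NT \<epsilon> Y)) (NT \<eta> (FO R Y)) = Ident (Src L) (FO R Y)"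
proof -
  note [simp] = adjunction_simps[OF assms]
  show "Comp (Tgt L) (NT \<epsilon> (FO L X)) (FA L (NT \<eta> X)) = Ident (Tgt L) (FO L X)" if "X \<in> Obj (Src L)"
  proof -
    have "NT ((\<epsilon> \<lhd> L) \<cdot> (L \<rhd> \<eta>)) X = NT (nid L) X" by (simp only: adjunction.triangle_L[OF assms])
    thus ?thesis using that by simp
  qed
  show "Comp (Src L) (FA R (NT \<epsilon> Y)) (NT \<eta> (FO R Y)) = Ident (Src L) (FO R Y)" if "Y \<in> Obj (Tgt L)"
  proof -
    have "NT ((R \<rhd> \<epsilon>) \<cdot> (\<eta> \<lhd> R)) Y = NT (nid R) Y" by (simp only: adjunction.triangle_R[OF assms])
    thus ?thesis using that by simp
  qed
qed

lemma adjunction_transpose: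
  assumes adj: "adjunction L R \<eta> \<epsilon>" and X: "X \<in> Obj (Src L)" and Z: "Z \<in> Obj (Tgt L)"
  shows "h \<in> hom (Src L) X (FO R Z) \<Longrightarrow>
      Comp (Src L) (FA R (Comp (Tgt L) (NT \<epsilon> Z) (FA L h))) (NT \<eta> X) = h"
    "k \<in> hom (Tgt L) (FO L X) Z \<Longrightarrow>
      Comp (Tgt L) (NT \<epsilon> Z) (FA L (Comp (Src L) (FA R k) (NT \<eta> X))) = k"
proof -
  note [simp] = adjunction_simps[OF adj] X Z adjunction_triangles[OF adj]
  assume h: "h \<in> hom (Src L) X (FO R Z)"
  have n: "Comp (Src L) (FA R (FA L h)) (NT \<eta> X) = Comp (Src L) (NT \<eta> (FO R Z)) h"
    using NT_naturality[of \<eta> "Src L" h "FO R Z"] h by simp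
  have "Comp (Src L) (FA R (Comp (Tgt L) (NT \<epsilon> Z) (FA L h))) (NT \<eta> X) =
      Comp (Src L) (FA R (NT \<epsilon> Z)) (Comp (Src L) (NT \<eta> (FO R Z)) h)"
    using h n by simp
  also have "\<dots> = Comp (Src L) (Ident (Src L) (FO R Z)) h"
    by (rule Comp_eq_extend1) (use h in simp_all)
  finally show "Comp (Src L) (FA R (Comp (Tgt L) (NT \<epsilon> Z) (FA L h))) (NT \<eta> X) = h" using h by simp
next
  note [simp] = adjunction_simps[OF adj] X Z adjunction_triangles[OF adj]
  assume k: "k \<in> hom (Tgt L) (FO L X) Z"
  have n: "Comp (Tgt L) (NT \<epsilon> Z) (FA L (FA R k)) = Comp (Tgt L) k (NT \<epsilon> (FO L X))"
    using NT_naturality[of \<epsilon> "Tgt L" k Z] k by simp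
  have "Comp (Tgt L) (NT \<epsilon> Z) (FA L (Comp (Src L) (FA R k) (NT \<eta> X))) =
      Comp (Tgt L) (NT \<epsilon> Z) (Comp (Tgt L) (FA L (FA R k)) (FA L (NT \<eta> X)))"
    using k by simp
  also have "\<dots> = Comp (Tgt L) k (Comp (Tgt L) (NT \<epsilon> (FO L X)) (FA L (NT \<eta> X)))"
    by (rule Comp_eq_extend) (use k n in simp_all)
  finally show "Comp (Tgt L) (NT \<epsilon> Z) (FA L (Comp (Src L) (FA R k) (NT \<eta> X))) = k" using k by simp
qed

text \<open>Identities between mates are proved below by comparing transposes with this lemma or the
  next.\<close>

lemma adjunction_eq_left:
  assumes "adjunction L R \<eta> \<epsilon>" "X \<in> Obj (Src L)" "Z \<in> Obj (Tgt L)"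
    "k \<in> hom (Tgt L) (FO L X) Z" "k' \<in> hom (Tgt L) (FO L X) Z"
    "Comp (Src L) (FA R k) (NT \<eta> X) = Comp (Src L) (FA R k') (NT \<eta> X)"
  shows "k = k'"
  using adjunction_transpose(2)[OF assms(1-4)] adjunction_transpose(2)[OF assms(1-3,5)] assms(6) by metis

lemma adjunction_eq_right:
  assumes "adjunction L R \<eta> \<epsilon>" "X \<in> Obj (Src L)" "Z \<in> Obj (Tgt L)"
    "h \<in> hom (Src L) X (FO R Z)" "h' \<in> hom (Src L) X (FO R Z)"
    "Comp (Tgt L) (NT \<epsilon> Z) (FA L h) = Comp (Tgt L) (NT \<epsilon> Z) (FA L h')"
  shows "h = h'"
  using adjunction_transpose(1)[OF assms(1-4)] adjunction_transpose(1)[OF assms(1-3,5)] assms(6) by metis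

lemma category_eq_empty:
  assumes "category A" "category B" "Obj A = {}" "Obj B = {}"
  shows "A = (B :: ('o, 'm) cat)"
proof -
  have "Arr A = {}" "Arr B = {}" using assms Dom_Obj' by fastforce+
  thus ?thesis using assms by (intro cat_eqI) auto
qed

definition fun_square :: "'u sfun \<Rightarrow> 'u sfun \<Rightarrow> 'u sfun \<Rightarrow> 'u sfun \<Rightarrow> bool" where
  "fun_square u1 u2 p q \<longleftrightarrow> isfun u1 \<and> isfun u2 \<and> isfun p \<and> isfun q \<and>
     Src u1 = Tgt p \<and> Src u2 = Src p \<and> Tgt u1 = Tgt q \<and> Tgt u2 = Src q"

context derivator
begin

lemma lan_adjunction:
  assumes "isfun u"
  shows "adjunction (lan D u) (dfun D u) (lan_unit D u) (lan_counit D u)"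
proof -
  have "\<exists>x. case x of (L, \<eta>, \<epsilon>) \<Rightarrow> adjunction L (dfun D u) \<eta> \<epsilon>"
    using Der3_left[of "Src u" "Tgt u" u] assms by auto
  from someI_ex[OF this] show ?thesis
    unfolding lan_def lan_unit_def lan_counit_def lan_data_def by (simp add: case_prod_beta')
qed

lemma ran_adjunction:
  assumes "isfun u"
  shows "adjunction (dfun D u) (ran D u) (ran_unit D u) (ran_counit D u)"
proof -
  have "\<exists>x. case x of (R, \<eta>, \<epsilon>) \<Rightarrow> adjunction (dfun D u) R \<eta> \<epsilon>"
    using Der3_right[of "Src u" "Tgt u" u] assms by auto
  from someI_ex[OF this] show ?thesis
    unfolding ran_def ran_unit_def ran_counit_def ran_data_def by (simp add: case_prod_beta')
qed

lemma lan_simps [simp]: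
  assumes "isfun u"
  shows "cat_functor (lan D u)" "Src (lan D u) = dcat D (Src u)" "Tgt (lan D u) = dcat D (Tgt u)"
    "nat_trans (lan_unit D u)" "NSrc (lan_unit D u) = fid (dcat D (Src u))" "NTgt (lan_unit D u) = dfun D u \<odot> lan D u"
    "nat_trans (lan_counit D u)" "NSrc (lan_counit D u) = lan D u \<odot> dfun D u" "NTgt (lan_counit D u) = fid (dcat D (Tgt u))"
  using adjunction_simps[OF lan_adjunction[OF assms]] assms by simp_all

lemma ran_simps [simp]:
  assumes "isfun u"
  shows "cat_functor (ran D u)" "Src (ran D u) = dcat D (Src u)" "Tgt (ran D u) = dcat D (Tgt u)"
    "nat_trans (ran_unit D u)" "NSrc (ran_unit D u) = fid (dcat D (Tgt u))" "NTgt (ran_unit D u) = ran D u \<odot> dfun D u"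
    "nat_trans (ran_counit D u)" "NSrc (ran_counit D u) = dfun D u \<odot> ran D u" "NTgt (ran_counit D u) = fid (dcat D (Src u))"
  using adjunction_simps[OF ran_adjunction[OF assms]] assms by simp_all

lemma lan_mate_simps:
  assumes "fun_square u1 u2 p q" and \<alpha>: "isnt \<alpha>" "NSrc \<alpha> = u1 \<odot> p" "NTgt \<alpha> = q \<odot> u2"
  shows "nat_trans (lan_mate D u1 u2 p q \<alpha>)" "NSrc (lan_mate D u1 u2 p q \<alpha>) = lan D u2 \<odot> dfun D p"
    "NTgt (lan_mate D u1 u2 p q \<alpha>) = dfun D q \<odot> lan D u1"
    "X \<in> Obj (dcat D (Src u1)) \<Longrightarrow> NT (lan_mate D u1 u2 p q \<alpha>) X =
      Comp (dcat D (Tgt u2)) (NT (lan_counit D u2) (FO (dfun D q) (FO (lan D u1) X)))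
       (FA (lan D u2) (Comp (dcat D (Src u2)) (NT (dnt D \<alpha>) (FO (lan D u1) X)) (FA (dfun D p) (NT (lan_unit D u1) X))))"
proof -
  have [simp]: "isfun u1" "isfun u2" "isfun p" "isfun q" "Src u1 = Tgt p" "Src u2 = Src p" "Tgt u1 = Tgt q" "Tgt u2 = Src q"
    using assms by (simp_all add: fun_square_def)
  note [simp] = \<alpha> lan_mate_def left_mate_def
  show "nat_trans (lan_mate D u1 u2 p q \<alpha>)" "NSrc (lan_mate D u1 u2 p q \<alpha>) = lan D u2 \<odot> dfun D p"
    "NTgt (lan_mate D u1 u2 p q \<alpha>) = dfun D q \<odot> lan D u1"
    by (simp_all add: fcomp_assoc dfun_fcomp del: FO_dfun_comp FA_dfun_comp)
  show "X \<in> Obj (dcat D (Src u1)) \<Longrightarrow> NT (lan_mate D u1 u2 p q \<alpha>) X =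
      Comp (dcat D (Tgt u2)) (NT (lan_counit D u2) (FO (dfun D q) (FO (lan D u1) X)))
       (FA (lan D u2) (Comp (dcat D (Src u2)) (NT (dnt D \<alpha>) (FO (lan D u1) X)) (FA (dfun D p) (NT (lan_unit D u1) X))))"
    by simp
qed

text \<open>The mate is the transpose of the right-hand side, so this equation determines it; later
  arguments use it in place of the pasted definition.\<close>

lemma lan_mate_char:
  assumes sq: "fun_square u1 u2 p q" and \<alpha>: "isnt \<alpha>" "NSrc \<alpha> = u1 \<odot> p" "NTgt \<alpha> = q \<odot> u2"
    and X: "X \<in> Obj (dcat D (Src u1))"
  shows "Comp (dcat D (Src u2)) (FA (dfun D u2) (NT (lan_mate D u1 u2 p q \<alpha>) X)) (NT (lan_unit D u2) (FO (dfun D p) X)) =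
     Comp (dcat D (Src u2)) (NT (dnt D \<alpha>) (FO (lan D u1) X)) (FA (dfun D p) (NT (lan_unit D u1) X))"
proof -
  have [simp]: "isfun u1" "isfun u2" "isfun p" "isfun q" "Src u1 = Tgt p" "Src u2 = Src p" "Tgt u1 = Tgt q" "Tgt u2 = Src q"
    using sq by (simp_all add: fun_square_def)
  note [simp] = \<alpha>
  show ?thesis unfolding lan_mate_simps(4)[OF sq \<alpha> X]
    using adjunction_transpose(1)[OF lan_adjunction, of u2 "FO (dfun D p) X" "FO (dfun D q) (FO (lan D u1) X)"
      "Comp (dcat D (Src p)) (NT (dnt D \<alpha>) (FO (lan D u1) X)) (FA (dfun D p) (NT (lan_unit D u1) X))"] X
    by (simp del: Comp_assoc' FA_Comp')
qed

lemma ran_mate_simps: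
  assumes "fun_square u1 u2 p q" and \<alpha>: "isnt \<alpha>" "NSrc \<alpha> = q \<odot> u2" "NTgt \<alpha> = u1 \<odot> p"
  shows "nat_trans (ran_mate D u1 u2 p q \<alpha>)" "NSrc (ran_mate D u1 u2 p q \<alpha>) = dfun D q \<odot> ran D u1"
    "NTgt (ran_mate D u1 u2 p q \<alpha>) = ran D u2 \<odot> dfun D p"
    "X \<in> Obj (dcat D (Src u1)) \<Longrightarrow> NT (ran_mate D u1 u2 p q \<alpha>) X =
      Comp (dcat D (Tgt u2)) (FA (ran D u2) (Comp (dcat D (Src u2)) (FA (dfun D p) (NT (ran_counit D u1) X))
        (NT (dnt D \<alpha>) (FO (ran D u1) X)))) (NT (ran_unit D u2) (FO (dfun D q) (FO (ran D u1) X)))"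
proof -
  have [simp]: "isfun u1" "isfun u2" "isfun p" "isfun q" "Src u1 = Tgt p" "Src u2 = Src p" "Tgt u1 = Tgt q" "Tgt u2 = Src q"
    using assms by (simp_all add: fun_square_def)
  note [simp] = \<alpha> ran_mate_def right_mate_def
  show "nat_trans (ran_mate D u1 u2 p q \<alpha>)" "NSrc (ran_mate D u1 u2 p q \<alpha>) = dfun D q \<odot> ran D u1"
    "NTgt (ran_mate D u1 u2 p q \<alpha>) = ran D u2 \<odot> dfun D p"
    by (simp_all add: fcomp_assoc dfun_fcomp del: FO_dfun_comp FA_dfun_comp)
  show "X \<in> Obj (dcat D (Src u1)) \<Longrightarrow> NT (ran_mate D u1 u2 p q \<alpha>) X =
      Comp (dcat D (Tgt u2)) (FA (ran D u2) (Comp (dcat D (Src u2)) (FA (dfun D p) (NT (ran_counit D u1) X))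
        (NT (dnt D \<alpha>) (FO (ran D u1) X)))) (NT (ran_unit D u2) (FO (dfun D q) (FO (ran D u1) X)))"
    by simp
qed

lemma ran_mate_char:
  assumes sq: "fun_square u1 u2 p q" and \<alpha>: "isnt \<alpha>" "NSrc \<alpha> = q \<odot> u2" "NTgt \<alpha> = u1 \<odot> p"
    and X: "X \<in> Obj (dcat D (Src u1))"
  shows "Comp (dcat D (Src u2)) (NT (ran_counit D u2) (FO (dfun D p) X)) (FA (dfun D u2) (NT (ran_mate D u1 u2 p q \<alpha>) X)) =
     Comp (dcat D (Src u2)) (FA (dfun D p) (NT (ran_counit D u1) X)) (NT (dnt D \<alpha>) (FO (ran D u1) X))"
proof -
  have [simp]: "isfun u1" "isfun u2" "isfun p" "isfun q" "Src u1 = Tgt p" "Src u2 = Src p" "Tgt u1 = Tgt q" "Tgt u2 = Src q"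
    using sq by (simp_all add: fun_square_def)
  note [simp] = \<alpha>
  show ?thesis unfolding ran_mate_simps(4)[OF sq \<alpha> X]
    using adjunction_transpose(2)[OF ran_adjunction, of u2 "FO (dfun D q) (FO (ran D u1) X)" "FO (dfun D p) X"
      "Comp (dcat D (Src p)) (FA (dfun D p) (NT (ran_counit D u1) X)) (NT (dnt D \<alpha>) (FO (ran D u1) X))"] X
    by (simp del: Comp_assoc' FA_Comp')
qed

subsection \<open>Universal cocones\<close>

lemma ucocone_hom: "ucocone K T V c \<Longrightarrow> K \<in> Cat \<and> T \<in> Obj (dcat D K) \<and> V \<in> Obj (dcat D one_cat) \<and> c \<in> Arr (dcat D K) \<and>
    Dom (dcat D K) c = T \<and> Cod (dcat D K) c = FO (dfun D (bang K)) V"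
  by (simp add: ucocone_def)

text \<open>Der4 makes the mate m of the slice square invertible. By \<open>lan_mate_char\<close>
  the displayed cocone is the universal one of the chosen colimit followed by m, and following a
  universal cocone by an isomorphism keeps it universal.\<close>

lemma ucocone_Der4:
  assumes u [simp]: "isfun u" and b [simp]: "b \<in> Obj (Tgt u)" and X [simp]: "X \<in> Obj (dcat D (Src u))"
  shows "ucocone (over_cat u b) (FO (dfun D (over_proj u b)) X) (FO (dfun D (point (Tgt u) b)) (FO (lan D u) X))
    (Comp (dcat D (over_cat u b)) (NT (dnt D (over_cell u b)) (FO (lan D u) X)) (FA (dfun D (over_proj u b)) (NT (lan_unit D u) X)))"
proof -
  define K where "K = over_cat u b"
  define p where "p = over_proj u b"
  define q where "q = point (Tgt u) b"
  define cl where "cl = over_cell u b"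
  define m where "m = NT (lan_mate D u (bang K) p q cl) X"
  define c where "c = Comp (dcat D K) (NT (dnt D cl) (FO (lan D u) X)) (FA (dfun D p) (NT (lan_unit D u) X))"
  have [simp]: "K \<in> Cat" "isfun p" "isfun q" "isnt cl" "NSrc cl = u \<odot> p" "NTgt cl = q \<odot> bang K" "Src p = K" "Tgt p = Src u"
    "Src q = one_cat" "Tgt q = Tgt u"
    by (simp_all add: K_def p_def q_def cl_def)
  have sq: "fun_square u (bang K) p q" by (simp add: fun_square_def)
  note ms = lan_mate_simps[OF sq, of cl]
  have "nat_iso (lan_mate D u (bang K) p q cl)"
    unfolding K_def p_def q_def cl_def by (rule Der4_left[of "Src u" "Tgt u"]) simp_all
  from nat_isoD[OF this, of "dcat D one_cat" X] have mi: "iso_arr (dcat D one_cat) m"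
    using ms by (simp add: m_def)
  note [simp] = iso_arr_Arr[OF mi]
  have [simp]: "Dom (dcat D one_cat) m = FO (lan D (bang K)) (FO (dfun D p) X)"
     "Cod (dcat D one_cat) m = FO (dfun D q) (FO (lan D u) X)"
    using NT_simps[OF ms(1), of "dcat D one_cat" X] ms(2,3) by (simp_all add: m_def)
  have c: "Comp (dcat D K) (FA (dfun D (bang K)) m) (NT (lan_unit D (bang K)) (FO (dfun D p) X)) = c"
    using lan_mate_char[OF sq, of cl X] by (simp add: m_def c_def)
  have [simp]: "c \<in> Arr (dcat D K)" "Dom (dcat D K) c = FO (dfun D p) X"
    "Cod (dcat D K) c = FO (dfun D (bang K)) (FO (dfun D q) (FO (lan D u) X))"
    by (simp_all add: c_def)
  have kc: "Comp (dcat D K) (FA (dfun D (bang K)) k) c =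
      Comp (dcat D K) (FA (dfun D (bang K)) (Comp (dcat D one_cat) k m)) (NT (lan_unit D (bang K)) (FO (dfun D p) X))"
    if "k \<in> hom (dcat D one_cat) (FO (dfun D q) (FO (lan D u) X)) Z" for k Z
    using that by (simp add: c[symmetric])
  show ?thesis unfolding K_def[symmetric] p_def[symmetric] q_def[symmetric] cl_def[symmetric] c_def[symmetric]
    unfolding ucocone_def
  proof (intro conjI ballI)
    fix Z h assume Z: "Z \<in> Obj (dcat D one_cat)" and h: "h \<in> hom (dcat D K) (FO (dfun D p) X) (FO (dfun D (bang K)) Z)"
    define k0 where "k0 = Comp (dcat D one_cat) (NT (lan_counit D (bang K)) Z) (FA (lan D (bang K)) h)"
    have k0: "k0 \<in> hom (dcat D one_cat) (FO (lan D (bang K)) (FO (dfun D p) X)) Z" using h Z by (simp add: k0_def)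
    have k0h: "Comp (dcat D K) (FA (dfun D (bang K)) k0) (NT (lan_unit D (bang K)) (FO (dfun D p) X)) = h"
      unfolding k0_def using adjunction_transpose(1)[OF lan_adjunction, of "bang K" "FO (dfun D p) X" Z h] Z h by (simp del: Comp_assoc' FA_Comp')
    show "\<exists>!k. k \<in> hom (dcat D one_cat) (FO (dfun D q) (FO (lan D u) X)) Z \<and> Comp (dcat D K) (FA (dfun D (bang K)) k) c = h"
    proof (rule ex1I[of _ "Comp (dcat D one_cat) k0 (inv_arr (dcat D one_cat) m)"])
      show "Comp (dcat D one_cat) k0 (inv_arr (dcat D one_cat) m) \<in> hom (dcat D one_cat) (FO (dfun D q) (FO (lan D u) X)) Z \<and>
        Comp (dcat D K) (FA (dfun D (bang K)) (Comp (dcat D one_cat) k0 (inv_arr (dcat D one_cat) m))) c = h"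
        using k0 k0h mi kc[of "Comp (dcat D one_cat) k0 (inv_arr (dcat D one_cat) m)" Z] by (simp del: FA_Comp')
    next
      fix k assume k: "k \<in> hom (dcat D one_cat) (FO (dfun D q) (FO (lan D u) X)) Z \<and> Comp (dcat D K) (FA (dfun D (bang K)) k) c = h"
      have "Comp (dcat D one_cat) k m = k0"
        by (rule adjunction_eq_left[OF lan_adjunction, of "bang K" "FO (dfun D p) X" Z])
           (use k k0 k0h kc[of k Z] Z in \<open>simp_all del: FA_Comp'\<close>)
      thus "k = Comp (dcat D one_cat) k0 (inv_arr (dcat D one_cat) m)" using k mi by auto
    qed
  qed (simp_all add: c_def)
qed

text \<open>Right adjoints are final: a cocone on \<open>T\<close> over \<open>Src l\<close> with
  vertex Z is a map from \<open>T\<close> to l^* of the constant diagram Z over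
  \<open>Tgt l\<close>, and such maps transpose to cocones on s^*T.\<close>

lemma ucocone_reflection:
  assumes r: "reflection l s \<upsilon>" and c: "ucocone (Src l) T V c"
  shows "ucocone (Tgt l) (FO (dfun D s) T) V (FA (dfun D s) c)"
proof -
  have [simp]: "isfun l" "isfun s" "Src s = Tgt l" "Tgt s = Src l" "l \<odot> s = fid (Tgt l)" "isnt \<upsilon>" "NSrc \<upsilon> = fid (Src l)" "NTgt \<upsilon> = s \<odot> l"
    using r by (simp_all add: reflection_def)
  note [simp] = ucocone_hom[OF c]
  show ?thesis unfolding ucocone_def
  proof (intro conjI ballI)
    fix Z h assume Z: "Z \<in> Obj (dcat D one_cat)" and h: "h \<in> hom (dcat D (Tgt l)) (FO (dfun D s) T) (FO (dfun D (bang (Tgt l))) Z)"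
    define h' where "h' = Comp (dcat D (Src l)) (FA (dfun D l) h) (NT (dnt D \<upsilon>) T)"
    have h': "h' \<in> hom (dcat D (Src l)) T (FO (dfun D (bang (Src l))) Z)" using h Z by (simp add: h'_def)
    have sh': "FA (dfun D s) h' = h" unfolding h'_def
      by (rule reflection_transpose(1)[OF r, of T "FO (dfun D (bang (Tgt l))) Z"]) (use h Z in simp_all)
    obtain k where k: "k \<in> hom (dcat D one_cat) V Z" "Comp (dcat D (Src l)) (FA (dfun D (bang (Src l))) k) c = h'"
      and ku: "\<And>k'. k' \<in> hom (dcat D one_cat) V Z \<Longrightarrow> Comp (dcat D (Src l)) (FA (dfun D (bang (Src l))) k') c = h' \<Longrightarrow> k' = k"
      using c h' Z unfolding ucocone_def by meson
    show "\<exists>!k. k \<in> hom (dcat D one_cat) V Z \<and> Comp (dcat D (Tgt l)) (FA (dfun D (bang (Tgt l))) k) (FA (dfun D s) c) = h"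
    proof (rule ex1I[of _ k])
      have "FA (dfun D s) (Comp (dcat D (Src l)) (FA (dfun D (bang (Src l))) k) c) = h" using k(2) sh' by simp
      thus "k \<in> hom (dcat D one_cat) V Z \<and> Comp (dcat D (Tgt l)) (FA (dfun D (bang (Tgt l))) k) (FA (dfun D s) c) = h"
        using k(1) by simp
      fix k' assume k': "k' \<in> hom (dcat D one_cat) V Z \<and> Comp (dcat D (Tgt l)) (FA (dfun D (bang (Tgt l))) k') (FA (dfun D s) c) = h"
      have 1: "FA (dfun D s) (Comp (dcat D (Src l)) (FA (dfun D (bang (Src l))) k') c) = h" using k' by simp
      have 2: "Comp (dcat D (Src l)) (FA (dfun D (bang (Src l))) k') c \<in> hom (dcat D (Src l)) T (FO (dfun D l) (FO (dfun D (bang (Tgt l))) Z))"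
        using k' Z by simp
      have "Comp (dcat D (Src l)) (FA (dfun D (bang (Src l))) k') c = h'"
        using reflection_transpose(2)[OF r _ _ 2] Z 1 by (simp add: h'_def)
      thus "k' = k" using ku k' by blast
    qed
  qed simp_all
qed

lemma ucocone_iso:
  assumes c: "ucocone K T V c" and c': "ucocone K T V' c'" and f: "f \<in> hom (dcat D one_cat) V V'"
    and fc: "Comp (dcat D K) (FA (dfun D (bang K)) f) c = c'"
  shows "iso_arr (dcat D one_cat) f"
proof -
  note [simp] = ucocone_hom[OF c] ucocone_hom[OF c']
  have u: "k = k'" if "k \<in> hom (dcat D one_cat) W Z" "k' \<in> hom (dcat D one_cat) W Z" "Z \<in> Obj (dcat D one_cat)"
      "Comp (dcat D K) (FA (dfun D (bang K)) k) d = Comp (dcat D K) (FA (dfun D (bang K)) k') d" "ucocone K T W d" for k k' W Z d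
  proof -
    note [simp] = ucocone_hom[OF that(5)]
    have "Comp (dcat D K) (FA (dfun D (bang K)) k) d \<in> hom (dcat D K) T (FO (dfun D (bang K)) Z)" using that(1-3) by simp
    thus ?thesis using that unfolding ucocone_def by metis
  qed
  have "\<exists>g. g \<in> hom (dcat D one_cat) V' V \<and> Comp (dcat D K) (FA (dfun D (bang K)) g) c' = c"
    using c c' unfolding ucocone_def by metis
  then obtain g where g: "g \<in> hom (dcat D one_cat) V' V" "Comp (dcat D K) (FA (dfun D (bang K)) g) c' = c" by blast
  have "Comp (dcat D one_cat) g f = Ident (dcat D one_cat) V"
    by (rule u[OF _ _ _ _ c]) (use f g fc ucocone_hom[OF c] in auto)
  moreover have "Comp (dcat D one_cat) f g = Ident (dcat D one_cat) V'"
    by (rule u[OF _ _ _ _ c']) (use f g fc ucocone_hom[OF c'] in auto)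
  ultimately show ?thesis using f g by (intro iso_arrI[of f _ g]) simp_all
qed

text \<open>Over the terminal category \<open>bang\<close> is the identity, so the identity of
  \<open>T\<close> is a universal cocone as well.\<close>

lemma ucocone_one:
  assumes c: "ucocone one_cat T V c"
  shows "iso_arr (dcat D one_cat) c"
proof (rule ucocone_iso[OF _ c])
  note [simp] = ucocone_hom[OF c]
  show "ucocone one_cat T T (Ident (dcat D one_cat) T)"
    unfolding ucocone_def by auto
qed (use ucocone_hom[OF c] in simp_all)

text \<open>This is Der1 for the empty family: D of the empty category is equivalent to the empty
  product, which has one object and one arrow.\<close>

lemma empty_hom:
  assumes K: "K \<in> Cat" "Obj K = {}" and X: "X \<in> Obj (dcat D K)" and Y: "Y \<in> Obj (dcat D K)"
  shows "\<exists>!f. f \<in> hom (dcat D K) X Y"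
proof -
  define F where "F = coprod_comparison D {} (\<lambda>_. K)"
  let ?C = "coprod_cat {} (\<lambda>_. K)"
  have cC: "category ?C"
    by standard (auto simp: coprod_cat_def Let_def)
  \<comment> \<open>Records are extensional, so any two categories without objects are equal, and
    Der1 for the empty coproduct speaks about \<open>K\<close> itself.\<close>
  have KC: "?C = K" by (rule category_eq_empty) (use cC K in \<open>auto simp: coprod_cat_def Let_def\<close>)
  have "equivalence F" unfolding F_def by (rule Der1) auto
  then obtain G \<eta> where F: "cat_functor F" and G: "G \<in> fhom (Tgt F) (Src F)" and \<eta>: "\<eta> \<in> nts (fid (Src F)) (G \<odot> F)" "nat_iso \<eta>"
    unfolding equivalence_def by blast
  have S: "Src F = dcat D K" by (simp add: F_def coprod_comparison_def KC)
  note [simp] = F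
  have one: "f = g" if "f \<in> Arr (Tgt F)" "g \<in> Arr (Tgt F)" for f g
    using that by (simp add: F_def coprod_comparison_def big_prod_cat_def Let_def)
  have oneO: "x = y" if "x \<in> Obj (Tgt F)" "y \<in> Obj (Tgt F)" for x y
    using that by (simp add: F_def coprod_comparison_def big_prod_cat_def Let_def)
  have iso: "iso_arr (dcat D K) (NT \<eta> Z)" if "Z \<in> Obj (dcat D K)" for Z
    using nat_isoD[OF \<eta>(2), of "dcat D K" Z] \<eta> S that by simp
  have FXY: "FO F X = FO F Y" using oneO X Y S by simp
  \<comment> \<open>\<open>F\<close> sends X and Y to the same object, so the unit at X followed by
    the inverse unit at Y is an arrow X -> Y; naturality of \<eta> shows that it is the only
    one.\<close>
  define e where "e = Comp (dcat D K) (inv_arr (dcat D K) (NT \<eta> Y)) (NT \<eta> X)"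
  have e: "e \<in> hom (dcat D K) X Y"
    unfolding e_def using iso[OF X] iso[OF Y] K X Y \<eta> S FXY by simp
  have "f = e" if f: "f \<in> hom (dcat D K) X Y" for f
  proof -
    have "FA F f = Ident (Tgt F) (FO F X)" by (rule one) (use f X S in simp_all)
    hence "Comp (dcat D K) (NT \<eta> Y) f = NT \<eta> X"
      using NT_naturality[of \<eta> "dcat D K" f Y] f \<eta> S G X K by simp
    thus ?thesis unfolding e_def using iso[OF Y] f K Y \<eta> S by (metis (no_types, lifting) NT_simps(2) category_dcat fid_simps(1,2) fid_simps(3) hom_iff inv_arr_cancel(1) nts_iff)
  qed
  thus ?thesis using e by blast
qed

text \<open>The colimit formula at \<open>b\<close> runs over an empty index category, where cocones
  with a given vertex are unique by \<open>empty_hom\<close>.\<close>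

lemma lan_empty_initial:
  assumes u [simp]: "isfun u" and b [simp]: "b \<in> Obj (Tgt u)" and X [simp]: "X \<in> Obj (dcat D (Src u))"
    and e: "Obj (over_cat u b) = {}"
  shows "initial_object (dcat D one_cat) (FO (dfun D (point (Tgt u) b)) (FO (lan D u) X))"
proof -
  let ?V = "FO (dfun D (point (Tgt u) b)) (FO (lan D u) X)" and ?K = "over_cat u b"
  note c = ucocone_Der4[OF u b X]
  note [simp] = ucocone_hom[OF c]
  show ?thesis unfolding initial_object_def
  proof (intro conjI ballI)
    show "?V \<in> Obj (dcat D one_cat)" by simp
    fix Z assume Z: "Z \<in> Obj (dcat D one_cat)"
    obtain h where h: "h \<in> hom (dcat D ?K) (FO (dfun D (over_proj u b)) X) (FO (dfun D (bang ?K)) Z)"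
      using empty_hom[OF _ e, of "FO (dfun D (over_proj u b)) X" "FO (dfun D (bang ?K)) Z"] Z by auto
    obtain k where k: "k \<in> hom (dcat D one_cat) ?V Z"
      using c h Z unfolding ucocone_def by blast
    moreover have "k' = k" if "k' \<in> hom (dcat D one_cat) ?V Z" for k'
    proof -
      let ?c = "Comp (dcat D ?K) (NT (dnt D (over_cell u b)) (FO (lan D u) X)) (FA (dfun D (over_proj u b)) (NT (lan_unit D u) X))"
      have "Comp (dcat D ?K) (FA (dfun D (bang ?K)) k') ?c = h" "Comp (dcat D ?K) (FA (dfun D (bang ?K)) k) ?c = h"
        using that k h empty_hom[OF _ e, of "FO (dfun D (over_proj u b)) X" "FO (dfun D (bang ?K)) Z"] Z by auto
      thus ?thesis using c h Z that k unfolding ucocone_def by blast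
    qed
    ultimately show "\<exists>!f. f \<in> hom (dcat D one_cat) ?V Z" by blast
  qed
qed

end

subsection \<open>Slices of a product functor\<close>

text \<open>The slice of u x C over (b, c) is (u/b) x (C/c), and C/c has the identity of c as
  terminal object. \<open>over_ins\<close> inserts that object, \<open>over_ret\<close> forgets the
  C-part, and \<open>over_unit\<close> is the unit of the resulting adjunction; its C-component at
  an object with structure map g : y -> c is g itself. Hence colimits over the slice of u x C can be
  taken over u/b.\<close>

definition over_ins :: "'u sfun \<Rightarrow> 'u el \<Rightarrow> 'u scat \<Rightarrow> 'u el \<Rightarrow> 'u sfun" where
  "over_ins u b C c = \<lparr>Src = over_cat u b, Tgt = over_cat (u \<otimes>\<^sub>f fid C) (Tup [b, c]),
     FO = \<lambda>x\<in>Obj (over_cat u b). Tup [Tup [pr 0 x, c], Tup [pr 1 x, Ident C c]],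
     FA = \<lambda>k\<in>Arr (over_cat u b). Tup [Tup [Tup [pr 0 (pr 0 k), c], Tup [pr 1 (pr 0 k), Ident C c]],
       Tup [pr 1 k, Ident C c], Tup [Tup [pr 0 (pr 2 k), c], Tup [pr 1 (pr 2 k), Ident C c]]]\<rparr>"

definition over_ret :: "'u sfun \<Rightarrow> 'u el \<Rightarrow> 'u scat \<Rightarrow> 'u el \<Rightarrow> 'u sfun" where
  "over_ret u b C c = \<lparr>Src = over_cat (u \<otimes>\<^sub>f fid C) (Tup [b, c]), Tgt = over_cat u b,
     FO = \<lambda>x\<in>Obj (over_cat (u \<otimes>\<^sub>f fid C) (Tup [b, c])). Tup [pr 0 (pr 0 x), pr 0 (pr 1 x)],
     FA = \<lambda>k\<in>Arr (over_cat (u \<otimes>\<^sub>f fid C) (Tup [b, c])). Tup [Tup [pr 0 (pr 0 (pr 0 k)), pr 0 (pr 1 (pr 0 k))],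
       pr 0 (pr 1 k), Tup [pr 0 (pr 0 (pr 2 k)), pr 0 (pr 1 (pr 2 k))]]\<rparr>"

definition over_unit :: "'u sfun \<Rightarrow> 'u el \<Rightarrow> 'u scat \<Rightarrow> 'u el \<Rightarrow> 'u snt" where
  "over_unit u b C c = \<lparr>NSrc = fid (over_cat (u \<otimes>\<^sub>f fid C) (Tup [b, c])), NTgt = over_ins u b C c \<odot> over_ret u b C c,
     NT = \<lambda>x\<in>Obj (over_cat (u \<otimes>\<^sub>f fid C) (Tup [b, c])).
       Tup [x, Tup [Ident (Src u) (pr 0 (pr 0 x)), pr 1 (pr 1 x)],
         Tup [Tup [pr 0 (pr 0 x), c], Tup [pr 0 (pr 1 x), Ident C c]]]\<rparr>"

lemma over_prod_ObjE:
  assumes "x \<in> Obj (over_cat (u \<otimes>\<^sub>f fid C) (Tup [b, c]))" "isfun u" "C \<in> Cat"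
  obtains a y f g where "x = Tup [Tup [a, y], Tup [f, g]]" "a \<in> Obj (Src u)" "y \<in> Obj C" "f \<in> Arr (Tgt u)" "g \<in> Arr C"
    "Dom (Tgt u) f = FO u a" "Cod (Tgt u) f = b" "Dom C g = y" "Cod C g = c"
  using assms by (auto elim!: over_cat_ObjE Obj_prodE Arr_prodE)

lemma over_prod_ArrE:
  assumes "k \<in> Arr (over_cat (u \<otimes>\<^sub>f fid C) (Tup [b, c]))" "isfun u" "C \<in> Cat"
  obtains a y f g h i a' y' f' g' where "k = Tup [Tup [Tup [a, y], Tup [f, g]], Tup [h, i], Tup [Tup [a', y'], Tup [f', g']]]"
    "a \<in> Obj (Src u)" "y \<in> Obj C" "f \<in> Arr (Tgt u)" "g \<in> Arr C" "Dom (Tgt u) f = FO u a" "Cod (Tgt u) f = b" "Dom C g = y" "Cod C g = c"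
    "a' \<in> Obj (Src u)" "y' \<in> Obj C" "f' \<in> Arr (Tgt u)" "g' \<in> Arr C" "Dom (Tgt u) f' = FO u a'" "Cod (Tgt u) f' = b" "Dom C g' = y'" "Cod C g' = c"
    "h \<in> Arr (Src u)" "Dom (Src u) h = a" "Cod (Src u) h = a'" "i \<in> Arr C" "Dom C i = y" "Cod C i = y'"
    "Comp (Tgt u) f' (FA u h) = f" "Comp C g' i = g"
proof -
  obtain x f0 h0 x' f0' where k: "k = Tup [Tup [x, f0], h0, Tup [x', f0']]" "x \<in> Obj (Src u \<otimes> C)"
    "f0 \<in> Arr (Tgt u \<otimes> C)" "Dom (Tgt u \<otimes> C) f0 = FO (u \<otimes>\<^sub>f fid C) x" "Cod (Tgt u \<otimes> C) f0 = Tup [b, c]" "x' \<in> Obj (Src u \<otimes> C)"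
    "f0' \<in> Arr (Tgt u \<otimes> C)" "Dom (Tgt u \<otimes> C) f0' = FO (u \<otimes>\<^sub>f fid C) x'" "Cod (Tgt u \<otimes> C) f0' = Tup [b, c]"
    "h0 \<in> Arr (Src u \<otimes> C)" "Dom (Src u \<otimes> C) h0 = x" "Cod (Src u \<otimes> C) h0 = x'" "Comp (Tgt u \<otimes> C) f0' (FA (u \<otimes>\<^sub>f fid C) h0) = f0"
    using assms(1) by (rule over_cat_ArrE) simp
  obtain a y where x: "x = Tup [a, y]" "a \<in> Obj (Src u)" "y \<in> Obj C" using k(2) by (rule Obj_prodE)
  obtain a' y' where x': "x' = Tup [a', y']" "a' \<in> Obj (Src u)" "y' \<in> Obj C" using k(6) by (rule Obj_prodE)
  obtain f g where f: "f0 = Tup [f, g]" "f \<in> Arr (Tgt u)" "g \<in> Arr C" using k(3) by (rule Arr_prodE)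
  obtain f' g' where f': "f0' = Tup [f', g']" "f' \<in> Arr (Tgt u)" "g' \<in> Arr C" using k(7) by (rule Arr_prodE)
  obtain h i where h: "h0 = Tup [h, i]" "h \<in> Arr (Src u)" "i \<in> Arr C" using k(10) by (rule Arr_prodE)
  show ?thesis using that[of a y f g h i a' y' f' g'] k x x' f f' h assms(2,3) by simp
qed

lemma over_ins_simps [simp]: "Src (over_ins u b C c) = over_cat u b" "Tgt (over_ins u b C c) = over_cat (u \<otimes>\<^sub>f fid C) (Tup [b, c])"
  "x \<in> Obj (over_cat u b) \<Longrightarrow> FO (over_ins u b C c) x = Tup [Tup [pr 0 x, c], Tup [pr 1 x, Ident C c]]"
  "k \<in> Arr (over_cat u b) \<Longrightarrow> FA (over_ins u b C c) k = Tup [Tup [Tup [pr 0 (pr 0 k), c], Tup [pr 1 (pr 0 k), Ident C c]],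
       Tup [pr 1 k, Ident C c], Tup [Tup [pr 0 (pr 2 k), c], Tup [pr 1 (pr 2 k), Ident C c]]]"
  by (simp_all add: over_ins_def)

lemma over_ret_simps [simp]: "Src (over_ret u b C c) = over_cat (u \<otimes>\<^sub>f fid C) (Tup [b, c])" "Tgt (over_ret u b C c) = over_cat u b"
  "x \<in> Obj (over_cat (u \<otimes>\<^sub>f fid C) (Tup [b, c])) \<Longrightarrow> FO (over_ret u b C c) x = Tup [pr 0 (pr 0 x), pr 0 (pr 1 x)]"
  "k \<in> Arr (over_cat (u \<otimes>\<^sub>f fid C) (Tup [b, c])) \<Longrightarrow> FA (over_ret u b C c) k = Tup [Tup [pr 0 (pr 0 (pr 0 k)), pr 0 (pr 1 (pr 0 k))],
       pr 0 (pr 1 k), Tup [pr 0 (pr 0 (pr 2 k)), pr 0 (pr 1 (pr 2 k))]]"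
  by (simp_all add: over_ret_def)

lemma over_unit_simps [simp]: "NSrc (over_unit u b C c) = fid (over_cat (u \<otimes>\<^sub>f fid C) (Tup [b, c]))"
  "NTgt (over_unit u b C c) = over_ins u b C c \<odot> over_ret u b C c"
  "x \<in> Obj (over_cat (u \<otimes>\<^sub>f fid C) (Tup [b, c])) \<Longrightarrow> NT (over_unit u b C c) x =
    Tup [x, Tup [Ident (Src u) (pr 0 (pr 0 x)), pr 1 (pr 1 x)], Tup [Tup [pr 0 (pr 0 x), c], Tup [pr 0 (pr 1 x), Ident C c]]]"
  by (simp_all add: over_unit_def)

lemma isfun_over_ins:
  assumes [simp]: "isfun u" "C \<in> Cat" "b \<in> Obj (Tgt u)" "c \<in> Obj C"
  shows "isfun (over_ins u b C c)"
proof (rule isfunI)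
  show "cat_functor (over_ins u b C c)"
  proof (rule cat_functorI)
    show "FO (over_ins u b C c) \<in> extensional (Obj (Src (over_ins u b C c)))"
      "FA (over_ins u b C c) \<in> extensional (Arr (Src (over_ins u b C c)))"
      by (auto simp: over_ins_def)
    have A: "FA (over_ins u b C c) k \<in> Arr (Tgt (over_ins u b C c))" if k: "k \<in> Arr (over_cat u b)" for k
    proof -
      from k obtain a f h a' f' where "k = Tup [Tup [a, f], h, Tup [a', f']]" "a \<in> Obj (Src u)"
        "f \<in> Arr (Tgt u)" "Dom (Tgt u) f = FO u a" "Cod (Tgt u) f = b" "a' \<in> Obj (Src u)"
        "f' \<in> Arr (Tgt u)" "Dom (Tgt u) f' = FO u a'" "Cod (Tgt u) f' = b"
        "h \<in> Arr (Src u)" "Dom (Src u) h = a" "Cod (Src u) h = a'" "Comp (Tgt u) f' (FA u h) = f"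
        by (rule over_cat_ArrE)
      thus ?thesis using k by simp
    qed
    fix k assume "k \<in> Arr (Src (over_ins u b C c))"
    hence k: "k \<in> Arr (over_cat u b)" by simp
    show "FA (over_ins u b C c) k \<in> Arr (Tgt (over_ins u b C c))" by (rule A[OF k])
    have k2: "pr 0 k \<in> Obj (over_cat u b)" "pr 2 k \<in> Obj (over_cat u b)"
      using Dom_Obj'[OF category_over_cat k] Cod_Obj'[OF category_over_cat k] k by simp_all
    thus "Dom (Tgt (over_ins u b C c)) (FA (over_ins u b C c) k) = FO (over_ins u b C c) (Dom (Src (over_ins u b C c)) k)"
      "Cod (Tgt (over_ins u b C c)) (FA (over_ins u b C c) k) = FO (over_ins u b C c) (Cod (Src (over_ins u b C c)) k)"
      using A[OF k] k by (simp_all del: over_cat_Arr_iff)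
    fix l assume "l \<in> Arr (Src (over_ins u b C c))" "Dom (Src (over_ins u b C c)) l = Cod (Src (over_ins u b C c)) k"
    hence l: "l \<in> Arr (over_cat u b)" "pr 0 l = pr 2 k" using k by simp_all
    have lk: "Comp (over_cat u b) l k \<in> Arr (over_cat u b)"
      by (rule Comp_Arr') (use l k category_over_cat in simp_all)
    have "pr 1 k \<in> Arr (Src u)" "pr 1 l \<in> Arr (Src u)" "Dom (Src u) (pr 1 l) = Cod (Src u) (pr 1 k)"
      using k l by (auto elim!: over_cat_ArrE)
    thus "FA (over_ins u b C c) (Comp (Src (over_ins u b C c)) l k) =
       Comp (Tgt (over_ins u b C c)) (FA (over_ins u b C c) l) (FA (over_ins u b C c) k)"
      using A[OF k] A[OF l(1)] k l lk by (simp del: over_cat_Arr_iff)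
  next
    fix x assume "x \<in> Obj (Src (over_ins u b C c))"
    hence x: "x \<in> Obj (over_cat u b)" by simp
    then obtain a f where x': "x = Tup [a, f]" "a \<in> Obj (Src u)" "f \<in> Arr (Tgt u)" "Dom (Tgt u) f = FO u a" "Cod (Tgt u) f = b"
      by (rule over_cat_ObjE)
    show "FO (over_ins u b C c) x \<in> Obj (Tgt (over_ins u b C c))" using x x' by simp
    have i: "Tup [x, Ident (Src u) (pr 0 x), x] \<in> Arr (over_cat u b)" using x' by simp
    show "FA (over_ins u b C c) (Ident (Src (over_ins u b C c)) x) = Ident (Tgt (over_ins u b C c)) (FO (over_ins u b C c) x)"
      using x i x' by simp
  qed (simp_all add: category_over_cat)
qed simp_all

lemma isfun_over_ret:
  assumes [simp]: "isfun u" "C \<in> Cat" "b \<in> Obj (Tgt u)" "c \<in> Obj C"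
  shows "isfun (over_ret u b C c)"
proof (rule isfunI)
  let ?v = "u \<otimes>\<^sub>f fid C" and ?d = "Tup [b, c]"
  show "cat_functor (over_ret u b C c)"
  proof (rule cat_functorI)
    show "FO (over_ret u b C c) \<in> extensional (Obj (Src (over_ret u b C c)))"
      "FA (over_ret u b C c) \<in> extensional (Arr (Src (over_ret u b C c)))"
      by (auto simp: over_ret_def)
    have A: "FA (over_ret u b C c) k \<in> Arr (Tgt (over_ret u b C c))" if k: "k \<in> Arr (over_cat ?v ?d)" for k
      using k by (rule over_prod_ArrE) (use k in simp_all)
    fix k assume "k \<in> Arr (Src (over_ret u b C c))"
    hence k: "k \<in> Arr (over_cat ?v ?d)" by simp
    show "FA (over_ret u b C c) k \<in> Arr (Tgt (over_ret u b C c))" by (rule A[OF k])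
    have k2: "pr 0 k \<in> Obj (over_cat ?v ?d)" "pr 2 k \<in> Obj (over_cat ?v ?d)"
      using Dom_Obj'[OF category_over_cat k] Cod_Obj'[OF category_over_cat k] k by simp_all
    thus "Dom (Tgt (over_ret u b C c)) (FA (over_ret u b C c) k) = FO (over_ret u b C c) (Dom (Src (over_ret u b C c)) k)"
      "Cod (Tgt (over_ret u b C c)) (FA (over_ret u b C c) k) = FO (over_ret u b C c) (Cod (Src (over_ret u b C c)) k)"
      using A[OF k] k by simp_all
    fix l assume "l \<in> Arr (Src (over_ret u b C c))" "Dom (Src (over_ret u b C c)) l = Cod (Src (over_ret u b C c)) k"
    hence l: "l \<in> Arr (over_cat ?v ?d)" "pr 0 l = pr 2 k" using k by simp_all
    have lk: "Comp (over_cat ?v ?d) l k \<in> Arr (over_cat ?v ?d)"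
      by (rule Comp_Arr') (use l k category_over_cat in simp_all)
    obtain h i where h: "pr 1 k = Tup [h, i]" "h \<in> Arr (Src u)" "i \<in> Arr C" "Cod (Src u \<otimes> C) (pr 1 k) = pr 0 (pr 2 k)"
      using k by (rule over_prod_ArrE) simp_all
    obtain h' i' where h': "pr 1 l = Tup [h', i']" "h' \<in> Arr (Src u)" "i' \<in> Arr C" "Dom (Src u \<otimes> C) (pr 1 l) = pr 0 (pr 0 l)"
      using l(1) by (rule over_prod_ArrE) simp_all
    have "Tup [Cod (Src u) h, Cod C i] = Tup [Dom (Src u) h', Dom C i']"
      using h(4) h'(4) unfolding h(1) h'(1) l(2) using h(2,3) h'(2,3) by simp
    hence "Comp (Src u \<otimes> C) (pr 1 l) (pr 1 k) = Tup [Comp (Src u) h' h, Comp C i' i]" using h h' by simp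
    thus "FA (over_ret u b C c) (Comp (Src (over_ret u b C c)) l k) =
       Comp (Tgt (over_ret u b C c)) (FA (over_ret u b C c) l) (FA (over_ret u b C c) k)"
      using A[OF k] A[OF l(1)] k l lk h h' by simp
  next
    fix x assume "x \<in> Obj (Src (over_ret u b C c))"
    hence x: "x \<in> Obj (over_cat ?v ?d)" by simp
    then obtain a y f g where x': "x = Tup [Tup [a, y], Tup [f, g]]" "a \<in> Obj (Src u)" "y \<in> Obj C" "f \<in> Arr (Tgt u)" "g \<in> Arr C"
      "Dom (Tgt u) f = FO u a" "Cod (Tgt u) f = b" "Dom C g = y" "Cod C g = c"
      by (rule over_prod_ObjE) simp_all
    show "FO (over_ret u b C c) x \<in> Obj (Tgt (over_ret u b C c))" using x x' by simp
    have i: "Tup [x, Ident (Src u \<otimes> C) (pr 0 x), x] \<in> Arr (over_cat ?v ?d)" using x x' by simp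
    show "FA (over_ret u b C c) (Ident (Src (over_ret u b C c)) x) = Ident (Tgt (over_ret u b C c)) (FO (over_ret u b C c) x)"
      using x i x' by simp
  qed (simp_all add: category_over_cat)
qed simp_all

lemma over_reflection:
  assumes [simp]: "isfun u" "C \<in> Cat" "b \<in> Obj (Tgt u)" "c \<in> Obj C"
  shows "reflection (over_ret u b C c) (over_ins u b C c) (over_unit u b C c)"
proof -
  let ?v = "u \<otimes>\<^sub>f fid C" and ?d = "Tup [b, c]"
  note [simp] = isfun_over_ins isfun_over_ret
  have ins: "FO (over_ins u b C c) x \<in> Obj (over_cat ?v ?d)" if "x \<in> Obj (over_cat u b)" for x
    using that FO_Obj'[of "over_ins u b C c" "over_cat ?v ?d" x] by simp
  have insA: "FA (over_ins u b C c) k \<in> Arr (over_cat ?v ?d)" if "k \<in> Arr (over_cat u b)" for k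
    using that FA_simps(1)[of "over_ins u b C c" "over_cat ?v ?d" k] by (simp del: over_cat_Arr_iff)
  have rl: "over_ret u b C c \<odot> over_ins u b C c = fid (over_cat u b)"
  proof (rule cfun_eqI)
    fix x assume "x \<in> Obj (Src (fid (over_cat u b)))"
    hence x: "x \<in> Obj (over_cat u b)" by simp
    thus "FO (over_ret u b C c \<odot> over_ins u b C c) x = FO (fid (over_cat u b)) x"
      using ins[OF x] by (auto elim!: over_cat_ObjE)
  next
    fix x assume "x \<in> Arr (Src (fid (over_cat u b)))"
    hence x: "x \<in> Arr (over_cat u b)" by simp
    have "x = Tup [Tup [pr 0 (pr 0 x), pr 1 (pr 0 x)], pr 1 x, Tup [pr 0 (pr 2 x), pr 1 (pr 2 x)]]"
      using x by (auto elim!: over_cat_ArrE)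
    thus "FA (over_ret u b C c \<odot> over_ins u b C c) x = FA (fid (over_cat u b)) x"
      using insA[OF x] x by (simp del: over_cat_Arr_iff)
  qed (simp_all add: category_over_cat)
  have U: "NT (over_unit u b C c) x \<in> hom (over_cat ?v ?d) x (FO (over_ins u b C c) (FO (over_ret u b C c) x))"
    if x: "x \<in> Obj (over_cat ?v ?d)" for x
  proof -
    have r: "FO (over_ret u b C c) x \<in> Obj (over_cat u b)"
      using x FO_Obj'[of "over_ret u b C c" "over_cat u b" x] by simp
    from x obtain a y f g where x': "x = Tup [Tup [a, y], Tup [f, g]]" "a \<in> Obj (Src u)" "y \<in> Obj C" "f \<in> Arr (Tgt u)" "g \<in> Arr C"
      "Dom (Tgt u) f = FO u a" "Cod (Tgt u) f = b" "Dom C g = y" "Cod C g = c"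
      by (rule over_prod_ObjE) simp_all
    have "NT (over_unit u b C c) x \<in> Arr (over_cat ?v ?d)" using x x' by simp
    thus ?thesis using x r by simp
  qed
  have n: "isnt (over_unit u b C c)"
  proof (rule isntI)
    show "nat_trans (over_unit u b C c)"
    proof (rule nat_transI)
      show "NT (over_unit u b C c) \<in> extensional (Obj (Src (NSrc (over_unit u b C c))))" by (simp add: over_unit_def)
      show "NT (over_unit u b C c) x \<in> hom (Tgt (NSrc (over_unit u b C c))) (FO (NSrc (over_unit u b C c)) x) (FO (NTgt (over_unit u b C c)) x)"
        if "x \<in> Obj (Src (NSrc (over_unit u b C c)))" for x
        using that U[of x] by (simp del: over_unit_simps(3) over_ins_simps(3) over_ret_simps(3))
      fix k assume "k \<in> Arr (Src (NSrc (over_unit u b C c)))"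
      hence k: "k \<in> Arr (over_cat ?v ?d)" by simp
      have k2: "pr 0 k \<in> Obj (over_cat ?v ?d)" "pr 2 k \<in> Obj (over_cat ?v ?d)"
        using Dom_Obj'[OF category_over_cat k] Cod_Obj'[OF category_over_cat k] k by simp_all
      have r: "FA (over_ret u b C c) k \<in> Arr (over_cat u b)"
        using k FA_simps(1)[of "over_ret u b C c" "over_cat u b" k] by simp
      from k obtain a y f g h i a' y' f' g' where k': "k = Tup [Tup [Tup [a, y], Tup [f, g]], Tup [h, i], Tup [Tup [a', y'], Tup [f', g']]]"
        "a \<in> Obj (Src u)" "y \<in> Obj C" "f \<in> Arr (Tgt u)" "g \<in> Arr C" "Dom (Tgt u) f = FO u a" "Cod (Tgt u) f = b" "Dom C g = y" "Cod C g = c"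
        "a' \<in> Obj (Src u)" "y' \<in> Obj C" "f' \<in> Arr (Tgt u)" "g' \<in> Arr C" "Dom (Tgt u) f' = FO u a'" "Cod (Tgt u) f' = b" "Dom C g' = y'" "Cod C g' = c"
        "h \<in> Arr (Src u)" "Dom (Src u) h = a" "Cod (Src u) h = a'" "i \<in> Arr C" "Dom C i = y" "Cod C i = y'"
        "Comp (Tgt u) f' (FA u h) = f" "Comp C g' i = g" by (rule over_prod_ArrE) simp_all
      have 1: "NT (over_unit u b C c) (pr 0 k) \<in> Arr (over_cat ?v ?d)" "NT (over_unit u b C c) (pr 2 k) \<in> Arr (over_cat ?v ?d)"
        using U[OF k2(1)] U[OF k2(2)] by simp_all
      have 2: "FA (over_ins u b C c) (FA (over_ret u b C c) k) \<in> Arr (over_cat ?v ?d)" by (rule insA[OF r])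
      have r': "FA (over_ret u b C c) k = Tup [Tup [a, f], h, Tup [a', f']]"
        unfolding over_ret_simps(4)[OF k] by (simp add: k'(1))
      have i': "FA (over_ins u b C c) (FA (over_ret u b C c) k) = Tup [Tup [Tup [a, c], Tup [f, Ident C c]],
         Tup [h, Ident C c], Tup [Tup [a', c], Tup [f', Ident C c]]]"
        unfolding over_ins_simps(4)[OF r] by (simp add: r')
      have u1: "NT (over_unit u b C c) (pr 0 k) = Tup [pr 0 k, Tup [Ident (Src u) a, g], Tup [Tup [a, c], Tup [f, Ident C c]]]"
        "NT (over_unit u b C c) (pr 2 k) = Tup [pr 2 k, Tup [Ident (Src u) a', g'], Tup [Tup [a', c], Tup [f', Ident C c]]]"
        unfolding over_unit_simps(3)[OF k2(1)] over_unit_simps(3)[OF k2(2)] by (simp_all add: k'(1))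
      have c1: "Comp (over_cat ?v ?d) (NT (over_unit u b C c) (pr 2 k)) k = Tup [pr 0 k,
          Comp (Src ?v) (pr 1 (NT (over_unit u b C c) (pr 2 k))) (pr 1 k), pr 2 (NT (over_unit u b C c) (pr 2 k))]"
        by (rule over_cat_simps(4)[OF k 1(2)]) (simp add: u1)
      have c2: "Comp (over_cat ?v ?d) (FA (over_ins u b C c) (FA (over_ret u b C c) k)) (NT (over_unit u b C c) (pr 0 k)) =
          Tup [pr 0 (NT (over_unit u b C c) (pr 0 k)), Comp (Src ?v) (pr 1 (FA (over_ins u b C c) (FA (over_ret u b C c) k)))
            (pr 1 (NT (over_unit u b C c) (pr 0 k))), pr 2 (FA (over_ins u b C c) (FA (over_ret u b C c) k))]"
        by (rule over_cat_simps(4)[OF 1(1) 2]) (simp add: u1 i')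
      have "Comp (over_cat ?v ?d) (NT (over_unit u b C c) (pr 2 k)) k =
          Comp (over_cat ?v ?d) (FA (over_ins u b C c) (FA (over_ret u b C c) k)) (NT (over_unit u b C c) (pr 0 k))"
        unfolding c1 c2 u1 i' by (simp add: k')
      thus "Comp (Tgt (NSrc (over_unit u b C c))) (NT (over_unit u b C c) (Cod (Src (NSrc (over_unit u b C c))) k)) (FA (NSrc (over_unit u b C c)) k) =
        Comp (Tgt (NSrc (over_unit u b C c))) (FA (NTgt (over_unit u b C c)) k) (NT (over_unit u b C c) (Dom (Src (NSrc (over_unit u b C c))) k))"
        using k by (simp del: over_unit_simps(3) over_ins_simps(4) over_ret_simps(4))
    qed (simp_all add: category_over_cat)
  qed simp
  have "over_ret u b C c \<rhd> over_unit u b C c = nid (over_ret u b C c)"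
  proof (rule ntr_eqI)
    show "NTgt (over_ret u b C c \<rhd> over_unit u b C c) = NTgt (nid (over_ret u b C c))"
      by (simp add: fcomp_assoc[symmetric] rl)
    fix x assume "x \<in> Obj (Src (NSrc (nid (over_ret u b C c))))"
    hence x: "x \<in> Obj (over_cat ?v ?d)" by simp
    hence r: "FO (over_ret u b C c) x \<in> Obj (over_cat u b)"
      using FO_Obj'[of "over_ret u b C c" "over_cat u b" x] by simp
    have "NT (over_unit u b C c) x \<in> Arr (over_cat ?v ?d)" using U[OF x] by simp
    thus "NT (over_ret u b C c \<rhd> over_unit u b C c) x = NT (nid (over_ret u b C c)) x"
      using x r by simp
  qed (use n in simp_all)
  moreover have "over_unit u b C c \<lhd> over_ins u b C c = nid (over_ins u b C c)"
  proof (rule ntr_eqI)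
    show "NTgt (over_unit u b C c \<lhd> over_ins u b C c) = NTgt (nid (over_ins u b C c))"
      by (simp add: fcomp_assoc rl)
    fix x assume "x \<in> Obj (Src (NSrc (nid (over_ins u b C c))))"
    hence x: "x \<in> Obj (over_cat u b)" by simp
    thus "NT (over_unit u b C c \<lhd> over_ins u b C c) x = NT (nid (over_ins u b C c)) x"
      using ins[OF x] by (auto elim!: over_cat_ObjE)
  qed (use n in simp_all)
  ultimately show ?thesis using n rl unfolding reflection_def by simp
qed

text \<open>The index category u/b no longer depends on C and c. Slices at c and at its image under
  a functor w of parameters can therefore be compared by strict equations, as in
  \<open>slice_proj_natural\<close> and \<open>slice_cell_natural\<close>.\<close>

definition slice_proj :: "'u sfun \<Rightarrow> 'u el \<Rightarrow> 'u scat \<Rightarrow> 'u el \<Rightarrow> 'u sfun" where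
  "slice_proj u b C c = over_proj (u \<otimes>\<^sub>f fid C) (Tup [b, c]) \<odot> over_ins u b C c"

definition slice_cell :: "'u sfun \<Rightarrow> 'u el \<Rightarrow> 'u scat \<Rightarrow> 'u el \<Rightarrow> 'u snt" where
  "slice_cell u b C c = over_cell (u \<otimes>\<^sub>f fid C) (Tup [b, c]) \<lhd> over_ins u b C c"

lemma slice_proj_simps [simp]:
  assumes [simp]: "isfun u" "C \<in> Cat" "b \<in> Obj (Tgt u)" "c \<in> Obj C"
  shows "isfun (slice_proj u b C c)" "Src (slice_proj u b C c) = over_cat u b" "Tgt (slice_proj u b C c) = Src u \<otimes> C"
    "x \<in> Obj (over_cat u b) \<Longrightarrow> FO (slice_proj u b C c) x = Tup [pr 0 x, c]"
    "k \<in> Arr (over_cat u b) \<Longrightarrow> FA (slice_proj u b C c) k = Tup [pr 1 k, Ident C c]"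
proof -
  note [simp] = isfun_over_ins slice_proj_def
  show "isfun (slice_proj u b C c)" "Src (slice_proj u b C c) = over_cat u b" "Tgt (slice_proj u b C c) = Src u \<otimes> C" by simp_all
  show "x \<in> Obj (over_cat u b) \<Longrightarrow> FO (slice_proj u b C c) x = Tup [pr 0 x, c]"
    using FO_Obj'[of "over_ins u b C c" "over_cat (u \<otimes>\<^sub>f fid C) (Tup [b, c])" x] by simp
  show "k \<in> Arr (over_cat u b) \<Longrightarrow> FA (slice_proj u b C c) k = Tup [pr 1 k, Ident C c]"
    using FA_simps(1)[of "over_ins u b C c" "over_cat (u \<otimes>\<^sub>f fid C) (Tup [b, c])" k] by (simp del: over_cat_Arr_iff)
qed

lemma slice_cell_simps [simp]:
  assumes [simp]: "isfun u" "C \<in> Cat" "b \<in> Obj (Tgt u)" "c \<in> Obj C"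
  shows "isnt (slice_cell u b C c)" "NSrc (slice_cell u b C c) = (u \<otimes>\<^sub>f fid C) \<odot> slice_proj u b C c"
    "NTgt (slice_cell u b C c) = point (Tgt u \<otimes> C) (Tup [b, c]) \<odot> bang (over_cat u b)"
    "x \<in> Obj (over_cat u b) \<Longrightarrow> NT (slice_cell u b C c) x = Tup [pr 1 x, Ident C c]"
proof -
  note [simp] = isfun_over_ins
  show "isnt (slice_cell u b C c)" by (simp add: slice_cell_def)
  show "NSrc (slice_cell u b C c) = (u \<otimes>\<^sub>f fid C) \<odot> slice_proj u b C c" by (simp add: slice_cell_def slice_proj_def fcomp_assoc)
  show "NTgt (slice_cell u b C c) = point (Tgt u \<otimes> C) (Tup [b, c]) \<odot> bang (over_cat u b)" by (simp add: slice_cell_def fcomp_assoc)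
  show "x \<in> Obj (over_cat u b) \<Longrightarrow> NT (slice_cell u b C c) x = Tup [pr 1 x, Ident C c]"
    using FO_Obj'[of "over_ins u b C c" "over_cat (u \<otimes>\<^sub>f fid C) (Tup [b, c])" x] by (simp add: slice_cell_def)
qed

lemma slice_proj_natural:
  assumes [simp]: "isfun u" "isfun w" "b \<in> Obj (Tgt u)" "c \<in> Obj (Src w)"
  shows "(fid (Src u) \<otimes>\<^sub>f w) \<odot> slice_proj u b (Src w) c = slice_proj u b (Tgt w) (FO w c)"
proof (rule cfun_eqI)
  fix x assume "x \<in> Obj (Src (slice_proj u b (Tgt w) (FO w c)))"
  thus "FO ((fid (Src u) \<otimes>\<^sub>f w) \<odot> slice_proj u b (Src w) c) x = FO (slice_proj u b (Tgt w) (FO w c)) x"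
    by (auto elim!: over_cat_ObjE)
next
  fix k assume "k \<in> Arr (Src (slice_proj u b (Tgt w) (FO w c)))"
  hence k: "k \<in> Arr (over_cat u b)" by simp
  moreover from this have "pr 1 k \<in> Arr (Src u)" by (auto elim!: over_cat_ArrE)
  ultimately show "FA ((fid (Src u) \<otimes>\<^sub>f w) \<odot> slice_proj u b (Src w) c) k = FA (slice_proj u b (Tgt w) (FO w c)) k" by simp
qed simp_all

lemma slice_cell_natural:
  assumes [simp]: "isfun u" "isfun w" "b \<in> Obj (Tgt u)" "c \<in> Obj (Src w)"
  shows "(fid (Tgt u) \<otimes>\<^sub>f w) \<rhd> slice_cell u b (Src w) c = slice_cell u b (Tgt w) (FO w c)"
proof (rule ntr_eqI)
  have "(fid (Tgt u) \<otimes>\<^sub>f w) \<odot> ((u \<otimes>\<^sub>f fid (Src w)) \<odot> slice_proj u b (Src w) c) =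
     (u \<otimes>\<^sub>f fid (Tgt w)) \<odot> ((fid (Src u) \<otimes>\<^sub>f w) \<odot> slice_proj u b (Src w) c)"
    by (simp add: fcomp_assoc[symmetric])
  thus "NSrc ((fid (Tgt u) \<otimes>\<^sub>f w) \<rhd> slice_cell u b (Src w) c) = NSrc (slice_cell u b (Tgt w) (FO w c))"
    by (simp add: slice_proj_natural)
  show "NTgt ((fid (Tgt u) \<otimes>\<^sub>f w) \<rhd> slice_cell u b (Src w) c) = NTgt (slice_cell u b (Tgt w) (FO w c))"
    by (simp add: fcomp_assoc[symmetric])
  fix x assume "x \<in> Obj (Src (NSrc (slice_cell u b (Tgt w) (FO w c))))"
  hence x: "x \<in> Obj (over_cat u b)" by simp
  moreover from this have "pr 1 x \<in> Arr (Tgt u)" by (auto elim!: over_cat_ObjE)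
  ultimately show "NT ((fid (Tgt u) \<otimes>\<^sub>f w) \<rhd> slice_cell u b (Src w) c) x = NT (slice_cell u b (Tgt w) (FO w c)) x"
    by simp
qed simp_all

section \<open>Left Kan extensions commute with change of parameters\<close>

context derivator
begin

text \<open>This is Der4 for u x C, restricted along the final functor
  \<open>over_ins\<close>.\<close>

lemma ucocone_slice:
  assumes [simp]: "isfun u" "C \<in> Cat" "b \<in> Obj (Tgt u)" "c \<in> Obj C" "X \<in> Obj (dcat D (Src u \<otimes> C))"
  shows "ucocone (over_cat u b) (FO (dfun D (slice_proj u b C c)) X)
    (FO (dfun D (point (Tgt u \<otimes> C) (Tup [b, c]))) (FO (lan D (u \<otimes>\<^sub>f fid C)) X))
    (Comp (dcat D (over_cat u b)) (NT (dnt D (slice_cell u b C c)) (FO (lan D (u \<otimes>\<^sub>f fid C)) X))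
      (FA (dfun D (slice_proj u b C c)) (NT (lan_unit D (u \<otimes>\<^sub>f fid C)) X)))"
proof -
  let ?v = "u \<otimes>\<^sub>f fid C" and ?d = "Tup [b, c]"
  note [simp] = isfun_over_ins isfun_over_ret
  have u: "ucocone (over_cat ?v ?d) (FO (dfun D (over_proj ?v ?d)) X) (FO (dfun D (point (Tgt u \<otimes> C) ?d)) (FO (lan D ?v) X))
      (Comp (dcat D (over_cat ?v ?d)) (NT (dnt D (over_cell ?v ?d)) (FO (lan D ?v) X)) (FA (dfun D (over_proj ?v ?d)) (NT (lan_unit D ?v) X)))"
    using ucocone_Der4[of ?v ?d X] by simp
  have "ucocone (Src (over_ret u b C c)) (FO (dfun D (over_proj ?v ?d)) X) (FO (dfun D (point (Tgt u \<otimes> C) ?d)) (FO (lan D ?v) X))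
      (Comp (dcat D (over_cat ?v ?d)) (NT (dnt D (over_cell ?v ?d)) (FO (lan D ?v) X)) (FA (dfun D (over_proj ?v ?d)) (NT (lan_unit D ?v) X)))"
    using u by simp
  from ucocone_reflection[OF over_reflection this] show ?thesis
    by (simp add: slice_proj_def slice_cell_def)
qed

lemma Der2_iso:
  assumes "A \<in> Cat" "f \<in> Arr (dcat D A)" "\<And>a. a \<in> Obj A \<Longrightarrow> iso_arr (dcat D one_cat) (FA (dfun D (point A a)) f)"
  shows "iso_arr (dcat D A) f"
  using Der2[OF assms(1,2)] assms(3) by blast

lemma iso_arr_dfun: "isfun u \<Longrightarrow> Src u = A \<Longrightarrow> iso_arr (dcat D (Tgt u)) f \<Longrightarrow> iso_arr (dcat D A) (FA (dfun D u) f)"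
  using iso_arr_FA[of "dfun D u" f] by simp

lemma lan_mate_product_square:
  "isfun u \<Longrightarrow> isfun w \<Longrightarrow> fun_square (u \<otimes>\<^sub>f fid (Tgt w)) (u \<otimes>\<^sub>f fid (Src w)) (fid (Src u) \<otimes>\<^sub>f w) (fid (Tgt u) \<otimes>\<^sub>f w)"
  by (simp add: fun_square_def)

lemma lan_mate_product_char:
  assumes [simp]: "isfun u" "isfun w" "X \<in> Obj (dcat D (Src u \<otimes> Tgt w))"
  shows "Comp (dcat D (Src u \<otimes> Src w)) (FA (dfun D (u \<otimes>\<^sub>f fid (Src w))) (NT (lan_mate D (u \<otimes>\<^sub>f fid (Tgt w)) (u \<otimes>\<^sub>f fid (Src w))
      (fid (Src u) \<otimes>\<^sub>f w) (fid (Tgt u) \<otimes>\<^sub>f w) (nid (u \<otimes>\<^sub>f w))) X))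
      (NT (lan_unit D (u \<otimes>\<^sub>f fid (Src w))) (FO (dfun D (fid (Src u) \<otimes>\<^sub>f w)) X)) =
    FA (dfun D (fid (Src u) \<otimes>\<^sub>f w)) (NT (lan_unit D (u \<otimes>\<^sub>f fid (Tgt w))) X)"
  using lan_mate_char[OF lan_mate_product_square, of u w "nid (u \<otimes>\<^sub>f w)" X] by simp

lemma lan_mate_product_hom:
  assumes [simp]: "isfun u" "isfun w" "X \<in> Obj (dcat D (Src u \<otimes> Tgt w))"
  shows "NT (lan_mate D (u \<otimes>\<^sub>f fid (Tgt w)) (u \<otimes>\<^sub>f fid (Src w)) (fid (Src u) \<otimes>\<^sub>f w) (fid (Tgt u) \<otimes>\<^sub>f w) (nid (u \<otimes>\<^sub>f w))) X
    \<in> hom (dcat D (Tgt u \<otimes> Src w)) (FO (lan D (u \<otimes>\<^sub>f fid (Src w))) (FO (dfun D (fid (Src u) \<otimes>\<^sub>f w)) X))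
       (FO (dfun D (fid (Tgt u) \<otimes>\<^sub>f w)) (FO (lan D (u \<otimes>\<^sub>f fid (Tgt w))) X))"
proof -
  note ms = lan_mate_simps(1-3)[OF lan_mate_product_square, of u w "nid (u \<otimes>\<^sub>f w)", simplified]
  show ?thesis using NT_simps[OF ms(1), of "dcat D (Tgt u \<otimes> Src w)" X] ms(2,3) by simp
qed

text \<open>By Der2 it is enough to look at a point (b, c). There both ends are colimits over u/b of
  one and the same diagram, and the mate carries one universal cocone to the other.\<close>

lemma lan_mate_product_iso:
  assumes [simp]: "isfun u" "isfun w" "X \<in> Obj (dcat D (Src u \<otimes> Tgt w))"
  shows "iso_arr (dcat D (Tgt u \<otimes> Src w)) (NT (lan_mate D (u \<otimes>\<^sub>f fid (Tgt w)) (u \<otimes>\<^sub>f fid (Src w))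
      (fid (Src u) \<otimes>\<^sub>f w) (fid (Tgt u) \<otimes>\<^sub>f w) (nid (u \<otimes>\<^sub>f w))) X)"
proof -
  define m where "m = NT (lan_mate D (u \<otimes>\<^sub>f fid (Tgt w)) (u \<otimes>\<^sub>f fid (Src w)) (fid (Src u) \<otimes>\<^sub>f w) (fid (Tgt u) \<otimes>\<^sub>f w) (nid (u \<otimes>\<^sub>f w))) X"
  define v v' where "v = u \<otimes>\<^sub>f fid (Src w)" and "v' = u \<otimes>\<^sub>f fid (Tgt w)"
  define p q where "p = fid (Src u) \<otimes>\<^sub>f w" and "q = fid (Tgt u) \<otimes>\<^sub>f w"
  have [simp]: "isfun v" "isfun v'" "isfun p" "isfun q" "Src v = Src u \<otimes> Src w" "Tgt v = Tgt u \<otimes> Src w"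
    "Src v' = Src u \<otimes> Tgt w" "Tgt v' = Tgt u \<otimes> Tgt w" "Src p = Src u \<otimes> Src w" "Tgt p = Src u \<otimes> Tgt w"
    "Src q = Tgt u \<otimes> Src w" "Tgt q = Tgt u \<otimes> Tgt w"
    by (simp_all add: v_def v'_def p_def q_def)
  let ?Z = "FO (lan D v') X"
  have [simp]: "m \<in> Arr (dcat D (Tgt u \<otimes> Src w))" "Dom (dcat D (Tgt u \<otimes> Src w)) m = FO (lan D v) (FO (dfun D p) X)"
     "Cod (dcat D (Tgt u \<otimes> Src w)) m = FO (dfun D q) ?Z"
    using lan_mate_product_hom[of u w X] by (simp_all add: m_def v_def v'_def p_def q_def)
  have mc: "Comp (dcat D (Src u \<otimes> Src w)) (FA (dfun D v) m) (NT (lan_unit D v) (FO (dfun D p) X)) = FA (dfun D p) (NT (lan_unit D v') X)"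
    unfolding m_def v_def v'_def p_def q_def by (rule lan_mate_product_char) simp_all
  have "iso_arr (dcat D (Tgt u \<otimes> Src w)) m"
  proof (rule Der2_iso)
    fix bc assume "bc \<in> Obj (Tgt u \<otimes> Src w)"
    then obtain b c where bc: "bc = Tup [b, c]" and [simp]: "b \<in> Obj (Tgt u)" "c \<in> Obj (Src w)" by (rule Obj_prodE)
    define K where "K = over_cat u b"
    define s where "s = slice_proj u b (Src w) c"
    define \<theta> where "\<theta> = slice_cell u b (Src w) c"
    define P where "P = point (Tgt u \<otimes> Src w) (Tup [b, c])"
    have [simp]: "K \<in> Cat" "isfun s" "Src s = K" "Tgt s = Src u \<otimes> Src w" "isnt \<theta>" "NSrc \<theta> = v \<odot> s" "NTgt \<theta> = P \<odot> bang K"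
      "isfun P" "Src P = one_cat" "Tgt P = Tgt u \<otimes> Src w"
      by (simp_all add: K_def s_def \<theta>_def P_def v_def)
    have s': "slice_proj u b (Tgt w) (FO w c) = p \<odot> s" by (simp add: slice_proj_natural s_def p_def)
    have \<theta>': "slice_cell u b (Tgt w) (FO w c) = q \<rhd> \<theta>" by (simp add: slice_cell_natural \<theta>_def q_def)
    have P': "point (Tgt u \<otimes> Tgt w) (Tup [b, FO w c]) = q \<odot> P" by (simp add: P_def q_def)
    have c1: "ucocone K (FO (dfun D (p \<odot> s)) X) (FO (dfun D P) (FO (lan D v) (FO (dfun D p) X)))
      (Comp (dcat D K) (NT (dnt D \<theta>) (FO (lan D v) (FO (dfun D p) X))) (FA (dfun D s) (NT (lan_unit D v) (FO (dfun D p) X))))"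
      using ucocone_slice[of u "Src w" b c "FO (dfun D p) X"] by (simp add: K_def s_def \<theta>_def P_def v_def)
    have c2: "ucocone K (FO (dfun D (p \<odot> s)) X) (FO (dfun D (q \<odot> P)) ?Z)
      (Comp (dcat D K) (NT (dnt D (q \<rhd> \<theta>)) ?Z) (FA (dfun D (p \<odot> s)) (NT (lan_unit D v') X)))"
      using ucocone_slice[of u "Tgt w" b "FO w c" X] by (simp add: s' \<theta>' P') (simp add: K_def v'_def)
    \<comment> \<open>Naturality of the slice 2-cell with respect to m moves m past this 2-cell,
      towards the unit, where \<open>mc\<close> applies.\<close>
    have nat: "Comp (dcat D K) (NT (dnt D \<theta>) (FO (dfun D q) ?Z)) (FA (dfun D (v \<odot> s)) m) =
        Comp (dcat D K) (FA (dfun D (P \<odot> bang K)) m) (NT (dnt D \<theta>) (FO (lan D v) (FO (dfun D p) X)))"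
      using NT_dnt_natural[of \<theta> m K "FO (lan D v) (FO (dfun D p) X)" "FO (dfun D q) ?Z"] by simp
    have sm: "Comp (dcat D K) (FA (dfun D (v \<odot> s)) m) (FA (dfun D s) (NT (lan_unit D v) (FO (dfun D p) X))) =
        FA (dfun D (p \<odot> s)) (NT (lan_unit D v') X)"
    proof -
      have "FA (dfun D s) (Comp (dcat D (Src u \<otimes> Src w)) (FA (dfun D v) m) (NT (lan_unit D v) (FO (dfun D p) X))) =
        FA (dfun D s) (FA (dfun D p) (NT (lan_unit D v') X))" by (simp only: mc)
      thus ?thesis by simp
    qed
    show "iso_arr (dcat D one_cat) (FA (dfun D (point (Tgt u \<otimes> Src w) bc)) m)"
      unfolding bc P_def[symmetric]
    proof (rule ucocone_iso[OF c1 c2])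
      show "FA (dfun D P) m \<in> hom (dcat D one_cat) (FO (dfun D P) (FO (lan D v) (FO (dfun D p) X))) (FO (dfun D (q \<odot> P)) ?Z)"
        by simp
      have "Comp (dcat D K) (FA (dfun D (P \<odot> bang K)) m) (Comp (dcat D K) (NT (dnt D \<theta>) (FO (lan D v) (FO (dfun D p) X))) (FA (dfun D s) (NT (lan_unit D v) (FO (dfun D p) X))))
         = Comp (dcat D K) (NT (dnt D \<theta>) (FO (dfun D q) ?Z)) (Comp (dcat D K) (FA (dfun D (v \<odot> s)) m) (FA (dfun D s) (NT (lan_unit D v) (FO (dfun D p) X))))"
        by (rule Comp_eq_extend[OF _ nat[symmetric]]) simp_all
      thus "Comp (dcat D K) (FA (dfun D (bang K)) (FA (dfun D P) m)) (Comp (dcat D K) (NT (dnt D \<theta>) (FO (lan D v) (FO (dfun D p) X))) (FA (dfun D s) (NT (lan_unit D v) (FO (dfun D p) X)))) =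
         Comp (dcat D K) (NT (dnt D (q \<rhd> \<theta>)) ?Z) (FA (dfun D (p \<odot> s)) (NT (lan_unit D v') X))"
        by (simp add: sm)
    qed
  qed simp_all
  thus ?thesis by (simp add: m_def)
qed

end

subsection \<open>Fully faithful functors\<close>

definition fully_faithful :: "'u sfun \<Rightarrow> bool" where
  "fully_faithful u \<longleftrightarrow> (\<forall>a\<in>Obj (Src u). \<forall>a'\<in>Obj (Src u). \<forall>g\<in>hom (Tgt u) (FO u a) (FO u a').
     \<exists>!h. h \<in> hom (Src u) a a' \<and> FA u h = g)"

lemma fully_faithful_prod:
  assumes u: "isfun u" "fully_faithful u" and C: "C \<in> Cat"
  shows "fully_faithful (u \<otimes>\<^sub>f fid C)"
  unfolding fully_faithful_def
proof (intro ballI)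
  fix x x' g assume x: "x \<in> Obj (Src (u \<otimes>\<^sub>f fid C))" "x' \<in> Obj (Src (u \<otimes>\<^sub>f fid C))"
    and g: "g \<in> hom (Tgt (u \<otimes>\<^sub>f fid C)) (FO (u \<otimes>\<^sub>f fid C) x) (FO (u \<otimes>\<^sub>f fid C) x')"
  obtain a c where xx: "x = Tup [a, c]" "a \<in> Obj (Src u)" "c \<in> Obj C" using x(1) by (auto elim: Obj_prodE)
  obtain a' c' where xx': "x' = Tup [a', c']" "a' \<in> Obj (Src u)" "c' \<in> Obj C" using x(2) by (auto elim: Obj_prodE)
  from g obtain g1 g2 where gg: "g = Tup [g1, g2]" "g1 \<in> Arr (Tgt u)" "g2 \<in> Arr C" by (auto elim: Arr_prodE)
  have g': "g1 \<in> hom (Tgt u) (FO u a) (FO u a')" "g2 \<in> hom C c c'" using g gg xx xx' u C by simp_all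
  then obtain h where h: "h \<in> hom (Src u) a a'" "FA u h = g1" and hu: "\<And>h'. h' \<in> hom (Src u) a a' \<Longrightarrow> FA u h' = g1 \<Longrightarrow> h' = h"
    using u(2) xx xx' unfolding fully_faithful_def by blast
  show "\<exists>!h. h \<in> hom (Src (u \<otimes>\<^sub>f fid C)) x x' \<and> FA (u \<otimes>\<^sub>f fid C) h = g"
  proof (rule ex1I[of _ "Tup [h, g2]"])
    show "Tup [h, g2] \<in> hom (Src (u \<otimes>\<^sub>f fid C)) x x' \<and> FA (u \<otimes>\<^sub>f fid C) (Tup [h, g2]) = g"
      using h g' gg xx xx' by simp
    fix k assume k: "k \<in> hom (Src (u \<otimes>\<^sub>f fid C)) x x' \<and> FA (u \<otimes>\<^sub>f fid C) k = g"
    obtain k1 k2 where kk: "k = Tup [k1, k2]" "k1 \<in> Arr (Src u)" "k2 \<in> Arr C" using k by (auto elim: Arr_prodE)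
    thus "k = Tup [h, g2]" using k hu[of k1] gg xx xx' by simp
  qed
qed

text \<open>An object of the slice over u a is an arrow u a' -> u a; its unique lift to an arrow a'
  -> a is the only map to the identity of u a.\<close>

lemma over_cat_terminal:
  assumes u: "isfun u" "fully_faithful u" and a: "a \<in> Obj (Src u)" and x: "x \<in> Obj (over_cat u (FO u a))"
  shows "\<exists>!f. f \<in> hom (over_cat u (FO u a)) x (Tup [a, Ident (Tgt u) (FO u a)])"
proof -
  obtain a' g where xx: "x = Tup [a', g]" "a' \<in> Obj (Src u)" "g \<in> Arr (Tgt u)" "Dom (Tgt u) g = FO u a'" "Cod (Tgt u) g = FO u a"
    using x by (rule over_cat_ObjE)
  have "g \<in> hom (Tgt u) (FO u a') (FO u a)" using xx by simp
  then obtain h where h: "h \<in> hom (Src u) a' a" "FA u h = g" and hu: "\<And>h'. h' \<in> hom (Src u) a' a \<Longrightarrow> FA u h' = g \<Longrightarrow> h' = h"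
    using u(2) xx(2) a unfolding fully_faithful_def by blast
  let ?t = "Tup [a, Ident (Tgt u) (FO u a)]"
  show ?thesis
  proof (rule ex1I[of _ "Tup [x, h, ?t]"])
    have "Tup [x, h, ?t] \<in> Arr (over_cat u (FO u a))" using h xx a u by simp
    thus "Tup [x, h, ?t] \<in> hom (over_cat u (FO u a)) x ?t" by (simp del: over_cat_Arr_iff)
    fix k assume k: "k \<in> hom (over_cat u (FO u a)) x ?t"
    hence k1: "k \<in> Arr (over_cat u (FO u a))" by simp
    then obtain b f i b' f' where kk: "k = Tup [Tup [b, f], i, Tup [b', f']]" "b \<in> Obj (Src u)"
      "f \<in> Arr (Tgt u)" "Dom (Tgt u) f = FO u b" "Cod (Tgt u) f = FO u a" "b' \<in> Obj (Src u)"
      "f' \<in> Arr (Tgt u)" "Dom (Tgt u) f' = FO u b'" "Cod (Tgt u) f' = FO u a"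
      "i \<in> Arr (Src u)" "Dom (Src u) i = b" "Cod (Src u) i = b'" "Comp (Tgt u) f' (FA u i) = f"
      by (rule over_cat_ArrE)
    have "pr 0 k = x" "pr 2 k = ?t" using k over_cat_simps(1,2)[OF k1] by auto
    hence e: "Tup [b, f] = x" "Tup [b', f'] = ?t" by (simp_all add: kk(1))
    have "FA u i = g" using e kk xx u a by simp
    hence "i = h" using hu[of i] e kk xx by simp
    thus "k = Tup [x, h, ?t]" using e kk(1) by simp
  qed
qed

lemma adjunction_ex1_iff:
  assumes adj: "adjunction L R \<eta> \<epsilon>" and X: "X \<in> Obj (Src L)" and Z: "Z \<in> Obj (Tgt L)"
  shows "(\<exists>!h. h \<in> hom (Src L) X (FO R Z)) \<longleftrightarrow> (\<exists>!k. k \<in> hom (Tgt L) (FO L X) Z)"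
proof -
  note [simp] = adjunction_simps[OF adj] X Z
  let ?up = "\<lambda>k. Comp (Src L) (FA R k) (NT \<eta> X)" and ?dn = "\<lambda>h. Comp (Tgt L) (NT \<epsilon> Z) (FA L h)"
  have 1: "?up k \<in> hom (Src L) X (FO R Z)" if "k \<in> hom (Tgt L) (FO L X) Z" for k using that by simp
  have 2: "?dn h \<in> hom (Tgt L) (FO L X) Z" if "h \<in> hom (Src L) X (FO R Z)" for h using that by simp
  note 3 = adjunction_transpose[OF adj X Z]
  show ?thesis
  proof
    assume "\<exists>!h. h \<in> hom (Src L) X (FO R Z)"
    then obtain h where h: "h \<in> hom (Src L) X (FO R Z)" and hu: "\<And>h'. h' \<in> hom (Src L) X (FO R Z) \<Longrightarrow> h' = h" by blast
    show "\<exists>!k. k \<in> hom (Tgt L) (FO L X) Z"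
    proof (rule ex1I[of _ "?dn h"])
      fix k assume k: "k \<in> hom (Tgt L) (FO L X) Z"
      show "k = ?dn h" using 3(2)[OF k] hu[OF 1[OF k]] by (simp only:)
    qed (rule 2[OF h])
  next
    assume "\<exists>!k. k \<in> hom (Tgt L) (FO L X) Z"
    then obtain k where k: "k \<in> hom (Tgt L) (FO L X) Z" and ku: "\<And>k'. k' \<in> hom (Tgt L) (FO L X) Z \<Longrightarrow> k' = k" by blast
    show "\<exists>!h. h \<in> hom (Src L) X (FO R Z)"
    proof (rule ex1I[of _ "?up k"])
      fix h assume h: "h \<in> hom (Src L) X (FO R Z)"
      show "h = ?up k" using 3(1)[OF h] ku[OF 2[OF h]] by (simp only:)
    qed (rule 1[OF k])
  qed
qed

lemma initial_adjunction:
  assumes adj: "adjunction L R \<eta> \<epsilon>" and X: "initial_object (Src L) X"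
  shows "initial_object (Tgt L) (FO L X)"
  unfolding initial_object_def
proof (intro conjI ballI)
  note [simp] = adjunction_simps[OF adj]
  have X': "X \<in> Obj (Src L)" using X unfolding initial_object_def by blast
  thus "FO L X \<in> Obj (Tgt L)" by simp
  fix Z assume Z: "Z \<in> Obj (Tgt L)"
  hence "FO R Z \<in> Obj (Src L)" by simp
  hence "\<exists>!h. h \<in> hom (Src L) X (FO R Z)" using X unfolding initial_object_def by blast
  thus "\<exists>!k. k \<in> hom (Tgt L) (FO L X) Z" using adjunction_ex1_iff[OF adj X' Z] by blast
qed

lemma terminal_adjunction:
  assumes adj: "adjunction L R \<eta> \<epsilon>" and Z: "terminal_object (Tgt L) Z"
  shows "terminal_object (Src L) (FO R Z)"
  unfolding terminal_object_def
proof (intro conjI ballI)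
  note [simp] = adjunction_simps[OF adj]
  have Z': "Z \<in> Obj (Tgt L)" using Z unfolding terminal_object_def by blast
  thus "FO R Z \<in> Obj (Src L)" by simp
  fix X assume X: "X \<in> Obj (Src L)"
  hence "FO L X \<in> Obj (Tgt L)" by simp
  hence "\<exists>!k. k \<in> hom (Tgt L) (FO L X) Z" using Z unfolding terminal_object_def by blast
  thus "\<exists>!h. h \<in> hom (Src L) X (FO R Z)" using adjunction_ex1_iff[OF adj X Z'] by blast
qed

section \<open>Kan extensions along fully faithful functors\<close>

context derivator
begin

text \<open>The slice over u a has the terminal object (a, id), so the colimit computing u_!X at u a
  is the value of X at a, and the universal cocone restricted to that object is the unit at
  a.\<close>

lemma lan_unit_iso:
  assumes u [simp]: "isfun u" and ff: "fully_faithful u" and X [simp]: "X \<in> Obj (dcat D (Src u))"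
  shows "iso_arr (dcat D (Src u)) (NT (lan_unit D u) X)"
proof (rule Der2_iso)
  fix a assume a [simp]: "a \<in> Obj (Src u)"
  define K where "K = over_cat u (FO u a)"
  define t where "t = Tup [a, Ident (Tgt u) (FO u a)]"
  have [simp]: "K \<in> Cat" "t \<in> Obj K" by (simp_all add: K_def t_def)
  obtain \<upsilon> where r: "reflection (bang K) (point K t) \<upsilon>"
    using reflection_terminal[of K t] over_cat_terminal[OF u ff a, folded K_def t_def] \<open>K \<in> Cat\<close> \<open>t \<in> Obj K\<close> by blast
  have 1: "over_proj u (FO u a) \<odot> point K t = point (Src u) a" by (simp add: K_def t_def)
  have 2: "over_cell u (FO u a) \<lhd> point K t = nid (point (Tgt u) (FO u a))"
    by (rule ntr_eqI) (simp_all add: K_def t_def fcomp_assoc)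
  have "ucocone (Src (bang K)) (FO (dfun D (over_proj u (FO u a))) X) (FO (dfun D (point (Tgt u) (FO u a))) (FO (lan D u) X))
    (Comp (dcat D K) (NT (dnt D (over_cell u (FO u a))) (FO (lan D u) X)) (FA (dfun D (over_proj u (FO u a))) (NT (lan_unit D u) X)))"
    using ucocone_Der4[of u "FO u a" X] by (simp add: K_def)
  from ucocone_reflection[OF r this]
  have "ucocone one_cat (FO (dfun D (point (Src u) a)) X) (FO (dfun D (point (Tgt u) (FO u a))) (FO (lan D u) X))
    (FA (dfun D (point (Src u) a)) (NT (lan_unit D u) X))"
    using 1 2 by (simp add: K_def[symmetric])
  thus "iso_arr (dcat D one_cat) (FA (dfun D (point (Src u) a)) (NT (lan_unit D u) X))" by (rule ucocone_one)
qed simp_all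

text \<open>In an adjoint triple u_!, u^*, u_* the left adjoint is fully faithful if and only if the
  right one is. The statement is thus deduced formally from \<open>lan_unit_iso\<close>.\<close>

lemma ran_counit_iso:
  assumes u [simp]: "isfun u" and ff: "fully_faithful u" and X [simp]: "X \<in> Obj (dcat D (Src u))"
  shows "iso_arr (dcat D (Src u)) (NT (ran_counit D u) X)"
proof -
  let ?A = "dcat D (Src u)" and ?e = "NT (ran_counit D u) X" and ?Y = "FO (ran D u) X"
  note iso = lan_unit_iso[OF u ff]
  \<comment> \<open>The counit is monic on maps into u^*u_*X: such a map from W is u^* of its
    transpose along u_!, preceded by the unit at W, and this unit may be cancelled because it is
    invertible.\<close>
  have mono: "f = f'" if f: "f \<in> hom ?A W (FO (dfun D u) ?Y)" "f' \<in> hom ?A W (FO (dfun D u) ?Y)" and W: "W \<in> Obj ?A"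
    and e: "Comp ?A ?e f = Comp ?A ?e f'" for f f' W
  proof -
    let ?c = "\<lambda>f. Comp (dcat D (Tgt u)) (NT (lan_counit D u) ?Y) (FA (lan D u) f)"
    let ?n = "NT (lan_unit D u) W"
    have c: "?c f \<in> hom (dcat D (Tgt u)) (FO (lan D u) W) ?Y" "?c f' \<in> hom (dcat D (Tgt u)) (FO (lan D u) W) ?Y"
      using f W by simp_all
    have t: "Comp ?A (FA (dfun D u) (?c f)) ?n = f" "Comp ?A (FA (dfun D u) (?c f')) ?n = f'"
      using adjunction_transpose(1)[OF lan_adjunction[OF u], of W ?Y] f W by simp_all
    have "Comp ?A (Comp ?A ?e (FA (dfun D u) (?c f))) ?n = Comp ?A ?e (Comp ?A (FA (dfun D u) (?c f)) ?n)"
      by (rule Comp_assoc') (use c f W in simp_all)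
    moreover have "Comp ?A (Comp ?A ?e (FA (dfun D u) (?c f'))) ?n = Comp ?A ?e (Comp ?A (FA (dfun D u) (?c f')) ?n)"
      by (rule Comp_assoc') (use c f W in simp_all)
    ultimately have "Comp ?A (Comp ?A ?e (FA (dfun D u) (?c f))) ?n = Comp ?A (Comp ?A ?e (FA (dfun D u) (?c f'))) ?n"
      unfolding t using e by simp
    hence "Comp ?A ?e (FA (dfun D u) (?c f)) = Comp ?A ?e (FA (dfun D u) (?c f'))"
      by (rule iso_arr_epi[OF _ iso[OF W], rotated]) (use c f W in simp_all)
    hence "?c f = ?c f'"
      by - (rule adjunction_eq_right[OF ran_adjunction[OF u], of "FO (lan D u) W" X], use c W in simp_all)
    thus "f = f'" using t by metis
  qed
  define n where "n = NT (lan_unit D u) X"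
  \<comment> \<open>\<open>t\<close> is the transpose along u_* of the inverse unit at X. Hence g,
    the unit followed by u^*t, is a section of the counit, and monicity makes it a two-sided
    inverse.\<close>
  define t where "t = Comp (dcat D (Tgt u)) (FA (ran D u) (inv_arr ?A n)) (NT (ran_unit D u) (FO (lan D u) X))"
  have n: "iso_arr ?A n" "n \<in> Arr ?A" "Dom ?A n = X" "Cod ?A n = FO (dfun D u) (FO (lan D u) X)" using iso[OF X] by (simp_all add: n_def)
  have t: "t \<in> hom (dcat D (Tgt u)) (FO (lan D u) X) ?Y" using n by (simp add: t_def)
  have et: "Comp ?A ?e (FA (dfun D u) t) = inv_arr ?A n"
    unfolding t_def using adjunction_transpose(2)[OF ran_adjunction[OF u], of "FO (lan D u) X" X "inv_arr ?A n"] n by simp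
  define g where "g = Comp ?A (FA (dfun D u) t) n"
  have g: "g \<in> hom ?A X (FO (dfun D u) ?Y)" using t n by (simp add: g_def)
  have "Comp ?A ?e g = Comp ?A (inv_arr ?A n) n" unfolding g_def
    by (rule Comp_eq_extend1) (use et t n in simp_all)
  hence eg: "Comp ?A ?e g = Ident ?A X" using n by simp
  have "Comp ?A ?e (Comp ?A g ?e) = Comp ?A (Ident ?A X) ?e"
    by (rule Comp_eq_extend1) (use eg g in simp_all)
  hence "Comp ?A g ?e = Ident ?A (FO (dfun D u) ?Y)"
    by - (rule mono[of _ "FO (dfun D u) ?Y"], use g in simp_all)
  thus ?thesis using eg g by (intro iso_arrI[of ?e _ g]) simp_all
qed

text \<open>By a triangle identity this arrow is a section of the counit at u^*Y, which is
  invertible.\<close>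

lemma ran_unit_dfun_iso:
  assumes u [simp]: "isfun u" and ff: "fully_faithful u" and Y [simp]: "Y \<in> Obj (dcat D (Tgt u))"
  shows "iso_arr (dcat D (Src u)) (FA (dfun D u) (NT (ran_unit D u) Y))"
proof -
  let ?A = "dcat D (Src u)"
  have "Comp ?A (NT (ran_counit D u) (FO (dfun D u) Y)) (FA (dfun D u) (NT (ran_unit D u) Y)) = Ident ?A (FO (dfun D u) Y)"
    using adjunction_triangles(1)[OF ran_adjunction[OF u], of Y] by simp
  thus ?thesis
    by - (rule iso_arr_cancel_left[OF _ ran_counit_iso[OF u ff, of "FO (dfun D u) Y"]], simp_all add: iso_arr_Ident)
qed

text \<open>Having adjoints on both sides, u^* preserves initial and terminal objects.\<close>

lemma dfun_zero_object:
  assumes u: "isfun u" "Src u = A" and X: "zero_object (dcat D (Tgt u)) X"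
  shows "zero_object (dcat D A) (FO (dfun D u) X)"
  using initial_adjunction[OF ran_adjunction[OF u(1)], of X] terminal_adjunction[OF lan_adjunction[OF u(1)], of X] u X
  by (simp add: zero_object_iff)

end

section \<open>Pointed derivators: vanishing at a point and extension by zero along sieves\<close>

locale pointed_derivator = derivator D for D :: "('u, 'o, 'm) prederiv" +
  assumes pointed: "pointed D"
begin

definition vanish :: "'u scat \<Rightarrow> 'u el \<Rightarrow> 'o \<Rightarrow> bool" where
  "vanish A a X \<longleftrightarrow> zero_object (dcat D one_cat) (FO (dfun D (point A a)) X)"

lemma vanish_dfun [simp]:
  "isfun u \<Longrightarrow> Src u = A \<Longrightarrow> a \<in> Obj A \<Longrightarrow> X \<in> Obj (dcat D (Tgt u)) \<Longrightarrow> vanish A a (FO (dfun D u) X) \<longleftrightarrow> vanish (Tgt u) (FO u a) X"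
  by (auto simp: vanish_def)

lemma vanish_iso:
  assumes "A \<in> Cat" "a \<in> Obj A" "iso_arr (dcat D one_cat) (FA (dfun D (point A a)) f)" "f \<in> hom (dcat D A) X Y"
  shows "vanish A a X \<longleftrightarrow> vanish A a Y"
  using zero_object_iso_iff[OF _ assms(3)] assms by (simp add: vanish_def)

lemma vanish_iso_arr:
  assumes "A \<in> Cat" "a \<in> Obj A" "vanish A a X" "vanish A a Y" "f \<in> hom (dcat D A) X Y"
  shows "iso_arr (dcat D one_cat) (FA (dfun D (point A a)) f)"
  by (rule zero_arr_iso) (use assms in \<open>auto simp: vanish_def\<close>)

text \<open>For the converse, the zero object is pulled back from the terminal category to
  \<open>A\<close>; the map from it to \<open>X\<close> joins zero objects at each point, so Der2
  makes it invertible.\<close>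

lemma zero_object_iff_vanish:
  assumes A [simp]: "A \<in> Cat" and X [simp]: "X \<in> Obj (dcat D A)"
  shows "zero_object (dcat D A) X \<longleftrightarrow> (\<forall>a\<in>Obj A. vanish A a X)"
proof
  assume "zero_object (dcat D A) X"
  thus "\<forall>a\<in>Obj A. vanish A a X"
    by (auto simp: vanish_def intro!: dfun_zero_object)
next
  assume v: "\<forall>a\<in>Obj A. vanish A a X"
  obtain z where z: "zero_object (dcat D one_cat) z" using pointed by (auto simp: pointed_def)
  define Z where "Z = FO (dfun D (bang A)) z"
  have Z: "zero_object (dcat D A) Z" unfolding Z_def by (rule dfun_zero_object) (use z in simp_all)
  have vZ: "vanish A a Z" if "a \<in> Obj A" for a using that Z by (auto simp: vanish_def intro!: dfun_zero_object)
  obtain f where f: "f \<in> hom (dcat D A) Z X" using Z X unfolding zero_object_def by blast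
  have "iso_arr (dcat D A) f"
    by (rule Der2_iso) (use f v vZ in \<open>auto intro!: vanish_iso_arr[of _ _ Z X]\<close>)
  thus "zero_object (dcat D A) X" using zero_object_iso_iff[of "dcat D A" f] Z f by simp
qed

lemma lan_vanish:
  assumes "isfun u" "b \<in> Obj (Tgt u)" "X \<in> Obj (dcat D (Src u))" "\<And>a. a \<in> Obj (Src u) \<Longrightarrow> hom (Tgt u) (FO u a) b = {}"
  shows "vanish (Tgt u) b (FO (lan D u) X)"
proof -
  obtain z where z: "zero_object (dcat D one_cat) z" using pointed by (auto simp: pointed_def)
  have "x \<notin> Obj (over_cat u b)" for x
  proof
    assume "x \<in> Obj (over_cat u b)"
    then obtain a f where "a \<in> Obj (Src u)" "f \<in> hom (Tgt u) (FO u a) b" by (auto elim: over_cat_ObjE)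
    thus False using assms(4) by blast
  qed
  hence "Obj (over_cat u b) = {}" by blast
  from lan_empty_initial[OF assms(1-3) this] show ?thesis
    unfolding vanish_def by - (rule initial_is_zero[OF _ z], simp_all)
qed

text \<open>Maps from Z to the value of u_*X at \<open>b\<close> correspond to maps from u^*b_!Z to
  X. The object u^*b_!Z is zero, since no arrow leads from \<open>b\<close> into the image of
  \<open>u\<close>; so the value is terminal.\<close>

lemma ran_vanish:
  assumes u [simp]: "isfun u" and b [simp]: "b \<in> Obj (Tgt u)" and X [simp]: "X \<in> Obj (dcat D (Src u))"
    and e: "\<And>a. a \<in> Obj (Src u) \<Longrightarrow> hom (Tgt u) b (FO u a) = {}"
  shows "vanish (Tgt u) b (FO (ran D u) X)"
proof -
  obtain z where z: "zero_object (dcat D one_cat) z" using pointed by (auto simp: pointed_def)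
  let ?p = "point (Tgt u) b"
  have "terminal_object (dcat D one_cat) (FO (dfun D ?p) (FO (ran D u) X))" unfolding terminal_object_def
  proof (intro conjI ballI)
    fix Z assume Z [simp]: "Z \<in> Obj (dcat D one_cat)"
    let ?W = "FO (dfun D u) (FO (lan D ?p) Z)"
    have "zero_object (dcat D (Src u)) ?W"
    proof (subst zero_object_iff_vanish)
      show "\<forall>a\<in>Obj (Src u). vanish (Src u) a ?W"
        using e by (auto intro!: lan_vanish[of ?p, simplified])
    qed simp_all
    hence "\<exists>!k. k \<in> hom (dcat D (Src u)) ?W X" unfolding zero_object_def using X by blast
    hence "\<exists>!k. k \<in> hom (dcat D (Tgt u)) (FO (lan D ?p) Z) (FO (ran D u) X)"
      using adjunction_ex1_iff[OF ran_adjunction[OF u], of "FO (lan D ?p) Z" X] by simp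
    thus "\<exists>!k. k \<in> hom (dcat D one_cat) Z (FO (dfun D ?p) (FO (ran D u) X))"
      using adjunction_ex1_iff[OF lan_adjunction[of ?p], of Z "FO (ran D u) X"] by simp
  qed simp
  thus ?thesis unfolding vanish_def by - (rule terminal_is_zero[OF _ z], simp_all)
qed

text \<open>In a pointed derivator u_* along such a functor is extension by zero:
  \<open>sieve_ran_vanish\<close> and \<open>ran_counit_iso\<close> give its values off and on the
  image.\<close>

definition sieve :: "'u sfun \<Rightarrow> bool" where
  "sieve u \<longleftrightarrow> isfun u \<and> fully_faithful u \<and>
    (\<forall>b\<in>Obj (Tgt u). b \<in> FO u ` Obj (Src u) \<or> (\<forall>a\<in>Obj (Src u). hom (Tgt u) b (FO u a) = {}))"

lemma sieve_prod:
  assumes "sieve u" "C \<in> Cat" shows "sieve (u \<otimes>\<^sub>f fid C)"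
  unfolding sieve_def
proof (intro conjI ballI)
  have u: "isfun u" "fully_faithful u" using assms by (auto simp: sieve_def)
  show "isfun (u \<otimes>\<^sub>f fid C)" "fully_faithful (u \<otimes>\<^sub>f fid C)" using u assms fully_faithful_prod by auto
  fix x assume "x \<in> Obj (Tgt (u \<otimes>\<^sub>f fid C))"
  then obtain b c where x: "x = Tup [b, c]" "b \<in> Obj (Tgt u)" "c \<in> Obj C" by (auto elim: Obj_prodE)
  consider a where "a \<in> Obj (Src u)" "b = FO u a" | "\<forall>a\<in>Obj (Src u). hom (Tgt u) b (FO u a) = {}"
    using assms(1) x(2) unfolding sieve_def by blast
  thus "x \<in> FO (u \<otimes>\<^sub>f fid C) ` Obj (Src (u \<otimes>\<^sub>f fid C)) \<or>
    (\<forall>a\<in>Obj (Src (u \<otimes>\<^sub>f fid C)). hom (Tgt (u \<otimes>\<^sub>f fid C)) x (FO (u \<otimes>\<^sub>f fid C) a) = {})"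
  proof cases
    case 1
    hence "x = FO (u \<otimes>\<^sub>f fid C) (Tup [a, c])" "Tup [a, c] \<in> Obj (Src (u \<otimes>\<^sub>f fid C))" using x by simp_all
    thus ?thesis by blast
  next
    case 2
    have "g \<notin> hom (Tgt (u \<otimes>\<^sub>f fid C)) x (FO (u \<otimes>\<^sub>f fid C) y)" if y: "y \<in> Obj (Src (u \<otimes>\<^sub>f fid C))" for y g
    proof
      assume g: "g \<in> hom (Tgt (u \<otimes>\<^sub>f fid C)) x (FO (u \<otimes>\<^sub>f fid C) y)"
      obtain a d where yy: "y = Tup [a, d]" "a \<in> Obj (Src u)" "d \<in> Obj C" using y by (auto elim: Obj_prodE)
      obtain g1 g2 where gg: "g = Tup [g1, g2]" "g1 \<in> Arr (Tgt u)" "g2 \<in> Arr C" using g by (auto elim: Arr_prodE)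
      have "g1 \<in> hom (Tgt u) b (FO u a)" using g gg yy x by simp
      thus False using 2 yy(2) by blast
    qed
    thus ?thesis by blast
  qed
qed

text \<open>Der2 splits the check: on the image it is the assumption on u^*f, and off the image
  \<open>f\<close> joins zero objects.\<close>

lemma sieve_iso:
  assumes u: "sieve u" and f: "f \<in> hom (dcat D (Tgt u)) X Y" and i: "iso_arr (dcat D (Src u)) (FA (dfun D u) f)"
    and v: "\<And>b. b \<in> Obj (Tgt u) \<Longrightarrow> b \<notin> FO u ` Obj (Src u) \<Longrightarrow> vanish (Tgt u) b X \<and> vanish (Tgt u) b Y"
  shows "iso_arr (dcat D (Tgt u)) f"
proof (rule Der2_iso)
  have [simp]: "isfun u" using u by (simp add: sieve_def)
  show "Tgt u \<in> Cat" "f \<in> Arr (dcat D (Tgt u))" using f by simp_all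
  fix b assume b: "b \<in> Obj (Tgt u)"
  show "iso_arr (dcat D one_cat) (FA (dfun D (point (Tgt u) b)) f)"
  proof (cases "b \<in> FO u ` Obj (Src u)")
    case True
    then obtain a where a: "a \<in> Obj (Src u)" "b = FO u a" by blast
    have "iso_arr (dcat D one_cat) (FA (dfun D (point (Src u) a)) (FA (dfun D u) f))"
      by (rule iso_arr_dfun) (use a i in simp_all)
    thus ?thesis using a f by simp
  next
    case False
    thus ?thesis using v[OF b] b f by (intro vanish_iso_arr[of _ _ X Y]) simp_all
  qed
qed

lemma sieve_ran_vanish:
  assumes u: "sieve u" and X: "X \<in> Obj (dcat D (Src u))" and b: "b \<in> Obj (Tgt u)" "b \<notin> FO u ` Obj (Src u)"
  shows "vanish (Tgt u) b (FO (ran D u) X)"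
  using u b X unfolding sieve_def by (intro ran_vanish) blast+

lemma sieve_ran_unit_iso:
  assumes u: "sieve u" and Y: "Y \<in> Obj (dcat D (Tgt u))"
    and v: "\<And>b. b \<in> Obj (Tgt u) \<Longrightarrow> b \<notin> FO u ` Obj (Src u) \<Longrightarrow> vanish (Tgt u) b Y"
  shows "iso_arr (dcat D (Tgt u)) (NT (ran_unit D u) Y)"
proof (rule sieve_iso[OF u])
  have [simp]: "isfun u" "fully_faithful u" using u by (simp_all add: sieve_def)
  show "NT (ran_unit D u) Y \<in> hom (dcat D (Tgt u)) Y (FO (ran D u) (FO (dfun D u) Y))" using Y by simp
  show "iso_arr (dcat D (Src u)) (FA (dfun D u) (NT (ran_unit D u) Y))" by (rule ran_unit_dfun_iso) (use Y in simp_all)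
  show "vanish (Tgt u) b Y \<and> vanish (Tgt u) b (FO (ran D u) (FO (dfun D u) Y))"
    if "b \<in> Obj (Tgt u)" "b \<notin> FO u ` Obj (Src u)" for b
    using that v sieve_ran_vanish[OF u, of "FO (dfun D u) Y"] Y by simp
qed

lemma ran_mate_product_char:
  assumes [simp]: "isfun u" "isfun w" "X \<in> Obj (dcat D (Src u \<otimes> Tgt w))"
  shows "Comp (dcat D (Src u \<otimes> Src w)) (NT (ran_counit D (u \<otimes>\<^sub>f fid (Src w))) (FO (dfun D (fid (Src u) \<otimes>\<^sub>f w)) X))
      (FA (dfun D (u \<otimes>\<^sub>f fid (Src w))) (NT (ran_mate D (u \<otimes>\<^sub>f fid (Tgt w)) (u \<otimes>\<^sub>f fid (Src w))
      (fid (Src u) \<otimes>\<^sub>f w) (fid (Tgt u) \<otimes>\<^sub>f w) (nid (u \<otimes>\<^sub>f w))) X)) =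
    FA (dfun D (fid (Src u) \<otimes>\<^sub>f w)) (NT (ran_counit D (u \<otimes>\<^sub>f fid (Tgt w))) X)"
  using ran_mate_char[OF lan_mate_product_square, of u w "nid (u \<otimes>\<^sub>f w)" X] by simp

lemma ran_mate_product_hom:
  assumes [simp]: "isfun u" "isfun w" "X \<in> Obj (dcat D (Src u \<otimes> Tgt w))"
  shows "NT (ran_mate D (u \<otimes>\<^sub>f fid (Tgt w)) (u \<otimes>\<^sub>f fid (Src w)) (fid (Src u) \<otimes>\<^sub>f w) (fid (Tgt u) \<otimes>\<^sub>f w) (nid (u \<otimes>\<^sub>f w))) X
    \<in> hom (dcat D (Tgt u \<otimes> Src w)) (FO (dfun D (fid (Tgt u) \<otimes>\<^sub>f w)) (FO (ran D (u \<otimes>\<^sub>f fid (Tgt w))) X))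
       (FO (ran D (u \<otimes>\<^sub>f fid (Src w))) (FO (dfun D (fid (Src u) \<otimes>\<^sub>f w)) X))"
proof -
  note ms = ran_mate_simps(1-3)[OF lan_mate_product_square, of u w "nid (u \<otimes>\<^sub>f w)", simplified]
  show ?thesis using NT_simps[OF ms(1), of "dcat D (Tgt u \<otimes> Src w)" X] ms(2,3) by simp
qed

text \<open>By \<open>sieve_iso\<close> two checks remain. On the sieve, the equation of
  \<open>ran_mate_product_char\<close> expresses the mate through two invertible counits. Off the
  sieve, both ends are extensions by zero.\<close>

lemma ran_mate_product_iso:
  assumes u: "sieve u" and w [simp]: "isfun w" and X [simp]: "X \<in> Obj (dcat D (Src u \<otimes> Tgt w))"
  shows "iso_arr (dcat D (Tgt u \<otimes> Src w)) (NT (ran_mate D (u \<otimes>\<^sub>f fid (Tgt w)) (u \<otimes>\<^sub>f fid (Src w))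
      (fid (Src u) \<otimes>\<^sub>f w) (fid (Tgt u) \<otimes>\<^sub>f w) (nid (u \<otimes>\<^sub>f w))) X)"
proof -
  define m where "m = NT (ran_mate D (u \<otimes>\<^sub>f fid (Tgt w)) (u \<otimes>\<^sub>f fid (Src w))
      (fid (Src u) \<otimes>\<^sub>f w) (fid (Tgt u) \<otimes>\<^sub>f w) (nid (u \<otimes>\<^sub>f w))) X"
  define v v' where "v = u \<otimes>\<^sub>f fid (Src w)" and "v' = u \<otimes>\<^sub>f fid (Tgt w)"
  define p q where "p = fid (Src u) \<otimes>\<^sub>f w" and "q = fid (Tgt u) \<otimes>\<^sub>f w"
  have uf [simp]: "isfun u" "fully_faithful u" using u by (simp_all add: sieve_def)
  have sv: "sieve v" "sieve v'" by (simp_all add: v_def v'_def sieve_prod u)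
  have [simp]: "isfun v" "isfun v'" "isfun p" "isfun q" "Src v = Src u \<otimes> Src w" "Tgt v = Tgt u \<otimes> Src w"
    "Src v' = Src u \<otimes> Tgt w" "Tgt v' = Tgt u \<otimes> Tgt w" "Src p = Src u \<otimes> Src w" "Tgt p = Src u \<otimes> Tgt w"
    "Src q = Tgt u \<otimes> Src w" "Tgt q = Tgt u \<otimes> Tgt w"
    by (simp_all add: v_def v'_def p_def q_def)
  have m: "m \<in> hom (dcat D (Tgt v)) (FO (dfun D q) (FO (ran D v') X)) (FO (ran D v) (FO (dfun D p) X))"
    using ran_mate_product_hom[of u w X] by (simp add: m_def v_def v'_def p_def q_def)
  have mc: "Comp (dcat D (Src u \<otimes> Src w)) (NT (ran_counit D v) (FO (dfun D p) X)) (FA (dfun D v) m) = FA (dfun D p) (NT (ran_counit D v') X)"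
    unfolding m_def v_def v'_def p_def q_def by (rule ran_mate_product_char) simp_all
  have "iso_arr (dcat D (Tgt v)) m"
  proof (rule sieve_iso[OF sv(1) m])
    have "iso_arr (dcat D (Src u \<otimes> Src w)) (FA (dfun D p) (NT (ran_counit D v') X))"
      by (rule iso_arr_dfun) (use ran_counit_iso[of v' X] sv(2) in \<open>simp_all add: sieve_def\<close>)
    thus "iso_arr (dcat D (Src v)) (FA (dfun D v) m)"
      using iso_arr_cancel_left[OF _ ran_counit_iso[of v "FO (dfun D p) X"], of "FA (dfun D v) m"] mc sv(1) m by (simp add: sieve_def)
    fix b assume b: "b \<in> Obj (Tgt v)" "b \<notin> FO v ` Obj (Src v)"
    from b(1) obtain b1 c where bb: "b = Tup [b1, c]" "b1 \<in> Obj (Tgt u)" "c \<in> Obj (Src w)" by (auto elim: Obj_prodE)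
    have "b1 \<notin> FO u ` Obj (Src u)"
    proof
      assume "b1 \<in> FO u ` Obj (Src u)"
      then obtain a where "a \<in> Obj (Src u)" "b1 = FO u a" by blast
      hence "b = FO v (Tup [a, c])" "Tup [a, c] \<in> Obj (Src v)" using bb by (simp_all add: v_def)
      thus False using b(2) by blast
    qed
    hence "FO q b \<notin> FO v' ` Obj (Src v')" using bb by (auto simp: q_def v'_def elim!: Obj_prodE)
    thus "vanish (Tgt v) b (FO (dfun D q) (FO (ran D v') X)) \<and> vanish (Tgt v) b (FO (ran D v) (FO (dfun D p) X))"
      using sieve_ran_vanish[OF sv(1), of "FO (dfun D p) X" b] sieve_ran_vanish[OF sv(2), of X "FO q b"] b
      by (simp add: FO_Obj'[of q])
  qed
  thus ?thesis by (simp add: m_def)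
qed

end

section \<open>Morphisms of prederivators\<close>

lemma inv_arr_eqI:
  assumes "category C" "inverse_arr C f g"
  shows "inv_arr C f = g"
  using inverse_arr_unique[OF assms(1) _ assms(2)] inverse_arr_inv_arr[OF assms(1)] assms(2) unfolding iso_arr_def by blast

lemma inv_arr_FA:
  assumes F: "cat_functor F" and i: "iso_arr (Src F) f"
  shows "inv_arr (Tgt F) (FA F f) = FA F (inv_arr (Src F) f)"
  using iso_arr_Arr[OF i] F i by (intro inv_arr_eqI) (simp_all add: inverse_arr_iff flip: FA_Comp' FA_Ident')

lemma inv_arr_Comp:
  assumes C: "category C" and g: "iso_arr C g" and f: "iso_arr C f" and gf: "Dom C g = Cod C f"
  shows "inv_arr C (Comp C g f) = Comp C (inv_arr C f) (inv_arr C g)"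
  using iso_arr_Arr[OF g] iso_arr_Arr[OF f] assms by (intro inv_arr_eqI) (simp_all add: inverse_arr_iff)

lemma shift_simps [simp]: "dcat (shift D A) B = dcat D (A \<otimes> B)" "dfun (shift D A) u = dfun D (fid A \<otimes>\<^sub>f u)"
  "dnt (shift D A) \<alpha> = dnt D (nid (fid A) \<otimes>\<^sub>n \<alpha>)"
  by (simp_all add: shift_def)

lemma isfun_fhom: "A \<in> Cat \<Longrightarrow> B \<in> Cat \<Longrightarrow> u \<in> fhom A B \<Longrightarrow> isfun u"
  by (rule isfunI) auto

lemma isnt_nts: "A \<in> Cat \<Longrightarrow> B \<in> Cat \<Longrightarrow> u \<in> fhom A B \<Longrightarrow> \<alpha> \<in> nts u v \<Longrightarrow> isnt \<alpha>"
  by (rule isntI) (auto intro: isfunI)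

lemma prederivator_shift:
  assumes D: "prederivator D" and A [simp]: "A \<in> Cat"
  shows "prederivator (shift D A)"
proof (rule prederivator.intro)
  interpret prederivator D by (rule D)
  show "category (dcat (shift D A) B)" if "B \<in> Cat" for B using that by simp
  show "dfun (shift D A) u \<in> fhom (dcat (shift D A) C) (dcat (shift D A) B)"
    if "B \<in> Cat" "C \<in> Cat" "u \<in> fhom B C" for B C u
    using that isfun_fhom[OF that] by simp
  show "dfun (shift D A) (fid B) = fid (dcat (shift D A) B)" if "B \<in> Cat" for B using that by simp
  show "dfun (shift D A) (v \<odot> u) = dfun (shift D A) u \<odot> dfun (shift D A) v"
    if "B \<in> Cat" "C \<in> Cat" "E \<in> Cat" "u \<in> fhom B C" "v \<in> fhom C E" for B C E u v
    using that isfun_fhom[OF that(1,2,4)] isfun_fhom[OF that(2,3,5)] by (simp flip: dfun_fcomp)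
  show "dnt (shift D A) \<alpha> \<in> nts (dfun (shift D A) u) (dfun (shift D A) v)"
    if "B \<in> Cat" "C \<in> Cat" "u \<in> fhom B C" "v \<in> fhom B C" "\<alpha> \<in> nts u v" for B C u v \<alpha>
    using that isfun_fhom[OF that(1-3)] isnt_nts[OF that(1-3,5)] by simp
  show "dnt (shift D A) (nid u) = nid (dfun (shift D A) u)"
    if "B \<in> Cat" "C \<in> Cat" "u \<in> fhom B C" for B C u
    using that isfun_fhom[OF that] by simp
  show "dnt (shift D A) (\<beta> \<cdot> \<alpha>) = dnt (shift D A) \<beta> \<cdot> dnt (shift D A) \<alpha>"
    if "B \<in> Cat" "C \<in> Cat" "u \<in> fhom B C" "v \<in> fhom B C" "w \<in> fhom B C" "\<alpha> \<in> nts u v" "\<beta> \<in> nts v w" for B C u v w \<alpha> \<beta>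
  proof -
    note n = isnt_nts[OF that(1-3,6)] isnt_nts[OF that(1,2,4,7)]
    note f = isfun_fhom[OF that(1-3)] isfun_fhom[OF that(1,2,4)] isfun_fhom[OF that(1,2,5)]
    have "dnt D ((nid (fid A) \<otimes>\<^sub>n \<beta>) \<cdot> (nid (fid A) \<otimes>\<^sub>n \<alpha>)) = dnt D (nid (fid A) \<otimes>\<^sub>n \<beta>) \<cdot> dnt D (nid (fid A) \<otimes>\<^sub>n \<alpha>)"
      by (rule dnt_vcomp[of "A \<otimes> B" "A \<otimes> C" "fid A \<otimes>\<^sub>f u" "fid A \<otimes>\<^sub>f v" "fid A \<otimes>\<^sub>f w"]) (use that n f in simp_all)
    thus ?thesis using that n f by simp
  qed
  show "dnt (shift D A) (hcomp \<beta> \<alpha>) = hcomp (dnt (shift D A) \<alpha>) (dnt (shift D A) \<beta>)"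
    if "B \<in> Cat" "C \<in> Cat" "E \<in> Cat" "u \<in> fhom B C" "u' \<in> fhom B C" "v \<in> fhom C E" "v' \<in> fhom C E"
      "\<alpha> \<in> nts u u'" "\<beta> \<in> nts v v'" for B C E u u' v v' \<alpha> \<beta>
  proof -
    note n = isnt_nts[OF that(1,2,4,8)] isnt_nts[OF that(2,3,6,9)]
    note f = isfun_fhom[OF that(1,2,4)] isfun_fhom[OF that(1,2,5)] isfun_fhom[OF that(2,3,6)] isfun_fhom[OF that(2,3,7)]
    have "dnt D (hcomp (nid (fid A) \<otimes>\<^sub>n \<beta>) (nid (fid A) \<otimes>\<^sub>n \<alpha>)) = hcomp (dnt D (nid (fid A) \<otimes>\<^sub>n \<alpha>)) (dnt D (nid (fid A) \<otimes>\<^sub>n \<beta>))"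
      by (rule dnt_hcomp[of "A \<otimes> B" "A \<otimes> C" "A \<otimes> E" "fid A \<otimes>\<^sub>f u" "fid A \<otimes>\<^sub>f u'" "fid A \<otimes>\<^sub>f v" "fid A \<otimes>\<^sub>f v'"])
         (use that n f in simp_all)
    moreover have "hcomp (nid (fid A) \<otimes>\<^sub>n \<beta>) (nid (fid A) \<otimes>\<^sub>n \<alpha>) = nid (fid A) \<otimes>\<^sub>n hcomp \<beta> \<alpha>"
      using that n f by (simp add: hcomp_def)
    ultimately show ?thesis by simp
  qed
qed

lemma pseudonatural_simps:
  assumes "pseudonatural D E F"
  shows "A \<in> Cat \<Longrightarrow> cat_functor (mfun F A)" "A \<in> Cat \<Longrightarrow> Src (mfun F A) = dcat D A" "A \<in> Cat \<Longrightarrow> Tgt (mfun F A) = dcat E A"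
    "isfun u \<Longrightarrow> nat_trans (mnt F u)" "isfun u \<Longrightarrow> NSrc (mnt F u) = dfun E u \<odot> mfun F (Tgt u)"
    "isfun u \<Longrightarrow> NTgt (mnt F u) = mfun F (Src u) \<odot> dfun D u"
  using pseudonatural.mfun_fhom[OF assms, of A] pseudonatural.mnt_nts[OF assms, of "Src u" "Tgt u" u] by auto

lemma pseudonatural_iso:
  assumes "pseudonatural D E F" "prederivator D" "prederivator E" "isfun u" "X \<in> Obj (dcat D (Tgt u))"
  shows "iso_arr (dcat E (Src u)) (NT (mnt F u) X)"
proof -
  interpret D: prederivator D by fact
  interpret E: prederivator E by fact
  note [simp] = pseudonatural_simps[OF assms(1)] assms(4)
  show ?thesis using nat_isoD[OF pseudonatural.mnt_iso[OF assms(1), of "Src u" "Tgt u" u], of "dcat E (Src u)" X] assms by simp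
qed

lemma pseudonatural_comp_NT:
  assumes "pseudonatural D E F" "prederivator D" "prederivator E" "isfun u" "isfun v" "Tgt u = Src v" "X \<in> Obj (dcat D (Tgt v))"
  shows "NT (mnt F (v \<odot> u)) X = Comp (dcat E (Src u)) (NT (mnt F u) (FO (dfun D v) X)) (FA (dfun E u) (NT (mnt F v) X))"
proof -
  interpret D: prederivator D by fact
  interpret E: prederivator E by fact
  note [simp] = pseudonatural_simps[OF assms(1)] assms(4-7)
  show ?thesis using pseudonatural.mnt_comp[OF assms(1), of "Src u" "Tgt u" "Tgt v" u v] by simp
qed

lemma pseudonatural_id_NT:
  assumes "pseudonatural D E F" "A \<in> Cat" "X \<in> Obj (dcat D A)"
  shows "NT (mnt F (fid A)) X = Ident (dcat E A) (FO (mfun F A) X)"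
  using pseudonatural.mnt_id[OF assms(1,2)] assms(3) pseudonatural_simps[OF assms(1)] assms(2) by simp

lemma pseudonatural_nt_NT:
  assumes "pseudonatural D E F" "prederivator D" "prederivator E" "isnt \<alpha>" "X \<in> Obj (dcat D (Tgt (NSrc \<alpha>)))"
  shows "Comp (dcat E (Src (NSrc \<alpha>))) (FA (mfun F (Src (NSrc \<alpha>))) (NT (dnt D \<alpha>) X)) (NT (mnt F (NSrc \<alpha>)) X) =
    Comp (dcat E (Src (NSrc \<alpha>))) (NT (mnt F (NTgt \<alpha>)) X) (NT (dnt E \<alpha>) (FO (mfun F (Tgt (NSrc \<alpha>))) X))"
proof -
  interpret D: prederivator D by fact
  interpret E: prederivator E by fact
  note [simp] = pseudonatural_simps[OF assms(1)] assms(4-5)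
  have "NT ((mfun F (Src (NSrc \<alpha>)) \<rhd> dnt D \<alpha>) \<cdot> mnt F (NSrc \<alpha>)) X = NT (mnt F (NTgt \<alpha>) \<cdot> (dnt E \<alpha> \<lhd> mfun F (Tgt (NSrc \<alpha>)))) X"
    using pseudonatural.mnt_natural[OF assms(1), of "Src (NSrc \<alpha>)" "Tgt (NSrc \<alpha>)" "NSrc \<alpha>" "NTgt \<alpha>" \<alpha>] by simp
  thus ?thesis by simp
qed

lemma pseudonatural_arr_NT:
  assumes "pseudonatural D E F" "prederivator D" "prederivator E" "isfun u" "f \<in> hom (dcat D (Tgt u)) X Y"
  shows "Comp (dcat E (Src u)) (NT (mnt F u) Y) (FA (dfun E u) (FA (mfun F (Tgt u)) f)) =
    Comp (dcat E (Src u)) (FA (mfun F (Src u)) (FA (dfun D u) f)) (NT (mnt F u) X)"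
proof -
  interpret D: prederivator D by fact
  interpret E: prederivator E by fact
  note [simp] = pseudonatural_simps[OF assms(1)]
  show ?thesis using NT_naturality[of "mnt F u" "dcat E (Src u)" f Y] assms(4,5) by simp
qed

text \<open>The axioms are equations between records of transformations; in their objectwise form
  they become accessible to simplification. \<open>modificationI\<close> plays the same part for
  modifications.\<close>

lemma pseudonaturalI:
  assumes D: "prederivator D" and E: "prederivator E"
    and f: "\<And>A. A \<in> Cat \<Longrightarrow> cat_functor (mfun F A) \<and> Src (mfun F A) = dcat D A \<and> Tgt (mfun F A) = dcat E A"
    and n: "\<And>u. isfun u \<Longrightarrow> nat_trans (mnt F u) \<and> NSrc (mnt F u) = dfun E u \<odot> mfun F (Tgt u) \<and> NTgt (mnt F u) = mfun F (Src u) \<odot> dfun D u"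
    and i: "\<And>u X. isfun u \<Longrightarrow> X \<in> Obj (dcat D (Tgt u)) \<Longrightarrow> iso_arr (dcat E (Src u)) (NT (mnt F u) X)"
    and id: "\<And>A X. A \<in> Cat \<Longrightarrow> X \<in> Obj (dcat D A) \<Longrightarrow> NT (mnt F (fid A)) X = Ident (dcat E A) (FO (mfun F A) X)"
    and c: "\<And>u v X. isfun u \<Longrightarrow> isfun v \<Longrightarrow> Tgt u = Src v \<Longrightarrow> X \<in> Obj (dcat D (Tgt v)) \<Longrightarrow>
      NT (mnt F (v \<odot> u)) X = Comp (dcat E (Src u)) (NT (mnt F u) (FO (dfun D v) X)) (FA (dfun E u) (NT (mnt F v) X))"
    and t: "\<And>\<alpha> X. isnt \<alpha> \<Longrightarrow> X \<in> Obj (dcat D (Tgt (NSrc \<alpha>))) \<Longrightarrow>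
      Comp (dcat E (Src (NSrc \<alpha>))) (FA (mfun F (Src (NSrc \<alpha>))) (NT (dnt D \<alpha>) X)) (NT (mnt F (NSrc \<alpha>)) X) =
      Comp (dcat E (Src (NSrc \<alpha>))) (NT (mnt F (NTgt \<alpha>)) X) (NT (dnt E \<alpha>) (FO (mfun F (Tgt (NSrc \<alpha>))) X))"
  shows "pseudonatural D E F"
proof
  interpret D: prederivator D by fact
  interpret E: prederivator E by fact
  note [simp] = f n
  show "mfun F A \<in> fhom (dcat D A) (dcat E A)" if "A \<in> Cat" for A using that by simp
  show "mnt F u \<in> nts (dfun E u \<odot> mfun F B) (mfun F A \<odot> dfun D u)" "nat_iso (mnt F u)"
    if "A \<in> Cat" "B \<in> Cat" "u \<in> fhom A B" for A B u
    using that isfun_fhom[OF that] i[of u] by (auto simp: nat_iso_def)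
  show "mnt F (fid A) = nid (mfun F A)" if "A \<in> Cat" for A
    by (rule ntr_eqI) (use that id in simp_all)
  show "mnt F (v \<odot> u) = (mnt F u \<lhd> dfun D v) \<cdot> (dfun E u \<rhd> mnt F v)"
    if "A \<in> Cat" "B \<in> Cat" "C \<in> Cat" "u \<in> fhom A B" "v \<in> fhom B C" for A B C u v
  proof -
    note [simp] = isfun_fhom[OF that(1,2,4)] isfun_fhom[OF that(2,3,5)]
    have [simp]: "Src u = A" "Tgt u = B" "Src v = B" "Tgt v = C" using that by simp_all
    note [simp] = that(1-3)
    show ?thesis
    proof (rule ntr_eqI)
      show "NSrc (mnt F (v \<odot> u)) = NSrc ((mnt F u \<lhd> dfun D v) \<cdot> (dfun E u \<rhd> mnt F v))"
        "NTgt (mnt F (v \<odot> u)) = NTgt ((mnt F u \<lhd> dfun D v) \<cdot> (dfun E u \<rhd> mnt F v))"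
        by (simp_all add: D.dfun_fcomp E.dfun_fcomp fcomp_assoc)
      show "nat_trans ((mnt F u \<lhd> dfun D v) \<cdot> (dfun E u \<rhd> mnt F v))" by (rule nat_trans_vcomp) (simp_all add: fcomp_assoc)
    qed (simp_all add: c)
  qed
  show "(mfun F A \<rhd> dnt D \<alpha>) \<cdot> mnt F u = mnt F v \<cdot> (dnt E \<alpha> \<lhd> mfun F B)"
    if "A \<in> Cat" "B \<in> Cat" "u \<in> fhom A B" "v \<in> fhom A B" "\<alpha> \<in> nts u v" for A B u v \<alpha>
  proof -
    note a [simp] = isnt_nts[OF that(1-3,5)]
    note [simp] = isfun_fhom[OF that(1-3)] isfun_fhom[OF that(1,2,4)]
    have [simp]: "NSrc \<alpha> = u" "NTgt \<alpha> = v" "Src u = A" "Tgt u = B" "Src v = A" "Tgt v = B" using that by simp_all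
    note [simp] = that(1-2)
    show ?thesis
      by (rule ntr_eqI) (use t[OF a] in simp_all)
  qed
qed

lemma modificationI:
  assumes D: "prederivator D" and E: "prederivator E" and F: "pseudonatural D E F" and G: "pseudonatural D E G"
    and n: "\<And>A. A \<in> Cat \<Longrightarrow> nat_trans (\<tau> A) \<and> NSrc (\<tau> A) = mfun F A \<and> NTgt (\<tau> A) = mfun G A"
    and c: "\<And>u X. isfun u \<Longrightarrow> X \<in> Obj (dcat D (Tgt u)) \<Longrightarrow>
      Comp (dcat E (Src u)) (NT (\<tau> (Src u)) (FO (dfun D u) X)) (NT (mnt F u) X) =
      Comp (dcat E (Src u)) (NT (mnt G u) X) (FA (dfun E u) (NT (\<tau> (Tgt u)) X))"
  shows "modification D E F G \<tau>"
proof (intro modification.intro F G modification_axioms.intro)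
  interpret D: prederivator D by fact
  interpret E: prederivator E by fact
  note [simp] = pseudonatural_simps[OF F] pseudonatural_simps[OF G] n
  show "\<tau> A \<in> nts (mfun F A) (mfun G A)" if "A \<in> Cat" for A using that by simp
  show "(\<tau> A \<lhd> dfun D u) \<cdot> mnt F u = mnt G u \<cdot> (dfun E u \<rhd> \<tau> B)" if "A \<in> Cat" "B \<in> Cat" "u \<in> fhom A B" for A B u
  proof -
    note u [simp] = isfun_fhom[OF that]
    have [simp]: "Src u = A" "Tgt u = B" using that by simp_all
    note [simp] = that(1-2)
    show ?thesis by (rule ntr_eqI) (use c[OF u] in simp_all)
  qed
qed

lemma modification_simps:
  assumes "modification D E F G \<tau>"
  shows "pseudonatural D E F" "pseudonatural D E G" "A \<in> Cat \<Longrightarrow> nat_trans (\<tau> A)" "A \<in> Cat \<Longrightarrow> NSrc (\<tau> A) = mfun F A"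
    "A \<in> Cat \<Longrightarrow> NTgt (\<tau> A) = mfun G A"
  using assms modification.component[OF assms, of A] unfolding modification_def by simp_all

lemma modification_NT:
  assumes "modification D E F G \<tau>" "prederivator D" "prederivator E" "isfun u" "X \<in> Obj (dcat D (Tgt u))"
  shows "Comp (dcat E (Src u)) (NT (\<tau> (Src u)) (FO (dfun D u) X)) (NT (mnt F u) X) =
      Comp (dcat E (Src u)) (NT (mnt G u) X) (FA (dfun E u) (NT (\<tau> (Tgt u)) X))"
proof -
  interpret D: prederivator D by fact
  interpret E: prederivator E by fact
  note m = modification_simps[OF assms(1)]
  note [simp] = pseudonatural_simps[OF m(1)] pseudonatural_simps[OF m(2)] m assms(4,5)
  have "NT ((\<tau> (Src u) \<lhd> dfun D u) \<cdot> mnt F u) X = NT (mnt G u \<cdot> (dfun E u \<rhd> \<tau> (Tgt u))) X"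
    using modification.compat[OF assms(1), of "Src u" "Tgt u" u] by simp
  thus ?thesis by simp
qed

subsection \<open>Composition\<close>

lemma mcomp_simps [simp]: "mfun (G \<circ>\<^sub>d F) A = mfun G A \<odot> mfun F A"
  by (simp add: mcomp_def)

lemma mcomp_NT:
  assumes "pseudonatural D E F" "pseudonatural E H G" "prederivator D" "prederivator E" "prederivator H" "isfun u" "X \<in> Obj (dcat D (Tgt u))"
  shows "NT (mnt (G \<circ>\<^sub>d F) u) X = Comp (dcat H (Src u)) (FA (mfun G (Src u)) (NT (mnt F u) X)) (NT (mnt G u) (FO (mfun F (Tgt u)) X))"
proof -
  interpret D: prederivator D by fact
  interpret E: prederivator E by fact
  interpret H: prederivator H by fact
  note [simp] = pseudonatural_simps[OF assms(1)] pseudonatural_simps[OF assms(2)] assms(6,7)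
  show ?thesis by (simp add: mcomp_def)
qed

lemma pseudonatural_mcomp:
  assumes F: "pseudonatural D E F" and G: "pseudonatural E H G" and pd: "prederivator D" "prederivator E" "prederivator H"
  shows "pseudonatural D H (G \<circ>\<^sub>d F)"
proof (rule pseudonaturalI[OF pd(1,3)])
  interpret D: prederivator D by fact
  interpret E: prederivator E by fact
  interpret H: prederivator H by fact
  note [simp] = pseudonatural_simps[OF F] pseudonatural_simps[OF G]
  note nt = mcomp_NT[OF F G pd]
  show "cat_functor (mfun (G \<circ>\<^sub>d F) A) \<and> Src (mfun (G \<circ>\<^sub>d F) A) = dcat D A \<and> Tgt (mfun (G \<circ>\<^sub>d F) A) = dcat H A"
    if "A \<in> Cat" for A using that by simp
  show "nat_trans (mnt (G \<circ>\<^sub>d F) u) \<and> NSrc (mnt (G \<circ>\<^sub>d F) u) = dfun H u \<odot> mfun (G \<circ>\<^sub>d F) (Tgt u) \<and>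
     NTgt (mnt (G \<circ>\<^sub>d F) u) = mfun (G \<circ>\<^sub>d F) (Src u) \<odot> dfun D u" if "isfun u" for u
    using that unfolding mcomp_def by (simp add: fcomp_assoc)
  show "iso_arr (dcat H (Src u)) (NT (mnt (G \<circ>\<^sub>d F) u) X)" if u: "isfun u" and X: "X \<in> Obj (dcat D (Tgt u))" for u X
    unfolding nt[OF u X]
    using pseudonatural_iso[OF F pd(1,2) u X] pseudonatural_iso[OF G pd(2,3) u, of "FO (mfun F (Tgt u)) X"] u X
    by (intro iso_arr_Comp iso_arr_FA) simp_all
  show "NT (mnt (G \<circ>\<^sub>d F) (fid A)) X = Ident (dcat H A) (FO (mfun (G \<circ>\<^sub>d F) A) X)"
    if "A \<in> Cat" "X \<in> Obj (dcat D A)" for A X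
    using that nt[of "fid A" X] pseudonatural_id_NT[OF F that] pseudonatural_id_NT[OF G that(1), of "FO (mfun F A) X"]
    by simp
  show "NT (mnt (G \<circ>\<^sub>d F) (v \<odot> u)) X = Comp (dcat H (Src u)) (NT (mnt (G \<circ>\<^sub>d F) u) (FO (dfun D v) X)) (FA (dfun H u) (NT (mnt (G \<circ>\<^sub>d F) v) X))"
    if u [simp]: "isfun u" and v [simp]: "isfun v" and uv [simp]: "Tgt u = Src v" and X [simp]: "X \<in> Obj (dcat D (Tgt v))" for u v X
  proof -
    let ?a = "FA (mfun G (Src u)) (NT (mnt F u) (FO (dfun D v) X))" and ?b = "FA (mfun G (Src u)) (FA (dfun E u) (NT (mnt F v) X))"
      and ?c = "NT (mnt G u) (FO (dfun E v) (FO (mfun F (Tgt v)) X))" and ?d = "FA (dfun H u) (NT (mnt G v) (FO (mfun F (Tgt v)) X))"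
      and ?e = "NT (mnt G u) (FO (mfun F (Src v)) (FO (dfun D v) X))" and ?f = "FA (dfun H u) (FA (mfun G (Src v)) (NT (mnt F v) X))"
    \<comment> \<open>Naturality of the structure of \<open>G\<close> with respect to the arrow
      \<open>NT (mnt F v) X\<close> exchanges the two inner factors.\<close>
    have bc: "Comp (dcat H (Src u)) ?b ?c = Comp (dcat H (Src u)) ?e ?f"
      using pseudonatural_arr_NT[OF G pd(2,3) u, of "NT (mnt F v) X"] by simp
    have "NT (mnt (G \<circ>\<^sub>d F) (v \<odot> u)) X = Comp (dcat H (Src u)) ?a (Comp (dcat H (Src u)) ?b (Comp (dcat H (Src u)) ?c ?d))"
      by (simp add: nt pseudonatural_comp_NT[OF F pd(1,2)] pseudonatural_comp_NT[OF G pd(2,3)]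
        del: D.FO_dfun_comp E.FO_dfun_comp H.FO_dfun_comp D.FA_dfun_comp E.FA_dfun_comp H.FA_dfun_comp)
    also have "Comp (dcat H (Src u)) ?b (Comp (dcat H (Src u)) ?c ?d) = Comp (dcat H (Src u)) ?e (Comp (dcat H (Src u)) ?f ?d)"
      by (rule Comp_eq_extend[OF _ bc]) simp_all
    also have "Comp (dcat H (Src u)) ?a (Comp (dcat H (Src u)) ?e (Comp (dcat H (Src u)) ?f ?d)) =
       Comp (dcat H (Src u)) (NT (mnt (G \<circ>\<^sub>d F) u) (FO (dfun D v) X)) (FA (dfun H u) (NT (mnt (G \<circ>\<^sub>d F) v) X))"
      by (simp add: nt del: D.FO_dfun_comp E.FO_dfun_comp H.FO_dfun_comp D.FA_dfun_comp E.FA_dfun_comp H.FA_dfun_comp)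
    finally show ?thesis .
  qed
  show "Comp (dcat H (Src (NSrc \<alpha>))) (FA (mfun (G \<circ>\<^sub>d F) (Src (NSrc \<alpha>))) (NT (dnt D \<alpha>) X)) (NT (mnt (G \<circ>\<^sub>d F) (NSrc \<alpha>)) X) =
      Comp (dcat H (Src (NSrc \<alpha>))) (NT (mnt (G \<circ>\<^sub>d F) (NTgt \<alpha>)) X) (NT (dnt H \<alpha>) (FO (mfun (G \<circ>\<^sub>d F) (Tgt (NSrc \<alpha>))) X))"
    if a [simp]: "isnt \<alpha>" and X [simp]: "X \<in> Obj (dcat D (Tgt (NSrc \<alpha>)))" for \<alpha> X
  proof -
    let ?A = "Src (NSrc \<alpha>)" and ?B = "Tgt (NSrc \<alpha>)" and ?u = "NSrc \<alpha>" and ?v = "NTgt \<alpha>"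
    let ?a = "FA (mfun G ?A) (FA (mfun F ?A) (NT (dnt D \<alpha>) X))" and ?b = "FA (mfun G ?A) (NT (mnt F ?u) X)"
      and ?c = "NT (mnt G ?u) (FO (mfun F ?B) X)" and ?d = "FA (mfun G ?A) (NT (mnt F ?v) X)"
      and ?e = "FA (mfun G ?A) (NT (dnt E \<alpha>) (FO (mfun F ?B) X))" and ?f = "NT (mnt G ?v) (FO (mfun F ?B) X)"
      and ?g = "NT (dnt H \<alpha>) (FO (mfun G ?B) (FO (mfun F ?B) X))"
    have "FA (mfun G ?A) (Comp (dcat E ?A) (FA (mfun F ?A) (NT (dnt D \<alpha>) X)) (NT (mnt F ?u) X)) =
       FA (mfun G ?A) (Comp (dcat E ?A) (NT (mnt F ?v) X) (NT (dnt E \<alpha>) (FO (mfun F ?B) X)))"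
      by (simp only: pseudonatural_nt_NT[OF F pd(1,2) a X])
    hence ab: "Comp (dcat H ?A) ?a ?b = Comp (dcat H ?A) ?d ?e" by simp
    have ec: "Comp (dcat H ?A) ?e ?c = Comp (dcat H ?A) ?f ?g"
      using pseudonatural_nt_NT[OF G pd(2,3) a, of "FO (mfun F ?B) X"] by simp
    have "Comp (dcat H ?A) (FA (mfun (G \<circ>\<^sub>d F) ?A) (NT (dnt D \<alpha>) X)) (NT (mnt (G \<circ>\<^sub>d F) ?u) X) = Comp (dcat H ?A) ?a (Comp (dcat H ?A) ?b ?c)"
      by (simp add: nt)
    also have "\<dots> = Comp (dcat H ?A) ?d (Comp (dcat H ?A) ?e ?c)"
      by (rule Comp_eq_extend[OF _ ab]) simp_all
    also have "\<dots> = Comp (dcat H ?A) (NT (mnt (G \<circ>\<^sub>d F) ?v) X) (NT (dnt H \<alpha>) (FO (mfun (G \<circ>\<^sub>d F) ?B) X))"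
      by (simp add: nt ec)
    finally show ?thesis .
  qed
qed

subsection \<open>Operations on modifications\<close>

lemma modification_vcomp:
  assumes \<tau>: "modification D E F G \<tau>" and \<sigma>: "modification D E G K \<sigma>" and pd: "prederivator D" "prederivator E"
  shows "modification D E F K (\<lambda>A. \<sigma> A \<cdot> \<tau> A)"
proof (rule modificationI[OF pd])
  interpret D: prederivator D by fact
  interpret E: prederivator E by fact
  note m = modification_simps[OF \<tau>] modification_simps[OF \<sigma>]
  note [simp] = pseudonatural_simps[OF m(1)] pseudonatural_simps[OF m(2)] pseudonatural_simps[OF m(7)] m(3-5,8-10)
  show "pseudonatural D E F" "pseudonatural D E K" using m by simp_all
  show "nat_trans (\<sigma> A \<cdot> \<tau> A) \<and> NSrc (\<sigma> A \<cdot> \<tau> A) = mfun F A \<and> NTgt (\<sigma> A \<cdot> \<tau> A) = mfun K A" if "A \<in> Cat" for A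
    using that by simp
  fix u X assume u [simp]: "isfun u" and X [simp]: "X \<in> Obj (dcat D (Tgt u))"
  let ?A = "Src u" and ?uX = "FO (dfun D u) X"
  note e1 = modification_NT[OF \<tau> pd u X] and e2 = modification_NT[OF \<sigma> pd u X]
  have "Comp (dcat E ?A) (NT (\<sigma> ?A \<cdot> \<tau> ?A) ?uX) (NT (mnt F u) X) =
     Comp (dcat E ?A) (NT (\<sigma> ?A) ?uX) (Comp (dcat E ?A) (NT (mnt G u) X) (FA (dfun E u) (NT (\<tau> (Tgt u)) X)))"
    by (simp add: e1)
  also have "\<dots> = Comp (dcat E ?A) (NT (mnt K u) X) (Comp (dcat E ?A) (FA (dfun E u) (NT (\<sigma> (Tgt u)) X)) (FA (dfun E u) (NT (\<tau> (Tgt u)) X)))"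
    by (rule Comp_eq_extend[OF _ e2]) simp_all
  finally show "Comp (dcat E ?A) (NT (\<sigma> ?A \<cdot> \<tau> ?A) ?uX) (NT (mnt F u) X) =
     Comp (dcat E ?A) (NT (mnt K u) X) (FA (dfun E u) (NT (\<sigma> (Tgt u) \<cdot> \<tau> (Tgt u)) X))" by simp
qed

lemma modification_inverse:
  assumes \<tau>: "modification D E F G \<tau>" and i: "\<And>A. A \<in> Cat \<Longrightarrow> nat_iso (\<tau> A)" and pd: "prederivator D" "prederivator E"
  shows "modification D E G F (\<lambda>A. ninv (\<tau> A))"
proof (rule modificationI[OF pd])
  interpret D: prederivator D by fact
  interpret E: prederivator E by fact
  note m = modification_simps[OF \<tau>]
  note [simp] = pseudonatural_simps[OF m(1)] pseudonatural_simps[OF m(2)] m(3-5) i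
  show "pseudonatural D E G" "pseudonatural D E F" using m by simp_all
  show "nat_trans (ninv (\<tau> A)) \<and> NSrc (ninv (\<tau> A)) = mfun G A \<and> NTgt (ninv (\<tau> A)) = mfun F A" if "A \<in> Cat" for A
    using that by simp
  fix u X assume u [simp]: "isfun u" and X [simp]: "X \<in> Obj (dcat D (Tgt u))"
  let ?t = "NT (\<tau> (Tgt u)) X" and ?s = "NT (\<tau> (Src u)) (FO (dfun D u) X)"
  have it: "iso_arr (dcat E (Tgt u)) ?t" using nat_isoD[OF i, of "Tgt u" "dcat E (Tgt u)" X] by simp
  have is': "iso_arr (dcat E (Src u)) ?s" using nat_isoD[OF i, of "Src u" "dcat E (Src u)" "FO (dfun D u) X"] by simp
  have "Comp (dcat E (Src u)) (inv_arr (dcat E (Src u)) ?s) (NT (mnt G u) X) = Comp (dcat E (Src u)) (NT (mnt F u) X)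
      (inv_arr (dcat E (Src u)) (FA (dfun E u) ?t))"
    by (rule inv_arr_naturality) (use modification_NT[OF \<tau> pd u X] is' iso_arr_FA[of "dfun E u" ?t] it in simp_all)
  moreover have "inv_arr (dcat E (Src u)) (FA (dfun E u) ?t) = FA (dfun E u) (inv_arr (dcat E (Tgt u)) ?t)"
    using inv_arr_FA[of "dfun E u" ?t] it by simp
  ultimately show "Comp (dcat E (Src u)) (NT (ninv (\<tau> (Src u))) (FO (dfun D u) X)) (NT (mnt G u) X) =
     Comp (dcat E (Src u)) (NT (mnt F u) X) (FA (dfun E u) (NT (ninv (\<tau> (Tgt u))) X))" by simp
qed

lemma modification_whisk_left:
  assumes \<tau>: "modification D E F G \<tau>" and K: "pseudonatural E H K" and pd: "prederivator D" "prederivator E" "prederivator H"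
  shows "modification D H (K \<circ>\<^sub>d F) (K \<circ>\<^sub>d G) (\<lambda>A. mfun K A \<rhd> \<tau> A)"
proof (rule modificationI[OF pd(1,3)])
  interpret D: prederivator D by fact
  interpret E: prederivator E by fact
  interpret H: prederivator H by fact
  note m = modification_simps[OF \<tau>]
  note [simp] = pseudonatural_simps[OF m(1)] pseudonatural_simps[OF m(2)] pseudonatural_simps[OF K] m(3-5)
  show "pseudonatural D H (K \<circ>\<^sub>d F)" "pseudonatural D H (K \<circ>\<^sub>d G)" using m K pd pseudonatural_mcomp by blast+
  show "nat_trans (mfun K A \<rhd> \<tau> A) \<and> NSrc (mfun K A \<rhd> \<tau> A) = mfun (K \<circ>\<^sub>d F) A \<and> NTgt (mfun K A \<rhd> \<tau> A) = mfun (K \<circ>\<^sub>d G) A"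
    if "A \<in> Cat" for A using that by simp
  fix u X assume u [simp]: "isfun u" and X [simp]: "X \<in> Obj (dcat D (Tgt u))"
  let ?C = "Comp (dcat H (Src u))"
  let ?a = "FA (mfun K (Src u)) (NT (\<tau> (Src u)) (FO (dfun D u) X))" and ?b = "FA (mfun K (Src u)) (NT (mnt F u) X)"
    and ?c = "NT (mnt K u) (FO (mfun F (Tgt u)) X)" and ?d = "FA (mfun K (Src u)) (NT (mnt G u) X)"
    and ?e = "FA (mfun K (Src u)) (FA (dfun E u) (NT (\<tau> (Tgt u)) X))" and ?f = "NT (mnt K u) (FO (mfun G (Tgt u)) X)"
    and ?g = "FA (dfun H u) (FA (mfun K (Tgt u)) (NT (\<tau> (Tgt u)) X))"
  have "FA (mfun K (Src u)) (Comp (dcat E (Src u)) (NT (\<tau> (Src u)) (FO (dfun D u) X)) (NT (mnt F u) X)) =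
     FA (mfun K (Src u)) (Comp (dcat E (Src u)) (NT (mnt G u) X) (FA (dfun E u) (NT (\<tau> (Tgt u)) X)))"
    by (simp only: modification_NT[OF \<tau> pd(1,2) u X])
  hence ab: "?C ?a ?b = ?C ?d ?e" by simp
  have ec: "?C ?e ?c = ?C ?f ?g"
    using pseudonatural_arr_NT[OF K pd(2,3) u, of "NT (\<tau> (Tgt u)) X"] by simp
  have "?C ?a (?C ?b ?c) = ?C ?d (?C ?e ?c)"
    by (rule Comp_eq_extend[OF _ ab]) simp_all
  thus "?C (NT (mfun K (Src u) \<rhd> \<tau> (Src u)) (FO (dfun D u) X)) (NT (mnt (K \<circ>\<^sub>d F) u) X) =
     ?C (NT (mnt (K \<circ>\<^sub>d G) u) X) (FA (dfun H u) (NT (mfun K (Tgt u) \<rhd> \<tau> (Tgt u)) X))"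
    by (simp add: ec mcomp_NT[OF m(1) K pd] mcomp_NT[OF m(2) K pd])
qed

lemma modification_whisk_right:
  assumes \<tau>: "modification E H F G \<tau>" and K: "pseudonatural D E K" and pd: "prederivator D" "prederivator E" "prederivator H"
  shows "modification D H (F \<circ>\<^sub>d K) (G \<circ>\<^sub>d K) (\<lambda>A. \<tau> A \<lhd> mfun K A)"
proof (rule modificationI[OF pd(1,3)])
  interpret D: prederivator D by fact
  interpret E: prederivator E by fact
  interpret H: prederivator H by fact
  note m = modification_simps[OF \<tau>]
  note [simp] = pseudonatural_simps[OF m(1)] pseudonatural_simps[OF m(2)] pseudonatural_simps[OF K] m(3-5)
  show "pseudonatural D H (F \<circ>\<^sub>d K)" "pseudonatural D H (G \<circ>\<^sub>d K)" using m K pd pseudonatural_mcomp by blast+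
  show "nat_trans (\<tau> A \<lhd> mfun K A) \<and> NSrc (\<tau> A \<lhd> mfun K A) = mfun (F \<circ>\<^sub>d K) A \<and> NTgt (\<tau> A \<lhd> mfun K A) = mfun (G \<circ>\<^sub>d K) A"
    if "A \<in> Cat" for A using that by simp
  fix u X assume u [simp]: "isfun u" and X [simp]: "X \<in> Obj (dcat D (Tgt u))"
  let ?C = "Comp (dcat H (Src u))"
  let ?a = "NT (\<tau> (Src u)) (FO (mfun K (Src u)) (FO (dfun D u) X))" and ?b = "FA (mfun F (Src u)) (NT (mnt K u) X)"
    and ?c = "NT (mnt F u) (FO (mfun K (Tgt u)) X)" and ?d = "FA (mfun G (Src u)) (NT (mnt K u) X)"
    and ?e = "NT (\<tau> (Src u)) (FO (dfun E u) (FO (mfun K (Tgt u)) X))"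
    and ?f = "NT (mnt G u) (FO (mfun K (Tgt u)) X)" and ?g = "FA (dfun H u) (NT (\<tau> (Tgt u)) (FO (mfun K (Tgt u)) X))"
  have ab: "?C ?a ?b = ?C ?d ?e"
    using NT_naturality[of "\<tau> (Src u)" "dcat H (Src u)" "NT (mnt K u) X"] by simp
  have ec: "?C ?e ?c = ?C ?f ?g"
    using modification_NT[OF \<tau> pd(2,3) u, of "FO (mfun K (Tgt u)) X"] by simp
  have "?C ?a (?C ?b ?c) = ?C ?d (?C ?e ?c)"
    by (rule Comp_eq_extend[OF _ ab]) simp_all
  thus "?C (NT (\<tau> (Src u) \<lhd> mfun K (Src u)) (FO (dfun D u) X)) (NT (mnt (F \<circ>\<^sub>d K) u) X) =
     ?C (NT (mnt (G \<circ>\<^sub>d K) u) X) (FA (dfun H u) (NT (\<tau> (Tgt u) \<lhd> mfun K (Tgt u)) X))"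
    by (simp add: ec mcomp_NT[OF K m(1) pd] mcomp_NT[OF K m(2) pd])
qed

text \<open>Morphisms are not extensional records; this is their equality up to junk values.\<close>

definition dmor_eq :: "('u, 'o1, 'm1, 'o2, 'm2) dmor \<Rightarrow> ('u, 'o1, 'm1, 'o2, 'm2) dmor \<Rightarrow> bool" (infix "\<approx>" 50) where
  "F \<approx> G \<longleftrightarrow> (\<forall>A\<in>Cat. mfun F A = mfun G A) \<and> (\<forall>u. isfun u \<longrightarrow> mnt F u = mnt G u)"

lemma dmor_eq_refl [simp]: "F \<approx> F" by (simp add: dmor_eq_def)

lemma dmor_eq_sym: "F \<approx> G \<Longrightarrow> G \<approx> F" by (simp add: dmor_eq_def)

lemma dmor_eq_trans [trans]: "F \<approx> G \<Longrightarrow> G \<approx> H \<Longrightarrow> F \<approx> H" by (simp add: dmor_eq_def)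

lemma dmor_eq_mcomp: "F \<approx> F' \<Longrightarrow> G \<approx> G' \<Longrightarrow> G \<circ>\<^sub>d F \<approx> G' \<circ>\<^sub>d F'"
  by (simp add: dmor_eq_def mcomp_def)

lemma pseudonatural_cong:
  assumes "pseudonatural D E F" "F \<approx> F'"
  shows "pseudonatural D E F'"
proof
  have m: "mfun F' A = mfun F A" if "A \<in> Cat" for A using that assms(2) by (simp add: dmor_eq_def)
  have n: "mnt F' u = mnt F u" if "A \<in> Cat" "B \<in> Cat" "u \<in> fhom A B" for A B u
    using isfun_fhom[OF that] assms(2) by (simp add: dmor_eq_def)
  note P = pseudonatural.mfun_fhom[OF assms(1)] pseudonatural.mnt_nts[OF assms(1)] pseudonatural.mnt_iso[OF assms(1)]
    pseudonatural.mnt_id[OF assms(1)] pseudonatural.mnt_comp[OF assms(1)] pseudonatural.mnt_natural[OF assms(1)]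
  show "mfun F' A \<in> fhom (dcat D A) (dcat E A)" if "A \<in> Cat" for A using P(1)[OF that] m[OF that] by simp
  show "mnt F' u \<in> nts (dfun E u \<odot> mfun F' B) (mfun F' A \<odot> dfun D u)" "nat_iso (mnt F' u)"
    if "A \<in> Cat" "B \<in> Cat" "u \<in> fhom A B" for A B u
    using P(2)[OF that] P(3)[OF that] unfolding m[OF that(1)] m[OF that(2)] n[OF that] .
  show "mnt F' (fid A) = nid (mfun F' A)" if "A \<in> Cat" for A
    using P(4)[OF that] n[of A A "fid A"] m[OF that] that by simp
  show "mnt F' (v \<odot> u) = (mnt F' u \<lhd> dfun D v) \<cdot> (dfun E u \<rhd> mnt F' v)"
    if "A \<in> Cat" "B \<in> Cat" "C \<in> Cat" "u \<in> fhom A B" "v \<in> fhom B C" for A B C u v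
    using P(5)[OF that] n[OF that(1,2,4)] n[OF that(2,3,5)] n[of A C "v \<odot> u"] that by simp
  show "(mfun F' A \<rhd> dnt D \<alpha>) \<cdot> mnt F' u = mnt F' v \<cdot> (dnt E \<alpha> \<lhd> mfun F' B)"
    if "A \<in> Cat" "B \<in> Cat" "u \<in> fhom A B" "v \<in> fhom A B" "\<alpha> \<in> nts u v" for A B u v \<alpha>
    using P(6)[OF that] n[OF that(1-3)] n[OF that(1,2,4)] m[OF that(1)] m[OF that(2)] by simp
qed

lemma modification_cong:
  assumes "modification D E F G \<tau>" "F \<approx> F'" "G \<approx> G'"
  shows "modification D E F' G' \<tau>"
proof (intro modification.intro modification_axioms.intro)
  show "pseudonatural D E F'" "pseudonatural D E G'"
    using modification_simps(1,2)[OF assms(1)] assms pseudonatural_cong by blast+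
  show "\<tau> A \<in> nts (mfun F' A) (mfun G' A)" if "A \<in> Cat" for A
    using modification.component[OF assms(1) that] assms(2,3) that by (simp add: dmor_eq_def)
  show "(\<tau> A \<lhd> dfun D u) \<cdot> mnt F' u = mnt G' u \<cdot> (dfun E u \<rhd> \<tau> B)" if "A \<in> Cat" "B \<in> Cat" "u \<in> fhom A B" for A B u
    using modification.compat[OF assms(1) that] assms(2,3) isfun_fhom[OF that] by (simp add: dmor_eq_def)
qed

lemma mcomp_assoc:
  assumes F: "pseudonatural A B F" and G: "pseudonatural B C G" and H: "pseudonatural C E H"
    and pd: "prederivator A" "prederivator B" "prederivator C" "prederivator E"
  shows "(H \<circ>\<^sub>d G) \<circ>\<^sub>d F \<approx> H \<circ>\<^sub>d (G \<circ>\<^sub>d F)"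
proof -
  interpret A: prederivator A by fact
  interpret B: prederivator B by fact
  interpret C: prederivator C by fact
  interpret E: prederivator E by fact
  note GF = pseudonatural_mcomp[OF F G pd(1-3)] and HG = pseudonatural_mcomp[OF G H pd(2-4)]
  note L = pseudonatural_mcomp[OF F HG pd(1,2,4)] and R = pseudonatural_mcomp[OF GF H pd(1,3,4)]
  note [simp] = pseudonatural_simps[OF F] pseudonatural_simps[OF G] pseudonatural_simps[OF H]
  have "mnt ((H \<circ>\<^sub>d G) \<circ>\<^sub>d F) u = mnt (H \<circ>\<^sub>d (G \<circ>\<^sub>d F)) u" if u [simp]: "isfun u" for u
  proof (rule ntr_eqI)
    show "nat_trans (mnt ((H \<circ>\<^sub>d G) \<circ>\<^sub>d F) u)" "nat_trans (mnt (H \<circ>\<^sub>d (G \<circ>\<^sub>d F)) u)"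
      using pseudonatural_simps(4)[OF L u] pseudonatural_simps(4)[OF R u] by simp_all
    show "NSrc (mnt ((H \<circ>\<^sub>d G) \<circ>\<^sub>d F) u) = NSrc (mnt (H \<circ>\<^sub>d (G \<circ>\<^sub>d F)) u)"
      using pseudonatural_simps(5)[OF L u] pseudonatural_simps(5)[OF R u] by (simp add: fcomp_assoc)
    show "NTgt (mnt ((H \<circ>\<^sub>d G) \<circ>\<^sub>d F) u) = NTgt (mnt (H \<circ>\<^sub>d (G \<circ>\<^sub>d F)) u)"
      using pseudonatural_simps(6)[OF L u] pseudonatural_simps(6)[OF R u] by (simp add: fcomp_assoc)
    fix X assume "X \<in> Obj (Src (NSrc (mnt (H \<circ>\<^sub>d (G \<circ>\<^sub>d F)) u)))"
    hence X: "X \<in> Obj (dcat A (Tgt u))" using pseudonatural_simps(5)[OF R u] by simp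
    show "NT (mnt ((H \<circ>\<^sub>d G) \<circ>\<^sub>d F) u) X = NT (mnt (H \<circ>\<^sub>d (G \<circ>\<^sub>d F)) u) X"
      unfolding mcomp_NT[OF F HG pd(1,2,4) u X] mcomp_NT[OF GF H pd(1,3,4) u X] mcomp_NT[OF F G pd(1-3) u X]
      using X mcomp_NT[OF G H pd(2-4) u, of "FO (mfun F (Tgt u)) X"] by simp
  qed
  thus ?thesis by (simp add: dmor_eq_def fcomp_assoc)
qed

subsection \<open>Strict morphisms\<close>

lemma strict_mor_simps [simp]: "mfun (strict_mor E \<Phi>) A = \<Phi> A" "mnt (strict_mor E \<Phi>) u = nid (dfun E u \<odot> \<Phi> (Tgt u))"
  by (simp_all add: strict_mor_def)

lemma pseudonatural_strict:
  assumes pd: "prederivator D" "prederivator E"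
    and f: "\<And>A. A \<in> Cat \<Longrightarrow> cat_functor (\<Phi> A) \<and> Src (\<Phi> A) = dcat D A \<and> Tgt (\<Phi> A) = dcat E A"
    and n: "\<And>u. isfun u \<Longrightarrow> dfun E u \<odot> \<Phi> (Tgt u) = \<Phi> (Src u) \<odot> dfun D u"
    and t: "\<And>\<alpha> X. isnt \<alpha> \<Longrightarrow> X \<in> Obj (dcat D (Tgt (NSrc \<alpha>))) \<Longrightarrow>
       FA (\<Phi> (Src (NSrc \<alpha>))) (NT (dnt D \<alpha>) X) = NT (dnt E \<alpha>) (FO (\<Phi> (Tgt (NSrc \<alpha>))) X)"
  shows "pseudonatural D E (strict_mor E \<Phi>)"
proof (rule pseudonaturalI[OF pd])
  interpret D: prederivator D by fact
  interpret E: prederivator E by fact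
  note [simp] = f
  have n': "FO (dfun E u) (FO (\<Phi> (Tgt u)) X) = FO (\<Phi> (Src u)) (FO (dfun D u) X)"
    if "isfun u" "X \<in> Obj (dcat D (Tgt u))" for u X
    using arg_cong[OF n[OF that(1)], of "\<lambda>F. FO F X"] that by simp
  show "cat_functor (mfun (strict_mor E \<Phi>) A) \<and> Src (mfun (strict_mor E \<Phi>) A) = dcat D A \<and> Tgt (mfun (strict_mor E \<Phi>) A) = dcat E A"
    if "A \<in> Cat" for A using that by simp
  show "nat_trans (mnt (strict_mor E \<Phi>) u) \<and> NSrc (mnt (strict_mor E \<Phi>) u) = dfun E u \<odot> mfun (strict_mor E \<Phi>) (Tgt u) \<and>
         NTgt (mnt (strict_mor E \<Phi>) u) = mfun (strict_mor E \<Phi>) (Src u) \<odot> dfun D u" if "isfun u" for u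
    using that n[OF that] by (metis strict_mor_simps nat_trans_nid nid_simps(1,2) cat_functor_fcomp E.dfun_simps f isfunD(3))
  show "iso_arr (dcat E (Src u)) (NT (mnt (strict_mor E \<Phi>) u) X)" if "isfun u" "X \<in> Obj (dcat D (Tgt u))" for u X
    using that by (simp add: iso_arr_Ident)
  show "NT (mnt (strict_mor E \<Phi>) (fid A)) X = Ident (dcat E A) (FO (mfun (strict_mor E \<Phi>) A) X)"
    if "A \<in> Cat" "X \<in> Obj (dcat D A)" for A X using that by simp
  show "NT (mnt (strict_mor E \<Phi>) (v \<odot> u)) X = Comp (dcat E (Src u)) (NT (mnt (strict_mor E \<Phi>) u) (FO (dfun D v) X))
     (FA (dfun E u) (NT (mnt (strict_mor E \<Phi>) v) X))"
    if "isfun u" "isfun v" "Tgt u = Src v" "X \<in> Obj (dcat D (Tgt v))" for u v X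
    using that by (simp add: n'[OF that(2,4), symmetric])
  show "Comp (dcat E (Src (NSrc \<alpha>))) (FA (mfun (strict_mor E \<Phi>) (Src (NSrc \<alpha>))) (NT (dnt D \<alpha>) X)) (NT (mnt (strict_mor E \<Phi>) (NSrc \<alpha>)) X) =
        Comp (dcat E (Src (NSrc \<alpha>))) (NT (mnt (strict_mor E \<Phi>) (NTgt \<alpha>)) X)
         (NT (dnt E \<alpha>) (FO (mfun (strict_mor E \<Phi>) (Tgt (NSrc \<alpha>))) X))" if "isnt \<alpha>" "X \<in> Obj (dcat D (Tgt (NSrc \<alpha>)))" for \<alpha> X
    using that t[OF that] by simp
qed

lemma strict_mor_comp:
  assumes pd: "prederivator D" "prederivator E" "prederivator H"
    and F: "pseudonatural D E (strict_mor E \<Phi>)" and G: "pseudonatural E H (strict_mor H \<Psi>)"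
  shows "strict_mor H \<Psi> \<circ>\<^sub>d strict_mor E \<Phi> \<approx> strict_mor H (\<lambda>A. \<Psi> A \<odot> \<Phi> A)"
proof -
  interpret D: prederivator D by fact
  interpret E: prederivator E by fact
  interpret H: prederivator H by fact
  note [simp] = pseudonatural_simps(1-3)[OF F, simplified] pseudonatural_simps(1-3)[OF G, simplified]
  have n: "\<Psi> (Src u) \<odot> dfun E u = dfun H u \<odot> \<Psi> (Tgt u)" if u: "isfun u" for u
    using pseudonatural_simps(5,6)[OF G u] by simp
  have "mnt (strict_mor H \<Psi> \<circ>\<^sub>d strict_mor E \<Phi>) u = mnt (strict_mor H (\<lambda>A. \<Psi> A \<odot> \<Phi> A)) u" if u [simp]: "isfun u" for u
    using n[OF u] by (simp add: mcomp_def fcomp_assoc[symmetric])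
  thus ?thesis by (simp add: dmor_eq_def)
qed

lemma strict_mor_cong: "(\<And>A. A \<in> Cat \<Longrightarrow> \<Phi> A = \<Psi> A) \<Longrightarrow> strict_mor E \<Phi> \<approx> strict_mor E \<Psi>"
  by (simp add: dmor_eq_def)

lemma pseudonatural_id_mor:
  assumes "prederivator D" shows "pseudonatural D D (id_mor D)"
proof -
  interpret D: prederivator D by fact
  show ?thesis unfolding id_mor_def by (rule pseudonatural_strict) (use assms in simp_all)
qed

lemma mcomp_id_right:
  assumes F: "pseudonatural D E F" and pd: "prederivator D" "prederivator E"
  shows "F \<circ>\<^sub>d id_mor D \<approx> F"
proof -
  interpret D: prederivator D by fact
  interpret E: prederivator E by fact
  note [simp] = pseudonatural_simps[OF F]
  have "mnt (F \<circ>\<^sub>d id_mor D) u = mnt F u" if u: "isfun u" for u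
    using u by (simp add: mcomp_def id_mor_def)
  thus ?thesis by (simp add: dmor_eq_def id_mor_def)
qed

lemma mcomp_id_left:
  assumes F: "pseudonatural D E F" and pd: "prederivator D" "prederivator E"
  shows "id_mor E \<circ>\<^sub>d F \<approx> F"
proof -
  interpret D: prederivator D by fact
  interpret E: prederivator E by fact
  note [simp] = pseudonatural_simps[OF F]
  have "mnt (id_mor E \<circ>\<^sub>d F) u = mnt F u" if u: "isfun u" for u
    using u by (simp add: mcomp_def id_mor_def)
  thus ?thesis by (simp add: dmor_eq_def id_mor_def)
qed

subsection \<open>Parameters\<close>

lemma shift_mor_simps [simp]: "mfun (shift_mor P F) B = mfun F (P \<otimes> B)" "mnt (shift_mor P F) w = mnt F (fid P \<otimes>\<^sub>f w)"
  by (simp_all add: shift_mor_def)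

lemma pseudonatural_shift_mor:
  assumes F: "pseudonatural D E F" and pd: "prederivator D" "prederivator E" and P [simp]: "P \<in> Cat"
  shows "pseudonatural (shift D P) (shift E P) (shift_mor P F)"
proof (rule pseudonaturalI[OF prederivator_shift[OF pd(1) P] prederivator_shift[OF pd(2) P]])
  interpret D: prederivator D by fact
  interpret E: prederivator E by fact
  note [simp] = pseudonatural_simps[OF F]
  show "cat_functor (mfun (shift_mor P F) A) \<and> Src (mfun (shift_mor P F) A) = dcat (shift D P) A \<and> Tgt (mfun (shift_mor P F) A) = dcat (shift E P) A"
    if "A \<in> Cat" for A using that by simp
  show "nat_trans (mnt (shift_mor P F) u) \<and> NSrc (mnt (shift_mor P F) u) = dfun (shift E P) u \<odot> mfun (shift_mor P F) (Tgt u) \<and>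
         NTgt (mnt (shift_mor P F) u) = mfun (shift_mor P F) (Src u) \<odot> dfun (shift D P) u" if "isfun u" for u
    using that by simp
  show "iso_arr (dcat (shift E P) (Src u)) (NT (mnt (shift_mor P F) u) X)" if "isfun u" "X \<in> Obj (dcat (shift D P) (Tgt u))" for u X
    using that pseudonatural_iso[OF F pd, of "fid P \<otimes>\<^sub>f u" X] by simp
  show "NT (mnt (shift_mor P F) (fid A)) X = Ident (dcat (shift E P) A) (FO (mfun (shift_mor P F) A) X)"
    if "A \<in> Cat" "X \<in> Obj (dcat (shift D P) A)" for A X using that pseudonatural_id_NT[OF F, of "P \<otimes> A" X] by simp
  show "NT (mnt (shift_mor P F) (v \<odot> u)) X = Comp (dcat (shift E P) (Src u)) (NT (mnt (shift_mor P F) u) (FO (dfun (shift D P) v) X))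
     (FA (dfun (shift E P) u) (NT (mnt (shift_mor P F) v) X))"
    if "isfun u" "isfun v" "Tgt u = Src v" "X \<in> Obj (dcat (shift D P) (Tgt v))" for u v X
    using that pseudonatural_comp_NT[OF F pd, of "fid P \<otimes>\<^sub>f u" "fid P \<otimes>\<^sub>f v" X] by simp
  show "Comp (dcat (shift E P) (Src (NSrc \<alpha>))) (FA (mfun (shift_mor P F) (Src (NSrc \<alpha>))) (NT (dnt (shift D P) \<alpha>) X)) (NT (mnt (shift_mor P F) (NSrc \<alpha>)) X) =
        Comp (dcat (shift E P) (Src (NSrc \<alpha>))) (NT (mnt (shift_mor P F) (NTgt \<alpha>)) X)
         (NT (dnt (shift E P) \<alpha>) (FO (mfun (shift_mor P F) (Tgt (NSrc \<alpha>))) X))" if "isnt \<alpha>" "X \<in> Obj (dcat (shift D P) (Tgt (NSrc \<alpha>)))" for \<alpha> X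
    using that pseudonatural_nt_NT[OF F pd, of "nid (fid P) \<otimes>\<^sub>n \<alpha>" X] by simp
qed

lemma modification_shift_mor:
  assumes \<tau>: "modification D E F G \<tau>" and pd: "prederivator D" "prederivator E" and P [simp]: "P \<in> Cat"
  shows "modification (shift D P) (shift E P) (shift_mor P F) (shift_mor P G) (\<lambda>B. \<tau> (P \<otimes> B))"
proof (rule modificationI[OF prederivator_shift[OF pd(1) P] prederivator_shift[OF pd(2) P]])
  note m = modification_simps[OF \<tau>]
  show "pseudonatural (shift D P) (shift E P) (shift_mor P F)" "pseudonatural (shift D P) (shift E P) (shift_mor P G)"
    using pseudonatural_shift_mor[OF m(1) pd P] pseudonatural_shift_mor[OF m(2) pd P] by blast+
  show "nat_trans (\<tau> (P \<otimes> A)) \<and> NSrc (\<tau> (P \<otimes> A)) = mfun (shift_mor P F) A \<and> NTgt (\<tau> (P \<otimes> A)) = mfun (shift_mor P G) A" if "A \<in> Cat" for A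
    using that m by simp
  show "Comp (dcat (shift E P) (Src u)) (NT (\<tau> (P \<otimes> Src u)) (FO (dfun (shift D P) u) X)) (NT (mnt (shift_mor P F) u) X) =
        Comp (dcat (shift E P) (Src u)) (NT (mnt (shift_mor P G) u) X) (FA (dfun (shift E P) u) (NT (\<tau> (P \<otimes> Tgt u)) X))"
    if "isfun u" "X \<in> Obj (dcat (shift D P) (Tgt u))" for u X
    using modification_NT[OF \<tau> pd, of "fid P \<otimes>\<^sub>f u" X] that by simp
qed

subsection \<open>Restriction and Kan extension morphisms\<close>

context prederivator
begin

lemma prederivator_D: "prederivator D"
  by (rule prederivator_axioms)

lemma prederivator_shift_D: "A \<in> Cat \<Longrightarrow> prederivator (shift D A)"
  by (rule prederivator_shift[OF prederivator_axioms])

lemma pseudonatural_restr: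
  assumes [simp]: "isfun u"
  shows "pseudonatural (shift D (Tgt u)) (shift D (Src u)) (restr_mor D u)"
  unfolding restr_mor_def
  by (rule pseudonatural_strict) (simp_all add: prederivator_shift_D flip: dfun_fcomp)

lemma pseudonatural_eval:
  assumes [simp]: "A \<in> Cat" "a \<in> Obj A"
  shows "pseudonatural (shift D A) D (eval_mor D A a)"
  unfolding eval_mor_def
  by (rule pseudonatural_strict) (simp_all add: prederivator_shift_D prederivator_D slice_at_natural slice_at_natural2 flip: dfun_fcomp)

lemma restr_mor_comp:
  assumes [simp]: "isfun u" "isfun v" "Src v = Tgt u"
  shows "restr_mor D u \<circ>\<^sub>d restr_mor D v \<approx> restr_mor D (v \<odot> u)"
proof -
  have "restr_mor D u \<circ>\<^sub>d restr_mor D v \<approx> strict_mor (shift D (Src u)) (\<lambda>C. dfun D (u \<otimes>\<^sub>f fid C) \<odot> dfun D (v \<otimes>\<^sub>f fid C))"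
    using strict_mor_comp[of "shift D (Tgt v)" "shift D (Src v)" "shift D (Src u)" "\<lambda>C. dfun D (v \<otimes>\<^sub>f fid C)" "\<lambda>C. dfun D (u \<otimes>\<^sub>f fid C)"]
      pseudonatural_restr[of u] pseudonatural_restr[of v] by (simp add: restr_mor_def prederivator_shift_D)
  also have "\<dots> \<approx> restr_mor D (v \<odot> u)"
    unfolding restr_mor_def fcomp_simps by (rule strict_mor_cong) (simp flip: dfun_fcomp)
  finally show ?thesis .
qed

lemma eval_restr_comp:
  assumes u [simp]: "isfun u" and A: "Src u = A" and a: "a \<in> Obj A"
  shows "eval_mor D A a \<circ>\<^sub>d restr_mor D u \<approx> eval_mor D (Tgt u) (FO u a)"
proof -
  have [simp]: "A \<in> Cat" "a \<in> Obj (Src u)" using A a isfunD(2)[OF u] by simp_all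
  have "eval_mor D A a \<circ>\<^sub>d restr_mor D u \<approx> strict_mor D (\<lambda>C. dfun D (slice_at A a C) \<odot> dfun D (u \<otimes>\<^sub>f fid C))"
    using strict_mor_comp[of "shift D (Tgt u)" "shift D (Src u)" D "\<lambda>C. dfun D (u \<otimes>\<^sub>f fid C)" "\<lambda>C. dfun D (slice_at A a C)"]
      pseudonatural_restr[of u] pseudonatural_eval[of A a] A a
    by (simp add: restr_mor_def eval_mor_def prederivator_shift_D prederivator_D)
  also have "\<dots> \<approx> eval_mor D (Tgt u) (FO u a)"
    unfolding eval_mor_def
  proof (rule strict_mor_cong)
    fix C :: "'u scat" assume "C \<in> Cat"
    thus "dfun D (slice_at A a C) \<odot> dfun D (u \<otimes>\<^sub>f fid C) = dfun D (slice_at (Tgt u) (FO u a) C)"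
      using fun_slice_at[OF u, of C a] A a by (simp flip: dfun_fcomp)
  qed
  finally show ?thesis .
qed

lemma modification_restr:
  assumes a [simp]: "isnt \<alpha>"
  shows "modification (shift D (Tgt (NSrc \<alpha>))) (shift D (Src (NSrc \<alpha>))) (restr_mor D (NSrc \<alpha>)) (restr_mor D (NTgt \<alpha>))
    (\<lambda>C. dnt D (\<alpha> \<otimes>\<^sub>n nid (fid C)))"
proof (rule modificationI)
  show "pseudonatural (shift D (Tgt (NSrc \<alpha>))) (shift D (Src (NSrc \<alpha>))) (restr_mor D (NTgt \<alpha>))"
    using pseudonatural_restr[of "NTgt \<alpha>"] by simp
qed (simp_all add: prederivator_shift_D pseudonatural_restr, simp_all add: restr_mor_def)

end

section \<open>Left Kan extension as a morphism of derivators\<close>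

context derivator
begin

text \<open>The base change map from u_!w^* to w^*u_!, with \<open>u\<close> acting on the diagram
  variable and \<open>w\<close> on the parameter. \<open>lan_mor\<close> takes its inverse as
  structure.\<close>

definition lan_bc where
  "lan_bc u w = lan_mate D (u \<otimes>\<^sub>f fid (Tgt w)) (u \<otimes>\<^sub>f fid (Src w)) (fid (Src u) \<otimes>\<^sub>f w) (fid (Tgt u) \<otimes>\<^sub>f w) (nid (u \<otimes>\<^sub>f w))"

lemma lan_bc_simps:
  assumes "isfun u" "isfun w"
  shows "nat_trans (lan_bc u w)" "NSrc (lan_bc u w) = lan D (u \<otimes>\<^sub>f fid (Src w)) \<odot> dfun D (fid (Src u) \<otimes>\<^sub>f w)"
    "NTgt (lan_bc u w) = dfun D (fid (Tgt u) \<otimes>\<^sub>f w) \<odot> lan D (u \<otimes>\<^sub>f fid (Tgt w))"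
  unfolding lan_bc_def using assms by (simp_all add: lan_mate_simps(1-3)[OF lan_mate_product_square])

lemma lan_bc_char:
  assumes "isfun u" "isfun w" "X \<in> Obj (dcat D (Src u \<otimes> Tgt w))"
  shows "Comp (dcat D (Src u \<otimes> Src w)) (FA (dfun D (u \<otimes>\<^sub>f fid (Src w))) (NT (lan_bc u w) X))
      (NT (lan_unit D (u \<otimes>\<^sub>f fid (Src w))) (FO (dfun D (fid (Src u) \<otimes>\<^sub>f w)) X)) =
    FA (dfun D (fid (Src u) \<otimes>\<^sub>f w)) (NT (lan_unit D (u \<otimes>\<^sub>f fid (Tgt w))) X)"
  unfolding lan_bc_def by (rule lan_mate_product_char) fact+

lemma lan_bc_iso:
  assumes "isfun u" "isfun w" "X \<in> Obj (dcat D (Src u \<otimes> Tgt w))"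
  shows "iso_arr (dcat D (Tgt u \<otimes> Src w)) (NT (lan_bc u w) X)"
  unfolding lan_bc_def by (rule lan_mate_product_iso) fact+

lemma lan_bc_id:
  assumes [simp]: "isfun u" "A \<in> Cat" "X \<in> Obj (dcat D (Src u \<otimes> A))"
  shows "NT (lan_bc u (fid A)) X = Ident (dcat D (Tgt u \<otimes> A)) (FO (lan D (u \<otimes>\<^sub>f fid A)) X)"
  by (rule adjunction_eq_left[OF lan_adjunction, of "u \<otimes>\<^sub>f fid A" X "FO (lan D (u \<otimes>\<^sub>f fid A)) X"])
    (use lan_bc_simps[of u "fid A"] lan_bc_char[of u "fid A" X] in simp_all)

text \<open>After composition with the unit both sides become the restriction of the unit along the
  composite of \<open>w\<close> and \<open>v\<close>, by \<open>lan_bc_char\<close> for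
  \<open>w\<close> and for \<open>v\<close>.\<close>

lemma lan_bc_comp:
  assumes [simp]: "isfun u" "isfun w" "isfun v" "Tgt w = Src v" "X \<in> Obj (dcat D (Src u \<otimes> Tgt v))"
  shows "NT (lan_bc u (v \<odot> w)) X = Comp (dcat D (Tgt u \<otimes> Src w)) (FA (dfun D (fid (Tgt u) \<otimes>\<^sub>f w)) (NT (lan_bc u v) X))
     (NT (lan_bc u w) (FO (dfun D (fid (Src u) \<otimes>\<^sub>f v)) X))"
proof (rule adjunction_eq_left[OF lan_adjunction, of "u \<otimes>\<^sub>f fid (Src w)" "FO (dfun D (fid (Src u) \<otimes>\<^sub>f (v \<odot> w))) X"
    "FO (dfun D (fid (Tgt u) \<otimes>\<^sub>f (v \<odot> w))) (FO (lan D (u \<otimes>\<^sub>f fid (Tgt v))) X)"])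
  note [simp] = lan_bc_simps
  let ?C = "Comp (dcat D (Src u \<otimes> Src w))" and ?u = "dfun D (u \<otimes>\<^sub>f fid (Src w))" and ?vX = "FO (dfun D (fid (Src u) \<otimes>\<^sub>f v)) X"
    and ?e = "NT (lan_unit D (u \<otimes>\<^sub>f fid (Src w))) (FO (dfun D (fid (Src u) \<otimes>\<^sub>f (v \<odot> w))) X)"
  have 1: "?C (FA ?u (NT (lan_bc u w) ?vX)) ?e = FA (dfun D (fid (Src u) \<otimes>\<^sub>f w)) (NT (lan_unit D (u \<otimes>\<^sub>f fid (Src v))) ?vX)"
    using lan_bc_char[of u w ?vX] by simp
  have "FA (dfun D (fid (Src u) \<otimes>\<^sub>f w)) (Comp (dcat D (Src u \<otimes> Src v)) (FA (dfun D (u \<otimes>\<^sub>f fid (Src v))) (NT (lan_bc u v) X))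
      (NT (lan_unit D (u \<otimes>\<^sub>f fid (Src v))) ?vX)) = FA (dfun D (fid (Src u) \<otimes>\<^sub>f w)) (FA (dfun D (fid (Src u) \<otimes>\<^sub>f v)) (NT (lan_unit D (u \<otimes>\<^sub>f fid (Tgt v))) X))"
    using lan_bc_char[of u v X] by simp
  hence 2: "?C (FA (dfun D (u \<otimes>\<^sub>f w)) (NT (lan_bc u v) X)) (FA (dfun D (fid (Src u) \<otimes>\<^sub>f w)) (NT (lan_unit D (u \<otimes>\<^sub>f fid (Src v))) ?vX)) =
      FA (dfun D (fid (Src u) \<otimes>\<^sub>f (v \<odot> w))) (NT (lan_unit D (u \<otimes>\<^sub>f fid (Tgt v))) X)" by simp
  have 3: "?C (FA ?u (NT (lan_bc u (v \<odot> w)) X)) ?e = FA (dfun D (fid (Src u) \<otimes>\<^sub>f (v \<odot> w))) (NT (lan_unit D (u \<otimes>\<^sub>f fid (Tgt v))) X)"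
    using lan_bc_char[of u "v \<odot> w" X] by simp
  show "Comp (Src (lan D (u \<otimes>\<^sub>f fid (Src w)))) (FA ?u (NT (lan_bc u (v \<odot> w)) X)) ?e =
    Comp (Src (lan D (u \<otimes>\<^sub>f fid (Src w)))) (FA ?u (Comp (dcat D (Tgt u \<otimes> Src w)) (FA (dfun D (fid (Tgt u) \<otimes>\<^sub>f w)) (NT (lan_bc u v) X)) (NT (lan_bc u w) ?vX))) ?e"
    using 1 2 3 by simp
qed (simp_all add: lan_bc_simps)

text \<open>Transposes are compared again; the extra ingredient is naturality of the 2-cell \<beta>
  at the unit arrow.\<close>

lemma lan_bc_nat:
  assumes b [simp]: "isfun u" "isnt \<beta>" "X \<in> Obj (dcat D (Src u \<otimes> Tgt (NSrc \<beta>)))"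
  shows "Comp (dcat D (Tgt u \<otimes> Src (NSrc \<beta>))) (NT (lan_bc u (NTgt \<beta>)) X)
      (FA (lan D (u \<otimes>\<^sub>f fid (Src (NSrc \<beta>)))) (NT (dnt D (nid (fid (Src u)) \<otimes>\<^sub>n \<beta>)) X)) =
    Comp (dcat D (Tgt u \<otimes> Src (NSrc \<beta>))) (NT (dnt D (nid (fid (Tgt u)) \<otimes>\<^sub>n \<beta>)) (FO (lan D (u \<otimes>\<^sub>f fid (Tgt (NSrc \<beta>)))) X))
      (NT (lan_bc u (NSrc \<beta>)) X)"
proof -
  let ?S = "Src (NSrc \<beta>)" and ?T = "Tgt (NSrc \<beta>)" and ?w = "NSrc \<beta>" and ?w' = "NTgt \<beta>"
  note [simp] = lan_bc_simps
  let ?C = "Comp (dcat D (Src u \<otimes> ?S))" and ?u = "dfun D (u \<otimes>\<^sub>f fid ?S)"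
  let ?e = "\<lambda>Y. NT (lan_unit D (u \<otimes>\<^sub>f fid ?S)) Y"
  let ?Z = "FO (lan D (u \<otimes>\<^sub>f fid ?T)) X" and ?x = "NT (dnt D (nid (fid (Src u)) \<otimes>\<^sub>n \<beta>)) X"
  let ?wX = "FO (dfun D (fid (Src u) \<otimes>\<^sub>f ?w)) X" and ?w'X = "FO (dfun D (fid (Src u) \<otimes>\<^sub>f ?w')) X"
  show ?thesis
  proof (rule adjunction_eq_left[OF lan_adjunction, of "u \<otimes>\<^sub>f fid ?S" ?wX "FO (dfun D (fid (Tgt u) \<otimes>\<^sub>f ?w')) ?Z"])
    have 1: "?C (FA ?u (FA (lan D (u \<otimes>\<^sub>f fid ?S)) ?x)) (?e ?wX) = ?C (?e ?w'X) ?x"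
      using NT_naturality[of "lan_unit D (u \<otimes>\<^sub>f fid ?S)" "dcat D (Src u \<otimes> ?S)" ?x ?w'X] by simp
    have 2: "?C (FA ?u (NT (lan_bc u ?w') X)) (?e ?w'X) = FA (dfun D (fid (Src u) \<otimes>\<^sub>f ?w')) (NT (lan_unit D (u \<otimes>\<^sub>f fid ?T)) X)"
      using lan_bc_char[of u ?w' X] by simp
    have 3: "?C (FA ?u (NT (lan_bc u ?w) X)) (?e ?wX) = FA (dfun D (fid (Src u) \<otimes>\<^sub>f ?w)) (NT (lan_unit D (u \<otimes>\<^sub>f fid ?T)) X)"
      using lan_bc_char[of u ?w X] by simp
    have 4: "?C (NT (dnt D (nid u \<otimes>\<^sub>n \<beta>)) ?Z) (FA (dfun D (fid (Src u) \<otimes>\<^sub>f ?w)) (NT (lan_unit D (u \<otimes>\<^sub>f fid ?T)) X)) =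
       ?C (FA (dfun D (fid (Src u) \<otimes>\<^sub>f ?w')) (NT (lan_unit D (u \<otimes>\<^sub>f fid ?T)) X)) ?x"
      using NT_dnt_natural[of "nid (fid (Src u)) \<otimes>\<^sub>n \<beta>" "NT (lan_unit D (u \<otimes>\<^sub>f fid ?T)) X" "Src u \<otimes> ?S"
          X "FO (dfun D (u \<otimes>\<^sub>f fid ?T)) ?Z"] by simp
    have "?C (FA ?u (NT (lan_bc u ?w') X)) (?C (FA ?u (FA (lan D (u \<otimes>\<^sub>f fid ?S)) ?x)) (?e ?wX)) =
       ?C (FA (dfun D (fid (Src u) \<otimes>\<^sub>f ?w')) (NT (lan_unit D (u \<otimes>\<^sub>f fid ?T)) X)) ?x"
      unfolding 1 by (rule Comp_eq_extend1[OF _ 2]) simp_all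
    thus "Comp (Src (lan D (u \<otimes>\<^sub>f fid ?S))) (FA ?u (Comp (dcat D (Tgt u \<otimes> ?S)) (NT (lan_bc u ?w') X) (FA (lan D (u \<otimes>\<^sub>f fid ?S)) ?x))) (?e ?wX) =
      Comp (Src (lan D (u \<otimes>\<^sub>f fid ?S))) (FA ?u (Comp (dcat D (Tgt u \<otimes> ?S)) (NT (dnt D (nid (fid (Tgt u)) \<otimes>\<^sub>n \<beta>)) ?Z) (NT (lan_bc u ?w) X))) (?e ?wX)"
      by (simp add: 3 4)
  qed simp_all
qed

lemma lan_mor_simps: "mfun (lan_mor D u) C = lan D (u \<otimes>\<^sub>f fid C)" "mnt (lan_mor D u) w = ninv (lan_bc u w)"
  by (simp_all add: lan_mor_def lan_bc_def)

lemma pseudonatural_lan: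
  assumes u [simp]: "isfun u"
  shows "pseudonatural (shift D (Src u)) (shift D (Tgt u)) (lan_mor D u)"
proof (rule pseudonaturalI)
  note [simp] = lan_mor_simps lan_bc_simps lan_bc_iso
  show "prederivator (shift D (Src u))" "prederivator (shift D (Tgt u))" by (simp_all add: prederivator_shift_D)
  have ni [simp]: "nat_iso (lan_bc u w)" if "isfun w" for w using that by (simp add: nat_iso_def)
  show "cat_functor (mfun (lan_mor D u) A) \<and> Src (mfun (lan_mor D u) A) = dcat (shift D (Src u)) A \<and>
    Tgt (mfun (lan_mor D u) A) = dcat (shift D (Tgt u)) A" if "A \<in> Cat" for A using that by simp
  show "nat_trans (mnt (lan_mor D u) w) \<and> NSrc (mnt (lan_mor D u) w) = dfun (shift D (Tgt u)) w \<odot> mfun (lan_mor D u) (Tgt w) \<and>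
         NTgt (mnt (lan_mor D u) w) = mfun (lan_mor D u) (Src w) \<odot> dfun (shift D (Src u)) w" if "isfun w" for w
    using that by simp
  show "iso_arr (dcat (shift D (Tgt u)) (Src w)) (NT (mnt (lan_mor D u) w) X)"
    if "isfun w" "X \<in> Obj (dcat (shift D (Src u)) (Tgt w))" for w X
    using that by (simp add: iso_arr_inv)
  show "NT (mnt (lan_mor D u) (fid A)) X = Ident (dcat (shift D (Tgt u)) A) (FO (mfun (lan_mor D u) A) X)"
    if "A \<in> Cat" "X \<in> Obj (dcat (shift D (Src u)) A)" for A X
    using that by (simp add: lan_bc_id inv_arr_eqI inverse_arr_iff)
  show "NT (mnt (lan_mor D u) (v \<odot> w)) X = Comp (dcat (shift D (Tgt u)) (Src w)) (NT (mnt (lan_mor D u) w) (FO (dfun (shift D (Src u)) v) X))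
      (FA (dfun (shift D (Tgt u)) w) (NT (mnt (lan_mor D u) v) X))"
    if [simp]: "isfun w" "isfun v" "Tgt w = Src v" "X \<in> Obj (dcat (shift D (Src u)) (Tgt v))" for w v X
  proof -
    have [simp]: "X \<in> Obj (dcat D (Src u \<otimes> Tgt v))" using that by simp
    have i: "iso_arr (dcat D (Tgt u \<otimes> Src v)) (NT (lan_bc u v) X)" by simp
    have i2: "iso_arr (dcat D (Tgt u \<otimes> Src w)) (NT (lan_bc u w) (FO (dfun D (fid (Src u) \<otimes>\<^sub>f v)) X))" by simp
    have "inv_arr (dcat D (Tgt u \<otimes> Src w)) (FA (dfun D (fid (Tgt u) \<otimes>\<^sub>f w)) (NT (lan_bc u v) X)) =
       FA (dfun D (fid (Tgt u) \<otimes>\<^sub>f w)) (inv_arr (dcat D (Tgt u \<otimes> Src v)) (NT (lan_bc u v) X))"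
      using inv_arr_FA[of "dfun D (fid (Tgt u) \<otimes>\<^sub>f w)" "NT (lan_bc u v) X"] i by simp
    moreover have "iso_arr (dcat D (Tgt u \<otimes> Src w)) (FA (dfun D (fid (Tgt u) \<otimes>\<^sub>f w)) (NT (lan_bc u v) X))"
      by (rule iso_arr_dfun) (use i in simp_all)
    ultimately have "inv_arr (dcat D (Tgt u \<otimes> Src w)) (NT (lan_bc u (v \<odot> w)) X) = Comp (dcat D (Tgt u \<otimes> Src w))
       (inv_arr (dcat D (Tgt u \<otimes> Src w)) (NT (lan_bc u w) (FO (dfun D (fid (Src u) \<otimes>\<^sub>f v)) X)))
       (FA (dfun D (fid (Tgt u) \<otimes>\<^sub>f w)) (inv_arr (dcat D (Tgt u \<otimes> Src v)) (NT (lan_bc u v) X)))"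
      using i2 by (simp add: lan_bc_comp inv_arr_Comp)
    thus ?thesis by simp
  qed
  show "Comp (dcat (shift D (Tgt u)) (Src (NSrc \<alpha>))) (FA (mfun (lan_mor D u) (Src (NSrc \<alpha>))) (NT (dnt (shift D (Src u)) \<alpha>) X)) (NT (mnt (lan_mor D u) (NSrc \<alpha>)) X) =
      Comp (dcat (shift D (Tgt u)) (Src (NSrc \<alpha>))) (NT (mnt (lan_mor D u) (NTgt \<alpha>)) X)
         (NT (dnt (shift D (Tgt u)) \<alpha>) (FO (mfun (lan_mor D u) (Tgt (NSrc \<alpha>))) X))"
    if [simp]: "isnt \<alpha>" and "X \<in> Obj (dcat (shift D (Src u)) (Tgt (NSrc \<alpha>)))" for \<alpha> X
  proof -
    have X [simp]: "X \<in> Obj (dcat D (Src u \<otimes> Tgt (NSrc \<alpha>)))" using that(2) by simp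
    have i: "iso_arr (dcat D (Tgt u \<otimes> Src (NSrc \<alpha>))) (NT (lan_bc u (NSrc \<alpha>)) X)" "iso_arr (dcat D (Tgt u \<otimes> Src (NSrc \<alpha>))) (NT (lan_bc u (NTgt \<alpha>)) X)"
      using lan_bc_iso[of u "NSrc \<alpha>" X] lan_bc_iso[of u "NTgt \<alpha>" X] by simp_all
    show ?thesis
      using inv_arr_naturality[OF _ lan_bc_nat[of u \<alpha> X] i] by simp
  qed
qed

lemma modification_lan_unit:
  assumes u [simp]: "isfun u"
  shows "modification (shift D (Src u)) (shift D (Src u)) (id_mor (shift D (Src u))) (restr_mor D u \<circ>\<^sub>d lan_mor D u)
    (\<lambda>C. lan_unit D (u \<otimes>\<^sub>f fid C))"
proof (rule modificationI)
  note pd = prederivator_shift_D[of "Src u"] prederivator_shift_D[of "Tgt u"]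
  show "prederivator (shift D (Src u))" "prederivator (shift D (Src u))" using pd by simp_all
  show "pseudonatural (shift D (Src u)) (shift D (Src u)) (id_mor (shift D (Src u)))" by (rule pseudonatural_id_mor) (simp add: pd)
  show "pseudonatural (shift D (Src u)) (shift D (Src u)) (restr_mor D u \<circ>\<^sub>d lan_mor D u)"
    by (rule pseudonatural_mcomp[OF pseudonatural_lan[OF u] pseudonatural_restr[OF u]]) (simp_all add: pd)
  show "nat_trans (lan_unit D (u \<otimes>\<^sub>f fid A)) \<and> NSrc (lan_unit D (u \<otimes>\<^sub>f fid A)) = mfun (id_mor (shift D (Src u))) A \<and>
    NTgt (lan_unit D (u \<otimes>\<^sub>f fid A)) = mfun (restr_mor D u \<circ>\<^sub>d lan_mor D u) A" if "A \<in> Cat" for A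
    using that by (simp add: id_mor_def restr_mor_def lan_mor_simps)
  fix w X assume w [simp]: "isfun w" and "X \<in> Obj (dcat (shift D (Src u)) (Tgt w))"
  hence X [simp]: "X \<in> Obj (dcat D (Src u \<otimes> Tgt w))" by simp
  note [simp] = lan_bc_simps lan_mor_simps
  have i: "iso_arr (dcat D (Tgt u \<otimes> Src w)) (NT (lan_bc u w) X)" by (rule lan_bc_iso) simp_all
  let ?A = "dcat D (Src u \<otimes> Src w)" and ?u = "dfun D (u \<otimes>\<^sub>f fid (Src w))" and ?m = "NT (lan_bc u w) X"
    and ?wX = "FO (dfun D (fid (Src u) \<otimes>\<^sub>f w)) X"
  \<comment> \<open>The structure of u^*u_! is u^* of the inverse base change map; composing
    \<open>lan_bc_char\<close> with it on the left gives the compatibility of the unit.\<close>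
  have "Comp ?A (FA ?u (inv_arr (dcat D (Tgt u \<otimes> Src w)) ?m)) (Comp ?A (FA ?u ?m) (NT (lan_unit D (u \<otimes>\<^sub>f fid (Src w))) ?wX)) =
    Comp ?A (Ident ?A (FO ?u (FO (lan D (u \<otimes>\<^sub>f fid (Src w))) ?wX))) (NT (lan_unit D (u \<otimes>\<^sub>f fid (Src w))) ?wX)"
  proof (rule Comp_eq_extend1)
    have "Comp ?A (FA ?u (inv_arr (dcat D (Tgt u \<otimes> Src w)) ?m)) (FA ?u ?m) =
       FA ?u (Comp (dcat D (Tgt u \<otimes> Src w)) (inv_arr (dcat D (Tgt u \<otimes> Src w)) ?m) ?m)"
      using FA_Comp'[of ?u "dcat D (Tgt u \<otimes> Src w)" "inv_arr (dcat D (Tgt u \<otimes> Src w)) ?m" ?m] i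
      by (simp del: inv_arr_simps(4))
    also have "\<dots> = Ident ?A (FO ?u (FO (lan D (u \<otimes>\<^sub>f fid (Src w))) ?wX))" using i by simp
    finally show "Comp ?A (FA ?u (inv_arr (dcat D (Tgt u \<otimes> Src w)) ?m)) (FA ?u ?m) = Ident ?A (FO ?u (FO (lan D (u \<otimes>\<^sub>f fid (Src w))) ?wX))" .
  qed (use i in simp_all)
  hence e: "Comp ?A (FA ?u (inv_arr (dcat D (Tgt u \<otimes> Src w)) ?m)) (FA (dfun D (fid (Src u) \<otimes>\<^sub>f w)) (NT (lan_unit D (u \<otimes>\<^sub>f fid (Tgt w))) X)) =
     NT (lan_unit D (u \<otimes>\<^sub>f fid (Src w))) ?wX"
    using lan_bc_char[of u w X] by simp
  have "NT (mnt (restr_mor D u \<circ>\<^sub>d lan_mor D u) w) X = FA ?u (inv_arr (dcat D (Tgt u \<otimes> Src w)) ?m)"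
    using mcomp_NT[OF pseudonatural_lan[OF u] pseudonatural_restr[OF u] pd(1) pd(2) pd(1) w, of X] i by (simp add: restr_mor_def)
  thus "Comp (dcat (shift D (Src u)) (Src w)) (NT (lan_unit D (u \<otimes>\<^sub>f fid (Src w))) (FO (dfun (shift D (Src u)) w) X)) (NT (mnt (id_mor (shift D (Src u))) w) X) =
    Comp (dcat (shift D (Src u)) (Src w)) (NT (mnt (restr_mor D u \<circ>\<^sub>d lan_mor D u) w) X) (FA (dfun (shift D (Src u)) w) (NT (lan_unit D (u \<otimes>\<^sub>f fid (Tgt w))) X))"
    using e by (simp add: id_mor_def)
qed

end

section \<open>Right Kan extension along sieves as a morphism of derivators\<close>

context pointed_derivator
begin

definition ran_bc where
  "ran_bc u w = ran_mate D (u \<otimes>\<^sub>f fid (Tgt w)) (u \<otimes>\<^sub>f fid (Src w)) (fid (Src u) \<otimes>\<^sub>f w) (fid (Tgt u) \<otimes>\<^sub>f w) (nid (u \<otimes>\<^sub>f w))"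

lemma ran_bc_simps:
  assumes "isfun u" "isfun w"
  shows "nat_trans (ran_bc u w)" "NSrc (ran_bc u w) = dfun D (fid (Tgt u) \<otimes>\<^sub>f w) \<odot> ran D (u \<otimes>\<^sub>f fid (Tgt w))"
    "NTgt (ran_bc u w) = ran D (u \<otimes>\<^sub>f fid (Src w)) \<odot> dfun D (fid (Src u) \<otimes>\<^sub>f w)"
  unfolding ran_bc_def using assms by (simp_all add: ran_mate_simps(1-3)[OF lan_mate_product_square])

lemma ran_bc_char:
  assumes "isfun u" "isfun w" "X \<in> Obj (dcat D (Src u \<otimes> Tgt w))"
  shows "Comp (dcat D (Src u \<otimes> Src w)) (NT (ran_counit D (u \<otimes>\<^sub>f fid (Src w))) (FO (dfun D (fid (Src u) \<otimes>\<^sub>f w)) X))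
      (FA (dfun D (u \<otimes>\<^sub>f fid (Src w))) (NT (ran_bc u w) X)) =
    FA (dfun D (fid (Src u) \<otimes>\<^sub>f w)) (NT (ran_counit D (u \<otimes>\<^sub>f fid (Tgt w))) X)"
  unfolding ran_bc_def by (rule ran_mate_product_char) fact+

lemma ran_bc_iso:
  assumes "sieve u" "isfun w" "X \<in> Obj (dcat D (Src u \<otimes> Tgt w))"
  shows "iso_arr (dcat D (Tgt u \<otimes> Src w)) (NT (ran_bc u w) X)"
  unfolding ran_bc_def by (rule ran_mate_product_iso) fact+

lemma ran_bc_id:
  assumes [simp]: "isfun u" "A \<in> Cat" "X \<in> Obj (dcat D (Src u \<otimes> A))"
  shows "NT (ran_bc u (fid A)) X = Ident (dcat D (Tgt u \<otimes> A)) (FO (ran D (u \<otimes>\<^sub>f fid A)) X)"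
  by (rule adjunction_eq_right[OF ran_adjunction, of "u \<otimes>\<^sub>f fid A" "FO (ran D (u \<otimes>\<^sub>f fid A)) X" X])
    (use ran_bc_simps[of u "fid A"] ran_bc_char[of u "fid A" X] in simp_all)

lemma ran_bc_comp:
  assumes [simp]: "isfun u" "isfun w" "isfun v" "Tgt w = Src v" "X \<in> Obj (dcat D (Src u \<otimes> Tgt v))"
  shows "NT (ran_bc u (v \<odot> w)) X = Comp (dcat D (Tgt u \<otimes> Src w))
     (NT (ran_bc u w) (FO (dfun D (fid (Src u) \<otimes>\<^sub>f v)) X)) (FA (dfun D (fid (Tgt u) \<otimes>\<^sub>f w)) (NT (ran_bc u v) X))"
proof (rule adjunction_eq_right[OF ran_adjunction, of "u \<otimes>\<^sub>f fid (Src w)"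
    "FO (dfun D (fid (Tgt u) \<otimes>\<^sub>f (v \<odot> w))) (FO (ran D (u \<otimes>\<^sub>f fid (Tgt v))) X)" "FO (dfun D (fid (Src u) \<otimes>\<^sub>f (v \<odot> w))) X"])
  note [simp] = ran_bc_simps
  let ?C = "Comp (dcat D (Src u \<otimes> Src w))" and ?u = "dfun D (u \<otimes>\<^sub>f fid (Src w))" and ?vX = "FO (dfun D (fid (Src u) \<otimes>\<^sub>f v)) X"
    and ?e = "NT (ran_counit D (u \<otimes>\<^sub>f fid (Src w))) (FO (dfun D (fid (Src u) \<otimes>\<^sub>f (v \<odot> w))) X)"
  have 1: "?C ?e (FA ?u (NT (ran_bc u w) ?vX)) = FA (dfun D (fid (Src u) \<otimes>\<^sub>f w)) (NT (ran_counit D (u \<otimes>\<^sub>f fid (Src v))) ?vX)"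
    using ran_bc_char[of u w ?vX] by simp
  have "FA (dfun D (fid (Src u) \<otimes>\<^sub>f w)) (Comp (dcat D (Src u \<otimes> Src v)) (NT (ran_counit D (u \<otimes>\<^sub>f fid (Src v))) ?vX)
      (FA (dfun D (u \<otimes>\<^sub>f fid (Src v))) (NT (ran_bc u v) X))) = FA (dfun D (fid (Src u) \<otimes>\<^sub>f w)) (FA (dfun D (fid (Src u) \<otimes>\<^sub>f v)) (NT (ran_counit D (u \<otimes>\<^sub>f fid (Tgt v))) X))"
    using ran_bc_char[of u v X] by simp
  hence 2: "?C (FA (dfun D (fid (Src u) \<otimes>\<^sub>f w)) (NT (ran_counit D (u \<otimes>\<^sub>f fid (Src v))) ?vX)) (FA (dfun D (u \<otimes>\<^sub>f w)) (NT (ran_bc u v) X)) =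
      FA (dfun D (fid (Src u) \<otimes>\<^sub>f (v \<odot> w))) (NT (ran_counit D (u \<otimes>\<^sub>f fid (Tgt v))) X)" by simp
  have 3: "?C ?e (FA ?u (NT (ran_bc u (v \<odot> w)) X)) = FA (dfun D (fid (Src u) \<otimes>\<^sub>f (v \<odot> w))) (NT (ran_counit D (u \<otimes>\<^sub>f fid (Tgt v))) X)"
    using ran_bc_char[of u "v \<odot> w" X] by simp
  have 4: "?C ?e (?C (FA ?u (NT (ran_bc u w) ?vX)) (FA (dfun D (u \<otimes>\<^sub>f w)) (NT (ran_bc u v) X))) =
     ?C (FA (dfun D (fid (Src u) \<otimes>\<^sub>f w)) (NT (ran_counit D (u \<otimes>\<^sub>f fid (Src v))) ?vX)) (FA (dfun D (u \<otimes>\<^sub>f w)) (NT (ran_bc u v) X))"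
    by (rule Comp_eq_extend1[OF _ 1]) simp_all
  show "Comp (Tgt (dfun D (u \<otimes>\<^sub>f fid (Src w)))) ?e (FA ?u (NT (ran_bc u (v \<odot> w)) X)) =
    Comp (Tgt (dfun D (u \<otimes>\<^sub>f fid (Src w)))) ?e (FA ?u (Comp (dcat D (Tgt u \<otimes> Src w)) (NT (ran_bc u w) ?vX) (FA (dfun D (fid (Tgt u) \<otimes>\<^sub>f w)) (NT (ran_bc u v) X))))"
    using 2 3 4 by simp
qed (simp_all add: ran_bc_simps)

lemma ran_bc_nat:
  assumes b [simp]: "isfun u" "isnt \<beta>" "X \<in> Obj (dcat D (Src u \<otimes> Tgt (NSrc \<beta>)))"
  shows "Comp (dcat D (Tgt u \<otimes> Src (NSrc \<beta>)))
      (FA (ran D (u \<otimes>\<^sub>f fid (Src (NSrc \<beta>)))) (NT (dnt D (nid (fid (Src u)) \<otimes>\<^sub>n \<beta>)) X)) (NT (ran_bc u (NSrc \<beta>)) X) =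
    Comp (dcat D (Tgt u \<otimes> Src (NSrc \<beta>))) (NT (ran_bc u (NTgt \<beta>)) X)
      (NT (dnt D (nid (fid (Tgt u)) \<otimes>\<^sub>n \<beta>)) (FO (ran D (u \<otimes>\<^sub>f fid (Tgt (NSrc \<beta>)))) X))"
proof -
  let ?S = "Src (NSrc \<beta>)" and ?T = "Tgt (NSrc \<beta>)" and ?w = "NSrc \<beta>" and ?w' = "NTgt \<beta>"
  note [simp] = ran_bc_simps
  let ?C = "Comp (dcat D (Src u \<otimes> ?S))" and ?u = "dfun D (u \<otimes>\<^sub>f fid ?S)"
  let ?e = "\<lambda>Y. NT (ran_counit D (u \<otimes>\<^sub>f fid ?S)) Y"
  let ?Z = "FO (ran D (u \<otimes>\<^sub>f fid ?T)) X" and ?x = "NT (dnt D (nid (fid (Src u)) \<otimes>\<^sub>n \<beta>)) X"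
  let ?wX = "FO (dfun D (fid (Src u) \<otimes>\<^sub>f ?w)) X" and ?w'X = "FO (dfun D (fid (Src u) \<otimes>\<^sub>f ?w')) X"
  show ?thesis
  proof (rule adjunction_eq_right[OF ran_adjunction, of "u \<otimes>\<^sub>f fid ?S" "FO (dfun D (fid (Tgt u) \<otimes>\<^sub>f ?w)) ?Z" ?w'X])
    have 1: "?C (?e ?w'X) (FA ?u (FA (ran D (u \<otimes>\<^sub>f fid ?S)) ?x)) = ?C ?x (?e ?wX)"
      using NT_naturality[of "ran_counit D (u \<otimes>\<^sub>f fid ?S)" "dcat D (Src u \<otimes> ?S)" ?x ?w'X] by simp
    have 2: "?C (?e ?w'X) (FA ?u (NT (ran_bc u ?w') X)) = FA (dfun D (fid (Src u) \<otimes>\<^sub>f ?w')) (NT (ran_counit D (u \<otimes>\<^sub>f fid ?T)) X)"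
      using ran_bc_char[of u ?w' X] by simp
    have 3: "?C (?e ?wX) (FA ?u (NT (ran_bc u ?w) X)) = FA (dfun D (fid (Src u) \<otimes>\<^sub>f ?w)) (NT (ran_counit D (u \<otimes>\<^sub>f fid ?T)) X)"
      using ran_bc_char[of u ?w X] by simp
    have 4: "?C ?x (FA (dfun D (fid (Src u) \<otimes>\<^sub>f ?w)) (NT (ran_counit D (u \<otimes>\<^sub>f fid ?T)) X)) =
       ?C (FA (dfun D (fid (Src u) \<otimes>\<^sub>f ?w')) (NT (ran_counit D (u \<otimes>\<^sub>f fid ?T)) X)) (NT (dnt D (nid u \<otimes>\<^sub>n \<beta>)) ?Z)"
      using NT_dnt_natural[of "nid (fid (Src u)) \<otimes>\<^sub>n \<beta>" "NT (ran_counit D (u \<otimes>\<^sub>f fid ?T)) X" "Src u \<otimes> ?S"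
          "FO (dfun D (u \<otimes>\<^sub>f fid ?T)) ?Z" X] by simp
    have "?C (?e ?w'X) (?C (FA ?u (FA (ran D (u \<otimes>\<^sub>f fid ?S)) ?x)) (FA ?u (NT (ran_bc u ?w) X))) =
       ?C ?x (?C (?e ?wX) (FA ?u (NT (ran_bc u ?w) X)))"
      by (rule Comp_eq_extend[OF _ 1]) simp_all
    moreover have "?C (?e ?w'X) (?C (FA ?u (NT (ran_bc u ?w') X)) (NT (dnt D (nid u \<otimes>\<^sub>n \<beta>)) ?Z)) =
       ?C (FA (dfun D (fid (Src u) \<otimes>\<^sub>f ?w')) (NT (ran_counit D (u \<otimes>\<^sub>f fid ?T)) X)) (NT (dnt D (nid u \<otimes>\<^sub>n \<beta>)) ?Z)"
      by (rule Comp_eq_extend1[OF _ 2]) simp_all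
    ultimately show "Comp (Tgt (dfun D (u \<otimes>\<^sub>f fid ?S))) (?e ?w'X) (FA ?u (Comp (dcat D (Tgt u \<otimes> ?S)) (FA (ran D (u \<otimes>\<^sub>f fid ?S)) ?x) (NT (ran_bc u ?w) X))) =
      Comp (Tgt (dfun D (u \<otimes>\<^sub>f fid ?S))) (?e ?w'X) (FA ?u (Comp (dcat D (Tgt u \<otimes> ?S)) (NT (ran_bc u ?w') X) (NT (dnt D (nid (fid (Tgt u)) \<otimes>\<^sub>n \<beta>)) ?Z)))"
      by (simp add: 3 4)
  qed simp_all
qed

lemma ran_mor_simps: "mfun (ran_mor D u) C = ran D (u \<otimes>\<^sub>f fid C)" "mnt (ran_mor D u) w = ran_bc u w"
  by (simp_all add: ran_mor_def ran_bc_def)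

lemma pseudonatural_ran:
  assumes s: "sieve u"
  shows "pseudonatural (shift D (Src u)) (shift D (Tgt u)) (ran_mor D u)"
proof (rule pseudonaturalI)
  note [simp] = ran_mor_simps ran_bc_simps
  have [simp]: "isfun u" using s by (simp add: sieve_def)
  show "prederivator (shift D (Src u))" "prederivator (shift D (Tgt u))" by (simp_all add: prederivator_shift_D)
qed (use s in \<open>simp_all add: sieve_def ran_mor_simps ran_bc_simps ran_bc_iso ran_bc_id ran_bc_comp ran_bc_nat\<close>)

text \<open>For u_* the base change map itself is the structure, so the compatibility of the counit
  is \<open>ran_bc_char\<close>.\<close>

lemma modification_ran_counit:
  assumes s: "sieve u"
  shows "modification (shift D (Src u)) (shift D (Src u)) (restr_mor D u \<circ>\<^sub>d ran_mor D u) (id_mor (shift D (Src u)))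
    (\<lambda>C. ran_counit D (u \<otimes>\<^sub>f fid C))"
proof (rule modificationI)
  have u [simp]: "isfun u" using s by (simp add: sieve_def)
  note pd = prederivator_shift_D[of "Src u"] prederivator_shift_D[of "Tgt u"]
  show "prederivator (shift D (Src u))" "prederivator (shift D (Src u))" using pd by simp_all
  show "pseudonatural (shift D (Src u)) (shift D (Src u)) (id_mor (shift D (Src u)))" by (rule pseudonatural_id_mor) (simp add: pd)
  show "pseudonatural (shift D (Src u)) (shift D (Src u)) (restr_mor D u \<circ>\<^sub>d ran_mor D u)"
    by (rule pseudonatural_mcomp[OF pseudonatural_ran[OF s] pseudonatural_restr[OF u]]) (simp_all add: pd)
  note [simp] = ran_bc_simps ran_mor_simps
  show "nat_trans (ran_counit D (u \<otimes>\<^sub>f fid A)) \<and> NSrc (ran_counit D (u \<otimes>\<^sub>f fid A)) = mfun (restr_mor D u \<circ>\<^sub>d ran_mor D u) A \<and>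
    NTgt (ran_counit D (u \<otimes>\<^sub>f fid A)) = mfun (id_mor (shift D (Src u))) A" if "A \<in> Cat" for A
    using that by (simp add: id_mor_def restr_mor_def)
  fix w X assume w [simp]: "isfun w" and "X \<in> Obj (dcat (shift D (Src u)) (Tgt w))"
  hence X [simp]: "X \<in> Obj (dcat D (Src u \<otimes> Tgt w))" by simp
  have "NT (mnt (restr_mor D u \<circ>\<^sub>d ran_mor D u) w) X = FA (dfun D (u \<otimes>\<^sub>f fid (Src w))) (NT (ran_bc u w) X)"
    using mcomp_NT[OF pseudonatural_ran[OF s] pseudonatural_restr[OF u] pd(1) pd(2) pd(1) w, of X] by (simp add: restr_mor_def)
  thus "Comp (dcat (shift D (Src u)) (Src w)) (NT (ran_counit D (u \<otimes>\<^sub>f fid (Src w))) (FO (dfun (shift D (Src u)) w) X)) (NT (mnt (restr_mor D u \<circ>\<^sub>d ran_mor D u) w) X) =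
    Comp (dcat (shift D (Src u)) (Src w)) (NT (mnt (id_mor (shift D (Src u))) w) X) (FA (dfun (shift D (Src u)) w) (NT (ran_counit D (u \<otimes>\<^sub>f fid (Tgt w))) X))"
    using ran_bc_char[of u w X] by (simp add: id_mor_def)
qed

end

section \<open>Cubes\<close>

lemma b0_neq_b1 [simp]: "b0 \<noteq> b1" "b1 \<noteq> b0"
  by (simp_all add: b0_def b1_def)

lemma ble_simps [simp]: "ble b0 y" "ble x b1" "ble b1 b0 \<longleftrightarrow> False" "ble b1 y \<longleftrightarrow> y = b1" "ble x b0 \<longleftrightarrow> x = b0"
  by (auto simp: ble_def)

lemma ble_trans: "ble x y \<Longrightarrow> ble y z \<Longrightarrow> ble x z"
  by (auto simp: ble_def)

lemma category_arrow: "category arrow_cat"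
  unfolding arrow_cat_def by (rule category_poset_cat) (auto intro: ble_trans)

lemma Cat_arrow [simp]: "arrow_cat \<in> Cat"
  using category_arrow unfolding arrow_cat_def by (rule Cat_poset_cat) simp

lemma Obj_arrow [simp]: "Obj arrow_cat = {b0, b1}"
  by (simp add: arrow_cat_def)

lemma cube_le_refl: "x \<in> cube_pts n \<Longrightarrow> cube_le x x"
  by (auto simp: cube_le_def cube_pts_def list_all2_same)

lemma cube_le_trans: "cube_le x y \<Longrightarrow> cube_le y z \<Longrightarrow> cube_le x z"
  unfolding cube_le_def by (rule list_all2_trans[of ble ble ble]) (auto intro: ble_trans)

lemma finite_cube_pts: "finite (cube_pts n :: 'a el set)"
proof -
  have "(cube_pts n :: 'a el set) = Tup ` {xs. set xs \<subseteq> {b0, b1} \<and> length xs = n}" by (auto simp: cube_pts_def)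
  thus ?thesis using finite_lists_length_eq[of "{b0, b1} :: 'a el set" n] by simp
qed

lemma category_cube_sub: "P \<subseteq> cube_pts n \<Longrightarrow> category (poset_cat P cube_le)"
  by (rule category_poset_cat) (auto intro: cube_le_trans cube_le_refl)

lemma Cat_cube [simp]: "cube n \<in> Cat"
  unfolding cube_def by (rule Cat_poset_cat) (auto intro: category_cube_sub finite_cube_pts)

lemma Cat_corner [simp]: "corner \<in> Cat"
  unfolding corner_def by (rule Cat_poset_cat) (auto intro: category_cube_sub[of _ 2] finite_cube_pts)

lemma Obj_cube [simp]: "Obj (cube n) = cube_pts n"
  by (simp add: cube_def)

lemma Obj_corner [simp]: "Obj corner = cube_pts 2 - {Tup [b1, b1]}"
  by (simp add: corner_def)

lemma cube_pts_2: "x \<in> cube_pts 2 \<longleftrightarrow> (\<exists>a b. x = Tup [a, b] \<and> a \<in> {b0, b1} \<and> b \<in> {b0, b1})"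
  by (auto simp: cube_pts_def length_Suc_conv numeral_2_eq_2)

lemma cube_le_2 [simp]: "cube_le (Tup [a, b]) (Tup [c, d]) \<longleftrightarrow> ble a c \<and> ble b d"
  by (simp add: cube_le_def)

lemma isfun_to_poset:
  assumes "A \<in> Cat" "poset_cat Q le' \<in> Cat" "A = poset_cat P le" "\<And>x. x \<in> P \<Longrightarrow> \<phi> x \<in> Q"
    "\<And>x y. x \<in> P \<Longrightarrow> y \<in> P \<Longrightarrow> le x y \<Longrightarrow> le' (\<phi> x) (\<phi> y)"
  shows "isfun (to_poset A (poset_cat Q le') \<phi>)"
proof (rule isfunI)
  show "cat_functor (to_poset A (poset_cat Q le') \<phi>)"
    by (rule cat_functor_to_poset) (use assms in \<open>auto elim!: Arr_poset_catE\<close>)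
qed (use assms in simp_all)

lemma isfun_arrow_to_poset:
  assumes "poset_cat Q le \<in> Cat" "\<phi> b0 \<in> Q" "\<phi> b1 \<in> Q" "le (\<phi> b0) (\<phi> b1)"
  shows "isfun (to_poset arrow_cat (poset_cat Q le) \<phi>)"
proof (rule isfun_to_poset[OF Cat_arrow assms(1) arrow_cat_def])
  have r: "le x x" if "x \<in> Q" for x
    using category.Ident_Arr[OF Cat_category[OF assms(1)], of x] that by simp
  show "\<phi> x \<in> Q" if "x \<in> {b0, b1}" for x using that assms by auto
  show "le (\<phi> x) (\<phi> y)" if "x \<in> {b0, b1}" "y \<in> {b0, b1}" "ble x y" for x y
    using that assms r by (auto simp: ble_def)
qed

lemma isnt_poset_nt:
  assumes "isfun F" "isfun G" "Src F = Src G" "Tgt F = poset_cat P le" "Tgt G = poset_cat P le"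
    "\<And>x. x \<in> Obj (Src G) \<Longrightarrow> le (FO F x) (FO G x)"
  shows "isnt (poset_nt F G)"
  by (rule isntI) (use nat_trans_poset_nt[of F G P le] assms in simp_all)

text \<open>Between posets the triangle identities are automatic; only the section property and the
  unit inequality have to be checked.\<close>

lemma reflection_poset:
  assumes l: "isfun l" "isfun s" "Src s = Tgt l" "Tgt s = Src l" "Src l = poset_cat P le" "Tgt l = poset_cat Q le'"
    "\<And>a. a \<in> Q \<Longrightarrow> FO l (FO s a) = a" "\<And>x. x \<in> P \<Longrightarrow> le x (FO s (FO l x))"
  shows "reflection l s (poset_nt (fid (Src l)) (s \<odot> l))"
proof -
  have [simp]: "poset_cat P le \<in> Cat" "poset_cat Q le' \<in> Cat" using isfunD(2,3)[OF l(1)] l(5,6) by simp_all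
  have n [simp]: "isnt (poset_nt (fid (Src l)) (s \<odot> l))" by (rule isnt_poset_nt[of _ _ P le]) (use l in simp_all)
  have ls [simp]: "l \<odot> s = fid (Tgt l)" by (rule cfun_poset_eqI[of _ _ Q le']) (use l in simp_all)
  have "l \<odot> (s \<odot> l) = (l \<odot> s) \<odot> l" "(s \<odot> l) \<odot> s = s \<odot> (l \<odot> s)" using l by (simp_all add: fcomp_assoc del: ls)
  hence e [simp]: "l \<odot> (s \<odot> l) = l" "(s \<odot> l) \<odot> s = s" using l by simp_all
  have "l \<rhd> poset_nt (fid (Src l)) (s \<odot> l) = nid l" by (rule ntr_poset_eqI[of _ _ Q le']) (use l n in simp_all)
  moreover have "poset_nt (fid (Src l)) (s \<odot> l) \<lhd> s = nid s" by (rule ntr_poset_eqI[of _ _ P le]) (use l n in simp_all)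
  ultimately show ?thesis unfolding reflection_def using l n by simp
qed

lemma coreflection_poset:
  assumes l: "isfun r" "isfun s" "Src s = Tgt r" "Tgt s = Src r" "Src r = poset_cat P le" "Tgt r = poset_cat Q le'"
    "\<And>a. a \<in> Q \<Longrightarrow> FO r (FO s a) = a" "\<And>x. x \<in> P \<Longrightarrow> le (FO s (FO r x)) x"
  shows "coreflection r s (poset_nt (s \<odot> r) (fid (Src r)))"
proof -
  have [simp]: "poset_cat P le \<in> Cat" "poset_cat Q le' \<in> Cat" using isfunD(2,3)[OF l(1)] l(5,6) by simp_all
  have n [simp]: "isnt (poset_nt (s \<odot> r) (fid (Src r)))" by (rule isnt_poset_nt[of _ _ P le]) (use l in simp_all)
  have ls [simp]: "r \<odot> s = fid (Tgt r)" by (rule cfun_poset_eqI[of _ _ Q le']) (use l in simp_all)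
  have "r \<odot> (s \<odot> r) = (r \<odot> s) \<odot> r" "(s \<odot> r) \<odot> s = s \<odot> (r \<odot> s)" using l by (simp_all add: fcomp_assoc del: ls)
  hence e [simp]: "r \<odot> (s \<odot> r) = r" "(s \<odot> r) \<odot> s = s" using l by simp_all
  have "r \<rhd> poset_nt (s \<odot> r) (fid (Src r)) = nid r" by (rule ntr_poset_eqI[of _ _ Q le']) (use l n in simp_all)
  moreover have "poset_nt (s \<odot> r) (fid (Src r)) \<lhd> s = nid s" by (rule ntr_poset_eqI[of _ _ P le]) (use l n in simp_all)
  ultimately show ?thesis unfolding coreflection_def using l n by simp
qed

lemma fully_faithful_poset:
  assumes u: "isfun u" "Src u = poset_cat P le" "Tgt u = poset_cat Q le'"
    and r: "\<And>x y. x \<in> P \<Longrightarrow> y \<in> P \<Longrightarrow> le' (FO u x) (FO u y) \<Longrightarrow> le x y"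
  shows "fully_faithful u"
  unfolding fully_faithful_def
proof (intro ballI)
  fix a a' g assume a: "a \<in> Obj (Src u)" "a' \<in> Obj (Src u)" and g: "g \<in> hom (Tgt u) (FO u a) (FO u a')"
  have gg: "g \<in> Arr (poset_cat Q le')" "g = Tup [FO u a, FO u a']"
    using g Arr_poset_cat_eq[of g Q le'] u by auto
  hence le: "le a a'" using r a u by simp
  have "Tup [a, a'] \<in> Arr (Src u)" using le a u by simp
  moreover from this have "FA u (Tup [a, a']) = Tup [FO u a, FO u a']"
    using Arr_poset_cat_eq[of "FA u (Tup [a, a'])" Q le'] u le a FA_simps[of u "poset_cat Q le'" "Tup [a, a']"] by simp
  moreover have "h = Tup [a, a']" if "h \<in> hom (Src u) a a'" for h
    using that Arr_poset_cat_eq[of h P le] u by auto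
  ultimately show "\<exists>!h. h \<in> hom (Src u) a a' \<and> FA u h = g"
    using gg le a u by (intro ex1I[of _ "Tup [a, a']"]) auto
qed

subsection \<open>Edges of the square\<close>

lemma isfun_corner_incl [simp]: "isfun corner_incl"
  unfolding corner_incl_def cube_def
  by (rule isfun_to_poset[OF Cat_corner _ corner_def]) (auto simp flip: cube_def)

lemma isfun_corner_arrow [simp]: "isfun corner_arrow"
  unfolding corner_arrow_def corner_def
  by (rule isfun_arrow_to_poset) (auto simp: cube_pts_2 simp flip: corner_def)

lemma corner_simps [simp]: "Src corner_incl = corner" "Tgt corner_incl = cube 2" "Src corner_arrow = arrow_cat" "Tgt corner_arrow = corner"
  "x \<in> Obj corner \<Longrightarrow> FO corner_incl x = x" "x \<in> {b0, b1} \<Longrightarrow> FO corner_arrow x = Tup [x, b0]"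
  by (simp_all add: corner_incl_def corner_arrow_def)

lemma fully_faithful_corner_incl [simp]: "fully_faithful corner_incl"
  by (rule fully_faithful_poset[where P = "cube_pts 2 - {Tup [b1, b1]}" and Q = "cube_pts 2" and le = cube_le and le' = cube_le])
    (simp_all, simp_all add: corner_def cube_def)

text \<open>The first coordinate runs along f : x -> y and the second along its cofiber: the
  vertices (0,0), (1,0), (0,1), (1,1) carry x, y, 0 and Cf. Thus the top edge is f, and
  \<open>cof_edge\<close> is y -> Cf.\<close>

definition top_edge :: "'u sfun" where
  "top_edge = to_poset arrow_cat (cube 2) (\<lambda>x. Tup [x, b0])"

definition diag_edge :: "'u sfun" where
  "diag_edge = to_poset arrow_cat (cube 2) (\<lambda>x. Tup [x, x])"

definition bottom_edge :: "'u sfun" where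
  "bottom_edge = to_poset arrow_cat (cube 2) (\<lambda>x. Tup [x, b1])"

lemma isfun_edges [simp]: "isfun top_edge" "isfun diag_edge" "isfun bottom_edge" "isfun cof_edge"
  unfolding top_edge_def diag_edge_def bottom_edge_def cof_edge_def cube_def
  by (rule isfun_arrow_to_poset; simp add: cube_pts_2 flip: cube_def)+

lemma edge_simps [simp]: "Src top_edge = arrow_cat" "Tgt top_edge = cube 2" "Src diag_edge = arrow_cat" "Tgt diag_edge = cube 2"
  "Src bottom_edge = arrow_cat" "Tgt bottom_edge = cube 2" "Src cof_edge = arrow_cat" "Tgt cof_edge = cube 2"
  "x \<in> {b0, b1} \<Longrightarrow> FO top_edge x = Tup [x, b0]" "x \<in> {b0, b1} \<Longrightarrow> FO diag_edge x = Tup [x, x]"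
  "x \<in> {b0, b1} \<Longrightarrow> FO bottom_edge x = Tup [x, b1]" "x \<in> {b0, b1} \<Longrightarrow> FO cof_edge x = Tup [b1, x]"
  by (simp_all add: top_edge_def diag_edge_def bottom_edge_def cof_edge_def)

lemma corner_incl_arrow [simp]: "corner_incl \<odot> corner_arrow = top_edge"
  by (rule cfun_poset_eqI[of _ _ "cube_pts 2" cube_le]) (auto simp: cube_pts_2, simp_all add: cube_def)

text \<open>Such an edge ends at (1,1), so it restricts the cofiber square to an arrow with target
  Cf. The three edges used below differ only at the source, which is (0,0), (0,1) or (1,0).\<close>

definition square_edge :: "'u sfun \<Rightarrow> bool" where
  "square_edge e \<longleftrightarrow> isfun e \<and> Src e = arrow_cat \<and> Tgt e = cube 2 \<and> cube_le (Tup [b1, b0]) (FO e b1) \<and> FO e b1 = Tup [b1, b1]"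

lemma square_edgeD:
  assumes "square_edge e"
  shows "isfun e" "Src e = arrow_cat" "Tgt e = cube 2" "FO e b1 = Tup [b1, b1]"
  using assms by (simp_all add: square_edge_def)

lemma square_edges [simp]: "square_edge diag_edge" "square_edge bottom_edge" "square_edge cof_edge"
  by (simp_all add: square_edge_def)

lemma isnt_edge:
  assumes "isfun e" "isfun e'" "Src e = arrow_cat" "Tgt e = cube 2" "Src e' = arrow_cat" "Tgt e' = cube 2"
    "cube_le (FO e b0) (FO e' b0)" "cube_le (FO e b1) (FO e' b1)"
  shows "isnt (poset_nt e e')"
  by (rule isnt_poset_nt[of _ _ "cube_pts 2" cube_le]) (use assms in \<open>auto simp: cube_def\<close>)

lemma isnt_top_edge [simp]: "square_edge e \<Longrightarrow> isnt (poset_nt top_edge e)"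
proof -
  assume e: "square_edge e"
  have "FO e b0 \<in> cube_pts 2" using e FO_Obj'[of e "cube 2" b0] by (simp add: square_edge_def)
  then obtain a b where "FO e b0 = Tup [a, b]" by (auto simp: cube_pts_2)
  thus ?thesis using e by (intro isnt_edge) (auto simp: square_edge_def)
qed

text \<open>Left adjoint of \<open>bottom_edge\<close> as a map of posets. Maps from the bottom edge
  of a square Q to g are thus maps from Q to the square that repeats g in the second
  direction.\<close>

definition square_proj :: "'u sfun" where
  "square_proj = to_poset (cube 2) arrow_cat (\<lambda>x. pr 0 x)"

lemma isfun_square_proj [simp]: "isfun square_proj"
  unfolding square_proj_def arrow_cat_def
  by (rule isfun_to_poset[OF Cat_cube _ cube_def]) (auto simp: cube_pts_2 simp flip: arrow_cat_def)

lemma square_proj_simps [simp]: "Src square_proj = cube 2" "Tgt square_proj = arrow_cat"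
  "x \<in> cube_pts 2 \<Longrightarrow> FO square_proj x = pr 0 x"
  by (simp_all add: square_proj_def)

definition square_unit :: "'u snt" where
  "square_unit = poset_nt (fid (cube 2)) (bottom_edge \<odot> square_proj)"

lemma square_reflection: "reflection square_proj bottom_edge square_unit"
proof -
  have "reflection square_proj bottom_edge (poset_nt (fid (Src square_proj)) (bottom_edge \<odot> square_proj))"
    by (rule reflection_poset[where P = "cube_pts 2" and le = cube_le and Q = "{b0, b1}" and le' = ble])
      (auto simp: cube_pts_2, simp_all add: cube_def arrow_cat_def)
  thus ?thesis by (simp add: square_unit_def)
qed

lemma square_proj_top [simp]: "square_proj \<odot> top_edge = fid arrow_cat"
  by (rule cfun_poset_eqI[of _ _ "{b0, b1}" ble]) (auto simp: cube_pts_2, simp_all add: arrow_cat_def)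

lemma isnt_square_unit [simp]: "isnt square_unit"
  unfolding square_unit_def
  by (rule isnt_poset_nt[where P = "cube_pts 2" and le = cube_le]) (auto simp: cube_pts_2, simp_all add: cube_def)

lemma square_unit_simps [simp]: "NSrc square_unit = fid (cube 2)" "NTgt square_unit = bottom_edge \<odot> square_proj"
  by (simp_all add: square_unit_def)

lemma square_unit_top: "square_unit \<lhd> top_edge = poset_nt top_edge bottom_edge"
proof -
  show ?thesis
    by (rule ntr_poset_eqI[of _ _ "cube_pts 2" cube_le]) (simp_all add: fcomp_assoc, simp add: cube_def)
qed

section \<open>The cofiber square and its universal property\<close>

context pointed_derivator
begin

text \<open>The only vertex of the corner off the image is (0,1), and nothing leads from it to a
  vertex with second coordinate 0. Right Kan extension along \<open>corner_arrow\<close> therefore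
  inserts the zero object at (0,1).\<close>

lemma sieve_corner_arrow [simp]: "sieve corner_arrow"
  unfolding sieve_def
proof (intro conjI ballI)
  show "fully_faithful corner_arrow"
    by (rule fully_faithful_poset[where P = "{b0, b1}" and le = ble and Q = "cube_pts 2 - {Tup [b1, b1]}" and le' = cube_le])
      (auto, simp_all add: arrow_cat_def corner_def)
  fix b assume "b \<in> Obj (Tgt corner_arrow)"
  then consider "b = Tup [b0, b0]" | "b = Tup [b1, b0]" | "b = Tup [b0, b1]" by (auto simp: cube_pts_2)
  thus "b \<in> FO corner_arrow ` Obj (Src corner_arrow) \<or> (\<forall>a\<in>Obj (Src corner_arrow). hom (Tgt corner_arrow) b (FO corner_arrow a) = {})"
  proof cases
    case 3
    have "f \<notin> hom corner b (Tup [x, b0])" for x f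
    proof
      assume f: "f \<in> hom corner b (Tup [x, b0])"
      hence "f \<in> Arr (poset_cat (cube_pts 2 - {Tup [b1, b1]}) cube_le)" by (simp add: corner_def)
      then obtain p q where pq: "f = Tup [p, q]" "p \<in> cube_pts 2 - {Tup [b1, b1]}" "q \<in> cube_pts 2 - {Tup [b1, b1]}" "cube_le p q"
        by (rule Arr_poset_catE)
      have "p = b" "q = Tup [x, b0]" using f pq(1) poset_cat_simps(3,4)[of p "cube_pts 2 - {Tup [b1, b1]}" q cube_le, OF pq(2-4)]
        by (simp_all only: hom_iff corner_def)
      thus False using pq(4) 3 by simp
    qed
    hence "hom corner b (Tup [x, b0]) = {}" for x by blast
    thus ?thesis by auto
  qed auto
qed simp

lemma sieve_corner_arrow_prod [simp]: "C \<in> Cat \<Longrightarrow> sieve (corner_arrow \<otimes>\<^sub>f fid C)"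
  by (simp add: sieve_prod)

lemma fully_faithful_corner_incl_prod [simp]: "C \<in> Cat \<Longrightarrow> fully_faithful (corner_incl \<otimes>\<^sub>f fid C)"
  by (simp add: fully_faithful_prod)

text \<open>An object \<open>Y\<close> vanishing off the image is u_*u^*Y by
  \<open>sieve_ran_unit_iso\<close>, so maps Z -> Y correspond to maps u^*Z -> u^*Y.\<close>

lemma sieve_dfun_ff:
  assumes u: "sieve u" and Y: "Y \<in> Obj (dcat D (Tgt u))" and Z: "Z \<in> Obj (dcat D (Tgt u))"
    and v: "\<And>b. b \<in> Obj (Tgt u) \<Longrightarrow> b \<notin> FO u ` Obj (Src u) \<Longrightarrow> vanish (Tgt u) b Y"
  shows "m \<in> hom (dcat D (Src u)) (FO (dfun D u) Z) (FO (dfun D u) Y) \<Longrightarrow> \<exists>k. k \<in> hom (dcat D (Tgt u)) Z Y \<and> FA (dfun D u) k = m"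
    and "k \<in> hom (dcat D (Tgt u)) Z Y \<Longrightarrow> k' \<in> hom (dcat D (Tgt u)) Z Y \<Longrightarrow> FA (dfun D u) k = FA (dfun D u) k' \<Longrightarrow> k = k'"
proof -
  have f [simp]: "isfun u" using u by (simp add: sieve_def)
  note [simp] = Y Z
  let ?A = "dcat D (Src u)" and ?B = "dcat D (Tgt u)" and ?n = "NT (ran_unit D u) Y" and ?e = "NT (ran_counit D u) (FO (dfun D u) Y)"
  note adj = ran_adjunction[OF f]
  have i: "iso_arr ?B ?n" by (rule sieve_ran_unit_iso[OF u Y v])
  have t: "Comp ?A ?e (FA (dfun D u) (Comp ?B ?n k)) = FA (dfun D u) k" if k: "k \<in> hom ?B Z Y" for k
  proof -
    have "Comp ?A ?e (Comp ?A (FA (dfun D u) ?n) (FA (dfun D u) k)) = Comp ?A (Ident ?A (FO (dfun D u) Y)) (FA (dfun D u) k)"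
      by (rule Comp_eq_extend1) (use adjunction_triangles(1)[OF adj, of Y] k in simp_all)
    thus ?thesis using k by simp
  qed
  show "\<exists>k. k \<in> hom ?B Z Y \<and> FA (dfun D u) k = m" if m: "m \<in> hom ?A (FO (dfun D u) Z) (FO (dfun D u) Y)"
  proof -
    let ?t = "Comp ?B (FA (ran D u) m) (NT (ran_unit D u) Z)"
    have et: "Comp ?A ?e (FA (dfun D u) ?t) = m"
      using adjunction_transpose(2)[OF adj, of Z "FO (dfun D u) Y" m] m by simp
    let ?k = "Comp ?B (inv_arr ?B ?n) ?t"
    have k: "?k \<in> hom ?B Z Y" using i m by simp
    have "Comp ?B ?n ?k = ?t" using i m by simp
    hence "FA (dfun D u) ?k = m" using t[OF k] et by simp
    thus ?thesis using k by blast
  qed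
  show "k = k'" if k: "k \<in> hom ?B Z Y" "k' \<in> hom ?B Z Y" and e: "FA (dfun D u) k = FA (dfun D u) k'"
  proof -
    have "Comp ?B ?n k = Comp ?B ?n k'"
      by (rule adjunction_eq_right[OF adj, of Z "FO (dfun D u) Y"]) (use k e t[OF k(1)] t[OF k(2)] in simp_all)
    thus "k = k'" using iso_arr_mono[OF _ i] k by simp
  qed
qed

definition ext_obj :: "'u scat \<Rightarrow> 'o \<Rightarrow> 'o" where
  "ext_obj C X = FO (ran D (corner_arrow \<otimes>\<^sub>f fid C)) X"

definition sq_obj :: "'u scat \<Rightarrow> 'o \<Rightarrow> 'o" where
  "sq_obj C X = FO (lan D (corner_incl \<otimes>\<^sub>f fid C)) (ext_obj C X)"

text \<open>The domain is the restricted extension of \<open>X\<close> instead of \<open>X\<close>.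
  The two are isomorphic by a counit, which is inverted only where needed, so that this arrow is a
  plain composite of a unit and a 2-cell.\<close>

definition edge_arr :: "'u sfun \<Rightarrow> 'u scat \<Rightarrow> 'o \<Rightarrow> 'm" where
  "edge_arr e C X = Comp (dcat D (arrow_cat \<otimes> C)) (NT (dnt D (poset_nt top_edge e \<otimes>\<^sub>n nid (fid C))) (sq_obj C X))
     (FA (dfun D (corner_arrow \<otimes>\<^sub>f fid C)) (NT (lan_unit D (corner_incl \<otimes>\<^sub>f fid C)) (ext_obj C X)))"

lemma ext_obj_simps [simp]: "C \<in> Cat \<Longrightarrow> X \<in> Obj (dcat D (arrow_cat \<otimes> C)) \<Longrightarrow> ext_obj C X \<in> Obj (dcat D (corner \<otimes> C))"
  by (simp add: ext_obj_def)

lemma sq_obj_simps [simp]: "C \<in> Cat \<Longrightarrow> X \<in> Obj (dcat D (arrow_cat \<otimes> C)) \<Longrightarrow> sq_obj C X \<in> Obj (dcat D (cube 2 \<otimes> C))"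
  by (simp add: sq_obj_def)

lemma edge_arr_hom [simp]:
  assumes [simp]: "square_edge e" "C \<in> Cat" "X \<in> Obj (dcat D (arrow_cat \<otimes> C))"
  shows "edge_arr e C X \<in> Arr (dcat D (arrow_cat \<otimes> C))"
    "Dom (dcat D (arrow_cat \<otimes> C)) (edge_arr e C X) = FO (dfun D (corner_arrow \<otimes>\<^sub>f fid C)) (ext_obj C X)"
    "Cod (dcat D (arrow_cat \<otimes> C)) (edge_arr e C X) = FO (dfun D (e \<otimes>\<^sub>f fid C)) (sq_obj C X)"
  using square_edgeD[OF assms(1)] by (simp_all add: edge_arr_def sq_obj_def[symmetric])

text \<open>The extension inserts zero at (0,1), and left Kan extension along the fully faithful
  \<open>corner_incl\<close> leaves the values on the corner unchanged.\<close>

lemma sq_obj_vanish: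
  assumes [simp]: "C \<in> Cat" "X \<in> Obj (dcat D (arrow_cat \<otimes> C))" "c \<in> Obj C"
  shows "vanish (cube 2 \<otimes> C) (Tup [Tup [b0, b1], c]) (sq_obj C X)"
proof -
  let ?c = "corner_incl \<otimes>\<^sub>f fid C" and ?p = "Tup [Tup [b0, b1], c]"
  have [simp]: "Tup [b0, b1] \<in> cube_pts 2" by (simp add: cube_pts_2)
  have "vanish (corner \<otimes> C) ?p (ext_obj C X)"
  proof -
    have "?p \<notin> FO (corner_arrow \<otimes>\<^sub>f fid C) ` Obj (arrow_cat \<otimes> C)" by (auto elim!: Obj_prodE)
    thus ?thesis unfolding ext_obj_def using sieve_ran_vanish[of "corner_arrow \<otimes>\<^sub>f fid C" X ?p] by simp
  qed
  hence "vanish (corner \<otimes> C) ?p (FO (dfun D ?c) (sq_obj C X))"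
    using vanish_iso[of "corner \<otimes> C" ?p "NT (lan_unit D ?c) (ext_obj C X)" "ext_obj C X" "FO (dfun D ?c) (sq_obj C X)"]
      iso_arr_dfun[of "point (corner \<otimes> C) ?p" one_cat "NT (lan_unit D ?c) (ext_obj C X)"] lan_unit_iso[of ?c "ext_obj C X"]
    by (simp add: sq_obj_def)
  thus ?thesis by simp
qed

text \<open>The cofiber square of an object \<open>X = (x \<rightarrow> y)\<close> of \<open>D\<^sup>[\<^sup>1\<^sup>]\<close>, read as a morphism from its top edge
  \<open>X\<close> to its bottom edge \<open>0 \<rightarrow> C X\<close>, is the reflection of \<open>X\<close> into the objects vanishing at the source.\<close>

lemma bottom_edge_local:
  assumes C [simp]: "C \<in> Cat" and X [simp]: "X \<in> Obj (dcat D (arrow_cat \<otimes> C))" and g [simp]: "g \<in> Obj (dcat D (arrow_cat \<otimes> C))"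
    and v: "\<And>c. c \<in> Obj C \<Longrightarrow> vanish (arrow_cat \<otimes> C) (Tup [b0, c]) g"
  shows "local_for (dcat D (arrow_cat \<otimes> C)) (edge_arr bottom_edge C X) g"
proof -
  let ?A = "dcat D (arrow_cat \<otimes> C)" and ?L = "dcat D (corner \<otimes> C)" and ?S = "dcat D (cube 2 \<otimes> C)"
  define l s \<upsilon> where "l = square_proj \<otimes>\<^sub>f fid C" and "s = bottom_edge \<otimes>\<^sub>f fid C" and "\<upsilon> = square_unit \<otimes>\<^sub>n nid (fid C)"
  define i k where "i = corner_arrow \<otimes>\<^sub>f fid C" and "k = corner_incl \<otimes>\<^sub>f fid C"
  have r: "reflection l s \<upsilon>" unfolding l_def s_def \<upsilon>_def by (rule reflection_prod[OF square_reflection C])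
  have [simp]: "isfun l" "isfun s" "isfun i" "isfun k" "Src l = cube 2 \<otimes> C" "Tgt l = arrow_cat \<otimes> C" "Src s = arrow_cat \<otimes> C" "Tgt s = cube 2 \<otimes> C"
    "Src i = arrow_cat \<otimes> C" "Tgt i = corner \<otimes> C" "Src k = corner \<otimes> C" "Tgt k = cube 2 \<otimes> C" "isnt \<upsilon>" "NSrc \<upsilon> = fid (cube 2 \<otimes> C)" "NTgt \<upsilon> = s \<odot> l"
    by (simp_all add: l_def s_def i_def k_def \<upsilon>_def)
  have ki: "k \<odot> i = top_edge \<otimes>\<^sub>f fid C" by (simp add: k_def i_def)
  have lki [simp]: "(l \<odot> k) \<odot> i = fid (arrow_cat \<otimes> C)" by (simp add: fcomp_assoc) (simp add: ki l_def)
  have lki' [simp]: "l \<odot> (k \<odot> i) = fid (arrow_cat \<otimes> C)" by (simp add: ki l_def)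
  have \<upsilon>ki: "\<upsilon> \<lhd> (k \<odot> i) = poset_nt top_edge bottom_edge \<otimes>\<^sub>n nid (fid C)" by (simp add: \<upsilon>_def ki square_unit_top)
  let ?R = "ext_obj C X" and ?Q = "sq_obj C X"
  have [simp]: "FO (lan D k) ?R = ?Q" by (simp add: sq_obj_def k_def)
  let ?n = "NT (lan_unit D k) ?R"
  \<comment> \<open>Maps from the bottom edge s^*Q to g are transposed twice: \<open>?T1\<close>
    yields maps from the square Q to l^*g, and \<open>?T2\<close> yields maps from the corner R to
    k^*l^*g. Restriction along i then ends with maps from i^*R to g, since l k i is the
    identity.\<close>
  let ?T1 = "\<lambda>h. Comp ?S (FA (dfun D l) h) (NT (dnt D \<upsilon>) ?Q)" and ?T2 = "\<lambda>m. Comp ?L (FA (dfun D k) m) ?n"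
  let ?Y = "FO (dfun D (l \<odot> k)) g"
  \<comment> \<open>The hypothesis on g enters here: the value of \<open>?Y\<close> at (0,1) is the
    value of g at 0, so restriction along the sieve i is bijective on maps into
    \<open>?Y\<close>.\<close>
  have vY: "vanish (Tgt i) b ?Y" if "b \<in> Obj (Tgt i)" "b \<notin> FO i ` Obj (Src i)" for b
  proof -
    have "b \<in> Obj (corner \<otimes> C)" using that by simp
    then obtain p c where b: "b = Tup [p, c]" "p \<in> Obj corner" "c \<in> Obj C" by (rule Obj_prodE)
    have "p \<noteq> FO corner_arrow a" if "a \<in> {b0, b1}" for a
    proof
      assume "p = FO corner_arrow a"
      hence "b = FO i (Tup [a, c])" "Tup [a, c] \<in> Obj (Src i)" using b that by (simp_all add: i_def)
      thus False using \<open>b \<notin> FO i ` Obj (Src i)\<close> by blast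
    qed
    from this[of b0] this[of b1] have "p = Tup [b0, b1]" using b(2) by (auto simp: cube_pts_2)
    moreover have "Tup [b0, b1] \<in> cube_pts 2" by (simp add: cube_pts_2)
    ultimately show ?thesis using b v[of c] by (simp add: l_def k_def)
  qed
  have T1: "?T1 h \<in> hom ?S ?Q (FO (dfun D l) g)" "FA (dfun D s) (?T1 h) = h" if "h \<in> hom ?A (FO (dfun D s) ?Q) g" for h
    using that reflection_transpose(1)[OF r, of ?Q g h] by simp_all
  have T2: "?T2 m \<in> hom ?L ?R ?Y" if "m \<in> hom ?S ?Q (FO (dfun D l) g)" for m
    using that by simp
  \<comment> \<open>The composite of the three correspondences is precomposition with
    \<open>edge_arr bottom_edge C X\<close>.\<close>
  have T12: "FA (dfun D i) (?T2 (?T1 h)) = Comp ?A h (edge_arr bottom_edge C X)" if "h \<in> hom ?A (FO (dfun D s) ?Q) g" for h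
  proof -
    have "FA (dfun D i) (?T2 (?T1 h)) = Comp ?A h (Comp ?A (NT (dnt D (\<upsilon> \<lhd> (k \<odot> i))) ?Q) (FA (dfun D i) ?n))"
      using that \<open>isnt \<upsilon>\<close> NT_dnt_whisk_right[of i "\<upsilon> \<lhd> k" ?Q]
      by (simp add: fcomp_assoc) (simp flip: NT_dnt_whisk_right)
    thus ?thesis by (simp add: \<upsilon>ki[unfolded ki] edge_arr_def i_def k_def)
  qed
  note adj = lan_adjunction[of k]
  have eX: "edge_arr bottom_edge C X \<in> hom ?A (FO (dfun D i) ?R) (FO (dfun D s) ?Q)" by (simp add: i_def s_def)
  show ?thesis
  proof (rule local_forI)
    fix f assume "f \<in> hom ?A (Dom ?A (edge_arr bottom_edge C X)) g"
    hence f: "f \<in> hom ?A (FO (dfun D i) ?R) g" using eX by simp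
    obtain m where m: "m \<in> hom ?L ?R ?Y" "FA (dfun D i) m = f"
      using sieve_dfun_ff(1)[of i ?Y ?R f] vY f by (auto simp: i_def[symmetric] simp del: hom_iff) (auto simp: i_def)
    let ?k = "Comp ?S (NT (lan_counit D k) (FO (dfun D l) g)) (FA (lan D k) m)"
    have k: "?k \<in> hom ?S ?Q (FO (dfun D l) g)" using m by simp
    have km: "?T2 ?k = m" using adjunction_transpose(1)[OF adj, of ?R "FO (dfun D l) g" m] m by simp
    let ?h = "FA (dfun D s) ?k"
    have h: "?h \<in> hom ?A (FO (dfun D s) ?Q) g" using k r by (simp add: reflection_def)
    have "?T1 ?h = ?k" using reflection_transpose(2)[OF r, of ?Q g ?k] k by simp
    hence "Comp ?A ?h (edge_arr bottom_edge C X) = f" using T12[OF h] km m by simp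
    thus "\<exists>h. h \<in> hom ?A (Cod ?A (edge_arr bottom_edge C X)) g \<and> Comp ?A h (edge_arr bottom_edge C X) = f"
      using h eX by auto
  next
    fix h h' assume "h \<in> hom ?A (Cod ?A (edge_arr bottom_edge C X)) g" "h' \<in> hom ?A (Cod ?A (edge_arr bottom_edge C X)) g"
      and e: "Comp ?A h (edge_arr bottom_edge C X) = Comp ?A h' (edge_arr bottom_edge C X)"
    hence h: "h \<in> hom ?A (FO (dfun D s) ?Q) g" and h': "h' \<in> hom ?A (FO (dfun D s) ?Q) g" using eX by simp_all
    have "?T2 (?T1 h) = ?T2 (?T1 h')"
      by (rule sieve_dfun_ff(2)[of i ?Y ?R]) (use vY T1(1)[OF h] T1(1)[OF h'] T12[OF h] T12[OF h'] e in \<open>simp_all add: i_def[symmetric]\<close>, simp_all add: i_def)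
    hence "?T1 h = ?T1 h'"
      by - (rule adjunction_eq_left[OF adj, of ?R "FO (dfun D l) g"], use T1(1)[OF h] T1(1)[OF h'] in simp_all)
    thus "h = h'" using T1(2)[OF h] T1(2)[OF h'] by metis
  qed (use eX in simp_all)
qed

end

subsection \<open>Inserting a coordinate\<close>

text \<open>Coordinates are counted from 0 here and from 1 in \<open>insert_coord\<close>, hence the
  indices \<open>Suc k\<close> below.\<close>

definition ins_pt :: "nat \<Rightarrow> 'u el \<Rightarrow> 'u el \<Rightarrow> 'u el" where
  "ins_pt k a q = Tup (take k (entries q) @ a # drop k (entries q))"

lemma cube_ptsE: assumes "x \<in> cube_pts n" obtains xs where "x = Tup xs" "length xs = n" "set xs \<subseteq> {b0, b1}"
  using assms by (auto simp: cube_pts_def)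

lemma ins_pt_cube_pts:
  assumes "k < n" "a \<in> {b0, b1}" "q \<in> cube_pts (n - 1)"
  shows "ins_pt k a q \<in> cube_pts n"
proof -
  obtain qs where "q = Tup qs" "length qs = n - 1" "set qs \<subseteq> {b0, b1}" using assms(3) by (rule cube_ptsE)
  thus ?thesis using assms(1,2) set_take_subset[of k qs] set_drop_subset[of k qs] by (auto simp: ins_pt_def cube_pts_def)
qed

lemma ins_pt_le:
  assumes "k < n" "q \<in> cube_pts (n - 1)" "q' \<in> cube_pts (n - 1)"
  shows "cube_le (ins_pt k a q) (ins_pt k a' q') \<longleftrightarrow> ble a a' \<and> cube_le q q'"
proof -
  obtain qs where q: "q = Tup qs" "length qs = n - 1" using assms(2) by (rule cube_ptsE)
  obtain qs' where q': "q' = Tup qs'" "length qs' = n - 1" using assms(3) by (rule cube_ptsE)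
  have "list_all2 ble (take k qs @ drop k qs) (take k qs' @ drop k qs') \<longleftrightarrow>
      list_all2 ble (take k qs) (take k qs') \<and> list_all2 ble (drop k qs) (drop k qs')"
    by (rule list_all2_append) (use q q' in simp)
  hence eq: "list_all2 ble qs qs' \<longleftrightarrow> list_all2 ble (take k qs) (take k qs') \<and> list_all2 ble (drop k qs) (drop k qs')"
    by (simp only: append_take_drop_id)
  have "cube_le (ins_pt k a q) (ins_pt k a' q') \<longleftrightarrow> list_all2 ble (take k qs @ (a # drop k qs)) (take k qs' @ (a' # drop k qs'))"
    by (simp only: ins_pt_def cube_le_def q q' el.sel)
  also have "\<dots> \<longleftrightarrow> list_all2 ble (take k qs) (take k qs') \<and> list_all2 ble (a # drop k qs) (a' # drop k qs')"
    by (rule list_all2_append) (use q q' in simp)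
  also have "\<dots> \<longleftrightarrow> ble a a' \<and> list_all2 ble qs qs'"
    unfolding eq list_all2_Cons by blast
  finally show ?thesis by (simp only: cube_le_def q q' el.sel)
qed

lemma ins_pt_nth:
  assumes "k < n" "q \<in> cube_pts (n - 1)" "j < n"
  shows "entries (ins_pt k a q) ! k = a" "j \<noteq> k \<Longrightarrow> entries (ins_pt k a q) ! j = entries (ins_pt k a' q) ! j"
proof -
  obtain qs where q: "q = Tup qs" "length qs = n - 1" using assms(2) by (rule cube_ptsE)
  have l: "length (take k qs) = k" using q assms(1) by simp
  show "entries (ins_pt k a q) ! k = a" using q l by (simp add: ins_pt_def nth_append)
  show "j \<noteq> k \<Longrightarrow> entries (ins_pt k a q) ! j = entries (ins_pt k a' q) ! j"
    using q l by (auto simp: ins_pt_def nth_append nth_Cons split: nat.split)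
qed

lemma ins_pt_bij:
  assumes "k < n"
  shows "bij_betw (\<lambda>x. ins_pt k (pr 0 x) (pr 1 x)) (Obj (arrow_cat \<otimes> cube (n - 1) :: 'a scat)) (cube_pts n)"
proof (rule bij_betw_byWitness[where f' = "\<lambda>x. Tup [entries x ! k, Tup (take k (entries x) @ drop (Suc k) (entries x))]"])
  show "\<forall>x\<in>Obj (arrow_cat \<otimes> cube (n - 1) :: 'a scat). Tup [entries (ins_pt k (pr 0 x) (pr 1 x)) ! k,
      Tup (take k (entries (ins_pt k (pr 0 x) (pr 1 x))) @ drop (Suc k) (entries (ins_pt k (pr 0 x) (pr 1 x))))] = x"
  proof
    fix x :: "'a el" assume "x \<in> Obj (arrow_cat \<otimes> cube (n - 1))"
    then obtain a q where x: "x = Tup [a, q]" "a \<in> {b0, b1}" "q \<in> cube_pts (n - 1)" by (auto elim: Obj_prodE)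
    obtain qs where q: "q = Tup qs" "length qs = n - 1" using x(3) by (rule cube_ptsE)
    have l: "length (take k qs) = k" using q assms by simp
    thus "Tup [entries (ins_pt k (pr 0 x) (pr 1 x)) ! k,
      Tup (take k (entries (ins_pt k (pr 0 x) (pr 1 x))) @ drop (Suc k) (entries (ins_pt k (pr 0 x) (pr 1 x))))] = x"
      using x q by (simp add: ins_pt_def nth_append)
  qed
  show "\<forall>x\<in>(cube_pts n :: 'a el set). ins_pt k (pr 0 (Tup [entries x ! k, Tup (take k (entries x) @ drop (Suc k) (entries x))]))
     (pr 1 (Tup [entries x ! k, Tup (take k (entries x) @ drop (Suc k) (entries x))])) = x"
  proof
    fix x :: "'a el" assume "x \<in> cube_pts n"
    then obtain xs where x: "x = Tup xs" "length xs = n" by (rule cube_ptsE)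
    thus "ins_pt k (pr 0 (Tup [entries x ! k, Tup (take k (entries x) @ drop (Suc k) (entries x))]))
     (pr 1 (Tup [entries x ! k, Tup (take k (entries x) @ drop (Suc k) (entries x))])) = x"
      using assms by (simp add: ins_pt_def id_take_nth_drop[symmetric])
  qed
  show "(\<lambda>x. ins_pt k (pr 0 x) (pr 1 x)) ` Obj (arrow_cat \<otimes> cube (n - 1) :: 'a scat) \<subseteq> cube_pts n"
    using assms by (auto elim!: Obj_prodE intro: ins_pt_cube_pts)
  show "(\<lambda>x. Tup [entries x ! k, Tup (take k (entries x) @ drop (Suc k) (entries x))]) ` cube_pts n \<subseteq> Obj (arrow_cat \<otimes> cube (n - 1) :: 'a scat)"
  proof
    fix y :: "'a el" assume "y \<in> (\<lambda>x. Tup [entries x ! k, Tup (take k (entries x) @ drop (Suc k) (entries x))]) ` cube_pts n"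
    then obtain x where x: "x \<in> cube_pts n" and y: "y = Tup [entries x ! k, Tup (take k (entries x) @ drop (Suc k) (entries x))]" by blast
    obtain xs where xs: "x = Tup xs" "length xs = n" "set xs \<subseteq> {b0, b1}" using x by (rule cube_ptsE)
    have "xs ! k \<in> {b0, b1}" using xs assms nth_mem[of k xs] by blast
    moreover have "Tup (take k xs @ drop (Suc k) xs) \<in> cube_pts (n - 1)"
      using xs assms set_take_subset[of k xs] set_drop_subset[of "Suc k" xs] by (auto simp: cube_pts_def)
    ultimately show "y \<in> Obj (arrow_cat \<otimes> cube (n - 1))" using y xs by simp
  qed
qed

lemma inverse_functors_bij:
  assumes F: "cat_functor F" and G: "cat_functor G" and GF: "G \<odot> F = fid (Src F)" "F \<odot> G = fid (Tgt F)"
    and S: "Src G = Tgt F" "Tgt G = Src F"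
  shows "bij_betw (FO F) (Obj (Src F)) (Obj (Tgt F))" "bij_betw (FA F) (Arr (Src F)) (Arr (Tgt F))"
proof -
  have O: "\<And>x. x \<in> Obj (Src F) \<Longrightarrow> FO G (FO F x) = x" "\<And>x. x \<in> Obj (Tgt F) \<Longrightarrow> FO F (FO G x) = x"
    using arg_cong[OF GF(1), of "\<lambda>H. FO H _"] arg_cong[OF GF(2), of "\<lambda>H. FO H _"] S by (metis fcomp_simps(3) fid_simps(3))+
  have A: "\<And>x. x \<in> Arr (Src F) \<Longrightarrow> FA G (FA F x) = x" "\<And>x. x \<in> Arr (Tgt F) \<Longrightarrow> FA F (FA G x) = x"
    using arg_cong[OF GF(1), of "\<lambda>H. FA H _"] arg_cong[OF GF(2), of "\<lambda>H. FA H _"] S by (metis fcomp_simps(4) fid_simps(4))+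
  show "bij_betw (FO F) (Obj (Src F)) (Obj (Tgt F))"
    by (rule bij_betw_byWitness[where f' = "FO G"]) (use O F G S in auto)
  show "bij_betw (FA F) (Arr (Src F)) (Arr (Tgt F))"
    by (rule bij_betw_byWitness[where f' = "FA G"]) (use A F G S in auto)
qed

lemma insert_coord_simps [simp]: "Src (insert_coord n (Suc k)) = arrow_cat \<otimes> cube (n - 1)" "Tgt (insert_coord n (Suc k)) = cube n"
  "x \<in> Obj (arrow_cat \<otimes> cube (n - 1)) \<Longrightarrow> FO (insert_coord n (Suc k)) x = ins_pt k (pr 0 x) (pr 1 x)"
  by (simp_all add: insert_coord_def ins_pt_def)

lemma Arr_arrow_cubeE:
  assumes "f \<in> Arr (arrow_cat \<otimes> cube m)"
  obtains a a' q q' where "f = Tup [Tup [a, a'], Tup [q, q']]" "a \<in> {b0, b1}" "a' \<in> {b0, b1}" "ble a a'"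
    "q \<in> cube_pts m" "q' \<in> cube_pts m" "cube_le q q'"
proof -
  obtain f1 f2 where f: "f = Tup [f1, f2]" "f1 \<in> Arr arrow_cat" "f2 \<in> Arr (cube m)" using assms by (rule Arr_prodE)
  obtain a a' where 1: "f1 = Tup [a, a']" "a \<in> {b0, b1}" "a' \<in> {b0, b1}" "ble a a'"
    using f(2) unfolding arrow_cat_def by (rule Arr_poset_catE)
  obtain q q' where 2: "f2 = Tup [q, q']" "q \<in> cube_pts m" "q' \<in> cube_pts m" "cube_le q q'"
    using f(3) unfolding cube_def by (rule Arr_poset_catE)
  show ?thesis using that f(1) 1 2 by blast
qed

lemma arrow_cube_dom [simp]:
  "a \<in> {b0, b1} \<Longrightarrow> a' \<in> {b0, b1} \<Longrightarrow> ble a a' \<Longrightarrow> q \<in> cube_pts m \<Longrightarrow> q' \<in> cube_pts m \<Longrightarrow> cube_le q q' \<Longrightarrow>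
    Dom (arrow_cat \<otimes> cube m) (Tup [Tup [a, a'], Tup [q, q']]) = Tup [a, q]"
  "a \<in> {b0, b1} \<Longrightarrow> a' \<in> {b0, b1} \<Longrightarrow> ble a a' \<Longrightarrow> q \<in> cube_pts m \<Longrightarrow> q' \<in> cube_pts m \<Longrightarrow> cube_le q q' \<Longrightarrow>
    Cod (arrow_cat \<otimes> cube m) (Tup [Tup [a, a'], Tup [q, q']]) = Tup [a', q']"
  unfolding arrow_cat_def cube_def by simp_all

lemma arrow_cube_Arr: "a \<in> {b0, b1} \<Longrightarrow> a' \<in> {b0, b1} \<Longrightarrow> ble a a' \<Longrightarrow> q \<in> cube_pts m \<Longrightarrow> q' \<in> cube_pts m \<Longrightarrow> cube_le q q' \<Longrightarrow>
    Tup [Tup [a, a'], Tup [q, q']] \<in> Arr (arrow_cat \<otimes> cube m)"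
  unfolding arrow_cat_def cube_def by simp

lemma isfun_insert_coord [simp]:
  assumes "k < n" shows "isfun (insert_coord n (Suc k))"
proof (rule isfunI)
  show "cat_functor (insert_coord n (Suc k))"
    unfolding insert_coord_def cube_def[of n]
  proof (rule cat_functor_to_poset)
    show "category (poset_cat (cube_pts n) cube_le)" by (rule category_cube_sub[of _ n]) simp
    show "Tup (take (Suc k - 1) (entries (pr 1 x)) @ pr 0 x # drop (Suc k - 1) (entries (pr 1 x))) \<in> cube_pts n"
      if x: "x \<in> Obj (arrow_cat \<otimes> cube (n - 1))" for x
    proof -
      obtain a q where "x = Tup [a, q]" "a \<in> {b0, b1}" "q \<in> cube_pts (n - 1)" using x by (auto elim: Obj_prodE)
      thus ?thesis using ins_pt_cube_pts[OF assms, of a q] by (simp add: ins_pt_def)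
    qed
    fix f assume "f \<in> Arr (arrow_cat \<otimes> cube (n - 1))"
    then obtain a a' q q' where f: "f = Tup [Tup [a, a'], Tup [q, q']]" "a \<in> {b0, b1}" "a' \<in> {b0, b1}" "ble a a'"
      "q \<in> cube_pts (n - 1)" "q' \<in> cube_pts (n - 1)" "cube_le q q'" by (rule Arr_arrow_cubeE)
    have "Dom (arrow_cat \<otimes> cube (n - 1)) f = Tup [a, q]" "Cod (arrow_cat \<otimes> cube (n - 1)) f = Tup [a', q']"
      unfolding f(1) by (rule arrow_cube_dom; fact f)+
    thus "cube_le
          (Tup (take (Suc k - 1) (entries (pr 1 (Dom (arrow_cat \<otimes> cube (n - 1)) f))) @
             pr 0 (Dom (arrow_cat \<otimes> cube (n - 1)) f) # drop (Suc k - 1) (entries (pr 1 (Dom (arrow_cat \<otimes> cube (n - 1)) f)))))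
          (Tup (take (Suc k - 1) (entries (pr 1 (Cod (arrow_cat \<otimes> cube (n - 1)) f))) @
             pr 0 (Cod (arrow_cat \<otimes> cube (n - 1)) f) # drop (Suc k - 1) (entries (pr 1 (Cod (arrow_cat \<otimes> cube (n - 1)) f)))))"
      using ins_pt_le[OF assms f(5,6), of a a'] f(4,7) by (simp add: ins_pt_def)
  qed simp
qed (simp_all)

text \<open>\<open>finv\<close> inverts objects and arrows separately by \<open>inv_into\<close>, so
  both bijections are needed. On arrows the claim follows from \<open>ins_pt_le\<close>, since an
  arrow on either side is determined by its ends.\<close>

lemma insert_coord_bij:
  assumes k: "k < n"
  shows "bij_betw (FO (insert_coord n (Suc k))) (Obj (arrow_cat \<otimes> cube (n - 1) :: 'a scat)) (Obj (cube n))"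
    "bij_betw (FA (insert_coord n (Suc k))) (Arr (arrow_cat \<otimes> cube (n - 1) :: 'a scat)) (Arr (cube n))"
proof -
  let ?I = "insert_coord n (Suc k) :: 'a sfun" and ?A = "arrow_cat \<otimes> cube (n - 1) :: 'a scat"
  have F: "cat_functor ?I" by (rule isfunD(1)[OF isfun_insert_coord[OF k]])
  show O: "bij_betw (FO ?I) (Obj ?A) (Obj (cube n))"
    using ins_pt_bij[OF k] by (subst bij_betw_cong[of _ _ "\<lambda>x. ins_pt k (pr 0 x) (pr 1 x)"]) simp_all
  have eq: "FA ?I f = Tup [FO ?I (Dom ?A f), FO ?I (Cod ?A f)]" if "f \<in> Arr ?A" for f
    using Arr_poset_cat_eq[of "FA ?I f" "cube_pts n" cube_le] FA_simps[OF F, of "cube n" f] that by (simp flip: cube_def)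
  have thin: "f = g" if fg: "f \<in> Arr ?A" "g \<in> Arr ?A" "Dom ?A f = Dom ?A g" "Cod ?A f = Cod ?A g" for f g
  proof -
    obtain a a' q q' where f: "f = Tup [Tup [a, a'], Tup [q, q']]" "a \<in> {b0, b1}" "a' \<in> {b0, b1}" "ble a a'"
      "q \<in> cube_pts (n - 1)" "q' \<in> cube_pts (n - 1)" "cube_le q q'" using fg(1) by (rule Arr_arrow_cubeE)
    obtain c c' p p' where g: "g = Tup [Tup [c, c'], Tup [p, p']]" "c \<in> {b0, b1}" "c' \<in> {b0, b1}" "ble c c'"
      "p \<in> cube_pts (n - 1)" "p' \<in> cube_pts (n - 1)" "cube_le p p'" using fg(2) by (rule Arr_arrow_cubeE)
    have "Dom ?A f = Tup [a, q]" "Cod ?A f = Tup [a', q']" unfolding f(1) by (rule arrow_cube_dom; fact f)+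
    moreover have "Dom ?A g = Tup [c, p]" "Cod ?A g = Tup [c', p']" unfolding g(1) by (rule arrow_cube_dom; fact g)+
    ultimately show "f = g" using fg(3,4) f(1) g(1) by simp
  qed
  show "bij_betw (FA ?I) (Arr ?A) (Arr (cube n))"
    unfolding bij_betw_def
  proof (intro conjI inj_onI set_eqI iffI)
    fix f g assume fg: "f \<in> Arr ?A" "g \<in> Arr ?A" "FA ?I f = FA ?I g"
    have "FO ?I (Dom ?A f) = FO ?I (Dom ?A g)" "FO ?I (Cod ?A f) = FO ?I (Cod ?A g)" using fg eq by simp_all
    hence "Dom ?A f = Dom ?A g" "Cod ?A f = Cod ?A g"
      using inj_onD[OF bij_betw_imp_inj_on[OF O], of "Dom ?A f" "Dom ?A g"]
        inj_onD[OF bij_betw_imp_inj_on[OF O], of "Cod ?A f" "Cod ?A g"] fg(1,2) by (simp_all del: insert_coord_simps(3))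
    thus "f = g" using thin fg by blast
  next
    fix g assume "g \<in> FA ?I ` Arr ?A" thus "g \<in> Arr (cube n)" using FA_simps(1)[OF F, of "cube n"] by auto
  next
    fix g :: "'a el" assume "g \<in> Arr (cube n)"
    then obtain x y where g: "g = Tup [x, y]" "x \<in> cube_pts n" "y \<in> cube_pts n" "cube_le x y"
      unfolding cube_def by (rule Arr_poset_catE)
    obtain u where u: "u \<in> Obj ?A" "FO ?I u = x" using g(2) bij_betw_imp_surj_on[OF O] by (metis Obj_cube imageE)
    obtain v where v: "v \<in> Obj ?A" "FO ?I v = y" using g(3) bij_betw_imp_surj_on[OF O] by (metis Obj_cube imageE)
    obtain a q where uu: "u = Tup [a, q]" "a \<in> {b0, b1}" "q \<in> cube_pts (n - 1)" using u(1) by (auto elim: Obj_prodE)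
    obtain a' q' where vv: "v = Tup [a', q']" "a' \<in> {b0, b1}" "q' \<in> cube_pts (n - 1)" using v(1) by (auto elim: Obj_prodE)
    have le: "ble a a'" "cube_le q q'" using ins_pt_le[OF k uu(3) vv(3), of a a'] g(4) u v uu vv by simp_all
    let ?f = "Tup [Tup [a, a'], Tup [q, q']]"
    have f: "?f \<in> Arr ?A" by (rule arrow_cube_Arr; fact)
    have "Dom ?A ?f = u" "Cod ?A ?f = v" unfolding uu(1) vv(1) by (rule arrow_cube_dom; fact)+
    hence "FA ?I ?f = g" using eq[OF f] u v g(1) by simp
    thus "g \<in> FA ?I ` Arr ?A" using f by blast
  qed
qed

lemma prod_assoc_bij:
  "bij_betw (FO (prod_assoc A B C)) (Obj (A \<otimes> (B \<otimes> C))) (Obj ((A \<otimes> B) \<otimes> C))"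
  "bij_betw (FA (prod_assoc A B C)) (Arr (A \<otimes> (B \<otimes> C))) (Arr ((A \<otimes> B) \<otimes> C))"
  by (rule bij_betw_byWitness[where f' = "\<lambda>x. Tup [pr 0 (pr 0 x), Tup [pr 1 (pr 0 x), pr 1 x]]"];
    auto elim!: Obj_prodE Arr_prodE)+

lemma coord_iso_simps:
  assumes "k < n" "B \<in> Cat"
  shows "isfun (coord_iso n (Suc k) B)" "Src (coord_iso n (Suc k) B) = arrow_cat \<otimes> (cube (n - 1) \<otimes> B)" "Tgt (coord_iso n (Suc k) B) = cube n \<otimes> B"
    "a \<in> {b0, b1} \<Longrightarrow> q \<in> cube_pts (n - 1) \<Longrightarrow> b \<in> Obj B \<Longrightarrow> FO (coord_iso n (Suc k) B) (Tup [a, Tup [q, b]]) = Tup [ins_pt k a q, b]"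
    "isfun (finv (coord_iso n (Suc k) B))" "finv (coord_iso n (Suc k) B) \<odot> coord_iso n (Suc k) B = fid (arrow_cat \<otimes> (cube (n - 1) \<otimes> B))"
    "coord_iso n (Suc k) B \<odot> finv (coord_iso n (Suc k) B) = fid (cube n \<otimes> B)"
proof -
  note [simp] = isfun_insert_coord[OF assms(1)] assms(2)
  let ?I = "insert_coord n (Suc k) :: 'a sfun" and ?c = "coord_iso n (Suc k) B"
  show c: "isfun ?c" "Src ?c = arrow_cat \<otimes> (cube (n - 1) \<otimes> B)" "Tgt ?c = cube n \<otimes> B"
    by (simp_all add: coord_iso_def)
  show "a \<in> {b0, b1} \<Longrightarrow> q \<in> cube_pts (n - 1) \<Longrightarrow> b \<in> Obj B \<Longrightarrow> FO ?c (Tup [a, Tup [q, b]]) = Tup [ins_pt k a q, b]"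
    by (simp add: coord_iso_def)
  have F: "cat_functor ?I" by (rule isfunD(1)[OF isfun_insert_coord[OF assms(1)]])
  note b = insert_coord_bij[OF assms(1)]
  note I = finv_functor[OF F, unfolded insert_coord_simps, OF b]
  have 1: "bij_betw (FO (?I \<otimes>\<^sub>f fid B)) (Obj (Src (?I \<otimes>\<^sub>f fid B))) (Obj (Tgt (?I \<otimes>\<^sub>f fid B)))"
    "bij_betw (FA (?I \<otimes>\<^sub>f fid B)) (Arr (Src (?I \<otimes>\<^sub>f fid B))) (Arr (Tgt (?I \<otimes>\<^sub>f fid B)))"
    by (rule inverse_functors_bij[of _ "finv ?I \<otimes>\<^sub>f fid B"]; use I in simp)+
  have "bij_betw (FO ?c) (Obj (Src ?c)) (Obj (Tgt ?c))"
    unfolding c(2,3) using bij_betw_trans[OF prod_assoc_bij(1)[of arrow_cat "cube (n - 1)" B] 1(1)[unfolded prod_fun_simps insert_coord_simps fid_simps]]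
    by (subst bij_betw_cong[of _ _ "FO (?I \<otimes>\<^sub>f fid B) \<circ> FO (prod_assoc arrow_cat (cube (n - 1)) B)"]) (simp_all add: coord_iso_def)
  moreover have "bij_betw (FA ?c) (Arr (Src ?c)) (Arr (Tgt ?c))"
    unfolding c(2,3) using bij_betw_trans[OF prod_assoc_bij(2)[of arrow_cat "cube (n - 1)" B] 1(2)[unfolded prod_fun_simps insert_coord_simps fid_simps]]
    by (subst bij_betw_cong[of _ _ "FA (?I \<otimes>\<^sub>f fid B) \<circ> FA (prod_assoc arrow_cat (cube (n - 1)) B)"]) (simp_all add: coord_iso_def)
  ultimately have v: "cat_functor (finv ?c)" "finv ?c \<odot> ?c = fid (Src ?c)" "?c \<odot> finv ?c = fid (Tgt ?c)"
    using finv_functor[of ?c] c(1) by simp_all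
  show "isfun (finv ?c)" by (rule isfunI) (use v c in simp_all)
  show "finv ?c \<odot> ?c = fid (arrow_cat \<otimes> (cube (n - 1) \<otimes> B))" "?c \<odot> finv ?c = fid (cube n \<otimes> B)" using v c by simp_all
qed

text \<open>Equality on the nose makes restriction along \<open>coord_iso\<close> a strict morphism
  in the parameter category.\<close>

lemma coord_iso_natural:
  assumes k: "k < n" and w [simp]: "isfun w"
  shows "coord_iso n (Suc k) (Tgt w) \<odot> (fid arrow_cat \<otimes>\<^sub>f (fid (cube (n - 1)) \<otimes>\<^sub>f w)) = (fid (cube n) \<otimes>\<^sub>f w) \<odot> coord_iso n (Suc k) (Src w)"
proof -
  note [simp] = isfun_insert_coord[OF k]
  have "prod_assoc arrow_cat (cube (n - 1)) (Tgt w) \<odot> (fid arrow_cat \<otimes>\<^sub>f (fid (cube (n - 1)) \<otimes>\<^sub>f w)) =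
     (fid (arrow_cat \<otimes> cube (n - 1)) \<otimes>\<^sub>f w) \<odot> prod_assoc arrow_cat (cube (n - 1)) (Src w)"
    by (rule cfun_eqI) (auto elim!: Obj_prodE Arr_prodE simp del: Obj_arrow Obj_cube)
  hence "(insert_coord n (Suc k) \<otimes>\<^sub>f fid (Tgt w)) \<odot> (prod_assoc arrow_cat (cube (n - 1)) (Tgt w) \<odot> (fid arrow_cat \<otimes>\<^sub>f (fid (cube (n - 1)) \<otimes>\<^sub>f w))) =
    ((insert_coord n (Suc k) \<otimes>\<^sub>f fid (Tgt w)) \<odot> (fid (arrow_cat \<otimes> cube (n - 1)) \<otimes>\<^sub>f w)) \<odot> prod_assoc arrow_cat (cube (n - 1)) (Src w)"
    by (simp add: fcomp_assoc del: prod_fun_fcomp prod_fun_fid)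
  thus ?thesis by (simp add: coord_iso_def fcomp_assoc[symmetric])
qed

lemma coord_iso_natural2:
  assumes k: "k < n" and a [simp]: "isnt \<alpha>"
  shows "coord_iso n (Suc k) (Tgt (NSrc \<alpha>)) \<rhd> (nid (fid arrow_cat) \<otimes>\<^sub>n (nid (fid (cube (n - 1))) \<otimes>\<^sub>n \<alpha>)) =
    (nid (fid (cube n)) \<otimes>\<^sub>n \<alpha>) \<lhd> coord_iso n (Suc k) (Src (NSrc \<alpha>))"
proof (rule ntr_eqI)
  note [simp] = coord_iso_simps[OF k] isfun_insert_coord[OF k]
  show "NSrc (coord_iso n (Suc k) (Tgt (NSrc \<alpha>)) \<rhd> (nid (fid arrow_cat) \<otimes>\<^sub>n (nid (fid (cube (n - 1))) \<otimes>\<^sub>n \<alpha>))) =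
     NSrc ((nid (fid (cube n)) \<otimes>\<^sub>n \<alpha>) \<lhd> coord_iso n (Suc k) (Src (NSrc \<alpha>)))"
    using coord_iso_natural[OF k, of "NSrc \<alpha>"] by simp
  show "NTgt (coord_iso n (Suc k) (Tgt (NSrc \<alpha>)) \<rhd> (nid (fid arrow_cat) \<otimes>\<^sub>n (nid (fid (cube (n - 1))) \<otimes>\<^sub>n \<alpha>))) =
     NTgt ((nid (fid (cube n)) \<otimes>\<^sub>n \<alpha>) \<lhd> coord_iso n (Suc k) (Src (NSrc \<alpha>)))"
    using coord_iso_natural[OF k, of "NTgt \<alpha>"] by simp
  show "nat_trans (coord_iso n (Suc k) (Tgt (NSrc \<alpha>)) \<rhd> (nid (fid arrow_cat) \<otimes>\<^sub>n (nid (fid (cube (n - 1))) \<otimes>\<^sub>n \<alpha>)))"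
  proof (rule nat_trans_whisk_left)
    show "cat_functor (coord_iso n (Suc k) (Tgt (NSrc \<alpha>)))" by (rule isfunD(1)) simp
    show "nat_trans (nid (fid arrow_cat) \<otimes>\<^sub>n (nid (fid (cube (n - 1))) \<otimes>\<^sub>n \<alpha>))" by simp
  qed simp
  show "nat_trans ((nid (fid (cube n)) \<otimes>\<^sub>n \<alpha>) \<lhd> coord_iso n (Suc k) (Src (NSrc \<alpha>)))"
  proof (rule nat_trans_whisk_right)
    show "cat_functor (coord_iso n (Suc k) (Src (NSrc \<alpha>)))" by (rule isfunD(1)) simp
    show "nat_trans (nid (fid (cube n)) \<otimes>\<^sub>n \<alpha>)" by simp
  qed simp
  fix x assume "x \<in> Obj (Src (NSrc ((nid (fid (cube n)) \<otimes>\<^sub>n \<alpha>) \<lhd> coord_iso n (Suc k) (Src (NSrc \<alpha>)))))"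
  hence "x \<in> Obj (arrow_cat \<otimes> (cube (n - 1) \<otimes> Src (NSrc \<alpha>)))" by simp
  then obtain a q b where x: "x = Tup [a, Tup [q, b]]" "a \<in> Obj arrow_cat" "q \<in> Obj (cube (n - 1))" "b \<in> Obj (Src (NSrc \<alpha>))"
    by (auto elim!: Obj_prodE simp del: Obj_arrow Obj_cube)
  have i: "FA (insert_coord n (Suc k)) (Tup [Ident arrow_cat a, Ident (cube (n - 1)) q]) = Ident (cube n) (ins_pt k a q)"
    using FA_Ident'[of "insert_coord n (Suc k)" "arrow_cat \<otimes> cube (n - 1)" "Tup [a, q]"] x by simp
  have "a \<in> {b0, b1}" "q \<in> cube_pts (n - 1)" using x by simp_all
  note p = ins_pt_cube_pts[OF k this]
  show "NT (coord_iso n (Suc k) (Tgt (NSrc \<alpha>)) \<rhd> (nid (fid arrow_cat) \<otimes>\<^sub>n (nid (fid (cube (n - 1))) \<otimes>\<^sub>n \<alpha>))) x =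
    NT ((nid (fid (cube n)) \<otimes>\<^sub>n \<alpha>) \<lhd> coord_iso n (Suc k) (Src (NSrc \<alpha>))) x"
    using x i p by (simp add: coord_iso_def)
qed

subsection \<open>Cofibers in one direction of a cube\<close>

lemma whisk_left_left [simp]: "cat_functor G \<Longrightarrow> cat_functor F \<Longrightarrow> nat_trans \<alpha> \<Longrightarrow> Src F = Tgt (NSrc \<alpha>) \<Longrightarrow> Src G = Tgt F \<Longrightarrow>
   G \<rhd> (F \<rhd> \<alpha>) = (G \<odot> F) \<rhd> \<alpha>"
  by (rule ntr_eqI) (simp_all add: fcomp_assoc)

lemma whisk_right_right [simp]: "cat_functor G \<Longrightarrow> cat_functor F \<Longrightarrow> nat_trans \<alpha> \<Longrightarrow> Tgt F = Src (NSrc \<alpha>) \<Longrightarrow> Src F = Tgt G \<Longrightarrow>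
   (\<alpha> \<lhd> F) \<lhd> G = \<alpha> \<lhd> (F \<odot> G)"
  by (rule ntr_eqI) (simp_all add: fcomp_assoc)

lemma whisk_left_right: "cat_functor G \<Longrightarrow> cat_functor F \<Longrightarrow> nat_trans \<alpha> \<Longrightarrow> Tgt F = Src (NSrc \<alpha>) \<Longrightarrow> Src G = Tgt (NSrc \<alpha>) \<Longrightarrow>
   G \<rhd> (\<alpha> \<lhd> F) = (G \<rhd> \<alpha>) \<lhd> F"
  by (rule ntr_eqI) (simp_all add: fcomp_assoc)

lemma inverse_natural:
  assumes [simp]: "isfun c" "isfun c'" "isfun d" "isfun d'" "isfun p" "isfun q"
    and [simp]: "Src c' = Tgt c" "Tgt c' = Src c" "Src d' = Tgt d" "Tgt d' = Src d" "Src d = Tgt p" "Src c = Src p" "Tgt c = Src q" "Tgt d = Tgt q"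
    and cc: "c \<odot> c' = fid (Src q)" and dd: "d' \<odot> d = fid (Tgt p)" and n: "d \<odot> p = q \<odot> c"
  shows "p \<odot> c' = d' \<odot> q"
proof -
  have "p \<odot> c' = (d' \<odot> d) \<odot> (p \<odot> c')" by (simp add: dd)
  also have "\<dots> = d' \<odot> ((d \<odot> p) \<odot> c')" by (simp add: fcomp_assoc)
  also have "\<dots> = (d' \<odot> q) \<odot> (c \<odot> c')" unfolding n by (simp add: fcomp_assoc)
  finally show ?thesis by (simp add: cc)
qed

lemma inverse_natural2:
  assumes [simp]: "isfun c" "isfun c'" "isfun d" "isfun d'" "isnt \<pi>" "isnt \<kappa>"
    and [simp]: "Src c' = Tgt c" "Tgt c' = Src c" "Src d' = Tgt d" "Tgt d' = Src d" "Src d = Tgt (NSrc \<pi>)" "Src c = Src (NSrc \<pi>)"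
      "Tgt c = Src (NSrc \<kappa>)" "Tgt d = Tgt (NSrc \<kappa>)"
    and cc: "c \<odot> c' = fid (Src (NSrc \<kappa>))" and dd: "d' \<odot> d = fid (Tgt (NSrc \<pi>))" and n: "d \<rhd> \<pi> = \<kappa> \<lhd> c"
  shows "\<pi> \<lhd> c' = d' \<rhd> \<kappa>"
proof -
  have "\<pi> \<lhd> c' = (d' \<odot> d) \<rhd> (\<pi> \<lhd> c')" by (simp add: dd)
  also have "\<dots> = d' \<rhd> ((d \<rhd> \<pi>) \<lhd> c')" by (simp add: whisk_left_right[symmetric])
  also have "\<dots> = d' \<rhd> (\<kappa> \<lhd> (c \<odot> c'))" unfolding n by simp
  finally show ?thesis by (simp add: cc)
qed

text \<open>\<open>cof_dir\<close> with an arbitrary endomorphism \<open>F\<close> of D^[1] in place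
  of \<open>cof\<close>, so that another edge of the cofiber square can take over in a single
  direction of the cube.\<close>

definition dir_mor :: "('u, 'o, 'm) prederiv \<Rightarrow> nat \<Rightarrow> nat \<Rightarrow> ('u, 'o, 'm, 'o, 'm) dmor \<Rightarrow> ('u, 'o, 'm, 'o, 'm) dmor" where
  "dir_mor D n i F =
     strict_mor (shift D (cube n)) (\<lambda>B. dfun D (finv (coord_iso n i B))) \<circ>\<^sub>d
     shift_mor (cube (n - 1)) F \<circ>\<^sub>d
     strict_mor (shift (shift D arrow_cat) (cube (n - 1))) (\<lambda>B. dfun D (coord_iso n i B))"

context prederivator
begin

lemma pseudonatural_coord:
  assumes k: "k < n"
  shows "pseudonatural (shift D (cube n)) (shift (shift D arrow_cat) (cube (n - 1)))
    (strict_mor (shift (shift D arrow_cat) (cube (n - 1))) (\<lambda>B. dfun D (coord_iso n (Suc k) B)))"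
proof (rule pseudonatural_strict)
  note [simp] = coord_iso_simps[OF k]
  show "prederivator (shift D (cube n))" "prederivator (shift (shift D arrow_cat) (cube (n - 1)))"
    by (simp_all add: prederivator_shift prederivator_D)
  show "cat_functor (dfun D (coord_iso n (Suc k) A)) \<and> Src (dfun D (coord_iso n (Suc k) A)) = dcat (shift D (cube n)) A \<and>
      Tgt (dfun D (coord_iso n (Suc k) A)) = dcat (shift (shift D arrow_cat) (cube (n - 1))) A" if "A \<in> Cat" for A
    using that by simp
  show "dfun (shift (shift D arrow_cat) (cube (n - 1))) u \<odot> dfun D (coord_iso n (Suc k) (Tgt u)) =
      dfun D (coord_iso n (Suc k) (Src u)) \<odot> dfun (shift D (cube n)) u" if u: "isfun u" for u
    using u coord_iso_natural[OF k u] by (simp flip: dfun_fcomp)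
  show "FA (dfun D (coord_iso n (Suc k) (Src (NSrc \<alpha>)))) (NT (dnt (shift D (cube n)) \<alpha>) X) =
      NT (dnt (shift (shift D arrow_cat) (cube (n - 1))) \<alpha>) (FO (dfun D (coord_iso n (Suc k) (Tgt (NSrc \<alpha>)))) X)"
    if a: "isnt \<alpha>" and X: "X \<in> Obj (dcat (shift D (cube n)) (Tgt (NSrc \<alpha>)))" for \<alpha> X
    using a X coord_iso_natural2[OF k a] by simp
qed

lemma pseudonatural_coord_inv:
  assumes k: "k < n"
  shows "pseudonatural (shift (shift D arrow_cat) (cube (n - 1))) (shift D (cube n))
    (strict_mor (shift D (cube n)) (\<lambda>B. dfun D (finv (coord_iso n (Suc k) B))))"
proof (rule pseudonatural_strict)
  note [simp] = coord_iso_simps[OF k]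
  show "prederivator (shift D (cube n))" "prederivator (shift (shift D arrow_cat) (cube (n - 1)))"
    by (simp_all add: prederivator_shift prederivator_D)
  show "cat_functor (dfun D (finv (coord_iso n (Suc k) A))) \<and> Src (dfun D (finv (coord_iso n (Suc k) A))) = dcat (shift (shift D arrow_cat) (cube (n - 1))) A \<and>
      Tgt (dfun D (finv (coord_iso n (Suc k) A))) = dcat (shift D (cube n)) A" if "A \<in> Cat" for A
    using that by simp
  show "dfun (shift D (cube n)) u \<odot> dfun D (finv (coord_iso n (Suc k) (Tgt u))) =
      dfun D (finv (coord_iso n (Suc k) (Src u))) \<odot> dfun (shift (shift D arrow_cat) (cube (n - 1))) u" if u [simp]: "isfun u" for u
  proof -
    have "(fid arrow_cat \<otimes>\<^sub>f (fid (cube (n - 1)) \<otimes>\<^sub>f u)) \<odot> finv (coord_iso n (Suc k) (Src u)) =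
       finv (coord_iso n (Suc k) (Tgt u)) \<odot> (fid (cube n) \<otimes>\<^sub>f u)"
      by (rule inverse_natural[OF _ _ _ _ _ _ _ _ _ _ _ _ _ _ _ _ coord_iso_natural[OF k u]]) simp_all
    thus ?thesis by (simp flip: dfun_fcomp)
  qed
  show "FA (dfun D (finv (coord_iso n (Suc k) (Src (NSrc \<alpha>))))) (NT (dnt (shift (shift D arrow_cat) (cube (n - 1))) \<alpha>) X) =
      NT (dnt (shift D (cube n)) \<alpha>) (FO (dfun D (finv (coord_iso n (Suc k) (Tgt (NSrc \<alpha>))))) X)"
    if a [simp]: "isnt \<alpha>" and X: "X \<in> Obj (dcat (shift (shift D arrow_cat) (cube (n - 1))) (Tgt (NSrc \<alpha>)))" for \<alpha> X
  proof -
    have "(nid (fid arrow_cat) \<otimes>\<^sub>n (nid (fid (cube (n - 1))) \<otimes>\<^sub>n \<alpha>)) \<lhd> finv (coord_iso n (Suc k) (Src (NSrc \<alpha>))) =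
       finv (coord_iso n (Suc k) (Tgt (NSrc \<alpha>))) \<rhd> (nid (fid (cube n)) \<otimes>\<^sub>n \<alpha>)"
      by (rule inverse_natural2[OF _ _ _ _ _ _ _ _ _ _ _ _ _ _ _ _ coord_iso_natural2[OF k a]]) simp_all
    thus ?thesis using X by simp
  qed
qed

lemma pseudonatural_dir_mor:
  assumes k: "k < n" and F: "pseudonatural (shift D arrow_cat) (shift D arrow_cat) F"
  shows "pseudonatural (shift D (cube n)) (shift D (cube n)) (dir_mor D n (Suc k) F)"
  unfolding dir_mor_def
  by (intro pseudonatural_mcomp[OF pseudonatural_mcomp[OF pseudonatural_coord[OF k] pseudonatural_shift_mor[OF F]] pseudonatural_coord_inv[OF k]])
    (simp_all add: prederivator_shift prederivator_D)

lemma modification_dir_mor: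
  assumes k: "k < n" and \<tau>: "modification (shift D arrow_cat) (shift D arrow_cat) F G \<tau>"
  shows "modification (shift D (cube n)) (shift D (cube n)) (dir_mor D n (Suc k) F) (dir_mor D n (Suc k) G)
    (\<lambda>B. dfun D (finv (coord_iso n (Suc k) B)) \<rhd> (\<tau> (cube (n - 1) \<otimes> B) \<lhd> dfun D (coord_iso n (Suc k) B)))"
  using modification_whisk_left[OF modification_whisk_right[OF modification_shift_mor[OF \<tau>, of "cube (n - 1)"] pseudonatural_coord[OF k]] pseudonatural_coord_inv[OF k]]
  unfolding dir_mor_def by (simp add: prederivator_shift prederivator_D)

lemma dir_mor_id:
  assumes k: "k < n"
  shows "dir_mor D n (Suc k) (id_mor (shift D arrow_cat)) \<approx> id_mor (shift D (cube n))"
proof -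
  note [simp] = coord_iso_simps[OF k]
  let ?E = "shift (shift D arrow_cat) (cube (n - 1))"
  have pd: "prederivator (shift D (cube n))" "prederivator ?E" by (simp_all add: prederivator_shift prederivator_D)
  have 1: "shift_mor (cube (n - 1)) (id_mor (shift D arrow_cat)) \<approx> id_mor ?E"
    by (simp add: dmor_eq_def id_mor_def)
  have "dir_mor D n (Suc k) (id_mor (shift D arrow_cat)) \<approx>
    strict_mor (shift D (cube n)) (\<lambda>B. dfun D (finv (coord_iso n (Suc k) B))) \<circ>\<^sub>d id_mor ?E \<circ>\<^sub>d strict_mor ?E (\<lambda>B. dfun D (coord_iso n (Suc k) B))"
    unfolding dir_mor_def by (intro dmor_eq_mcomp 1 dmor_eq_refl)
  also have "\<dots> \<approx> strict_mor (shift D (cube n)) (\<lambda>B. dfun D (finv (coord_iso n (Suc k) B))) \<circ>\<^sub>d strict_mor ?E (\<lambda>B. dfun D (coord_iso n (Suc k) B))"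
    by (intro dmor_eq_mcomp dmor_eq_refl mcomp_id_left[OF pseudonatural_coord[OF k] pd])
  also have "\<dots> \<approx> strict_mor (shift D (cube n)) (\<lambda>B. dfun D (finv (coord_iso n (Suc k) B)) \<odot> dfun D (coord_iso n (Suc k) B))"
    by (rule strict_mor_comp[OF pd(1,2,1) pseudonatural_coord[OF k] pseudonatural_coord_inv[OF k]])
  also have "\<dots> \<approx> id_mor (shift D (cube n))"
    unfolding id_mor_def by (rule strict_mor_cong) (simp flip: dfun_fcomp)
  finally show ?thesis .
qed

lemma local_for_isomorphic:
  assumes c [simp]: "isfun c" "isfun c'" "Src c' = Tgt c" "Tgt c' = Src c" and cc: "c \<odot> c' = fid (Tgt c)" "c' \<odot> c = fid (Src c)"
    and f [simp]: "f \<in> Arr (dcat D (Tgt c))" and W [simp]: "W \<in> Obj (dcat D (Tgt c))" and l: "local_for (dcat D (Tgt c)) f W"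
  shows "local_for (dcat D (Src c)) (FA (dfun D c) f) (FO (dfun D c) W)"
proof (rule local_forI)
  note [simp] = cc
  fix h assume h: "h \<in> hom (dcat D (Src c)) (Dom (dcat D (Src c)) (FA (dfun D c) f)) (FO (dfun D c) W)"
  hence "FA (dfun D c') h \<in> hom (dcat D (Tgt c)) (Dom (dcat D (Tgt c)) f) W" by simp
  then obtain k where k: "k \<in> hom (dcat D (Tgt c)) (Cod (dcat D (Tgt c)) f) W" "Comp (dcat D (Tgt c)) k f = FA (dfun D c') h"
    by (rule local_forE[OF l])
  have "FA (dfun D c) (Comp (dcat D (Tgt c)) k f) = h" unfolding k(2) using h by simp
  thus "\<exists>k. k \<in> hom (dcat D (Src c)) (Cod (dcat D (Src c)) (FA (dfun D c) f)) (FO (dfun D c) W) \<and> Comp (dcat D (Src c)) k (FA (dfun D c) f) = h"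
    using k(1) by (intro exI[of _ "FA (dfun D c) k"]) simp
next
  note [simp] = cc
  fix k m assume km: "k \<in> hom (dcat D (Src c)) (Cod (dcat D (Src c)) (FA (dfun D c) f)) (FO (dfun D c) W)"
    "m \<in> hom (dcat D (Src c)) (Cod (dcat D (Src c)) (FA (dfun D c) f)) (FO (dfun D c) W)"
    "Comp (dcat D (Src c)) k (FA (dfun D c) f) = Comp (dcat D (Src c)) m (FA (dfun D c) f)"
  have "FA (dfun D c') (Comp (dcat D (Src c)) k (FA (dfun D c) f)) = FA (dfun D c') (Comp (dcat D (Src c)) m (FA (dfun D c) f))"
    by (simp only: km(3))
  hence "FA (dfun D c') k = FA (dfun D c') m"
    by - (rule local_for_inj[OF l], use km(1,2) in simp_all)
  hence "FA (dfun D c) (FA (dfun D c') k) = FA (dfun D c) (FA (dfun D c') m)" by simp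
  thus "k = m" using km(1,2) by simp
qed simp_all

end

section \<open>Vanishing and invertibility on faces of the cube\<close>

context pointed_derivator
begin

lemma exists_zero_object:
  assumes A: "A \<in> Cat"
  obtains z where "zero_object (dcat D A) z"
proof -
  obtain z where z: "zero_object (dcat D one_cat) z" using pointed by (auto simp: pointed_def)
  have "zero_object (dcat D A) (FO (dfun D (bang A)) z)"
    by (rule dfun_zero_object) (use A z in simp_all)
  thus ?thesis by (rule that)
qed

lemma lan_zero_object:
  assumes u: "isfun u" and X: "zero_object (dcat D (Src u)) X"
  shows "zero_object (dcat D (Tgt u)) (FO (lan D u) X)"
proof -
  note [simp] = u
  obtain z where z: "zero_object (dcat D (Tgt u)) z" by (rule exists_zero_object[of "Tgt u"]) simp
  have i: "initial_object (Src (lan D u)) X" using X zero_object_iff[of "dcat D (Src u)" X] by simp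
  show ?thesis by (rule initial_is_zero[OF _ z]) (use initial_adjunction[OF lan_adjunction[OF u] i] in simp_all)
qed

lemma ran_zero_object:
  assumes u: "isfun u" and X: "zero_object (dcat D (Src u)) X"
  shows "zero_object (dcat D (Tgt u)) (FO (ran D u) X)"
proof -
  note [simp] = u
  obtain z where z: "zero_object (dcat D (Tgt u)) z" by (rule exists_zero_object[of "Tgt u"]) simp
  have i: "terminal_object (Tgt (dfun D u)) X" using X zero_object_iff[of "dcat D (Src u)" X] by simp
  show ?thesis by (rule terminal_is_zero[OF _ z]) (use terminal_adjunction[OF ran_adjunction[OF u] i] in simp_all)
qed

text \<open>For \<open>cof_edge\<close> this is \<open>cof\<close>; for \<open>bottom_edge\<close>
  it is the reflection, sending f to 0 -> Cf; for \<open>diag_edge\<close> it sends f to the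
  composite x -> Cf.\<close>

definition edge_mor where
  "edge_mor e = restr_mor D e \<circ>\<^sub>d lan_mor D corner_incl \<circ>\<^sub>d ran_mor D corner_arrow"

definition sq_fun where
  "sq_fun C = lan D (corner_incl \<otimes>\<^sub>f fid C) \<odot> ran D (corner_arrow \<otimes>\<^sub>f fid C)"

lemma sq_fun_simps [simp]:
  assumes "C \<in> Cat"
  shows "cat_functor (sq_fun C)" "Src (sq_fun C) = dcat D (arrow_cat \<otimes> C)" "Tgt (sq_fun C) = dcat D (cube 2 \<otimes> C)"
    "X \<in> Obj (dcat D (arrow_cat \<otimes> C)) \<Longrightarrow> FO (sq_fun C) X = sq_obj C X"
    "f \<in> Arr (dcat D (arrow_cat \<otimes> C)) \<Longrightarrow> FA (sq_fun C) f = FA (lan D (corner_incl \<otimes>\<^sub>f fid C)) (FA (ran D (corner_arrow \<otimes>\<^sub>f fid C)) f)"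
  using assms by (simp_all add: sq_fun_def sq_obj_def ext_obj_def)

lemma mfun_edge_mor: "mfun (edge_mor e) C = dfun D (e \<otimes>\<^sub>f fid C) \<odot> sq_fun C"
  by (simp add: edge_mor_def restr_mor_def lan_mor_simps ran_mor_simps sq_fun_def)

lemma pseudonatural_edge_mor:
  assumes "isfun e" "Src e = arrow_cat" "Tgt e = cube 2"
  shows "pseudonatural (shift D arrow_cat) (shift D arrow_cat) (edge_mor e)"
proof -
  have l: "pseudonatural (shift D corner) (shift D (cube 2)) (lan_mor D corner_incl)" using pseudonatural_lan[of corner_incl] by simp
  have r: "pseudonatural (shift D arrow_cat) (shift D corner) (ran_mor D corner_arrow)" using pseudonatural_ran[of corner_arrow] by simp
  have s: "pseudonatural (shift D (cube 2)) (shift D arrow_cat) (restr_mor D e)" using pseudonatural_restr[of e] assms by simp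
  show ?thesis unfolding edge_mor_def
    by (intro pseudonatural_mcomp[OF pseudonatural_mcomp[OF r l] s]) (simp_all add: prederivator_shift_D)
qed

definition iso_at :: "'u scat \<Rightarrow> 'u el \<Rightarrow> 'm \<Rightarrow> bool" where
  "iso_at A a f \<longleftrightarrow> iso_arr (dcat D one_cat) (FA (dfun D (point A a)) f)"

lemma iso_at_dfun [simp]:
  "isfun u \<Longrightarrow> Src u = A \<Longrightarrow> a \<in> Obj A \<Longrightarrow> f \<in> Arr (dcat D (Tgt u)) \<Longrightarrow> iso_at A a (FA (dfun D u) f) \<longleftrightarrow> iso_at (Tgt u) (FO u a) f"
  by (auto simp: iso_at_def)

lemma iso_at_iso: "A \<in> Cat \<Longrightarrow> a \<in> Obj A \<Longrightarrow> iso_arr (dcat D A) f \<Longrightarrow> iso_at A a f"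
  unfolding iso_at_def by (rule iso_arr_dfun) simp_all

lemma iso_if_iso_at: "A \<in> Cat \<Longrightarrow> f \<in> Arr (dcat D A) \<Longrightarrow> (\<And>a. a \<in> Obj A \<Longrightarrow> iso_at A a f) \<Longrightarrow> iso_arr (dcat D A) f"
  unfolding iso_at_def by (rule Der2_iso)

lemma iso_at_square:
  assumes A [simp]: "A \<in> Cat" "a \<in> Obj A" and e: "Comp (dcat D A) y f = Comp (dcat D A) g x" and i: "iso_at A a x" "iso_at A a y"
    and t: "f \<in> Arr (dcat D A)" "g \<in> Arr (dcat D A)" "x \<in> Arr (dcat D A)" "y \<in> Arr (dcat D A)"
    "Dom (dcat D A) f = Dom (dcat D A) x" "Cod (dcat D A) f = Dom (dcat D A) y" "Dom (dcat D A) g = Cod (dcat D A) x" "Cod (dcat D A) g = Cod (dcat D A) y"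
  shows "iso_at A a f \<longleftrightarrow> iso_at A a g"
proof -
  let ?p = "FA (dfun D (point A a))"
  have "?p (Comp (dcat D A) y f) = ?p (Comp (dcat D A) g x)" using e by simp
  hence "Comp (dcat D one_cat) (?p y) (?p f) = Comp (dcat D one_cat) (?p g) (?p x)" using t by simp
  thus ?thesis using i t unfolding iso_at_def by (intro iso_arr_square[of _ "?p y" _ _ "?p x"]) simp_all
qed

definition fiberwise where
  "fiberwise F \<longleftrightarrow> pseudonatural (shift D arrow_cat) (shift D arrow_cat) F \<and>
    (\<forall>C\<in>Cat. \<forall>X. zero_object (dcat D (arrow_cat \<otimes> C)) X \<longrightarrow> zero_object (dcat D (arrow_cat \<otimes> C)) (FO (mfun F C) X))"

lemma fiberwise_edge_mor:
  assumes "isfun e" "Src e = arrow_cat" "Tgt e = cube 2"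
  shows "fiberwise (edge_mor e)"
  unfolding fiberwise_def
proof (intro conjI ballI allI impI)
  show "pseudonatural (shift D arrow_cat) (shift D arrow_cat) (edge_mor e)" by (rule pseudonatural_edge_mor) fact+
  fix C X assume C [simp]: "C \<in> Cat" and X: "zero_object (dcat D (arrow_cat \<otimes> C)) X"
  have "zero_object (dcat D (cube 2 \<otimes> C)) (sq_obj C X)"
    unfolding sq_obj_def ext_obj_def
    using lan_zero_object[of "corner_incl \<otimes>\<^sub>f fid C"] ran_zero_object[of "corner_arrow \<otimes>\<^sub>f fid C" X] X by simp
  thus "zero_object (dcat D (arrow_cat \<otimes> C)) (FO (mfun (edge_mor e) C) X)"
    using dfun_zero_object[of "e \<otimes>\<^sub>f fid C" "arrow_cat \<otimes> C" "sq_obj C X"] X assms by (simp add: mfun_edge_mor)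
qed

text \<open>By pseudonaturality with respect to \<open>c : 1 \<rightarrow> C\<close>, the edge over \<open>c\<close> of \<open>F X\<close> depends only on the
  edge over \<open>c\<close> of \<open>X\<close>.\<close>

lemma fiberwise_vanish:
  assumes F: "fiberwise F" and C [simp]: "C \<in> Cat" "c \<in> Obj C" and X [simp]: "X \<in> Obj (dcat D (arrow_cat \<otimes> C))"
    and v: "vanish (arrow_cat \<otimes> C) (Tup [b0, c]) X" "vanish (arrow_cat \<otimes> C) (Tup [b1, c]) X" and a: "a \<in> {b0, b1}"
  shows "vanish (arrow_cat \<otimes> C) (Tup [a, c]) (FO (mfun F C) X)"
proof -
  have p: "pseudonatural (shift D arrow_cat) (shift D arrow_cat) F" using F by (simp add: fiberwise_def)
  note [simp] = pseudonatural_simps[OF p]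
  define w where "w = fid arrow_cat \<otimes>\<^sub>f point C c"
  have [simp]: "isfun w" "Src w = arrow_cat \<otimes> one_cat" "Tgt w = arrow_cat \<otimes> C" "x \<in> {b0, b1} \<Longrightarrow> FO w (Tup [x, Tup []]) = Tup [x, c]" for x
    by (simp_all add: w_def)
  have "zero_object (dcat D (arrow_cat \<otimes> one_cat)) (FO (dfun D w) X)"
    by (subst zero_object_iff_vanish) (use v in \<open>auto elim!: Obj_prodE\<close>)
  hence z: "zero_object (dcat D (arrow_cat \<otimes> one_cat)) (FO (mfun F one_cat) (FO (dfun D w) X))"
    using F by (simp add: fiberwise_def)
  let ?m = "NT (mnt F (point C c)) X"
  have "iso_arr (dcat D (arrow_cat \<otimes> one_cat)) ?m"
    using pseudonatural_iso[OF p, of "point C c" X] by (simp add: prederivator_shift_D)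
  from zero_object_iso_iff[OF _ this] have "zero_object (dcat D (arrow_cat \<otimes> one_cat)) (FO (dfun D w) (FO (mfun F C) X))"
    using z by (simp flip: w_def)
  hence "vanish (arrow_cat \<otimes> one_cat) (Tup [a, Tup []]) (FO (dfun D w) (FO (mfun F C) X))"
    using a by (subst (asm) zero_object_iff_vanish) (simp, simp, drule bspec[where x = "Tup [a, Tup []]"], auto)
  thus ?thesis using a by auto
qed

text \<open>The argument of \<open>fiberwise_vanish\<close> for arrows: naturality of the structure
  relates F f over \<open>c\<close>, by isomorphisms at both ends, to F applied to the restriction
  of f.\<close>

lemma fiberwise_iso:
  assumes F: "fiberwise F" and C [simp]: "C \<in> Cat" "c \<in> Obj C" and f [simp]: "f \<in> Arr (dcat D (arrow_cat \<otimes> C))"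
    and v: "iso_at (arrow_cat \<otimes> C) (Tup [b0, c]) f" "iso_at (arrow_cat \<otimes> C) (Tup [b1, c]) f" and a: "a \<in> {b0, b1}"
  shows "iso_at (arrow_cat \<otimes> C) (Tup [a, c]) (FA (mfun F C) f)"
proof -
  have p: "pseudonatural (shift D arrow_cat) (shift D arrow_cat) F" using F by (simp add: fiberwise_def)
  note [simp] = pseudonatural_simps[OF p]
  define w where "w = fid arrow_cat \<otimes>\<^sub>f point C c"
  have [simp]: "isfun w" "Src w = arrow_cat \<otimes> one_cat" "Tgt w = arrow_cat \<otimes> C" "x \<in> {b0, b1} \<Longrightarrow> FO w (Tup [x, Tup []]) = Tup [x, c]" for x
    by (simp_all add: w_def)
  have i: "iso_arr (dcat D (arrow_cat \<otimes> one_cat)) (FA (dfun D w) f)"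
    by (rule iso_if_iso_at) (use v in \<open>auto elim!: Obj_prodE\<close>)
  let ?A = "dcat D (arrow_cat \<otimes> one_cat)" and ?X = "Dom (dcat D (arrow_cat \<otimes> C)) f" and ?Y = "Cod (dcat D (arrow_cat \<otimes> C)) f"
  let ?m = "\<lambda>Z. NT (mnt F (point C c)) Z"
  have m: "iso_arr ?A (?m ?X)" "iso_arr ?A (?m ?Y)"
    using pseudonatural_iso[OF p, of "point C c" ?X] pseudonatural_iso[OF p, of "point C c" ?Y] by (simp_all add: prederivator_shift_D)
  have "Comp ?A (?m ?Y) (FA (dfun D w) (FA (mfun F C) f)) = Comp ?A (FA (mfun F one_cat) (FA (dfun D w) f)) (?m ?X)"
    using pseudonatural_arr_NT[OF p, of "point C c" f ?X ?Y] by (simp add: prederivator_shift_D flip: w_def)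
  moreover have "iso_arr ?A (FA (mfun F one_cat) (FA (dfun D w) f))" by (rule iso_arr_FA) (use i in simp_all)
  ultimately have "iso_arr ?A (FA (dfun D w) (FA (mfun F C) f))"
    using iso_arr_square[of ?A "?m ?Y" "FA (dfun D w) (FA (mfun F C) f)" "FA (mfun F one_cat) (FA (dfun D w) f)" "?m ?X"] m
    by (simp flip: w_def)
  hence "iso_at (arrow_cat \<otimes> one_cat) (Tup [a, Tup []]) (FA (dfun D w) (FA (mfun F C) f))"
    using a by (intro iso_at_iso) auto
  thus ?thesis using a by simp
qed

lemma mfun_dir_mor: "mfun (dir_mor D n i F) B = dfun D (finv (coord_iso n i B)) \<odot> (mfun F (cube (n - 1) \<otimes> B) \<odot> dfun D (coord_iso n i B))"
  by (simp add: dir_mor_def)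

lemma finv_coord_pt:
  assumes k: "k < n" and B [simp]: "B \<in> Cat" and x: "x \<in> cube_pts n" and b: "b \<in> Obj B"
  obtains a q where "a \<in> {b0, b1}" "q \<in> cube_pts (n - 1)" "FO (finv (coord_iso n (Suc k) B)) (Tup [x, b]) = Tup [a, Tup [q, b]]" "x = ins_pt k a q"
proof -
  note [simp] = coord_iso_simps[OF k]
  let ?c = "coord_iso n (Suc k) B"
  have p: "FO (finv ?c) (Tup [x, b]) \<in> Obj (arrow_cat \<otimes> (cube (n - 1) \<otimes> B))"
    by (rule FO_Obj') (use x b in simp_all)
  then obtain a q b' where e: "FO (finv ?c) (Tup [x, b]) = Tup [a, Tup [q, b']]" "a \<in> {b0, b1}" "q \<in> cube_pts (n - 1)" "b' \<in> Obj B"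
    by (auto elim!: Obj_prodE)
  have "FO ?c (FO (finv ?c) (Tup [x, b])) = Tup [x, b]"
  proof -
    have "FO ?c (FO (finv ?c) (Tup [x, b])) = FO (?c \<odot> finv ?c) (Tup [x, b])"
      using x b by (simp del: coord_iso_simps(7)[OF k])
    thus ?thesis using x b by simp
  qed
  hence "Tup [ins_pt k a q, b'] = Tup [x, b]" unfolding e(1) using e by simp
  hence xb: "x = ins_pt k a q" "b' = b" by simp_all
  show ?thesis by (rule that[OF e(2,3) e(1)[unfolded xb(2)] xb(1)])
qed

text \<open>The line through \<open>x\<close> in direction \<open>k\<close> stays in the face where
  coordinate \<open>j\<close> has the value \<open>t\<close>, so \<open>fiberwise_vanish\<close>
  applies to its two points. \<open>dir_mor_iso\<close> is the same for arrows.\<close>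

lemma dir_mor_vanish:
  assumes F: "fiberwise F" and k: "k < n" and j: "j < n" "j \<noteq> k" and B [simp]: "B \<in> Cat" and X [simp]: "X \<in> Obj (dcat D (cube n \<otimes> B))"
    and v: "\<And>x b. x \<in> cube_pts n \<Longrightarrow> entries x ! j = t \<Longrightarrow> b \<in> Obj B \<Longrightarrow> vanish (cube n \<otimes> B) (Tup [x, b]) X"
    and x: "x \<in> cube_pts n" "entries x ! j = t" and b: "b \<in> Obj B"
  shows "vanish (cube n \<otimes> B) (Tup [x, b]) (FO (mfun (dir_mor D n (Suc k) F) B) X)"
proof -
  have p: "pseudonatural (shift D arrow_cat) (shift D arrow_cat) F" using F by (simp add: fiberwise_def)
  note [simp] = pseudonatural_simps[OF p] coord_iso_simps[OF k]
  let ?c = "coord_iso n (Suc k) B"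
  obtain a q where q: "a \<in> {b0, b1}" "q \<in> cube_pts (n - 1)" "FO (finv ?c) (Tup [x, b]) = Tup [a, Tup [q, b]]" "x = ins_pt k a q"
    using finv_coord_pt[OF k B x(1) b] by blast
  have "vanish (arrow_cat \<otimes> (cube (n - 1) \<otimes> B)) (Tup [a', Tup [q, b]]) (FO (dfun D ?c) X)" if a': "a' \<in> {b0, b1}" for a'
    using v[OF ins_pt_cube_pts[OF k a' q(2)], of b] ins_pt_nth(2)[OF k q(2) j, of a' a] x q b a' by simp
  hence "vanish (arrow_cat \<otimes> (cube (n - 1) \<otimes> B)) (Tup [a, Tup [q, b]]) (FO (mfun F (cube (n - 1) \<otimes> B)) (FO (dfun D ?c) X))"
    using q b by (intro fiberwise_vanish[OF F]) simp_all
  thus ?thesis using x b q by (simp add: mfun_dir_mor)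
qed

lemma dir_mor_iso:
  assumes F: "fiberwise F" and k: "k < n" and j: "j < n" "j \<noteq> k" and B [simp]: "B \<in> Cat" and f [simp]: "f \<in> Arr (dcat D (cube n \<otimes> B))"
    and v: "\<And>x b. x \<in> cube_pts n \<Longrightarrow> entries x ! j = t \<Longrightarrow> b \<in> Obj B \<Longrightarrow> iso_at (cube n \<otimes> B) (Tup [x, b]) f"
    and x: "x \<in> cube_pts n" "entries x ! j = t" and b: "b \<in> Obj B"
  shows "iso_at (cube n \<otimes> B) (Tup [x, b]) (FA (mfun (dir_mor D n (Suc k) F) B) f)"
proof -
  have p: "pseudonatural (shift D arrow_cat) (shift D arrow_cat) F" using F by (simp add: fiberwise_def)
  note [simp] = pseudonatural_simps[OF p] coord_iso_simps[OF k]
  let ?c = "coord_iso n (Suc k) B"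
  obtain a q where q: "a \<in> {b0, b1}" "q \<in> cube_pts (n - 1)" "FO (finv ?c) (Tup [x, b]) = Tup [a, Tup [q, b]]" "x = ins_pt k a q"
    using finv_coord_pt[OF k B x(1) b] by blast
  have "iso_at (arrow_cat \<otimes> (cube (n - 1) \<otimes> B)) (Tup [a', Tup [q, b]]) (FA (dfun D ?c) f)" if a': "a' \<in> {b0, b1}" for a'
    using v[OF ins_pt_cube_pts[OF k a' q(2)], of b] ins_pt_nth(2)[OF k q(2) j, of a' a] x q b a' by simp
  hence "iso_at (arrow_cat \<otimes> (cube (n - 1) \<otimes> B)) (Tup [a, Tup [q, b]]) (FA (mfun F (cube (n - 1) \<otimes> B)) (FA (dfun D ?c) f))"
    using q b by (intro fiberwise_iso[OF F]) simp_all
  thus ?thesis using x b q by (simp add: mfun_dir_mor)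
qed

lemma cof_eq: "cof D = edge_mor cof_edge"
  by (simp add: cof_def edge_mor_def)

lemma cof_dir_eq: "cof_dir D n i = dir_mor D n i (edge_mor cof_edge)"
  by (simp add: cof_dir_def dir_mor_def cof_eq)

end

subsection \<open>Comparison of the edges of the cofiber square\<close>

context pointed_derivator
begin

definition edge_trans where
  "edge_trans e e' C = dnt D (poset_nt e e' \<otimes>\<^sub>n nid (fid C)) \<lhd> sq_fun C"

lemma edge_trans_simps:
  assumes [simp]: "square_edge e" "square_edge e'" "isnt (poset_nt e e')" "C \<in> Cat"
  shows "nat_trans (edge_trans e e' C)" "NSrc (edge_trans e e' C) = mfun (edge_mor e) C" "NTgt (edge_trans e e' C) = mfun (edge_mor e') C"
    "X \<in> Obj (dcat D (arrow_cat \<otimes> C)) \<Longrightarrow> NT (edge_trans e e' C) X = NT (dnt D (poset_nt e e' \<otimes>\<^sub>n nid (fid C))) (sq_obj C X)"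
  using square_edgeD[OF assms(1)] square_edgeD[OF assms(2)] by (simp_all add: edge_trans_def mfun_edge_mor)

lemma poset_nt_point_eq:
  assumes "isnt (poset_nt e f)" "isnt (poset_nt e' f')" "Src e = arrow_cat" "Src e' = arrow_cat" "Src f = arrow_cat" "Src f' = arrow_cat"
     "Tgt e = cube 2" "Tgt e' = cube 2" "Tgt f = cube 2" "Tgt f' = cube 2"
     "isfun e" "isfun e'" "isfun f" "isfun f'"
    and "C \<in> Cat" "c \<in> Obj C" "FO e b1 = FO e' b1" "FO f b1 = FO f' b1"
  shows "(poset_nt e f \<otimes>\<^sub>n nid (fid C)) \<lhd> point (arrow_cat \<otimes> C) (Tup [b1, c]) = (poset_nt e' f' \<otimes>\<^sub>n nid (fid C)) \<lhd> point (arrow_cat \<otimes> C) (Tup [b1, c])"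
  by (rule ntr_eqI) (use assms in simp_all)

text \<open>Both edges end at (1,1), so over \<open>b1\<close> the 2-cell between them is an
  identity.\<close>

lemma edge_trans_iso:
  assumes e: "square_edge e" "square_edge e'" and n [simp]: "isnt (poset_nt e e')" and C [simp]: "C \<in> Cat" "c \<in> Obj C"
    and X [simp]: "X \<in> Obj (dcat D (arrow_cat \<otimes> C))"
  shows "iso_at (arrow_cat \<otimes> C) (Tup [b1, c]) (NT (edge_trans e e' C) X)"
proof -
  note [simp] = square_edgeD[OF e(1)] square_edgeD[OF e(2)]
  let ?p = "point (arrow_cat \<otimes> C) (Tup [b1, c])"
  have i: "(poset_nt e e' \<otimes>\<^sub>n nid (fid C)) \<lhd> ?p = nid ((e \<otimes>\<^sub>f fid C) \<odot> ?p)"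
  proof (rule ntr_eqI)
    have "isfun (point (cube 2 \<otimes> C) (Tup [Tup [b1, b1], c]))" by (simp add: cube_pts_2)
    thus "nat_trans (nid ((e \<otimes>\<^sub>f fid C) \<odot> ?p))" by simp
    have "Ident (cube 2) (Tup [b1, b1]) = Tup [Tup [b1, b1], Tup [b1, b1 :: 'u el]]" by (simp add: cube_def cube_pts_2)
    thus "NT ((poset_nt e e' \<otimes>\<^sub>n nid (fid C)) \<lhd> ?p) x = NT (nid ((e \<otimes>\<^sub>f fid C) \<odot> ?p)) x"
      if "x \<in> Obj (Src (NSrc (nid ((e \<otimes>\<^sub>f fid C) \<odot> ?p))))" for x
      using that by (simp add: cube_pts_2)
  qed simp_all
  have "FA (dfun D ?p) (NT (edge_trans e e' C) X) = NT (dnt D ((poset_nt e e' \<otimes>\<^sub>n nid (fid C)) \<lhd> ?p)) (sq_obj C X)"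
    using e by (simp add: edge_trans_simps)
  thus ?thesis unfolding iso_at_def i by (simp add: cube_pts_2 iso_arr_Ident)
qed

definition edge_nt where
  "edge_nt e C = (dnt D (poset_nt top_edge e \<otimes>\<^sub>n nid (fid C)) \<lhd> sq_fun C) \<cdot>
    (dfun D (corner_arrow \<otimes>\<^sub>f fid C) \<rhd> (lan_unit D (corner_incl \<otimes>\<^sub>f fid C) \<lhd> ran D (corner_arrow \<otimes>\<^sub>f fid C)))"

definition ext_mor where
  "ext_mor = restr_mor D corner_arrow \<circ>\<^sub>d ran_mor D corner_arrow"

lemma ext_mor_simps: "mfun ext_mor C = dfun D (corner_arrow \<otimes>\<^sub>f fid C) \<odot> ran D (corner_arrow \<otimes>\<^sub>f fid C)"
  by (simp add: ext_mor_def restr_mor_def ran_mor_simps)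

lemma edge_nt_NT:
  assumes [simp]: "square_edge e" "C \<in> Cat" "X \<in> Obj (dcat D (arrow_cat \<otimes> C))"
  shows "NT (edge_nt e C) X = edge_arr e C X"
proof -
  note [simp] = square_edgeD[OF assms(1)]
  show ?thesis by (simp add: edge_nt_def edge_arr_def ext_obj_def[symmetric])
qed

lemma modification_edge:
  assumes e [simp]: "square_edge e"
  shows "modification (shift D arrow_cat) (shift D arrow_cat) ext_mor (edge_mor e) (edge_nt e)"
proof -
  note [simp] = square_edgeD[OF e]
  let ?ran = "ran_mor D corner_arrow" and ?lan = "lan_mor D corner_incl" and ?ra = "restr_mor D corner_arrow" and ?rc = "restr_mor D corner_incl"
  let ?A = "shift D arrow_cat" and ?K = "shift D corner" and ?S = "shift D (cube 2)"
  have pd: "prederivator ?A" "prederivator ?K" "prederivator ?S" by (simp_all add: prederivator_shift_D)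
  have p: "pseudonatural ?A ?K ?ran" "pseudonatural ?K ?S ?lan" "pseudonatural ?K ?A ?ra" "pseudonatural ?S ?K ?rc" "pseudonatural ?S ?A (restr_mor D top_edge)"
    using pseudonatural_ran[of corner_arrow] pseudonatural_lan[of corner_incl] pseudonatural_restr[of corner_arrow] pseudonatural_restr[of corner_incl]
      pseudonatural_restr[of top_edge] by simp_all
  have "modification ?K ?K (id_mor ?K) (?rc \<circ>\<^sub>d ?lan) (\<lambda>C. lan_unit D (corner_incl \<otimes>\<^sub>f fid C))"
    using modification_lan_unit[of corner_incl] by simp
  note modification_whisk_left[OF modification_whisk_right[OF this p(1) pd(1,2,2)] p(3) pd(1,2,1)]
  moreover have "?ra \<circ>\<^sub>d (id_mor ?K \<circ>\<^sub>d ?ran) \<approx> ext_mor"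
    unfolding ext_mor_def by (intro dmor_eq_mcomp dmor_eq_refl mcomp_id_left[OF p(1) pd(1,2)])
  \<comment> \<open>Restricting the square to the corner and then along \<open>corner_arrow\<close>
    is restricting to the top edge; here the unit of the left Kan extension meets the 2-cells out of
    \<open>top_edge\<close>.\<close>
  moreover have "?ra \<circ>\<^sub>d ((?rc \<circ>\<^sub>d ?lan) \<circ>\<^sub>d ?ran) \<approx> restr_mor D top_edge \<circ>\<^sub>d (?lan \<circ>\<^sub>d ?ran)"
  proof -
    have "?ra \<circ>\<^sub>d ((?rc \<circ>\<^sub>d ?lan) \<circ>\<^sub>d ?ran) \<approx> ?ra \<circ>\<^sub>d (?rc \<circ>\<^sub>d (?lan \<circ>\<^sub>d ?ran))"
      by (intro dmor_eq_mcomp dmor_eq_refl mcomp_assoc[OF p(1,2,4) pd(1,2,3,2)])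
    also have "\<dots> \<approx> (?ra \<circ>\<^sub>d ?rc) \<circ>\<^sub>d (?lan \<circ>\<^sub>d ?ran)"
      by (rule dmor_eq_sym[OF mcomp_assoc[OF pseudonatural_mcomp[OF p(1,2) pd(1,2,3)] p(4,3) pd(1,3,2,1)]])
    also have "?ra \<circ>\<^sub>d ?rc \<approx> restr_mor D (corner_incl \<odot> corner_arrow)"
      by (rule restr_mor_comp) simp_all
    hence "(?ra \<circ>\<^sub>d ?rc) \<circ>\<^sub>d (?lan \<circ>\<^sub>d ?ran) \<approx> restr_mor D top_edge \<circ>\<^sub>d (?lan \<circ>\<^sub>d ?ran)"
      by (intro dmor_eq_mcomp) (simp_all add: corner_incl_arrow)
    finally show ?thesis .
  qed
  ultimately have 1: "modification ?A ?A ext_mor (restr_mor D top_edge \<circ>\<^sub>d (?lan \<circ>\<^sub>d ?ran))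
     (\<lambda>C. mfun ?ra C \<rhd> (lan_unit D (corner_incl \<otimes>\<^sub>f fid C) \<lhd> mfun ?ran C))"
    by (rule modification_cong)
  have "modification ?S ?A (restr_mor D top_edge) (restr_mor D e) (\<lambda>C. dnt D (poset_nt top_edge e \<otimes>\<^sub>n nid (fid C)))"
    using modification_restr[OF isnt_top_edge[OF e]] by simp
  note 2 = modification_whisk_right[OF this pseudonatural_mcomp[OF p(1,2) pd(1,2,3)] pd(1,3,1)]
  have "edge_nt e = (\<lambda>C. (dnt D (poset_nt top_edge e \<otimes>\<^sub>n nid (fid C)) \<lhd> mfun (?lan \<circ>\<^sub>d ?ran) C) \<cdot>
     (mfun ?ra C \<rhd> (lan_unit D (corner_incl \<otimes>\<^sub>f fid C) \<lhd> mfun ?ran C)))"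
    by (rule ext) (simp add: edge_nt_def sq_fun_def lan_mor_simps ran_mor_simps restr_mor_def)
  thus ?thesis using modification_vcomp[OF 1 2 pd(1,1)] by (simp add: edge_mor_def)
qed

definition ext_counit where
  "ext_counit C = ran_counit D (corner_arrow \<otimes>\<^sub>f fid C)"

lemma modification_ext_counit: "modification (shift D arrow_cat) (shift D arrow_cat) ext_mor (id_mor (shift D arrow_cat)) ext_counit"
  using modification_ran_counit[of corner_arrow] by (simp add: ext_mor_def ext_counit_def[abs_def])

lemma ext_counit_iso: "C \<in> Cat \<Longrightarrow> X \<in> Obj (dcat D (arrow_cat \<otimes> C)) \<Longrightarrow> iso_arr (dcat D (arrow_cat \<otimes> C)) (NT (ext_counit C) X)"
  unfolding ext_counit_def using ran_counit_iso[of "corner_arrow \<otimes>\<^sub>f fid C" X] sieve_corner_arrow_prod[of C] by (simp add: sieve_def)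

lemma ext_counit_hom:
  assumes "C \<in> Cat" "X \<in> Obj (dcat D (arrow_cat \<otimes> C))"
  shows "NT (ext_counit C) X \<in> hom (dcat D (arrow_cat \<otimes> C)) (FO (dfun D (corner_arrow \<otimes>\<^sub>f fid C)) (ext_obj C X)) X"
  using assms by (simp add: ext_counit_def ext_obj_def)

lemma ext_obj_vanish:
  assumes C [simp]: "C \<in> Cat" and X [simp]: "X \<in> Obj (dcat D (arrow_cat \<otimes> C))" and a: "a \<in> {b0, b1}" "c \<in> Obj C"
  shows "vanish (arrow_cat \<otimes> C) (Tup [a, c]) (FO (dfun D (corner_arrow \<otimes>\<^sub>f fid C)) (ext_obj C X)) \<longleftrightarrow> vanish (arrow_cat \<otimes> C) (Tup [a, c]) X"
  by (rule vanish_iso[OF _ _ _ ext_counit_hom]) (use a iso_at_iso[OF _ _ ext_counit_iso[OF C X]] in \<open>simp_all add: iso_at_def\<close>)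

text \<open>If \<open>X\<close> vanishes at 0, both \<open>X\<close> and its reflection 0 -> CX are
  local for the reflection arrow, so \<open>iso_if_local\<close> applies: the cone of 0 -> y is
  y.\<close>

lemma bottom_edge_iso:
  assumes C [simp]: "C \<in> Cat" and X [simp]: "X \<in> Obj (dcat D (arrow_cat \<otimes> C))"
    and v: "\<And>c. c \<in> Obj C \<Longrightarrow> vanish (arrow_cat \<otimes> C) (Tup [b0, c]) X"
  shows "iso_arr (dcat D (arrow_cat \<otimes> C)) (edge_arr bottom_edge C X)"
proof (rule iso_if_local)
  show "local_for (dcat D (arrow_cat \<otimes> C)) (edge_arr bottom_edge C X) (Dom (dcat D (arrow_cat \<otimes> C)) (edge_arr bottom_edge C X))"
    by (rule bottom_edge_local[OF C X]) (use v ext_obj_vanish in simp_all)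
  show "local_for (dcat D (arrow_cat \<otimes> C)) (edge_arr bottom_edge C X) (Cod (dcat D (arrow_cat \<otimes> C)) (edge_arr bottom_edge C X))"
    by (rule bottom_edge_local[OF C X]) (use sq_obj_vanish in simp_all)
qed simp_all

text \<open>All square edges agree at the target, so the claim for \<open>e\<close> is the one for
  \<open>bottom_edge\<close>.\<close>

lemma edge_arr_iso_at:
  assumes e: "square_edge e" and C [simp]: "C \<in> Cat" "c \<in> Obj C" and X [simp]: "X \<in> Obj (dcat D (arrow_cat \<otimes> C))"
    and v: "\<And>c. c \<in> Obj C \<Longrightarrow> vanish (arrow_cat \<otimes> C) (Tup [b0, c]) X"
  shows "iso_at (arrow_cat \<otimes> C) (Tup [b1, c]) (edge_arr e C X)"
proof -
  note [simp] = e square_edgeD[OF e]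
  let ?p = "point (arrow_cat \<otimes> C) (Tup [b1, c])"
  have eq: "FA (dfun D ?p) (edge_arr e C X) = FA (dfun D ?p) (edge_arr bottom_edge C X)"
    using poset_nt_point_eq[of top_edge e top_edge bottom_edge C c] by (simp add: edge_arr_def sq_obj_def[symmetric])
  have "iso_at (arrow_cat \<otimes> C) (Tup [b1, c]) (edge_arr bottom_edge C X)"
    by (rule iso_at_iso) (use bottom_edge_iso[OF C(1) X v] in simp_all)
  thus ?thesis by (simp add: iso_at_def eq)
qed

lemma edge_nt_simps:
  assumes "square_edge e" "C \<in> Cat"
  shows "nat_trans (edge_nt e C)" "NSrc (edge_nt e C) = mfun ext_mor C" "NTgt (edge_nt e C) = mfun (edge_mor e) C"
  using modification_simps[OF modification_edge[OF assms(1)]] assms(2) by simp_all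

lemma ext_counit_simps:
  assumes "C \<in> Cat"
  shows "nat_trans (ext_counit C)" "NSrc (ext_counit C) = mfun ext_mor C" "NTgt (ext_counit C) = fid (dcat D (arrow_cat \<otimes> C))"
  using modification_simps[OF modification_ext_counit] assms by (simp_all add: id_mor_def)

lemma ext_mor_functor:
  assumes "C \<in> Cat"
  shows "cat_functor (mfun ext_mor C)" "Src (mfun ext_mor C) = dcat D (arrow_cat \<otimes> C)" "Tgt (mfun ext_mor C) = dcat D (arrow_cat \<otimes> C)"
    "X \<in> Obj (dcat D (arrow_cat \<otimes> C)) \<Longrightarrow> FO (mfun ext_mor C) X = FO (dfun D (corner_arrow \<otimes>\<^sub>f fid C)) (ext_obj C X)"
  using assms by (simp_all add: ext_mor_simps ext_obj_def)

lemma nat_iso_ext_counit: "C \<in> Cat \<Longrightarrow> nat_iso (ext_counit C)"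
  by (simp add: nat_iso_def ext_counit_simps ext_mor_functor ext_counit_iso)

text \<open>The map from f : x -> y to its cofiber, with components x -> y and y -> Cf. It comes
  from the 2-cell between \<open>top_edge\<close> and \<open>cof_edge\<close>, after inverting the
  identification of the restricted extension with the original object.\<close>

definition cof_unit where
  "cof_unit C = edge_nt cof_edge C \<cdot> ninv (ext_counit C)"

lemma modification_cof_unit: "modification (shift D arrow_cat) (shift D arrow_cat) (id_mor (shift D arrow_cat)) (edge_mor cof_edge) cof_unit"
proof -
  have pd: "prederivator (shift D arrow_cat)" by (simp add: prederivator_shift_D)
  have "modification (shift D arrow_cat) (shift D arrow_cat) (id_mor (shift D arrow_cat)) ext_mor (\<lambda>C. ninv (ext_counit C))"
    by (rule modification_inverse[OF modification_ext_counit nat_iso_ext_counit pd pd])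
  from modification_vcomp[OF this modification_edge pd pd, of cof_edge] show ?thesis
    by (simp add: cof_unit_def[abs_def])
qed

text \<open>If x is zero, then y -> Cf is invertible by \<open>edge_arr_iso_at\<close>.\<close>

lemma cof_unit_iso_at:
  assumes C [simp]: "C \<in> Cat" "c \<in> Obj C" and X [simp]: "X \<in> Obj (dcat D (arrow_cat \<otimes> C))"
    and v: "\<And>c. c \<in> Obj C \<Longrightarrow> vanish (arrow_cat \<otimes> C) (Tup [b0, c]) X"
  shows "iso_at (arrow_cat \<otimes> C) (Tup [b1, c]) (NT (cof_unit C) X)"
proof -
  let ?A = "dcat D (arrow_cat \<otimes> C)" and ?p = "dfun D (point (arrow_cat \<otimes> C) (Tup [b1, c]))" and ?e = "NT (ext_counit C) X"
  note i = ext_counit_iso[OF C(1) X] and h = ext_counit_hom[OF C(1) X]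
  have k: "NT (cof_unit C) X = Comp ?A (edge_arr cof_edge C X) (inv_arr ?A ?e)"
    by (simp add: cof_unit_def ext_counit_simps ext_mor_functor edge_nt_NT)
  have e: "iso_arr (dcat D one_cat) (FA ?p (edge_arr cof_edge C X))"
    using edge_arr_iso_at[OF _ C X v, of cof_edge] by (simp add: iso_at_def)
  have "iso_arr (dcat D one_cat) (FA ?p (inv_arr ?A ?e))"
    using iso_at_iso[OF _ _ iso_arr_inv[OF _ i], of "Tup [b1, c]"] by (simp add: iso_at_def)
  with e show ?thesis using h i by (simp add: iso_at_def k iso_arr_Comp)
qed

definition dir_unit where
  "dir_unit n k B = dfun D (finv (coord_iso n (Suc k) B)) \<rhd> (cof_unit (cube (n - 1) \<otimes> B) \<lhd> dfun D (coord_iso n (Suc k) B))"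

lemma modification_dir_unit:
  assumes k: "k < n"
  shows "modification (shift D (cube n)) (shift D (cube n)) (id_mor (shift D (cube n))) (cof_dir D n (Suc k)) (dir_unit n k)"
  unfolding dir_unit_def[abs_def] cof_dir_eq
  by (rule modification_cong[OF modification_dir_mor[OF k modification_cof_unit] dir_mor_id[OF k] dmor_eq_refl])

lemma dir_unit_iso_at:
  assumes k: "k < n" and B [simp]: "B \<in> Cat" and X [simp]: "X \<in> Obj (dcat D (cube n \<otimes> B))"
    and v: "\<And>x b. x \<in> cube_pts n \<Longrightarrow> entries x ! k = b0 \<Longrightarrow> b \<in> Obj B \<Longrightarrow> vanish (cube n \<otimes> B) (Tup [x, b]) X"
    and x: "x \<in> cube_pts n" "entries x ! k = b1" and b: "b \<in> Obj B"
  shows "iso_at (cube n \<otimes> B) (Tup [x, b]) (NT (dir_unit n k B) X)"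
proof -
  note [simp] = coord_iso_simps[OF k]
  let ?c = "coord_iso n (Suc k) B" and ?C = "cube (n - 1) \<otimes> B"
  have C: "?C \<in> Cat" by simp
  note [simp] = modification_simps[OF modification_cof_unit, unfolded id_mor_def shift_simps strict_mor_simps]
  note p = pseudonatural_edge_mor[OF isfun_edges(4) edge_simps(7,8)]
  note [simp] = pseudonatural_simps[OF p]
  obtain a q where q: "a \<in> {b0, b1}" "q \<in> cube_pts (n - 1)" "FO (finv ?c) (Tup [x, b]) = Tup [a, Tup [q, b]]" "x = ins_pt k a q"
    by (rule finv_coord_pt[OF k B x(1) b])
  have a: "a = b1" using ins_pt_nth(1)[OF k q(2) k, of a] x(2) q by simp
  have "iso_at (arrow_cat \<otimes> ?C) (Tup [b1, Tup [q, b]]) (NT (cof_unit ?C) (FO (dfun D ?c) X))"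
  proof (rule cof_unit_iso_at)
    fix c assume "c \<in> Obj ?C"
    then obtain q' b' where c: "c = Tup [q', b']" "q' \<in> cube_pts (n - 1)" "b' \<in> Obj B" by (auto elim!: Obj_prodE)
    show "vanish (arrow_cat \<otimes> ?C) (Tup [b0, c]) (FO (dfun D ?c) X)"
      using v[of "ins_pt k b0 q'" b'] ins_pt_cube_pts[OF k _ c(2), of b0] ins_pt_nth(1)[OF k c(2) k, of b0] c by simp
  qed (use q b in simp_all)
  thus ?thesis using x b q unfolding a by (simp add: dir_unit_def)
qed

end

subsection \<open>Iterated cofibers and arrows local for objects supported at the last vertex\<close>

lemma top_pt_cube_pts [simp]: "top_pt n \<in> cube_pts n"
  by (auto simp: top_pt_def cube_pts_def)

lemma top_pt_nth [simp]: "i < n \<Longrightarrow> entries (top_pt n) ! i = b1"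
  by (simp add: top_pt_def)

lemma not_top_ptE:
  assumes "x \<in> cube_pts n" "x \<noteq> top_pt n"
  obtains i where "i < n" "entries x ! i = b0"
proof -
  obtain xs where x: "x = Tup xs" "length xs = n" "set xs \<subseteq> {b0, b1}" using assms(1) by (auto simp: cube_pts_def)
  have "\<exists>i<n. xs ! i \<noteq> b1"
  proof (rule ccontr)
    assume "\<not> ?thesis"
    hence "xs = replicate n b1" using x(2) by (intro nth_equalityI) auto
    thus False using assms(2) x(1) by (simp add: top_pt_def)
  qed
  then obtain i where i: "i < n" "xs ! i \<noteq> b1" by blast
  have "xs ! i \<in> {b0, b1}" using x(2,3) i(1) nth_mem by blast
  thus ?thesis using that[of i] i x(1) by simp
qed

context pointed_derivator
begin

text \<open>The cofibers in the directions k + 1, ..., k + m. The recursion splits off the direction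
  applied first, in contrast to \<open>cof_upto\<close>, because the induction in
  \<open>cofs_iso_top\<close> replaces the innermost cofiber.\<close>

primrec cofs :: "nat \<Rightarrow> 'u scat \<Rightarrow> nat \<Rightarrow> nat \<Rightarrow> ('o, 'm, 'o, 'm) cfun" where
  "cofs n B k 0 = fid (dcat D (cube n \<otimes> B))"
| "cofs n B k (Suc m) = cofs n B (Suc k) m \<odot> mfun (cof_dir D n (Suc k)) B"

lemma dir_edge_functor:
  assumes k: "k < n" and e: "square_edge e" and B: "B \<in> Cat"
  shows "cat_functor (mfun (dir_mor D n (Suc k) (edge_mor e)) B)" "Src (mfun (dir_mor D n (Suc k) (edge_mor e)) B) = dcat D (cube n \<otimes> B)"
    "Tgt (mfun (dir_mor D n (Suc k) (edge_mor e)) B) = dcat D (cube n \<otimes> B)"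
  using pseudonatural_simps(1-3)[OF pseudonatural_dir_mor[OF k pseudonatural_edge_mor[OF square_edgeD(1-3)[OF e]]] B] by simp_all

lemma cofs_functor:
  assumes B: "B \<in> Cat"
  shows "k + m \<le> n \<Longrightarrow> cat_functor (cofs n B k m) \<and> Src (cofs n B k m) = dcat D (cube n \<otimes> B) \<and> Tgt (cofs n B k m) = dcat D (cube n \<otimes> B)"
proof (induction m arbitrary: k)
  case (Suc m)
  hence k: "k < n" by simp
  note [simp] = dir_edge_functor[OF k square_edges(3) B]
  show ?case using Suc.IH[of "Suc k"] Suc.prems by (simp add: cof_dir_eq)
qed (use B in simp)

lemmas cofs_functor' = conjunct1[OF cofs_functor] conjunct1[OF conjunct2[OF cofs_functor]] conjunct2[OF conjunct2[OF cofs_functor]]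

lemma pseudonatural_cof_dir:
  assumes "k < n"
  shows "pseudonatural (shift D (cube n)) (shift D (cube n)) (cof_dir D n (Suc k))"
  unfolding cof_dir_eq by (rule pseudonatural_dir_mor[OF assms pseudonatural_edge_mor]) simp_all

lemma pseudonatural_cof_upto:
  "m \<le> n \<Longrightarrow> pseudonatural (shift D (cube n)) (shift D (cube n)) (cof_upto D n m)"
proof (induction m)
  case 0
  show ?case by (simp add: pseudonatural_id_mor prederivator_shift_D)
next
  case (Suc m)
  hence "pseudonatural (shift D (cube n)) (shift D (cube n)) (cof_dir D n (Suc m) \<circ>\<^sub>d cof_upto D n m)"
    by (intro pseudonatural_mcomp[OF Suc.IH pseudonatural_cof_dir]) (simp_all add: prederivator_shift_D)
  thus ?case by simp
qed

lemma cof_upto_add: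
  assumes B: "B \<in> Cat"
  shows "k + m \<le> n \<Longrightarrow> mfun (cof_upto D n (k + m)) B = cofs n B k m \<odot> mfun (cof_upto D n k) B"
proof (induction m arbitrary: k)
  case 0
  thus ?case using pseudonatural_simps(1-3)[OF pseudonatural_cof_upto[of k n] B] by simp
next
  case (Suc m)
  hence k: "k < n" by simp
  have "mfun (cof_upto D n (Suc k + m)) B = cofs n B (Suc k) m \<odot> mfun (cof_upto D n (Suc k)) B"
    by (rule Suc.IH) (use Suc.prems in simp)
  thus ?case
    using cofs_functor'[OF B, of "Suc k" m n] Suc.prems pseudonatural_simps(1-3)[OF pseudonatural_cof_upto[of k n] B]
      pseudonatural_simps(1-3)[OF pseudonatural_cof_dir[OF k] B]
    by (simp add: fcomp_assoc)
qed

lemma cofs_eq: "B \<in> Cat \<Longrightarrow> mfun (cof_upto D n n) B = cofs n B 0 n"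
  using cof_upto_add[of B 0 n n] cofs_functor'[of B 0 n n] by (simp add: id_mor_def)

lemma fiberwise_square_edge: "square_edge e \<Longrightarrow> fiberwise (edge_mor e)"
  by (rule fiberwise_edge_mor) (simp_all add: square_edge_def)

text \<open>The remaining directions all differ from that of coordinate j, so each cofiber preserves
  invertibility on the face where this coordinate is 1.\<close>

lemma cofs_iso_at:
  assumes B: "B \<in> Cat"
  shows "k + m \<le> n \<Longrightarrow> j < k \<Longrightarrow> f \<in> Arr (dcat D (cube n \<otimes> B)) \<Longrightarrow>
    (\<And>x b. x \<in> cube_pts n \<Longrightarrow> entries x ! j = b1 \<Longrightarrow> b \<in> Obj B \<Longrightarrow> iso_at (cube n \<otimes> B) (Tup [x, b]) f) \<Longrightarrow>
    x \<in> cube_pts n \<Longrightarrow> entries x ! j = b1 \<Longrightarrow> b \<in> Obj B \<Longrightarrow> iso_at (cube n \<otimes> B) (Tup [x, b]) (FA (cofs n B k m) f)"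
proof (induction m arbitrary: k f x b)
  case 0
  thus ?case by simp
next
  case (Suc m)
  hence k: "k < n" by simp
  note [simp] = dir_edge_functor[OF k square_edges(3) B]
  have "iso_at (cube n \<otimes> B) (Tup [x, b]) (FA (cofs n B (Suc k) m) (FA (mfun (cof_dir D n (Suc k)) B) f))"
  proof (rule Suc.IH)
    show "FA (mfun (cof_dir D n (Suc k)) B) f \<in> Arr (dcat D (cube n \<otimes> B))" using Suc.prems by (simp add: cof_dir_eq)
    fix y c :: "'u el" assume y: "y \<in> cube_pts n" "entries y ! j = b1" "c \<in> Obj B"
    show "iso_at (cube n \<otimes> B) (Tup [y, c]) (FA (mfun (cof_dir D n (Suc k)) B) f)"
      unfolding cof_dir_eq
      by (rule dir_mor_iso[OF fiberwise_square_edge k, of _ j]) (use Suc.prems y B in simp_all)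
  qed (use Suc.prems in simp_all)
  thus ?case using Suc.prems by (simp add: cof_dir_eq)
qed

definition top_supported :: "nat \<Rightarrow> 'u scat \<Rightarrow> 'o \<Rightarrow> bool" where
  "top_supported n B W \<longleftrightarrow> W \<in> Obj (dcat D (cube n \<otimes> B)) \<and>
     (\<forall>x\<in>cube_pts n - {top_pt n}. \<forall>b\<in>Obj B. vanish (cube n \<otimes> B) (Tup [x, b]) W)"

definition top_local :: "nat \<Rightarrow> 'u scat \<Rightarrow> 'm \<Rightarrow> bool" where
  "top_local n B \<phi> \<longleftrightarrow> \<phi> \<in> Arr (dcat D (cube n \<otimes> B)) \<and>
     (\<forall>W. top_supported n B W \<longrightarrow> local_for (dcat D (cube n \<otimes> B)) \<phi> W)"

definition dir_trans where
  "dir_trans n k B e e' = dfun D (finv (coord_iso n (Suc k) B)) \<rhd> (edge_trans e e' (cube (n - 1) \<otimes> B) \<lhd> dfun D (coord_iso n (Suc k) B))"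

lemma dir_trans_simps:
  assumes k: "k < n" and e [simp]: "square_edge e" "square_edge e'" "isnt (poset_nt e e')" and B [simp]: "B \<in> Cat"
  shows "nat_trans (dir_trans n k B e e')" "NSrc (dir_trans n k B e e') = mfun (dir_mor D n (Suc k) (edge_mor e)) B"
    "NTgt (dir_trans n k B e e') = mfun (dir_mor D n (Suc k) (edge_mor e')) B"
proof -
  note [simp] = coord_iso_simps[OF k] edge_trans_simps[OF e]
  note [simp] = square_edgeD[OF e(1)] square_edgeD[OF e(2)]
  show "nat_trans (dir_trans n k B e e')" "NSrc (dir_trans n k B e e') = mfun (dir_mor D n (Suc k) (edge_mor e)) B"
    "NTgt (dir_trans n k B e e') = mfun (dir_mor D n (Suc k) (edge_mor e')) B"
    by (simp_all add: dir_trans_def mfun_dir_mor mfun_edge_mor[of e] mfun_edge_mor[of e'])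
qed

lemma dir_trans_iso_at:
  assumes k: "k < n" and e [simp]: "square_edge e" "square_edge e'" "isnt (poset_nt e e')" and B [simp]: "B \<in> Cat"
    and X [simp]: "X \<in> Obj (dcat D (cube n \<otimes> B))" and x: "x \<in> cube_pts n" "entries x ! k = b1" and b: "b \<in> Obj B"
  shows "iso_at (cube n \<otimes> B) (Tup [x, b]) (NT (dir_trans n k B e e') X)"
proof -
  note [simp] = coord_iso_simps[OF k] edge_trans_simps(1-3)[OF e]
  let ?c = "coord_iso n (Suc k) B" and ?C = "cube (n - 1) \<otimes> B"
  note [simp] = square_edgeD[OF e(1)] square_edgeD[OF e(2)]
  obtain a q where q: "a \<in> {b0, b1}" "q \<in> cube_pts (n - 1)" "FO (finv ?c) (Tup [x, b]) = Tup [a, Tup [q, b]]" "x = ins_pt k a q"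
    by (rule finv_coord_pt[OF k B x(1) b])
  have a: "a = b1" using ins_pt_nth(1)[OF k q(2) k, of a] x(2) q by simp
  have "iso_at (arrow_cat \<otimes> ?C) (Tup [b1, Tup [q, b]]) (NT (edge_trans e e' ?C) (FO (dfun D ?c) X))"
    by (rule edge_trans_iso[OF e]) (use q b in simp_all)
  thus ?thesis using x b q unfolding a by (simp add: dir_trans_def mfun_edge_mor[of e] mfun_edge_mor[of e'])
qed

text \<open>In direction \<open>k\<close> the bottom edge has the zero object at its source,
  whatever the input.\<close>

lemma bottom_vanish:
  assumes k: "k < n" and B [simp]: "B \<in> Cat"
    and X [simp]: "X \<in> Obj (dcat D (cube n \<otimes> B))" and x: "x \<in> cube_pts n" "entries x ! k = b0" and b: "b \<in> Obj B"
  shows "vanish (cube n \<otimes> B) (Tup [x, b]) (FO (mfun (dir_mor D n (Suc k) (edge_mor bottom_edge)) B) X)"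
proof -
  note [simp] = coord_iso_simps[OF k]
  let ?c = "coord_iso n (Suc k) B" and ?C = "cube (n - 1) \<otimes> B"
  obtain a q where q: "a \<in> {b0, b1}" "q \<in> cube_pts (n - 1)" "FO (finv ?c) (Tup [x, b]) = Tup [a, Tup [q, b]]" "x = ins_pt k a q"
    by (rule finv_coord_pt[OF k B x(1) b])
  have a: "a = b0" using ins_pt_nth(1)[OF k q(2) k, of a] x(2) q by simp
  have "vanish (cube 2 \<otimes> ?C) (Tup [Tup [b0, b1], Tup [q, b]]) (sq_obj ?C (FO (dfun D ?c) X))"
    by (rule sq_obj_vanish) (use q b in simp_all)
  thus ?thesis using x b q unfolding a by (simp add: mfun_dir_mor mfun_edge_mor)
qed

text \<open>Seen along direction \<open>k\<close>, a top-supported object vanishes at 0, because a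
  vertex with coordinate \<open>k\<close> equal to 0 is not the last one. Hence it is local for
  every reflection arrow in that direction, and two-out-of-three in the naturality square transfers
  locality from \<phi> to its image.\<close>

lemma top_local_bottom:
  assumes k: "k < n" and B [simp]: "B \<in> Cat" and \<phi>: "top_local n B \<phi>"
  shows "top_local n B (FA (mfun (dir_mor D n (Suc k) (edge_mor bottom_edge)) B) \<phi>)"
  unfolding top_local_def
proof (intro conjI allI impI)
  note [simp] = coord_iso_simps[OF k] dir_edge_functor[OF k square_edges(2) B]
  let ?c = "coord_iso n (Suc k) B" and ?C = "cube (n - 1) \<otimes> B" and ?L = "mfun (dir_mor D n (Suc k) (edge_mor bottom_edge)) B"
  let ?A = "dcat D (cube n \<otimes> B)" and ?E = "dcat D (arrow_cat \<otimes> ?C)"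
  have f [simp]: "\<phi> \<in> Arr ?A" using \<phi> by (simp add: top_local_def)
  thus "FA ?L \<phi> \<in> Arr ?A" by simp
  fix W assume W: "top_supported n B W"
  hence [simp]: "W \<in> Obj ?A" by (simp add: top_supported_def)
  have "local_for ?A \<phi> W" using \<phi> W by (simp add: top_local_def)
  hence 1: "local_for ?E (FA (dfun D ?c) \<phi>) (FO (dfun D ?c) W)"
    using local_for_isomorphic[of ?c "finv ?c" \<phi> W] by simp
  define V f where "V = FO (dfun D ?c) W" and "f = FA (dfun D ?c) \<phi>"
  have [simp]: "V \<in> Obj ?E" "f \<in> Arr ?E" by (simp_all add: V_def f_def)
  have v: "vanish (arrow_cat \<otimes> ?C) (Tup [b0, c]) V" if c': "c \<in> Obj ?C" for c
  proof -
    obtain q b where c: "c = Tup [q, b]" "q \<in> cube_pts (n - 1)" "b \<in> Obj B" using c' by (auto elim!: Obj_prodE)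
    have "entries (top_pt n :: 'u el) ! k = b1" by (rule top_pt_nth[OF k])
    hence "ins_pt k b0 q \<noteq> top_pt n" using ins_pt_nth(1)[OF k c(2) k, of b0] by auto
    thus ?thesis using W ins_pt_cube_pts[OF k _ c(2), of b0] c by (simp add: top_supported_def V_def)
  qed
  let ?X = "Dom ?E f" and ?Y = "Cod ?E f"
  let ?R = "FA (mfun ext_mor ?C) f"
  note [simp del] = One_nat_def
  have C: "?C \<in> Cat" by simp
  note ext = ext_mor_functor[OF C] ext_counit_simps[OF C] edge_nt_simps[OF square_edges(2) C]
  note bot = pseudonatural_simps[OF pseudonatural_edge_mor[OF isfun_edges(3) edge_simps(5,6)], unfolded shift_simps]
  \<comment> \<open>The reflection arrow starts at the restricted extension, so f is first replaced
    by its isomorphic copy \<open>?R\<close>.\<close>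
  have 2: "local_for ?E ?R V \<longleftrightarrow> local_for ?E f V"
  proof (rule local_for_square)
    show "Comp ?E (NT (ext_counit ?C) ?Y) ?R = Comp ?E f (NT (ext_counit ?C) ?X)"
      using nat_trans.NT_natural[OF ext(5), of f ?X ?Y] by (simp add: ext)
    show "local_for ?E (NT (ext_counit ?C) ?X) V" "local_for ?E (NT (ext_counit ?C) ?Y) V"
      by (rule local_for_iso, simp, rule ext_counit_iso, simp, simp)+
  qed (use ext_counit_hom[OF C] in \<open>simp_all add: ext\<close>)
  have 3: "local_for ?E ?R V \<longleftrightarrow> local_for ?E (FA (mfun (edge_mor bottom_edge) ?C) f) V"
  proof (rule local_for_square)
    show "Comp ?E (edge_arr bottom_edge ?C ?Y) ?R = Comp ?E (FA (mfun (edge_mor bottom_edge) ?C) f) (edge_arr bottom_edge ?C ?X)"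
      using nat_trans.NT_natural[OF ext(8), of f ?X ?Y] by (simp add: ext edge_nt_NT)
    show "local_for ?E (edge_arr bottom_edge ?C ?X) V" "local_for ?E (edge_arr bottom_edge ?C ?Y) V"
      by (rule bottom_edge_local[OF C _ _ v]; simp)+
  qed (simp_all add: ext bot, simp_all add: mfun_edge_mor)
  have "local_for ?E (FA (mfun (edge_mor bottom_edge) ?C) f) V" using 1 2 3 by (simp add: V_def f_def)
  hence "local_for ?A (FA (dfun D (finv ?c)) (FA (mfun (edge_mor bottom_edge) ?C) f)) (FO (dfun D (finv ?c)) V)"
    using local_for_isomorphic[of "finv ?c" ?c "FA (mfun (edge_mor bottom_edge) ?C) f" V] bot(1-3)[OF C] by simp
  thus "local_for ?A (FA ?L \<phi>) W" by (simp add: V_def f_def mfun_dir_mor mfun_edge_mor)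
qed

lemma isnt_edges [simp]: "isnt (poset_nt diag_edge cof_edge)" "isnt (poset_nt diag_edge bottom_edge)"
  by (rule isnt_edge; simp)+

text \<open>The cofibers in the first \<open>k\<close> directions are replaced by their bottom edges, which vanish where one
  of the first \<open>k\<close> coordinates is \<open>b0\<close>; for \<open>k = n\<close> the arrow becomes one between objects for which it is
  local, so it is invertible.\<close>

lemma cofs_iso_top:
  assumes B: "B \<in> Cat" and b: "b \<in> Obj B"
  shows "k + m = n \<Longrightarrow> top_local n B \<phi> \<Longrightarrow>
    (\<And>i x c. i < k \<Longrightarrow> x \<in> cube_pts n \<Longrightarrow> entries x ! i = b0 \<Longrightarrow> c \<in> Obj B \<Longrightarrow>
       vanish (cube n \<otimes> B) (Tup [x, c]) (Dom (dcat D (cube n \<otimes> B)) \<phi>) \<and> vanish (cube n \<otimes> B) (Tup [x, c]) (Cod (dcat D (cube n \<otimes> B)) \<phi>)) \<Longrightarrow>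
    iso_at (cube n \<otimes> B) (Tup [top_pt n, b]) (FA (cofs n B k m) \<phi>)"
proof (induction m arbitrary: k \<phi>)
  case 0
  let ?A = "dcat D (cube n \<otimes> B)"
  have f: "\<phi> \<in> Arr ?A" using 0(2) by (simp add: top_local_def)
  have "top_supported n B Z" if Z: "Z = Dom ?A \<phi> \<or> Z = Cod ?A \<phi>" for Z
    unfolding top_supported_def
  proof (intro conjI ballI)
    show "Z \<in> Obj ?A" using Z f B by auto
    fix x c :: "'u el" assume x: "x \<in> cube_pts n - {top_pt n}" and c: "c \<in> Obj B"
    obtain i where "i < n" "entries x ! i = b0" using x by (auto elim: not_top_ptE)
    thus "vanish (cube n \<otimes> B) (Tup [x, c]) Z" using 0(3)[of i x c] 0(1) x c Z by auto
  qed
  hence "local_for ?A \<phi> (Dom ?A \<phi>)" "local_for ?A \<phi> (Cod ?A \<phi>)" using 0(2) by (simp_all add: top_local_def)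
  hence "iso_arr ?A \<phi>" by - (rule iso_if_local, use f B in simp_all)
  thus ?case using f iso_at_iso[of "cube n \<otimes> B"] B b by simp
next
  case (Suc m)
  hence k: "k < n" by simp
  let ?A = "dcat D (cube n \<otimes> B)" and ?t = "Tup [top_pt n, b]"
  define F where "F e = mfun (dir_mor D n (Suc k) (edge_mor e)) B" for e
  define G where "G = cofs n B (Suc k) m"
  have f [simp]: "\<phi> \<in> Arr ?A" using Suc.prems(2) by (simp add: top_local_def)
  have F [simp]: "cat_functor (F e)" "Src (F e) = ?A" "Tgt (F e) = ?A" if "square_edge e" for e
    using dir_edge_functor[OF k that B] by (simp_all add: F_def)
  have G [simp]: "cat_functor G" "Src G = ?A" "Tgt G = ?A"
    using cofs_functor'[OF B, of "Suc k" m n] Suc.prems by (simp_all add: G_def)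
  have t [simp]: "?t \<in> Obj (cube n \<otimes> B)" using b by simp
  \<comment> \<open>The comparison from the diagonal to \<open>e\<close> is invertible where
    coordinate k is 1. The remaining cofibers act in other directions and keep it so, and the last
    vertex lies on that face. Applied to \<open>bottom_edge\<close> and to \<open>cof_edge\<close>,
    this exchanges one for the other.\<close>
  have step: "iso_at (cube n \<otimes> B) ?t (FA G (FA (F diag_edge) \<phi>)) \<longleftrightarrow> iso_at (cube n \<otimes> B) ?t (FA G (FA (F e) \<phi>))"
    if e [simp]: "square_edge e" and n [simp]: "isnt (poset_nt diag_edge e)" for e
  proof -
    let ?T = "dir_trans n k B diag_edge e" and ?X = "Dom ?A \<phi>" and ?Y = "Cod ?A \<phi>"
    note T [simp] = dir_trans_simps[OF k square_edges(1) e n B, folded F_def]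
    have i: "iso_at (cube n \<otimes> B) ?t (FA G (NT ?T Z))" if Z: "Z \<in> Obj ?A" for Z
      unfolding G_def
    proof (rule cofs_iso_at[OF B, where j = k])
      show "iso_at (cube n \<otimes> B) (Tup [x, c]) (NT ?T Z)" if "x \<in> cube_pts n" "entries x ! k = b1" "c \<in> Obj B" for x c
        by (rule dir_trans_iso_at[OF k square_edges(1) e n B Z that])
    qed (use Z B b Suc.prems k in simp_all)
    have "Comp ?A (NT ?T ?Y) (FA (F diag_edge) \<phi>) = Comp ?A (FA (F e) \<phi>) (NT ?T ?X)"
      using nat_trans.NT_natural[OF T(1), of \<phi> ?X ?Y] B by simp
    hence "FA G (Comp ?A (NT ?T ?Y) (FA (F diag_edge) \<phi>)) = FA G (Comp ?A (FA (F e) \<phi>) (NT ?T ?X))" by simp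
    hence eq: "Comp ?A (FA G (NT ?T ?Y)) (FA G (FA (F diag_edge) \<phi>)) = Comp ?A (FA G (FA (F e) \<phi>)) (FA G (NT ?T ?X))"
      using B by simp
    show ?thesis by (rule iso_at_square[OF _ t eq i i]) (use B in simp_all)
  qed
  \<comment> \<open>The ends of the new arrow vanish where coordinate k is 0 by
    \<open>bottom_vanish\<close>, and where an earlier coordinate is 0 by
    \<open>dir_mor_vanish\<close>, so the vanishing condition of the induction holds for
    \<open>Suc k\<close>.\<close>
  have "iso_at (cube n \<otimes> B) ?t (FA G (FA (F bottom_edge) \<phi>))"
    unfolding G_def
  proof (rule Suc.IH)
    show "top_local n B (FA (F bottom_edge) \<phi>)" unfolding F_def by (rule top_local_bottom[OF k B Suc.prems(2)])
    fix i and x c :: "'u el" assume x: "i < Suc k" "x \<in> cube_pts n" "entries x ! i = b0" "c \<in> Obj B"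
    have "vanish (cube n \<otimes> B) (Tup [x, c]) (FO (F bottom_edge) Z)" if Z: "Z = Dom ?A \<phi> \<or> Z = Cod ?A \<phi>" for Z
    proof (cases "i = k")
      case True
      show ?thesis unfolding F_def by (rule bottom_vanish[OF k B]) (use Z x B f True in auto)
    next
      case False
      hence i: "i < k" using x(1) by simp
      show ?thesis unfolding F_def
        by (rule dir_mor_vanish[OF fiberwise_square_edge k _ False B]) (use Z x i B f False k Suc.prems(3) in auto)
    qed
    thus "vanish (cube n \<otimes> B) (Tup [x, c]) (Dom ?A (FA (F bottom_edge) \<phi>)) \<and> vanish (cube n \<otimes> B) (Tup [x, c]) (Cod ?A (FA (F bottom_edge) \<phi>))"
      by simp
  qed (use Suc.prems in simp)
  hence "iso_at (cube n \<otimes> B) ?t (FA G (FA (F cof_edge) \<phi>))" using step[of bottom_edge] step[of cof_edge] by simp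
  thus ?case using F[of cof_edge] by (simp add: G_def F_def cof_dir_eq)
qed

end

subsection \<open>The unit of the iterated cofiber\<close>

lemma modification_id:
  assumes D: "prederivator D"
  shows "modification D D (id_mor D) (id_mor D) (\<lambda>A. nid (fid (dcat D A)))"
proof (rule modificationI[OF D D pseudonatural_id_mor[OF D] pseudonatural_id_mor[OF D]])
  interpret prederivator D by (rule D)
  show "nat_trans (nid (fid (dcat D A))) \<and> NSrc (nid (fid (dcat D A))) = mfun (id_mor D) A \<and> NTgt (nid (fid (dcat D A))) = mfun (id_mor D) A"
    if "A \<in> Cat" for A using that by (simp add: id_mor_def)
  show "Comp (dcat D (Src u)) (NT (nid (fid (dcat D (Src u)))) (FO (dfun D u) X)) (NT (mnt (id_mor D) u) X) =
      Comp (dcat D (Src u)) (NT (mnt (id_mor D) u) X) (FA (dfun D u) (NT (nid (fid (dcat D (Tgt u)))) X))"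
    if "isfun u" "X \<in> Obj (dcat D (Tgt u))" for u X
    using that by (simp add: id_mor_def)
qed

context pointed_derivator
begin

text \<open>The map from an object to its iterated cofiber in the first m directions; for m = n,
  evaluated at the last vertex, it compares the value of the object there with its iterated
  cone.\<close>

primrec cube_unit :: "nat \<Rightarrow> nat \<Rightarrow> 'u scat \<Rightarrow> ('o, 'm, 'o, 'm) ntr" where
  "cube_unit n 0 B = nid (fid (dcat D (cube n \<otimes> B)))"
| "cube_unit n (Suc m) B = (dir_unit n m B \<lhd> mfun (cof_upto D n m) B) \<cdot> cube_unit n m B"

lemma modification_cube_unit:
  "m \<le> n \<Longrightarrow> modification (shift D (cube n)) (shift D (cube n)) (id_mor (shift D (cube n))) (cof_upto D n m) (cube_unit n m)"
proof (induction m)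
  case 0
  have "cube_unit n 0 = (\<lambda>B. nid (fid (dcat (shift D (cube n)) B)))" by (rule ext) simp
  thus ?case using modification_id[OF prederivator_shift_D[OF Cat_cube]] by simp
next
  case (Suc m)
  let ?E = "shift D (cube n)"
  have pd: "prederivator ?E" by (simp add: prederivator_shift_D)
  have p: "pseudonatural ?E ?E (cof_upto D n m)" using Suc.prems by (simp add: pseudonatural_cof_upto)
  have "modification ?E ?E (id_mor ?E) (cof_dir D n (Suc m)) (dir_unit n m)" using Suc.prems by (simp add: modification_dir_unit)
  from modification_cong[OF modification_whisk_right[OF this p pd pd pd] mcomp_id_left[OF p pd pd] dmor_eq_refl]
  have 1: "modification ?E ?E (cof_upto D n m) (cof_dir D n (Suc m) \<circ>\<^sub>d cof_upto D n m) (\<lambda>B. dir_unit n m B \<lhd> mfun (cof_upto D n m) B)" .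
  have 2: "modification ?E ?E (id_mor ?E) (cof_upto D n m) (cube_unit n m)" using Suc by simp
  have "cube_unit n (Suc m) = (\<lambda>B. (dir_unit n m B \<lhd> mfun (cof_upto D n m) B) \<cdot> cube_unit n m B)" by (rule ext) simp
  thus ?case using modification_vcomp[OF 2 1 pd pd] by simp
qed

text \<open>A coordinate i >= m, counted from 0, belongs to a direction not yet treated, and
  cofibers in the other directions preserve vanishing on its face.\<close>

lemma cof_upto_vanish:
  assumes B [simp]: "B \<in> Cat" and X: "top_supported n B X"
  shows "m \<le> i \<Longrightarrow> i < n \<Longrightarrow> x \<in> cube_pts n \<Longrightarrow> entries x ! i = b0 \<Longrightarrow> b \<in> Obj B \<Longrightarrow>
    vanish (cube n \<otimes> B) (Tup [x, b]) (FO (mfun (cof_upto D n m) B) X)"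
proof (induction m arbitrary: x b)
  case 0
  have "entries (top_pt n :: 'u el) ! i = b1" using 0 by simp
  hence "x \<noteq> top_pt n" using 0(4) by auto
  thus ?case using X 0 by (simp add: top_supported_def id_mor_def)
next
  case (Suc m)
  hence m: "m \<le> n" "m < n" by simp_all
  note [simp] = pseudonatural_simps[OF pseudonatural_cof_upto[OF m(1)], unfolded shift_simps] pseudonatural_simps[OF pseudonatural_cof_dir[OF m(2)], unfolded shift_simps]
  have [simp]: "X \<in> Obj (dcat D (cube n \<otimes> B))" using X by (simp add: top_supported_def)
  have "vanish (cube n \<otimes> B) (Tup [x, b]) (FO (mfun (cof_dir D n (Suc m)) B) (FO (mfun (cof_upto D n m) B) X))"
    unfolding cof_dir_eq by (rule dir_mor_vanish[OF fiberwise_square_edge m(2), of _ i]) (use Suc in simp_all)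
  thus ?case by simp
qed

text \<open>Before the step for coordinate m the object still vanishes where this coordinate is 0,
  so the unit of that step is invertible at the last vertex by
  \<open>dir_unit_iso_at\<close>.\<close>

lemma cube_unit_iso_at:
  assumes B [simp]: "B \<in> Cat" and X: "top_supported n B X" and b: "b \<in> Obj B"
  shows "m \<le> n \<Longrightarrow> iso_at (cube n \<otimes> B) (Tup [top_pt n, b]) (NT (cube_unit n m B) X)"
proof (induction m)
  case 0
  have "X \<in> Obj (dcat D (cube n \<otimes> B))" using X by (simp add: top_supported_def)
  thus ?case using b by (simp add: iso_at_iso iso_arr_Ident)
next
  case (Suc m)
  hence m: "m \<le> n" "m < n" by simp_all
  note [simp] = pseudonatural_simps[OF pseudonatural_cof_upto[OF m(1)], unfolded shift_simps]
  note [simp] = modification_simps(3-5)[OF modification_cube_unit[OF m(1)]] modification_simps(3-5)[OF modification_dir_unit[OF m(2)]]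
  have X' [simp]: "X \<in> Obj (dcat D (cube n \<otimes> B))" using X by (simp add: top_supported_def)
  let ?p = "dfun D (point (cube n \<otimes> B) (Tup [top_pt n, b]))" and ?Y = "FO (mfun (cof_upto D n m) B) X"
  have "iso_at (cube n \<otimes> B) (Tup [top_pt n, b]) (NT (dir_unit n m B) ?Y)"
    by (rule dir_unit_iso_at[OF m(2)]) (use m b cof_upto_vanish[OF B X order.refl m(2)] in simp_all)
  thus ?case using Suc b unfolding iso_at_def by (simp add: id_mor_def iso_arr_Comp)
qed

end

subsection \<open>The cube with an additional terminal object\<close>

lemma ext_cube_simps [simp]: "Obj (ext_cube n) = insert (Tup []) ((\<lambda>x. Tup [x]) ` cube_pts n)"
  by (simp add: ext_cube_def)

lemma ext_le_trans: "ext_le x y \<Longrightarrow> ext_le y z \<Longrightarrow> ext_le x z"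
  by (auto simp: ext_le_def intro: cube_le_trans)

lemma Cat_ext_cube [simp]: "(ext_cube n :: 'a scat) \<in> Cat"
  unfolding ext_cube_def
proof (rule Cat_poset_cat)
  show "category (poset_cat (insert (Tup []) ((\<lambda>x. Tup [x]) ` (cube_pts n :: 'a el set))) ext_le)"
  proof (rule category_poset_cat)
    show "ext_le x x" if "x \<in> insert (Tup []) ((\<lambda>x. Tup [x]) ` (cube_pts n :: 'a el set))" for x
      using that by (auto simp: ext_le_def cube_le_refl)
  qed (rule ext_le_trans)
qed (simp add: finite_cube_pts)

lemma cube_le_top: "x \<in> cube_pts n \<Longrightarrow> cube_le x (top_pt n)"
  by (auto simp: cube_pts_def cube_le_def top_pt_def list_all2_conv_all_nth)

lemma cube_le_bot: "x \<in> cube_pts n \<Longrightarrow> cube_le (Tup (replicate n b0)) x"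
  by (auto simp: cube_pts_def cube_le_def list_all2_conv_all_nth)

lemma cube_le_antisym_top:
  assumes "cube_le (top_pt n) x" "x \<in> cube_pts n"
  shows "x = top_pt n"
proof (rule ccontr)
  assume "x \<noteq> top_pt n"
  then obtain i where i: "i < n" "entries x ! i = b0" using not_top_ptE[OF assms(2)] by blast
  have "ble (entries (top_pt n) ! i) (entries x ! i)" using assms(1) i(1) by (simp add: cube_le_def list_all2_conv_all_nth top_pt_def)
  thus False using i by (simp add: ble_def)
qed

text \<open>This is \<chi>; \<open>ext_last\<close> is its extension to the enlarged cube along
  \<open>tcof_incl\<close>.\<close>

definition cube_last :: "nat \<Rightarrow> 'u sfun" where
  "cube_last n = to_poset (cube n) arrow_cat (\<lambda>x. if x = top_pt n then b1 else b0)"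

definition ext_last :: "nat \<Rightarrow> 'u sfun" where
  "ext_last n = to_poset (ext_cube n) arrow_cat (\<lambda>x. if x = Tup [] then b1 else b0)"

text \<open>The least and the last vertex. For n >= 1 they differ, and then this is a section of
  \<open>cube_last\<close> that is left adjoint to it.\<close>

definition cube_ends :: "nat \<Rightarrow> 'u sfun" where
  "cube_ends n = to_poset arrow_cat (cube n) (\<lambda>x. Tup (replicate n x))"

lemma isfun_cube_last [simp]: "isfun (cube_last n)"
  unfolding cube_last_def arrow_cat_def
  by (rule isfun_to_poset[OF Cat_cube _ cube_def]) (auto simp: cube_le_antisym_top simp flip: arrow_cat_def)

lemma isfun_ext_last [simp]: "isfun (ext_last n)"
  unfolding ext_last_def arrow_cat_def
  by (rule isfun_to_poset[OF Cat_ext_cube _ ext_cube_def]) (auto simp: ext_le_def simp flip: arrow_cat_def)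

lemma replicate_cube_pts [simp]: "x \<in> {b0, b1} \<Longrightarrow> Tup (replicate n x) \<in> cube_pts n"
  by (auto simp: cube_pts_def)

lemma isfun_cube_ends [simp]: "isfun (cube_ends n)"
  unfolding cube_ends_def cube_def
  by (rule isfun_arrow_to_poset) (simp_all add: cube_le_bot flip: cube_def)

lemma isfun_tcof_incl [simp]: "isfun (tcof_incl n)"
  unfolding tcof_incl_def ext_cube_def
  by (rule isfun_to_poset[OF Cat_cube _ cube_def]) (auto simp: ext_le_def cube_le_antisym_top simp flip: ext_cube_def)

lemma isfun_tcof_edge [simp]: "isfun (tcof_edge n)"
  unfolding tcof_edge_def ext_cube_def
  by (rule isfun_arrow_to_poset) (auto simp: ext_le_def simp flip: ext_cube_def)

lemma cube_functor_simps [simp]: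
  "Src (cube_last n) = cube n" "Tgt (cube_last n) = arrow_cat" "Src (ext_last n) = ext_cube n" "Tgt (ext_last n) = arrow_cat"
  "Src (cube_ends n) = arrow_cat" "Tgt (cube_ends n) = cube n" "Src (tcof_incl n) = cube n" "Tgt (tcof_incl n) = ext_cube n"
  "Src (tcof_edge n) = arrow_cat" "Tgt (tcof_edge n) = ext_cube n"
  by (simp_all add: cube_last_def ext_last_def cube_ends_def tcof_incl_def tcof_edge_def)

lemma cube_functor_FO [simp]:
  "x \<in> cube_pts n \<Longrightarrow> FO (cube_last n) x = (if x = top_pt n then b1 else b0)"
  "x = Tup [] \<or> x \<in> (\<lambda>x. Tup [x]) ` cube_pts n \<Longrightarrow> FO (ext_last n) x = (if x = Tup [] then b1 else b0)"
  "x \<in> {b0, b1} \<Longrightarrow> FO (cube_ends n) x = Tup (replicate n x)"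
  "x \<in> cube_pts n \<Longrightarrow> FO (tcof_incl n) x = (if x = top_pt n then Tup [] else Tup [x])"
  "x \<in> {b0, b1} \<Longrightarrow> FO (tcof_edge n) x = (if x = b1 then Tup [] else Tup [top_pt n])"
  by (simp_all add: cube_last_def ext_last_def cube_ends_def tcof_incl_def tcof_edge_def)

lemma ext_last_incl: "ext_last n \<odot> tcof_incl n = cube_last n"
  by (rule cfun_poset_eqI[of _ _ "{b0, b1}" ble]) (auto, simp add: arrow_cat_def)

definition ext_unit :: "nat \<Rightarrow> 'u snt" where
  "ext_unit n = poset_nt (fid (ext_cube n)) (tcof_edge n \<odot> ext_last n)"

text \<open>Every old vertex lies below the old top and everything lies below the new one, so
  \<open>ext_last\<close> is left adjoint to the edge joining the two tops.\<close>

lemma ext_reflection: "reflection (ext_last n) (tcof_edge n) (ext_unit n)"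
proof -
  have "reflection (ext_last n) (tcof_edge n) (poset_nt (fid (Src (ext_last n))) (tcof_edge n \<odot> ext_last n))"
    by (rule reflection_poset[where P = "insert (Tup []) ((\<lambda>x. Tup [x]) ` cube_pts n)" and le = ext_le and Q = "{b0, b1}" and le' = ble])
      (auto simp: ext_le_def cube_le_top, simp_all add: ext_cube_def arrow_cat_def)
  thus ?thesis by (simp add: ext_unit_def)
qed

definition cube_counit :: "nat \<Rightarrow> 'u snt" where
  "cube_counit n = poset_nt (cube_ends n \<odot> cube_last n) (fid (cube n))"

lemma replicate_b0_b1: "n \<ge> 1 \<Longrightarrow> Tup (replicate n b0) \<noteq> top_pt n" "Tup (replicate n b1) = top_pt n"
  by (auto simp: top_pt_def replicate_eq_replicate)

lemma cube_coreflection: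
  assumes n: "n \<ge> 1"
  shows "coreflection (cube_last n) (cube_ends n) (cube_counit n)"
proof -
  note [simp] = replicate_b0_b1(1)[OF n] replicate_b0_b1(2)[of n]
  have "coreflection (cube_last n) (cube_ends n) (poset_nt (cube_ends n \<odot> cube_last n) (fid (Src (cube_last n))))"
    by (rule coreflection_poset[where P = "cube_pts n" and le = cube_le and Q = "{b0, b1}" and le' = ble])
      (auto simp: cube_le_top cube_le_bot, simp_all add: cube_def arrow_cat_def)
  thus ?thesis by (simp add: cube_counit_def)
qed

subsection \<open>The comparison map of the total cofiber\<close>

definition tcof_cell :: "nat \<Rightarrow> 'u snt" where
  "tcof_cell n = poset_nt (tcof_incl n) (tcof_edge n \<odot> cube_last n)"

lemma isnt_ext_unit [simp]: "isnt (ext_unit n)"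
  unfolding ext_unit_def
  by (rule isnt_poset_nt[where P = "insert (Tup []) ((\<lambda>x. Tup [x]) ` cube_pts n)" and le = ext_le])
    (auto simp: ext_le_def cube_le_top, simp_all add: ext_cube_def)

lemma ext_unit_simps [simp]: "NSrc (ext_unit n) = fid (ext_cube n)" "NTgt (ext_unit n) = tcof_edge n \<odot> ext_last n"
  by (simp_all add: ext_unit_def)

lemma tcof_cell_simps [simp]: "NSrc (tcof_cell n) = tcof_incl n" "NTgt (tcof_cell n) = tcof_edge n \<odot> cube_last n"
  by (simp_all add: tcof_cell_def)

lemma isnt_tcof_cell [simp]: "isnt (tcof_cell n)"
  unfolding tcof_cell_def
  by (rule isnt_poset_nt[where P = "insert (Tup []) ((\<lambda>x. Tup [x]) ` cube_pts n)" and le = ext_le])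
    (auto simp: ext_le_def cube_le_top, simp_all add: ext_cube_def)

lemma tcof_cell_eq: "ext_unit n \<lhd> tcof_incl n = tcof_cell n"
  by (rule ntr_poset_eqI[of _ _ "insert (Tup []) ((\<lambda>x. Tup [x]) ` cube_pts n)" ext_le])
    (simp_all add: fcomp_assoc ext_last_incl, simp add: ext_cube_def)

context pointed_derivator
begin

definition tot_mor where
  "tot_mor n = restr_mor D (tcof_edge n) \<circ>\<^sub>d lan_mor D (tcof_incl n)"

text \<open>With t = \<open>tcof_incl n\<close> and N = \<open>tot_mor n\<close>, this is the unit X
  -> t^*t_!X followed by the map induced by the 2-cell that pushes each vertex up to one of the two
  tops; it lands in \<chi>^* N X.\<close>

definition tot_unit where
  "tot_unit n C = (dnt D (tcof_cell n \<otimes>\<^sub>n nid (fid C)) \<lhd> lan D (tcof_incl n \<otimes>\<^sub>f fid C)) \<cdot> lan_unit D (tcof_incl n \<otimes>\<^sub>f fid C)"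

lemma modification_tot_unit:
  "modification (shift D (cube n)) (shift D (cube n)) (id_mor (shift D (cube n))) (restr_mor D (cube_last n) \<circ>\<^sub>d tot_mor n) (tot_unit n)"
proof -
  let ?Q = "shift D (cube n)" and ?E = "shift D (ext_cube n)" and ?A = "shift D arrow_cat"
  let ?l = "lan_mor D (tcof_incl n)"
  have pd: "prederivator ?Q" "prederivator ?E" "prederivator ?A" by (simp_all add: prederivator_shift_D)
  have p: "pseudonatural ?Q ?E ?l" "pseudonatural ?E ?A (restr_mor D (tcof_edge n))" "pseudonatural ?A ?Q (restr_mor D (cube_last n))"
    using pseudonatural_lan[of "tcof_incl n"] pseudonatural_restr[of "tcof_edge n"] pseudonatural_restr[of "cube_last n"] by simp_all
  have 1: "modification ?Q ?Q (id_mor ?Q) (restr_mor D (tcof_incl n) \<circ>\<^sub>d ?l) (\<lambda>C. lan_unit D (tcof_incl n \<otimes>\<^sub>f fid C))"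
    using modification_lan_unit[of "tcof_incl n"] by simp
  have "modification ?E ?Q (restr_mor D (tcof_incl n)) (restr_mor D (tcof_edge n \<odot> cube_last n)) (\<lambda>C. dnt D (tcof_cell n \<otimes>\<^sub>n nid (fid C)))"
    using modification_restr[of "tcof_cell n"] by simp
  note 2 = modification_whisk_right[OF this p(1) pd(1,2,1)]
  have "restr_mor D (tcof_edge n \<odot> cube_last n) \<approx> restr_mor D (cube_last n) \<circ>\<^sub>d restr_mor D (tcof_edge n)"
    by (rule dmor_eq_sym[OF restr_mor_comp]) simp_all
  hence "restr_mor D (tcof_edge n \<odot> cube_last n) \<circ>\<^sub>d ?l \<approx> (restr_mor D (cube_last n) \<circ>\<^sub>d restr_mor D (tcof_edge n)) \<circ>\<^sub>d ?l"
    by (rule dmor_eq_mcomp[OF dmor_eq_refl])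
  also have "\<dots> \<approx> restr_mor D (cube_last n) \<circ>\<^sub>d tot_mor n"
    unfolding tot_mor_def by (rule mcomp_assoc[OF p(1,2,3) pd(1,2,3,1)])
  finally have 3: "restr_mor D (tcof_edge n \<odot> cube_last n) \<circ>\<^sub>d ?l \<approx> restr_mor D (cube_last n) \<circ>\<^sub>d tot_mor n" .
  have "tot_unit n = (\<lambda>C. (dnt D (tcof_cell n \<otimes>\<^sub>n nid (fid C)) \<lhd> mfun ?l C) \<cdot> lan_unit D (tcof_incl n \<otimes>\<^sub>f fid C))"
    by (rule ext) (simp add: tot_unit_def lan_mor_simps)
  thus ?thesis using modification_vcomp[OF 1 modification_cong[OF 2 dmor_eq_refl 3] pd(1,1)] by simp
qed

text \<open>A left adjoint section makes \<chi>^* fully faithful: at an object \<chi>^*g the counit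
  is an identity, so transposing \<open>k\<close> twice returns \<chi>^* of its restriction.\<close>

lemma cube_last_full:
  assumes n: "n \<ge> 1" and C [simp]: "C \<in> Cat" and Y [simp]: "Y \<in> Obj (dcat D (arrow_cat \<otimes> C))" "g \<in> Obj (dcat D (arrow_cat \<otimes> C))"
    and k: "k \<in> hom (dcat D (cube n \<otimes> C)) (FO (dfun D (cube_last n \<otimes>\<^sub>f fid C)) Y) (FO (dfun D (cube_last n \<otimes>\<^sub>f fid C)) g)"
  shows "FA (dfun D (cube_last n \<otimes>\<^sub>f fid C)) (FA (dfun D (cube_ends n \<otimes>\<^sub>f fid C)) k) = k"
proof -
  define r s \<kappa> where "r = cube_last n \<otimes>\<^sub>f fid C" and "s = cube_ends n \<otimes>\<^sub>f fid C" and "\<kappa> = cube_counit n \<otimes>\<^sub>n nid (fid C)"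
  have c: "coreflection r s \<kappa>" unfolding r_def s_def \<kappa>_def by (rule coreflection_prod[OF cube_coreflection[OF n] C])
  have [simp]: "isfun r" "Src r = cube n \<otimes> C" "Tgt r = arrow_cat \<otimes> C" "isfun s" "Src s = arrow_cat \<otimes> C" "Tgt s = cube n \<otimes> C"
    by (simp_all add: r_def s_def)
  have [simp]: "isnt \<kappa>" "NSrc \<kappa> = s \<odot> r" "NTgt \<kappa> = fid (cube n \<otimes> C)" "r \<rhd> \<kappa> = nid r"
    and rs: "r \<odot> s = fid (arrow_cat \<otimes> C)"
    using c by (simp_all add: coreflection_def)
  have [simp]: "r \<odot> (s \<odot> r) = r" using rs by (simp flip: fcomp_assoc)
  have k: "k \<in> hom (dcat D (Src r)) (FO (dfun D r) Y) (FO (dfun D r) g)" using k by (simp add: r_def)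
  have "Comp (dcat D (Src r)) (NT (dnt D \<kappa>) (FO (dfun D r) g)) (FA (dfun D r) (FA (dfun D s) k)) = k"
    by (rule coreflection_transpose(2)[OF c _ _ k]) simp_all
  moreover have "NT (dnt D \<kappa>) (FO (dfun D r) g) = Ident (dcat D (cube n \<otimes> C)) (FO (dfun D r) g)"
    using NT_dnt_whisk_left[of r \<kappa> g] by simp
  ultimately have "FA (dfun D r) (FA (dfun D s) k) = k" using k by simp
  thus ?thesis by (simp add: r_def s_def)
qed

text \<open>Write \<chi> = r t with r = \<open>ext_last n\<close>, and let e =
  \<open>tcof_edge n\<close>. Then hom(\<chi>^*NX, \<chi>^*g) = hom(NX, g) = hom(e^*t_!X, g) =
  hom(t_!X, r^*g) = hom(X, t^*r^*g), by full faithfulness of \<chi>^*, the reflection, and the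
  adjunction of t_! and t^*. The composite is precomposition with the unit.\<close>

lemma tot_unit_local:
  assumes n: "n \<ge> 1" and C [simp]: "C \<in> Cat" and X [simp]: "X \<in> Obj (dcat D (cube n \<otimes> C))" and g [simp]: "g \<in> Obj (dcat D (arrow_cat \<otimes> C))"
  shows "local_for (dcat D (cube n \<otimes> C)) (NT (tot_unit n C) X) (FO (dfun D (cube_last n \<otimes>\<^sub>f fid C)) g)"
proof -
  define x r e t \<upsilon> where "x = cube_last n \<otimes>\<^sub>f fid C" and "r = ext_last n \<otimes>\<^sub>f fid C" and "e = tcof_edge n \<otimes>\<^sub>f fid C"
    and "t = tcof_incl n \<otimes>\<^sub>f fid C" and "\<upsilon> = ext_unit n \<otimes>\<^sub>n nid (fid C)"
  let ?Q = "dcat D (cube n \<otimes> C)" and ?E = "dcat D (ext_cube n \<otimes> C)" and ?A = "dcat D (arrow_cat \<otimes> C)"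
  have [simp]: "isfun x" "Src x = cube n \<otimes> C" "Tgt x = arrow_cat \<otimes> C" "isfun r" "Src r = ext_cube n \<otimes> C" "Tgt r = arrow_cat \<otimes> C"
    "isfun e" "Src e = arrow_cat \<otimes> C" "Tgt e = ext_cube n \<otimes> C" "isfun t" "Src t = cube n \<otimes> C" "Tgt t = ext_cube n \<otimes> C"
    "isnt \<upsilon>" "NSrc \<upsilon> = fid (ext_cube n \<otimes> C)" "NTgt \<upsilon> = e \<odot> r"
    by (simp_all add: x_def r_def e_def t_def \<upsilon>_def)
  have rt [simp]: "r \<odot> t = x" by (simp add: r_def t_def x_def ext_last_incl)
  have refl: "reflection r e \<upsilon>" unfolding r_def e_def \<upsilon>_def by (rule reflection_prod[OF ext_reflection C])
  hence [simp]: "r \<odot> e = fid (arrow_cat \<otimes> C)" by (simp add: reflection_def)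
  have cell: "tcof_cell n \<otimes>\<^sub>n nid (fid C) = \<upsilon> \<lhd> t"
    by (rule ntr_eqI) (simp_all add: \<upsilon>_def t_def e_def r_def flip: tcof_cell_eq)
  note adj = lan_adjunction[OF \<open>isfun t\<close>]
  let ?L = "FO (lan D t) X" and ?\<eta> = "NT (lan_unit D t) X" and ?u = "NT (dnt D \<upsilon>) (FO (lan D t) X)"
  have q: "NT (tot_unit n C) X = Comp ?Q (FA (dfun D t) ?u) ?\<eta>"
    unfolding tot_unit_def cell t_def[symmetric] by simp
  have qh: "NT (tot_unit n C) X \<in> hom ?Q X (FO (dfun D x) (FO (dfun D e) ?L))"
    unfolding q by (simp add: fcomp_assoc flip: rt)
  have ad: "Comp ?Q (FA (dfun D x) h) (NT (tot_unit n C) X) = Comp ?Q (FA (dfun D t) (Comp ?E (FA (dfun D r) h) ?u)) ?\<eta>"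
    if h: "h \<in> hom ?A (FO (dfun D e) ?L) g" for h
    unfolding q using h by (simp add: fcomp_assoc flip: rt)
  have tr: "Comp ?E (FA (dfun D r) h) ?u \<in> hom ?E ?L (FO (dfun D r) g)" if "h \<in> hom ?A (FO (dfun D e) ?L) g" for h
    using that by simp
  show ?thesis unfolding x_def[symmetric]
  proof (rule local_forI)
    fix f assume "f \<in> hom ?Q (Dom ?Q (NT (tot_unit n C) X)) (FO (dfun D x) g)"
    hence f: "f \<in> hom ?Q X (FO (dfun D t) (FO (dfun D r) g))" using qh by (simp flip: rt)
    obtain m where m: "m \<in> hom ?E ?L (FO (dfun D r) g)" "Comp ?Q (FA (dfun D t) m) ?\<eta> = f"
    proof (rule that)
      let ?m = "Comp ?E (NT (lan_counit D t) (FO (dfun D r) g)) (FA (lan D t) f)"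
      show "?m \<in> hom ?E ?L (FO (dfun D r) g)" using f by simp
      show "Comp ?Q (FA (dfun D t) ?m) ?\<eta> = f"
        using adjunction_transpose(1)[OF adj, of X "FO (dfun D r) g" f] f by simp
    qed
    let ?h = "FA (dfun D e) m"
    have h: "?h \<in> hom ?A (FO (dfun D e) ?L) g" using m by simp
    have "Comp ?E (FA (dfun D r) ?h) ?u = m"
      using reflection_transpose(2)[OF refl, of ?L g m] m by simp
    hence "Comp ?Q (FA (dfun D x) ?h) (NT (tot_unit n C) X) = f" using ad[OF h] m by simp
    thus "\<exists>k. k \<in> hom ?Q (Cod ?Q (NT (tot_unit n C) X)) (FO (dfun D x) g) \<and> Comp ?Q k (NT (tot_unit n C) X) = f"
      using h qh by (intro exI[of _ "FA (dfun D x) ?h"]) simp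
  next
    fix k k' assume "k \<in> hom ?Q (Cod ?Q (NT (tot_unit n C) X)) (FO (dfun D x) g)" "k' \<in> hom ?Q (Cod ?Q (NT (tot_unit n C) X)) (FO (dfun D x) g)"
      and eq: "Comp ?Q k (NT (tot_unit n C) X) = Comp ?Q k' (NT (tot_unit n C) X)"
    hence k: "k \<in> hom ?Q (FO (dfun D x) (FO (dfun D e) ?L)) (FO (dfun D x) g)" "k' \<in> hom ?Q (FO (dfun D x) (FO (dfun D e) ?L)) (FO (dfun D x) g)"
      using qh by simp_all
    have "\<exists>h. h \<in> hom ?A (FO (dfun D e) ?L) g \<and> FA (dfun D x) h = k" if k: "k \<in> hom ?Q (FO (dfun D x) (FO (dfun D e) ?L)) (FO (dfun D x) g)" for k
    proof (intro exI conjI)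
      let ?h = "FA (dfun D (cube_ends n \<otimes>\<^sub>f fid C)) k"
      show "FA (dfun D x) ?h = k" using cube_last_full[OF n C _ g k[unfolded x_def]] by (simp add: x_def)
      have "x \<odot> (cube_ends n \<otimes>\<^sub>f fid C) = fid (arrow_cat \<otimes> C)"
        using coreflection_prod[OF cube_coreflection[OF n] C] by (simp add: coreflection_def x_def)
      thus "?h \<in> hom ?A (FO (dfun D e) ?L) g" using k by (simp add: fcomp_assoc)
    qed
    then obtain h h' where h: "h \<in> hom ?A (FO (dfun D e) ?L) g" "FA (dfun D x) h = k"
      and h': "h' \<in> hom ?A (FO (dfun D e) ?L) g" "FA (dfun D x) h' = k'" using k by metis
    have "Comp ?E (FA (dfun D r) h) ?u = Comp ?E (FA (dfun D r) h') ?u"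
      by (rule adjunction_eq_left[OF adj, of X "FO (dfun D r) g"]) (use tr[OF h(1)] tr[OF h'(1)] ad[OF h(1)] ad[OF h'(1)] h h' eq in simp_all)
    hence "FA (dfun D e) (Comp ?E (FA (dfun D r) h) ?u) = FA (dfun D e) (Comp ?E (FA (dfun D r) h') ?u)" by simp
    hence "h = h'" using reflection_transpose(1)[OF refl, of ?L g] h(1) h'(1) by simp
    thus "k = k'" using h h' by simp
  qed (use qh in simp_all)
qed

text \<open>Every top-supported object is isomorphic to \<chi>^*V for V vanishing at 0, namely for
  its restriction V to the least and the last vertex. Locality has to be tested only against such
  objects.\<close>

lemma top_localI:
  assumes n: "n \<ge> 1" and C [simp]: "C \<in> Cat" and \<phi>: "\<phi> \<in> Arr (dcat D (cube n \<otimes> C))"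
    and l: "\<And>V. V \<in> Obj (dcat D (arrow_cat \<otimes> C)) \<Longrightarrow> (\<And>c. c \<in> Obj C \<Longrightarrow> vanish (arrow_cat \<otimes> C) (Tup [b0, c]) V) \<Longrightarrow>
      local_for (dcat D (cube n \<otimes> C)) \<phi> (FO (dfun D (cube_last n \<otimes>\<^sub>f fid C)) V)"
  shows "top_local n C \<phi>"
  unfolding top_local_def
proof (intro conjI allI impI)
  fix W assume W: "top_supported n C W"
  let ?Q = "dcat D (cube n \<otimes> C)"
  define r s \<kappa> where "r = cube_last n \<otimes>\<^sub>f fid C" and "s = cube_ends n \<otimes>\<^sub>f fid C" and "\<kappa> = cube_counit n \<otimes>\<^sub>n nid (fid C)"
  have c: "coreflection r s \<kappa>" unfolding r_def s_def \<kappa>_def by (rule coreflection_prod[OF cube_coreflection[OF n] C])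
  have [simp]: "isfun r" "Src r = cube n \<otimes> C" "Tgt r = arrow_cat \<otimes> C" "isfun s" "Src s = arrow_cat \<otimes> C" "Tgt s = cube n \<otimes> C"
    by (simp_all add: r_def s_def)
  have \<kappa> [simp]: "isnt \<kappa>" "NSrc \<kappa> = s \<odot> r" "NTgt \<kappa> = fid (cube n \<otimes> C)"
    using c by (simp_all add: coreflection_def)
  have W' [simp]: "W \<in> Obj ?Q" using W by (simp add: top_supported_def)
  have v: "vanish (cube n \<otimes> C) (Tup [x, c]) W" if "x \<in> cube_pts n" "x \<noteq> top_pt n" "c \<in> Obj C" for x c
    using W that by (simp add: top_supported_def)
  note [simp] = replicate_b0_b1(1)[OF n] replicate_b0_b1(2)[of n]
  have "local_for ?Q \<phi> (FO (dfun D r) (FO (dfun D s) W))"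
    unfolding r_def by (rule l) (use v in \<open>simp_all add: s_def\<close>)
  \<comment> \<open>At the last vertex \<kappa> is an identity. At any other vertex the arrow runs
    from the value of W at the least vertex to its value at the given one, and both vanish; here n
    >= 1 is used.\<close>
  moreover have "iso_arr ?Q (NT (dnt D \<kappa>) W)"
  proof (rule iso_if_iso_at)
    fix p assume "p \<in> Obj (cube n \<otimes> C)"
    then obtain x c where p: "p = Tup [x, c]" "x \<in> cube_pts n" "c \<in> Obj C" by (auto elim!: Obj_prodE)
    show "iso_at (cube n \<otimes> C) p (NT (dnt D \<kappa>) W)"
    proof (cases "x = top_pt n")
      case True
      have 1: "\<kappa> \<lhd> point (cube n \<otimes> C) p = nid (point (cube n \<otimes> C) p)"
      proof (rule ntr_eqI)
        have "Ident (cube n) (top_pt n) = Tup [top_pt n, top_pt n :: 'u el]" by (simp add: cube_def)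
        thus "NT (\<kappa> \<lhd> point (cube n \<otimes> C) p) y = NT (nid (point (cube n \<otimes> C) p)) y" if "y \<in> Obj (Src (NSrc (nid (point (cube n \<otimes> C) p))))" for y
          using that p True by (simp add: \<kappa>_def cube_counit_def)
      qed (use p True in \<open>simp_all add: r_def s_def\<close>)
      have "FA (dfun D (point (cube n \<otimes> C) p)) (NT (dnt D \<kappa>) W) = NT (dnt D (\<kappa> \<lhd> point (cube n \<otimes> C) p)) W"
        using p by simp
      thus ?thesis unfolding iso_at_def 1 using p by (simp add: iso_arr_Ident)
    next
      case False
      show ?thesis unfolding iso_at_def
        by (rule vanish_iso_arr[where X = "FO (dfun D r) (FO (dfun D s) W)" and Y = W])
          (use p False v in \<open>simp_all\<close>, simp_all add: r_def s_def v)
    qed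
  qed simp_all
  ultimately show "local_for ?Q \<phi> W" using local_for_iso_target[of ?Q \<phi> "NT (dnt D \<kappa>) W"] \<phi> by simp
qed (rule \<phi>)

text \<open>Full faithfulness of \<chi>^* turns locality of V for f into locality of \<chi>^*V for
  \<chi>^*f, and \<open>top_localI\<close> does the rest.\<close>

lemma top_local_cube_last:
  assumes n: "n \<ge> 1" and C [simp]: "C \<in> Cat" and f [simp]: "f \<in> Arr (dcat D (arrow_cat \<otimes> C))"
    and l: "\<And>V. V \<in> Obj (dcat D (arrow_cat \<otimes> C)) \<Longrightarrow> (\<And>c. c \<in> Obj C \<Longrightarrow> vanish (arrow_cat \<otimes> C) (Tup [b0, c]) V) \<Longrightarrow>
      local_for (dcat D (arrow_cat \<otimes> C)) f V"
  shows "top_local n C (FA (dfun D (cube_last n \<otimes>\<^sub>f fid C)) f)"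
proof (rule top_localI[OF n C])
  let ?Q = "dcat D (cube n \<otimes> C)" and ?A = "dcat D (arrow_cat \<otimes> C)"
  define x s where "x = cube_last n \<otimes>\<^sub>f fid C" and "s = cube_ends n \<otimes>\<^sub>f fid C"
  have [simp]: "isfun x" "Src x = cube n \<otimes> C" "Tgt x = arrow_cat \<otimes> C" "isfun s" "Src s = arrow_cat \<otimes> C" "Tgt s = cube n \<otimes> C"
    by (simp_all add: x_def s_def)
  have [simp]: "x \<odot> s = fid (arrow_cat \<otimes> C)"
    using coreflection_prod[OF cube_coreflection[OF n] C] by (simp add: coreflection_def x_def s_def)
  show "FA (dfun D (cube_last n \<otimes>\<^sub>f fid C)) f \<in> Arr ?Q" by simp
  fix V assume V [simp]: "V \<in> Obj ?A" and "\<And>c. c \<in> Obj C \<Longrightarrow> vanish (arrow_cat \<otimes> C) (Tup [b0, c]) V"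
  hence loc: "local_for ?A f V" by (rule l)
  have full: "FA (dfun D x) (FA (dfun D s) k) = k" if "k \<in> hom ?Q (FO (dfun D x) Y) (FO (dfun D x) V)" "Y \<in> Obj ?A" for k Y
    unfolding x_def s_def by (rule cube_last_full[OF n C that(2) V]) (use that in \<open>simp add: x_def\<close>)
  show "local_for ?Q (FA (dfun D (cube_last n \<otimes>\<^sub>f fid C)) f) (FO (dfun D (cube_last n \<otimes>\<^sub>f fid C)) V)"
    unfolding x_def[symmetric]
  proof (rule local_forI)
    fix h assume "h \<in> hom ?Q (Dom ?Q (FA (dfun D x) f)) (FO (dfun D x) V)"
    hence h: "h \<in> hom ?Q (FO (dfun D x) (Dom ?A f)) (FO (dfun D x) V)" by simp
    hence "FA (dfun D s) h \<in> hom ?A (Dom ?A f) V" by simp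
    then obtain k where k: "k \<in> hom ?A (Cod ?A f) V" "Comp ?A k f = FA (dfun D s) h" by (rule local_forE[OF loc])
    have "FA (dfun D x) (Comp ?A k f) = h" unfolding k(2) by (rule full[OF h]) simp
    hence "Comp ?Q (FA (dfun D x) k) (FA (dfun D x) f) = h" using k(1) by simp
    thus "\<exists>k. k \<in> hom ?Q (Cod ?Q (FA (dfun D x) f)) (FO (dfun D x) V) \<and> Comp ?Q k (FA (dfun D x) f) = h"
      using k(1) by (intro exI[of _ "FA (dfun D x) k"]) simp
  next
    fix k m assume "k \<in> hom ?Q (Cod ?Q (FA (dfun D x) f)) (FO (dfun D x) V)" "m \<in> hom ?Q (Cod ?Q (FA (dfun D x) f)) (FO (dfun D x) V)"
      and e: "Comp ?Q k (FA (dfun D x) f) = Comp ?Q m (FA (dfun D x) f)"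
    hence km: "k \<in> hom ?Q (FO (dfun D x) (Cod ?A f)) (FO (dfun D x) V)" "m \<in> hom ?Q (FO (dfun D x) (Cod ?A f)) (FO (dfun D x) V)" by simp_all
    have "FA (dfun D s) (Comp ?Q k (FA (dfun D x) f)) = FA (dfun D s) (Comp ?Q m (FA (dfun D x) f))" by (simp only: e)
    hence "FA (dfun D s) k = FA (dfun D s) m" by - (rule local_for_inj[OF loc], use km in simp_all)
    hence "FA (dfun D x) (FA (dfun D s) k) = FA (dfun D x) (FA (dfun D s) m)" by simp
    thus "k = m" using full[OF km(1)] full[OF km(2)] by simp
  qed simp_all
qed

end

subsection \<open>The comparison with the iterated cone\<close>

lemma iso_modification_trans:
  assumes pd: "prederivator D" "prederivator E" and F: "\<exists>\<tau>. iso_modification D E F G \<tau>" and G: "\<exists>\<tau>. iso_modification D E G H \<tau>"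
  shows "\<exists>\<tau>. iso_modification D E F H \<tau>"
proof -
  obtain \<tau> \<sigma> where \<tau>: "modification D E F G \<tau>" "\<And>A. A \<in> Cat \<Longrightarrow> nat_iso (\<tau> A)"
    and \<sigma>: "modification D E G H \<sigma>" "\<And>A. A \<in> Cat \<Longrightarrow> nat_iso (\<sigma> A)"
    using F G by (auto simp: iso_modification_def)
  note m = modification_simps[OF \<tau>(1)] modification_simps[OF \<sigma>(1)]
  have "nat_iso (\<sigma> A \<cdot> \<tau> A)" if A: "A \<in> Cat" for A
    unfolding nat_iso_def
  proof (intro ballI)
    note [simp] = m(3-5)[OF A] m(8-10)[OF A] pseudonatural_simps(1-3)[OF m(1) A] pseudonatural_simps(1-3)[OF m(2) A] pseudonatural_simps(1-3)[OF m(7) A]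
      prederivator.dcat_category[OF pd(1) A] prederivator.dcat_category[OF pd(2) A]
    fix x assume "x \<in> Obj (Src (NSrc (\<sigma> A \<cdot> \<tau> A)))"
    hence x: "x \<in> Obj (dcat D A)" by simp
    have "iso_arr (dcat E A) (NT (\<tau> A) x)" "iso_arr (dcat E A) (NT (\<sigma> A) x)"
      using \<tau>(2)[OF A] \<sigma>(2)[OF A] x by (simp_all add: nat_iso_def)
    thus "iso_arr (Tgt (NSrc (\<sigma> A \<cdot> \<tau> A))) (NT (\<sigma> A \<cdot> \<tau> A) x)" using x by (simp add: iso_arr_Comp)
  qed
  thus ?thesis using modification_vcomp[OF \<tau>(1) \<sigma>(1) pd] by (auto simp: iso_modification_def)
qed

lemma iso_modification_sym:
  assumes pd: "prederivator D" "prederivator E" and F: "\<exists>\<tau>. iso_modification D E F G \<tau>"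
  shows "\<exists>\<tau>. iso_modification D E G F \<tau>"
proof -
  obtain \<tau> where \<tau>: "modification D E F G \<tau>" "\<And>A. A \<in> Cat \<Longrightarrow> nat_iso (\<tau> A)"
    using F by (auto simp: iso_modification_def)
  have "nat_iso (ninv (\<tau> A))" if A: "A \<in> Cat" for A
    by (rule nat_iso_ninv) (use modification_simps[OF \<tau>(1)] \<tau>(2) A in simp_all)
  thus ?thesis using modification_inverse[OF \<tau> pd] by (auto simp: iso_modification_def)
qed

lemma iso_modification_cong:
  assumes "\<exists>\<tau>. iso_modification D E F G \<tau>" "F \<approx> F'" "G \<approx> G'"
  shows "\<exists>\<tau>. iso_modification D E F' G' \<tau>"
  using assms modification_cong unfolding iso_modification_def by blast

context pointed_derivator
begin

lemma iterated_cone_simps: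
  assumes [simp]: "B \<in> Cat"
  shows "cat_functor (mfun (iterated_cone D n) B)" "Src (mfun (iterated_cone D n) B) = dcat D (cube n \<otimes> B)" "Tgt (mfun (iterated_cone D n) B) = dcat D B"
    "mfun (iterated_cone D n) B = dfun D (slice_at (cube n) (top_pt n) B) \<odot> cofs n B 0 n"
  using cofs_functor'[of B 0 n n] by (simp_all add: iterated_cone_def eval_mor_def cofs_eq)

lemma iterated_cone_iso:
  assumes B [simp]: "B \<in> Cat" and \<phi>: "top_local n B \<phi>"
  shows "iso_arr (dcat D B) (FA (mfun (iterated_cone D n) B) \<phi>)"
proof -
  note [simp] = cofs_functor'[OF B, of 0 n n, simplified]
  have [simp]: "\<phi> \<in> Arr (dcat D (cube n \<otimes> B))" using \<phi> by (simp add: top_local_def)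
  show ?thesis unfolding iterated_cone_simps(4)[OF B]
  proof (rule iso_if_iso_at)
    fix b assume b: "b \<in> Obj B"
    \<comment> \<open>For k = 0 no coordinate has been treated, and the vanishing condition of
      \<open>cofs_iso_top\<close> is empty.\<close>
    have "iso_at (cube n \<otimes> B) (Tup [top_pt n, b]) (FA (cofs n B 0 n) \<phi>)"
      by (rule cofs_iso_top[OF B b _ \<phi>]) simp_all
    thus "iso_at B b (FA (dfun D (slice_at (cube n) (top_pt n) B) \<odot> cofs n B 0 n) \<phi>)" using b by simp
  qed simp_all
qed

lemma edge_mor_vanish:
  assumes "B \<in> Cat" "Z \<in> Obj (dcat D (arrow_cat \<otimes> B))" "c \<in> Obj B"
  shows "vanish (arrow_cat \<otimes> B) (Tup [b0, c]) (FO (mfun (edge_mor bottom_edge) B) Z)"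
  using assms sq_obj_vanish[OF assms] by (simp add: mfun_edge_mor)

text \<open>The target of a square edge is (1,1), so evaluation at \<open>b1\<close> does not see
  which edge was taken. The cone may thus be computed from the bottom edge.\<close>

lemma eval_edge_mor:
  assumes e: "square_edge e"
  shows "eval_mor D arrow_cat b1 \<circ>\<^sub>d edge_mor e \<approx> eval_mor D (cube 2) (Tup [b1, b1]) \<circ>\<^sub>d (lan_mor D corner_incl \<circ>\<^sub>d ran_mor D corner_arrow)"
proof -
  note [simp] = square_edgeD[OF e]
  let ?A = "shift D arrow_cat" and ?K = "shift D corner" and ?S = "shift D (cube 2)"
  have pd: "prederivator ?A" "prederivator ?K" "prederivator ?S" "prederivator D" by (simp_all add: prederivator_shift_D prederivator_D)
  have p: "pseudonatural ?A ?K (ran_mor D corner_arrow)" "pseudonatural ?K ?S (lan_mor D corner_incl)" "pseudonatural ?S ?A (restr_mor D e)"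
     "pseudonatural ?A D (eval_mor D arrow_cat b1)"
    using pseudonatural_ran[of corner_arrow] pseudonatural_lan[of corner_incl] pseudonatural_restr[of e] pseudonatural_eval[of arrow_cat b1] by simp_all
  have "eval_mor D arrow_cat b1 \<circ>\<^sub>d edge_mor e \<approx> (eval_mor D arrow_cat b1 \<circ>\<^sub>d restr_mor D e) \<circ>\<^sub>d (lan_mor D corner_incl \<circ>\<^sub>d ran_mor D corner_arrow)"
    unfolding edge_mor_def by (rule dmor_eq_sym[OF mcomp_assoc[OF pseudonatural_mcomp[OF p(1,2) pd(1-3)] p(3,4) pd(1,3,1,4)]])
  also have "\<dots> \<approx> eval_mor D (cube 2) (Tup [b1, b1]) \<circ>\<^sub>d (lan_mor D corner_incl \<circ>\<^sub>d ran_mor D corner_arrow)"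
    using eval_restr_comp[of e arrow_cat b1] by (intro dmor_eq_mcomp dmor_eq_refl) simp
  finally show ?thesis .
qed

text \<open>The last vertex goes to \<open>b1\<close> under \<chi>, so evaluating there after
  \<chi>^* is evaluating at \<open>b1\<close>; on the bottom edge this is the cone, and the cone
  after \<open>tot_mor n\<close> is \<open>tcof\<close>.\<close>

lemma tcof_eq:
  "eval_mor D (cube n) (top_pt n) \<circ>\<^sub>d ((restr_mor D (cube_last n) \<circ>\<^sub>d edge_mor bottom_edge) \<circ>\<^sub>d tot_mor n) \<approx> tcof D n"
proof -
  let ?Q = "shift D (cube n)" and ?E = "shift D (ext_cube n)" and ?A = "shift D arrow_cat"
  let ?ev = "eval_mor D (cube n) (top_pt n)" and ?\<chi> = "restr_mor D (cube_last n)" and ?L = "edge_mor bottom_edge"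
  have pd: "prederivator ?Q" "prederivator ?E" "prederivator ?A" "prederivator D" by (simp_all add: prederivator_shift_D prederivator_D)
  have p: "pseudonatural ?Q ?E (lan_mor D (tcof_incl n))" "pseudonatural ?E ?A (restr_mor D (tcof_edge n))" "pseudonatural ?A ?A ?L"
    "pseudonatural ?A ?Q ?\<chi>" "pseudonatural ?Q D ?ev"
    using pseudonatural_lan[of "tcof_incl n"] pseudonatural_restr[of "tcof_edge n"] pseudonatural_restr[of "cube_last n"]
      pseudonatural_edge_mor[of bottom_edge] pseudonatural_eval[of "cube n" "top_pt n"] by simp_all
  have t: "pseudonatural ?Q ?A (tot_mor n)" unfolding tot_mor_def by (rule pseudonatural_mcomp[OF p(1,2) pd(1-3)])
  have "?ev \<circ>\<^sub>d ((?\<chi> \<circ>\<^sub>d ?L) \<circ>\<^sub>d tot_mor n) \<approx> (?ev \<circ>\<^sub>d (?\<chi> \<circ>\<^sub>d ?L)) \<circ>\<^sub>d tot_mor n"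
    by (rule dmor_eq_sym[OF mcomp_assoc[OF t pseudonatural_mcomp[OF p(3,4) pd(3,3,1)] p(5) pd(1,3,1,4)]])
  also have "?ev \<circ>\<^sub>d (?\<chi> \<circ>\<^sub>d ?L) \<approx> cone D"
  proof -
    have "?ev \<circ>\<^sub>d (?\<chi> \<circ>\<^sub>d ?L) \<approx> (?ev \<circ>\<^sub>d ?\<chi>) \<circ>\<^sub>d ?L"
      by (rule dmor_eq_sym[OF mcomp_assoc[OF p(3,4,5) pd(3,3,1,4)]])
    also have "\<dots> \<approx> eval_mor D arrow_cat b1 \<circ>\<^sub>d ?L"
      using eval_restr_comp[of "cube_last n" "cube n" "top_pt n"] by (intro dmor_eq_mcomp dmor_eq_refl) simp
    also have "\<dots> \<approx> eval_mor D (cube 2) (Tup [b1, b1]) \<circ>\<^sub>d (lan_mor D corner_incl \<circ>\<^sub>d ran_mor D corner_arrow)"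
      by (rule eval_edge_mor) simp
    also have "\<dots> \<approx> cone D" unfolding cone_def cof_eq by (rule dmor_eq_sym[OF eval_edge_mor]) simp
    finally show ?thesis .
  qed
  hence "(?ev \<circ>\<^sub>d (?\<chi> \<circ>\<^sub>d ?L)) \<circ>\<^sub>d tot_mor n \<approx> tcof D n"
    unfolding tcof_def tot_mor_def by (rule dmor_eq_mcomp[OF dmor_eq_refl])
  finally show ?thesis .
qed

text \<open>With G the iterated cone, L the bottom edge and N = \<open>tot_mor n\<close>, the
  isomorphism is the zigzag tcof -> G \<chi>^* L N <- G \<chi>^* \<open>ext_mor\<close> N -> G
  \<chi>^* N <- G. The detour through \<open>ext_mor\<close> arises because the map to the bottom
  edge starts at the restricted extension instead of the identity.\<close>

lemma tcof_iso_iterated_cone: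
  assumes n: "n \<ge> 1"
  shows "\<exists>\<tau>. iso_modification (shift D (cube n)) D (tcof D n) (iterated_cone D n) \<tau>"
proof -
  let ?Q = "shift D (cube n)" and ?E = "shift D (ext_cube n)" and ?A = "shift D arrow_cat"
  let ?ev = "eval_mor D (cube n) (top_pt n)" and ?\<chi> = "restr_mor D (cube_last n)" and ?L = "edge_mor bottom_edge"
    and ?N = "tot_mor n" and ?G = "iterated_cone D n"
  have pd: "prederivator ?Q" "prederivator ?E" "prederivator ?A" "prederivator D" by (simp_all add: prederivator_shift_D prederivator_D)
  have p: "pseudonatural ?Q ?E (lan_mor D (tcof_incl n))" "pseudonatural ?E ?A (restr_mor D (tcof_edge n))" "pseudonatural ?A ?A ?L"
    "pseudonatural ?A ?Q ?\<chi>" "pseudonatural ?Q D ?ev" "pseudonatural ?Q ?Q (cof_upto D n n)"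
    using pseudonatural_lan[of "tcof_incl n"] pseudonatural_restr[of "tcof_edge n"] pseudonatural_restr[of "cube_last n"]
      pseudonatural_edge_mor[of bottom_edge] pseudonatural_eval[of "cube n" "top_pt n"] pseudonatural_cof_upto[of n n] by simp_all
  have N: "pseudonatural ?Q ?A ?N" unfolding tot_mor_def by (rule pseudonatural_mcomp[OF p(1,2) pd(1-3)])
  have G: "pseudonatural ?Q D ?G" unfolding iterated_cone_def by (rule pseudonatural_mcomp[OF p(6,5) pd(1,1,4)])
  have \<chi>L: "pseudonatural ?A ?Q (?\<chi> \<circ>\<^sub>d ?L)" by (rule pseudonatural_mcomp[OF p(3,4) pd(3,3,1)])
  have \<chi>LN: "pseudonatural ?Q ?Q ((?\<chi> \<circ>\<^sub>d ?L) \<circ>\<^sub>d ?N)" by (rule pseudonatural_mcomp[OF N \<chi>L pd(1,3,1)])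
  have \<chi>: "mfun ?\<chi> B = dfun D (cube_last n \<otimes>\<^sub>f fid B)" for B by (simp add: restr_mor_def)
  note Ns [simp] = pseudonatural_simps(1-3)[OF N, unfolded shift_simps]
  note Ls [simp] = pseudonatural_simps(1-3)[OF p(3), unfolded shift_simps]
  note [simp] = iterated_cone_simps(1-3) ext_mor_functor

  \<comment> \<open>G inverts \<open>tot_unit\<close>, because objects supported at the last vertex
    are local for it.\<close>
  have 1: "\<exists>\<tau>. iso_modification ?Q D (?G \<circ>\<^sub>d id_mor ?Q) (?G \<circ>\<^sub>d (?\<chi> \<circ>\<^sub>d ?N)) \<tau>"
  proof (intro exI, unfold iso_modification_def, intro conjI ballI)
    show "modification ?Q D (?G \<circ>\<^sub>d id_mor ?Q) (?G \<circ>\<^sub>d (?\<chi> \<circ>\<^sub>d ?N)) (\<lambda>B. mfun ?G B \<rhd> tot_unit n B)"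
      by (rule modification_whisk_left[OF modification_tot_unit G pd(1,1,4)])
    fix B :: "'u scat" assume B [simp]: "B \<in> Cat"
    note [simp] = modification_simps(3-5)[OF modification_tot_unit B]
    show "nat_iso (mfun ?G B \<rhd> tot_unit n B)"
      unfolding nat_iso_def
    proof (intro ballI)
      fix X assume "X \<in> Obj (Src (NSrc (mfun ?G B \<rhd> tot_unit n B)))"
      hence X: "X \<in> Obj (dcat D (cube n \<otimes> B))" by (simp add: id_mor_def)
      have "NT (tot_unit n B) X \<in> Arr (dcat D (cube n \<otimes> B))" using X by (simp add: id_mor_def)
      hence "top_local n B (NT (tot_unit n B) X)"
        by (rule top_localI[OF n B]) (use tot_unit_local[OF n B X] in simp)
      from iterated_cone_iso[OF B this] show "iso_arr (Tgt (NSrc (mfun ?G B \<rhd> tot_unit n B))) (NT (mfun ?G B \<rhd> tot_unit n B) X)"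
        using X by (simp add: id_mor_def)
    qed
  qed

  \<comment> \<open>The counit is invertible already before \<chi>^* and G are applied.\<close>
  have 2: "\<exists>\<tau>. iso_modification ?Q D (?G \<circ>\<^sub>d ((?\<chi> \<circ>\<^sub>d ext_mor) \<circ>\<^sub>d ?N)) (?G \<circ>\<^sub>d ((?\<chi> \<circ>\<^sub>d id_mor ?A) \<circ>\<^sub>d ?N)) \<tau>"
  proof (intro exI, unfold iso_modification_def, intro conjI ballI)
    show "modification ?Q D (?G \<circ>\<^sub>d ((?\<chi> \<circ>\<^sub>d ext_mor) \<circ>\<^sub>d ?N)) (?G \<circ>\<^sub>d ((?\<chi> \<circ>\<^sub>d id_mor ?A) \<circ>\<^sub>d ?N))
       (\<lambda>B. mfun ?G B \<rhd> ((mfun ?\<chi> B \<rhd> ext_counit B) \<lhd> mfun ?N B))"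
      by (rule modification_whisk_left[OF modification_whisk_right[OF modification_whisk_left[OF modification_ext_counit p(4) pd(3,3,1)] N pd(1,3,1)] G pd(1,1,4)])
    fix B :: "'u scat" assume B [simp]: "B \<in> Cat"
    note [simp] = ext_counit_simps[OF B]
    show "nat_iso (mfun ?G B \<rhd> ((mfun ?\<chi> B \<rhd> ext_counit B) \<lhd> mfun ?N B))"
      unfolding nat_iso_def \<chi>
    proof (intro ballI)
      let ?\<tau> = "mfun ?G B \<rhd> ((dfun D (cube_last n \<otimes>\<^sub>f fid B) \<rhd> ext_counit B) \<lhd> mfun ?N B)"
      fix X assume "X \<in> Obj (Src (NSrc ?\<tau>))"
      hence X: "X \<in> Obj (dcat D (cube n \<otimes> B))" by simp
      have "iso_arr (dcat D (arrow_cat \<otimes> B)) (NT (ext_counit B) (FO (mfun ?N B) X))"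
        by (rule ext_counit_iso) (use X in simp_all)
      hence "iso_arr (dcat D (cube n \<otimes> B)) (FA (dfun D (cube_last n \<otimes>\<^sub>f fid B)) (NT (ext_counit B) (FO (mfun ?N B) X)))"
        by - (rule iso_arr_dfun, simp_all)
      from iso_arr_FA[OF iterated_cone_simps(1)[OF B, of n], unfolded iterated_cone_simps(2,3)[OF B], OF this]
      show "iso_arr (Tgt (NSrc ?\<tau>)) (NT ?\<tau> X)" using X by simp
    qed
  qed

  \<comment> \<open>The map to the bottom edge becomes invertible only under G: after \<chi>^* it is
    one for which objects supported at the last vertex are local.\<close>
  have 3: "\<exists>\<tau>. iso_modification ?Q D (?G \<circ>\<^sub>d ((?\<chi> \<circ>\<^sub>d ext_mor) \<circ>\<^sub>d ?N)) (?G \<circ>\<^sub>d ((?\<chi> \<circ>\<^sub>d ?L) \<circ>\<^sub>d ?N)) \<tau>"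
  proof (intro exI, unfold iso_modification_def, intro conjI ballI)
    show "modification ?Q D (?G \<circ>\<^sub>d ((?\<chi> \<circ>\<^sub>d ext_mor) \<circ>\<^sub>d ?N)) (?G \<circ>\<^sub>d ((?\<chi> \<circ>\<^sub>d ?L) \<circ>\<^sub>d ?N))
       (\<lambda>B. mfun ?G B \<rhd> ((mfun ?\<chi> B \<rhd> edge_nt bottom_edge B) \<lhd> mfun ?N B))"
      by (rule modification_whisk_left[OF modification_whisk_right[OF modification_whisk_left[OF modification_edge p(4) pd(3,3,1)] N pd(1,3,1)] G pd(1,1,4)]) simp
    fix B :: "'u scat" assume B [simp]: "B \<in> Cat"
    note [simp] = edge_nt_simps[OF square_edges(2) B]
    show "nat_iso (mfun ?G B \<rhd> ((mfun ?\<chi> B \<rhd> edge_nt bottom_edge B) \<lhd> mfun ?N B))"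
      unfolding nat_iso_def \<chi>
    proof (intro ballI)
      let ?\<tau> = "mfun ?G B \<rhd> ((dfun D (cube_last n \<otimes>\<^sub>f fid B) \<rhd> edge_nt bottom_edge B) \<lhd> mfun ?N B)"
      fix X assume "X \<in> Obj (Src (NSrc ?\<tau>))"
      hence X: "X \<in> Obj (dcat D (cube n \<otimes> B))" by simp
      have "top_local n B (FA (dfun D (cube_last n \<otimes>\<^sub>f fid B)) (edge_arr bottom_edge B (FO (mfun ?N B) X)))"
        by (rule top_local_cube_last[OF n B]) (use X bottom_edge_local[OF B] in simp_all)
      from iterated_cone_iso[OF B this] show "iso_arr (Tgt (NSrc ?\<tau>)) (NT ?\<tau> X)" using X by (simp add: edge_nt_NT)
    qed
  qed

  \<comment> \<open>The objects \<chi>^*LNX are supported at the last vertex, where the unit of the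
    iterated cofiber is invertible on them; this identifies their value there with G.\<close>
  have 4: "\<exists>\<tau>. iso_modification ?Q D ((?ev \<circ>\<^sub>d id_mor ?Q) \<circ>\<^sub>d ((?\<chi> \<circ>\<^sub>d ?L) \<circ>\<^sub>d ?N)) (?G \<circ>\<^sub>d ((?\<chi> \<circ>\<^sub>d ?L) \<circ>\<^sub>d ?N)) \<tau>"
  proof (intro exI, unfold iso_modification_def, intro conjI ballI)
    have u: "modification ?Q ?Q (id_mor ?Q) (cof_upto D n n) (cube_unit n n)" by (rule modification_cube_unit) simp
    show "modification ?Q D ((?ev \<circ>\<^sub>d id_mor ?Q) \<circ>\<^sub>d ((?\<chi> \<circ>\<^sub>d ?L) \<circ>\<^sub>d ?N)) (?G \<circ>\<^sub>d ((?\<chi> \<circ>\<^sub>d ?L) \<circ>\<^sub>d ?N))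
       (\<lambda>B. (mfun ?ev B \<rhd> cube_unit n n B) \<lhd> mfun ((?\<chi> \<circ>\<^sub>d ?L) \<circ>\<^sub>d ?N) B)"
      unfolding iterated_cone_def
      by (rule modification_whisk_right[OF modification_whisk_left[OF u p(5) pd(1,1,4)] \<chi>LN pd(1,1,4)])
    fix B :: "'u scat" assume B [simp]: "B \<in> Cat"
    note [simp] = modification_simps(3-5)[OF u B] pseudonatural_simps(1-3)[OF p(6) B, unfolded shift_simps]
    have ev: "mfun ?ev B = dfun D (slice_at (cube n) (top_pt n) B)" by (simp add: eval_mor_def)
    show "nat_iso ((mfun ?ev B \<rhd> cube_unit n n B) \<lhd> mfun ((?\<chi> \<circ>\<^sub>d ?L) \<circ>\<^sub>d ?N) B)"
      unfolding nat_iso_def ev mcomp_simps \<chi>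
    proof (intro ballI)
      let ?\<tau> = "(dfun D (slice_at (cube n) (top_pt n) B) \<rhd> cube_unit n n B) \<lhd> (dfun D (cube_last n \<otimes>\<^sub>f fid B) \<odot> mfun ?L B \<odot> mfun ?N B)"
      fix X assume "X \<in> Obj (Src (NSrc ?\<tau>))"
      hence X: "X \<in> Obj (dcat D (cube n \<otimes> B))" by simp
      let ?Y = "FO (dfun D (cube_last n \<otimes>\<^sub>f fid B)) (FO (mfun ?L B) (FO (mfun ?N B) X))"
      have Y: "top_supported n B ?Y"
        unfolding top_supported_def using X edge_mor_vanish[of B "FO (mfun ?N B) X"] by simp
      have "iso_arr (dcat D B) (FA (dfun D (slice_at (cube n) (top_pt n) B)) (NT (cube_unit n n B) ?Y))"
      proof (rule iso_if_iso_at)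
        show "iso_at B b (FA (dfun D (slice_at (cube n) (top_pt n) B)) (NT (cube_unit n n B) ?Y))" if b: "b \<in> Obj B" for b
          using cube_unit_iso_at[OF B Y b, of n] b X by (simp add: id_mor_def)
      qed (use X in \<open>simp_all add: id_mor_def\<close>)
      thus "iso_arr (Tgt (NSrc ?\<tau>)) (NT ?\<tau> X)" using X by (simp add: id_mor_def)
    qed
  qed

  have e: "(?ev \<circ>\<^sub>d id_mor ?Q) \<circ>\<^sub>d ((?\<chi> \<circ>\<^sub>d ?L) \<circ>\<^sub>d ?N) \<approx> tcof D n"
    by (rule dmor_eq_trans[OF dmor_eq_mcomp[OF dmor_eq_refl mcomp_id_right[OF p(5) pd(1,4)]] tcof_eq])
  have e': "?G \<circ>\<^sub>d ((?\<chi> \<circ>\<^sub>d id_mor ?A) \<circ>\<^sub>d ?N) \<approx> ?G \<circ>\<^sub>d (?\<chi> \<circ>\<^sub>d ?N)"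
    by (intro dmor_eq_mcomp dmor_eq_refl mcomp_id_right[OF p(4) pd(3,1)])
  note a = iso_modification_cong[OF 2 dmor_eq_refl e'] and b = iso_modification_cong[OF 1 mcomp_id_right[OF G pd(1,4)] dmor_eq_refl]
    and c = iso_modification_cong[OF 4 e dmor_eq_refl]
  note tr = iso_modification_trans[OF pd(1,4)] and sy = iso_modification_sym[OF pd(1,4)]
  show ?thesis by (rule tr[OF c tr[OF sy[OF 3] tr[OF a sy[OF b]]]])
qed

end

theorem theorem8p25:
  fixes D :: "('u, 'o, 'm) prederiv" and n :: nat
  assumes "regular_universe TYPE('u)"
    and "derivator D"
    and "pointed D"
    and "n \<ge> 1"
  shows "\<exists>\<tau>. iso_modification (shift D (cube n)) D (tcof D n) (iterated_cone D n) \<tau>"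
proof -
  interpret pointed_derivator D
    using assms(2,3) by (simp add: pointed_derivator_def pointed_derivator_axioms_def)
  show ?thesis by (rule tcof_iso_iterated_cone[OF assms(4)])
qed

end
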